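(* Let $(\varepsilon_t)_{t\in\mathbb{Z}}$ be i.i.d. copies of a random variable $\varepsilon$, $Y$ measurable and $X_t=Y(\varepsilon_t,\varepsilon_{t-1},\dots)$. Fix $\tau\in(0,1)$ and suppose: (A) there exist $\delta>0$ and $\sigma\in(0,1)$ such that $\sup_{\xi\in\mathcal{X}_\tau(\delta)}\|1\{X_n<\xi\}-1\{X_n'<\xi\}\|_2=O(\sigma^n)$; (B) $F_X$ is Lipschitz continuous in a neighborhood of $\xi_0(\tau)$ and has a positive and continuous Lebesgue density at $\xi_0(\tau)$. Then: (i) if there is $\delta>0$ such that $\mathbb{P}(X_0<\xi,X_j<\xi')=\mathbb{P}(X_0<\xi)\mathbb{P}(X_0<\xi')$ for all $j>0$ and all $\xi,\xi'\in\mathcal{X}_\tau(\delta)$, then $CM_{n,\tau}\rightsquigarrow\|S_\tau\|_\Pi^2$; (ii) if $r_\tau(j)\neq0$ for some $j>0$, then $\mathbb{P}(CM_{n,\tau}>B)\to1$ for every $B\in\mathbb{R}$.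
   Context: $(\varepsilon_t^* )$ is an independent i.i.d. copy of $(\varepsilon_t)$, $X_t'=Y(\varepsilon_t,\dots,\varepsilon_1,\varepsilon_0^*,\varepsilon_{-1}^*,\dots)$, $\|Z\|_2=(\mathbb{E}|Z|^2)^{1/2}$. $F_X(x)=\mathbb{P}(X_0\le x)$, $\xi_0(\tau)=\inf\{x:F_X(x)\ge\tau\}$, $\mathcal{X}_\tau(\delta)=\{\xi:|\xi_0(\tau)-\xi|\le\delta\}$. $V_t(\tau,\xi)=\tau-1\{X_t<\xi\}$, $V_t(\tau)=V_t(\tau,\xi_0(\tau))$, $r_\tau(j)=\mathbb{E}V_0(\tau)V_j(\tau)$. Given $X_1,\dots,X_n$: $\hat\xi_n(\tau)$ minimizes $\sum_{t=1}^n\rho_\tau(X_t-x)$ over $x$, $\rho_\tau(x)=x(\tau-1\{x<0\})$; $\hat V_t(\tau)=V_t(\tau,\hat\xi_n(\tau))$; $\hat r_{n,\tau}(j)=n^{-1}\sum_{t=j+1}^n\hat V_t(\tau)\hat V_{t-j}(\tau)$; $CM_{n,\tau}=\frac{n}{2\pi}\sum_{j=1}^{n-1}(\hat r_{n,\tau}(j)/j)^2$. $\Pi=[0,\pi]$, $L_2(\Pi)$ has inner product $\langle f,g\rangle_\Pi=\int_\Pi fg\,d\lambda$ and norm $\|\cdot\|_\Pi$. $\psi_j(\lambda)=\sin(j\lambda)/(\pi j)$. $S_\tau$ is a mean-zero Gaussian random element of $L_2(\Pi)$ with covariance $\mathbb{E}S_\tau(\lambda)S_\tau(\lambda')=\sum_{j>0}\sum_{k>0}\sum_{l\in\mathbb{Z}}\mathrm{Cov}(V_0(\tau)V_j(\tau),V_{j-l}(\tau)V_{j-l-k}(\tau))\psi_j(\lambda)\psi_k(\lambda')$,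 $\lambda,\lambda'\in\Pi$. $\rightsquigarrow$ denotes convergence in distribution. *)

theory Defs
  imports "HOL-Probability.Probability" "HOL-Library.Landau_Symbols"
begin

definition Xproc :: "(int \<Rightarrow> 'a \<Rightarrow> 'e) \<Rightarrow> ((nat \<Rightarrow> 'e) \<Rightarrow> real) \<Rightarrow> int \<Rightarrow> 'a \<Rightarrow> real" where
  "Xproc eps Y t \<omega> = Y (\<lambda>k. eps (t - int k) \<omega>)"

definition FX :: "'a measure \<Rightarrow> (int \<Rightarrow> 'a \<Rightarrow> 'e) \<Rightarrow> ((nat \<Rightarrow> 'e) \<Rightarrow> real) \<Rightarrow> real \<Rightarrow> real" where
  "FX M eps Y x = measure M {\<omega> \<in> space M. Xproc eps Y 0 \<omega> \<le> x}"

definition xi0 :: "'a measure \<Rightarrow> (int \<Rightarrow> 'a \<Rightarrow> 'e) \<Rightarrow> ((nat \<Rightarrow> 'e) \<Rightarrow> real) \<Rightarrow> real \<Rightarrow> real" where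
  "xi0 M eps Y \<tau> = Inf {x. FX M eps Y x \<ge> \<tau>}"

definition Xnbhd :: "'a measure \<Rightarrow> (int \<Rightarrow> 'a \<Rightarrow> 'e) \<Rightarrow> ((nat \<Rightarrow> 'e) \<Rightarrow> real) \<Rightarrow> real \<Rightarrow> real \<Rightarrow> real set" where
  "Xnbhd M eps Y \<tau> \<delta> = {\<xi>. \<bar>xi0 M eps Y \<tau> - \<xi>\<bar> \<le> \<delta>}"

definition Vfun :: "real \<Rightarrow> real \<Rightarrow> real \<Rightarrow> real" where
  "Vfun \<tau> \<xi> x = \<tau> - (if x < \<xi> then 1 else 0)"

definition Vproc :: "'a measure \<Rightarrow> (int \<Rightarrow> 'a \<Rightarrow> 'e) \<Rightarrow> ((nat \<Rightarrow> 'e) \<Rightarrow> real) \<Rightarrow> real \<Rightarrow> int \<Rightarrow> 'a \<Rightarrow> real" where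
  "Vproc M eps Y \<tau> t \<omega> = Vfun \<tau> (xi0 M eps Y \<tau>) (Xproc eps Y t \<omega>)"

definition rtau :: "'a measure \<Rightarrow> (int \<Rightarrow> 'a \<Rightarrow> 'e) \<Rightarrow> ((nat \<Rightarrow> 'e) \<Rightarrow> real) \<Rightarrow> real \<Rightarrow> int \<Rightarrow> real" where
  "rtau M eps Y \<tau> j = (\<integral>\<omega>. Vproc M eps Y \<tau> 0 \<omega> * Vproc M eps Y \<tau> j \<omega> \<partial>M)"

definition rho :: "real \<Rightarrow> real \<Rightarrow> real" where
  "rho \<tau> x = x * (\<tau> - (if x < 0 then 1 else 0))"

text \<open>Sample autocovariance hat r_{n,tau}(j), given the estimator value xh = hat xi_n(tau).\<close>
definition rhat :: "(int \<Rightarrow> 'a \<Rightarrow> 'e) \<Rightarrow> ((nat \<Rightarrow> 'e) \<Rightarrow> real) \<Rightarrow> real \<Rightarrow> real \<Rightarrow> nat \<Rightarrow> nat \<Rightarrow> 'a \<Rightarrow> real" where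
  "rhat eps Y \<tau> xh n j \<omega> = (1 / real n) *
     (\<Sum>t = j + 1..n. Vfun \<tau> xh (Xproc eps Y (int t) \<omega>) * Vfun \<tau> xh (Xproc eps Y (int t - int j) \<omega>))"

text \<open>Cramer-von Mises type statistic CM_{n,tau}; xih n \<omega> is the quantile estimator.\<close>
definition CM :: "(int \<Rightarrow> 'a \<Rightarrow> 'e) \<Rightarrow> ((nat \<Rightarrow> 'e) \<Rightarrow> real) \<Rightarrow> real \<Rightarrow> (nat \<Rightarrow> 'a \<Rightarrow> real) \<Rightarrow> nat \<Rightarrow> 'a \<Rightarrow> real" where
  "CM eps Y \<tau> xih n \<omega> = real n / (2 * pi) *
     (\<Sum>j = 1..n - 1. (rhat eps Y \<tau> (xih n \<omega>) n j \<omega> / real j)\<^sup>2)"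

text \<open>Canonical coupling space: i.i.d. family indexed by bool x int with the law of eps_0;
  index (False,t) is eps_t, index (True,t) is the independent copy eps*_t.\<close>
definition coupling_space :: "'a measure \<Rightarrow> 'e measure \<Rightarrow> (int \<Rightarrow> 'a \<Rightarrow> 'e) \<Rightarrow> (bool \<times> int \<Rightarrow> 'e) measure" where
  "coupling_space M E eps = PiM UNIV (\<lambda>_. distr M E (eps 0))"

definition Xc :: "((nat \<Rightarrow> 'e) \<Rightarrow> real) \<Rightarrow> int \<Rightarrow> (bool \<times> int \<Rightarrow> 'e) \<Rightarrow> real" where
  "Xc Y t w = Y (\<lambda>k. w (False, t - int k))"

definition Xc' :: "((nat \<Rightarrow> 'e) \<Rightarrow> real) \<Rightarrow> int \<Rightarrow> (bool \<times> int \<Rightarrow> 'e) \<Rightarrow> real" where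
  "Xc' Y t w = Y (\<lambda>k. if int k < t then w (False, t - int k) else w (True, t - int k))"

definition coupling_dist :: "'a measure \<Rightarrow> 'e measure \<Rightarrow> (int \<Rightarrow> 'a \<Rightarrow> 'e) \<Rightarrow> ((nat \<Rightarrow> 'e) \<Rightarrow> real) \<Rightarrow> nat \<Rightarrow> real \<Rightarrow> real" where
  "coupling_dist M E eps Y n \<xi> = sqrt (\<integral>w. ((if Xc Y (int n) w < \<xi> then 1 else 0) - (if Xc' Y (int n) w < \<xi> then 1 else 0))\<^sup>2 \<partial>coupling_space M E eps)"

definition psi :: "nat \<Rightarrow> real \<Rightarrow> real" where
  "psi j lam = sin (real j * lam) / (pi * real j)"

definition covV :: "'a measure \<Rightarrow> (int \<Rightarrow> 'a \<Rightarrow> 'e) \<Rightarrow> ((nat \<Rightarrow> 'e) \<Rightarrow> real) \<Rightarrow> real \<Rightarrow> int \<Rightarrow> int \<Rightarrow> int \<Rightarrow> real" where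
  "covV M eps Y \<tau> j k l =
     (let V = Vproc M eps Y \<tau> in
       (\<integral>\<omega>. V 0 \<omega> * V j \<omega> * V (j - l) \<omega> * V (j - l - k) \<omega> \<partial>M)
       - (\<integral>\<omega>. V 0 \<omega> * V j \<omega> \<partial>M) * (\<integral>\<omega>. V (j - l) \<omega> * V (j - l - k) \<omega> \<partial>M))"

definition Kcov :: "'a measure \<Rightarrow> (int \<Rightarrow> 'a \<Rightarrow> 'e) \<Rightarrow> ((nat \<Rightarrow> 'e) \<Rightarrow> real) \<Rightarrow> real \<Rightarrow> real \<Rightarrow> real \<Rightarrow> real" where
  "Kcov M eps Y \<tau> lam lam' =
     (\<Sum>j. \<Sum>k. (\<Sum>\<^sub>\<infinity>l\<in>(UNIV :: int set). covV M eps Y \<tau> (int (Suc j)) (int (Suc k)) l)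
                 * psi (Suc j) lam * psi (Suc k) lam')"

abbreviation PiI :: "real set" where "PiI \<equiv> {0..pi}"

definition L2Pi :: "(real \<Rightarrow> real) \<Rightarrow> bool" where
  "L2Pi f \<longleftrightarrow> f \<in> borel_measurable lborel \<and> set_integrable lborel PiI (\<lambda>x. (f x)\<^sup>2)"

text \<open>S is a mean-zero Gaussian random element of L_2(Pi) with covariance kernel K:
  every inner product <S, f>_Pi, f in L_2(Pi), is a centred normal variable with variance
  int int K(x,y) f(x) f(y) dx dy (characteristic function exp(-v t^2/2)).\<close>
definition gaussian_L2Pi :: "'b measure \<Rightarrow> ('b \<Rightarrow> real \<Rightarrow> real) \<Rightarrow> (real \<Rightarrow> real \<Rightarrow> real) \<Rightarrow> bool" where
  "gaussian_L2Pi N S K \<longleftrightarrow>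
     prob_space N \<and>
     (\<lambda>(\<omega>, x). S \<omega> x) \<in> borel_measurable (N \<Otimes>\<^sub>M lborel) \<and>
     (\<forall>\<omega>\<in>space N. L2Pi (S \<omega>)) \<and>
     (\<forall>f. L2Pi f \<longrightarrow>
        (\<lambda>\<omega>. set_lebesgue_integral lborel PiI (\<lambda>x. S \<omega> x * f x)) \<in> borel_measurable N \<and>
        char (distr N borel (\<lambda>\<omega>. set_lebesgue_integral lborel PiI (\<lambda>x. S \<omega> x * f x))) =
          (\<lambda>t. complex_of_real (exp (- (set_lebesgue_integral lborel PiI (\<lambda>x.
                 set_lebesgue_integral lborel PiI (\<lambda>y. K x y * f x * f y))) * t\<^sup>2 / 2))))"

definition normPi2 :: "(real \<Rightarrow> real) \<Rightarrow> real" where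
  "normPi2 f = set_lebesgue_integral lborel PiI (\<lambda>x. (f x)\<^sup>2)"

end

(* Replacing the innovations up to time 0 by an independent copy decouples the future from the past, so
   the coupling condition gives geometric decorrelation for functions of threshold indicators. For (i),
   pairwise independence makes the covariances of the lagged products of indicators decay
   geometrically both in the time shift and in the difference of the lags, and blocking gives a joint
   central limit theorem for finitely many normalised autocovariances. The sine functions psi_j are
   orthogonal on [0, pi] with squared norm 1 / (2 pi j^2), so by Parseval CM_n is the sum of the squared normalised autocovariances with exactly these weights and the limit
   is the same sum over a Gaussian sequence. Laplace transforms carry the convergence over, the
   exponential of a negative quadratic form being a Gaussian mixture of characteristic functions.
   The estimated quantile is within O(1/sqrt n) of the true one, and on that scale the autocovariances
   hardly move: their first-order term vanishes because the indicators are centred, and monotonicity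
   of the counts reduces the supremum over the threshold to a finite grid. For (ii), a law of
   large numbers makes a single nonzero autocovariance drive CM_n to infinity linearly. *)
theory Submission
  imports Defs "HOL-Real_Asymp.Real_Asymp"
begin

text \<open>The obstacle is uniformity in the lag: the lags run up to n - 1 while the weights decay
  only like 1/j^2, so every moment bound must hold with a constant that does not depend on the lag.
  Geometric decorrelation alone loses a factor growing with the lag, because the two factors of a
  lagged product are far apart. Part (ii) can afford this, as it follows one fixed lag. In part (i)
  the loss is avoided because a mixed moment of four centred indicators can always be cut at a long
  gap in such a way that one side of the cut has mean zero. The order of limits is the second
  difficulty: the threshold is estimated on the scale 1/sqrt n, and a grid refined together with n
  would need stronger moment bounds. All truncations are therefore tied to a single parameter m that
  stays fixed while n tends to infinity; only afterwards does m tend to infinity. With a fixed grid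
  second moments suffice throughout.\<close>

abbreviation path_space :: "(int \<Rightarrow> real) measure" where
  "path_space \<equiv> PiM UNIV (\<lambda>_::int. borel)"

section \<open>Independence of coordinates on product spaces\<close>

lemma indep_vars_PiM_coords:
  assumes P: "prob_space P"
  shows "prob_space.indep_vars (PiM UNIV (\<lambda>_::'i. P)) (\<lambda>_. P) (\<lambda>i w. w i) UNIV"
proof -
  interpret C: prob_space "PiM UNIV (\<lambda>_::'i. P)" by (intro prob_space_PiM P)
  have "distr (PiM UNIV (\<lambda>_::'i. P)) (PiM UNIV (\<lambda>_::'i. P)) (\<lambda>x. x) = PiM UNIV (\<lambda>_::'i. P)"
    by (rule distr_id)
  then show ?thesis
    by (subst C.indep_vars_iff_distr_eq_PiM) (auto simp: restrict_UNIV distr_PiM_component[of UNIV "\<lambda>_. P", OF P])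
qed

text \<open>A function that ignores the coordinates outside S is unchanged when these are
  overwritten by a fixed point \<open>c\<close>. It therefore factors through the restriction to S,
  and independence of disjoint families of coordinates applies.\<close>

lemma integral_mult_disjoint_coords:
  fixes f g :: "('i \<Rightarrow> 'e) \<Rightarrow> complex"
  assumes P: "prob_space P"
    and f[measurable]: "f \<in> borel_measurable (PiM UNIV (\<lambda>_. P))"
    and g[measurable]: "g \<in> borel_measurable (PiM UNIV (\<lambda>_. P))"
    and fS: "\<And>w w'. (\<And>i. i \<in> S \<Longrightarrow> w i = w' i) \<Longrightarrow> f w = f w'"
    and gT: "\<And>w w'. (\<And>i. i \<in> T \<Longrightarrow> w i = w' i) \<Longrightarrow> g w = g w'"
    and ST: "S \<inter> T = {}"
    and bnd: "\<And>w. norm (f w) \<le> 1" "\<And>w. norm (g w) \<le> 1"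
  shows "(\<integral>w. f w * g w \<partial>PiM UNIV (\<lambda>_. P)) = (\<integral>w. f w \<partial>PiM UNIV (\<lambda>_. P)) * (\<integral>w. g w \<partial>PiM UNIV (\<lambda>_. P))"
proof -
  interpret C: prob_space "PiM UNIV (\<lambda>_::'i. P)" by (intro prob_space_PiM P)
  obtain c where c: "c \<in> space (PiM UNIV (\<lambda>_::'i. P))" using C.not_empty by blast
  have c': "c i \<in> space P" for i using c by (auto simp: space_PiM)
  have extm: "(\<lambda>v i. if i \<in> A then v i else c i) \<in> measurable (PiM A (\<lambda>_. P)) (PiM UNIV (\<lambda>_. P))" for A
  proof (intro measurable_PiM_single')
    show "(\<lambda>v. if i \<in> A then v i else c i) \<in> measurable (PiM A (\<lambda>_. P)) P" for i
      using c' by (cases "i \<in> A") auto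
  qed (use c' in \<open>auto simp: space_PiM PiE_iff\<close>)
  have "C.indep_var (PiM S (\<lambda>_. P)) (\<lambda>\<omega>. restrict (\<lambda>i. \<omega> i) S) (PiM T (\<lambda>_. P)) (\<lambda>\<omega>. restrict (\<lambda>i. \<omega> i) T)"
    by (rule C.indep_var_restrict[OF indep_vars_PiM_coords[OF P]]) (use ST in auto)
  from C.indep_var_compose[OF this measurable_compose[OF extm f] measurable_compose[OF extm g]]
  have "C.indep_var borel ((\<lambda>v. f (\<lambda>i. if i \<in> S then v i else c i)) \<circ> (\<lambda>\<omega>. restrict (\<lambda>i. \<omega> i) S))
     borel ((\<lambda>v. g (\<lambda>i. if i \<in> T then v i else c i)) \<circ> (\<lambda>\<omega>. restrict (\<lambda>i. \<omega> i) T))" .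
  moreover have "((\<lambda>v. f (\<lambda>i. if i \<in> S then v i else c i)) \<circ> (\<lambda>\<omega>. restrict (\<lambda>i. \<omega> i) S)) = f"
    unfolding comp_def by (rule ext, rule fS) auto
  moreover have "((\<lambda>v. g (\<lambda>i. if i \<in> T then v i else c i)) \<circ> (\<lambda>\<omega>. restrict (\<lambda>i. \<omega> i) T)) = g"
    unfolding comp_def by (rule ext, rule gT) auto
  ultimately have "C.indep_var borel f borel g" by simp
  then show ?thesis
    by (rule C.indep_var_lebesgue_integral)
       (auto intro!: C.integrable_const_bound[where B=1] simp: bnd)
qed

subsection \<open>Decorrelation of Bernoulli shifts\<close>

locale bernoulli_shift = prob_space M for M :: "'a measure" +
  fixes E :: "'e measure" and eps :: "int \<Rightarrow> 'a \<Rightarrow> 'e" and Y :: "(nat \<Rightarrow> 'e) \<Rightarrow> real"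
  assumes eps_meas[measurable]: "\<And>t. eps t \<in> measurable M E"
    and eps_indep: "indep_vars (\<lambda>_. E) eps UNIV"
    and eps_ident: "\<And>t. distr M E (eps t) = distr M E (eps 0)"
    and Y_meas: "Y \<in> borel_measurable (PiM UNIV (\<lambda>_::nat. E))"
begin

abbreviation "P \<equiv> distr M E (eps 0)"
abbreviation "X \<equiv> Xproc eps Y"

lemma P: "prob_space P" by (rule prob_space_distr) simp

lemma Y_meas'[measurable]: "Y \<in> borel_measurable (PiM UNIV (\<lambda>_::nat. P))"
  by (subst measurable_cong_sets[OF sets_PiM_cong[of UNIV UNIV _ "\<lambda>_. E"] refl]) (auto intro: Y_meas)

lemma X_meas[measurable]: "X t \<in> borel_measurable M"
  unfolding Xproc_def
  by (rule measurable_compose[OF _ Y_meas]) (intro measurable_PiM_single', auto simp: measurable_space[OF eps_meas])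

lemma path_meas[measurable]: "(\<lambda>\<omega> t. X (h t) \<omega>) \<in> measurable M path_space"
  by (intro measurable_PiM_single') auto

lemma Y_coord_meas: "(\<lambda>w. Y (\<lambda>k. w (h k))) \<in> borel_measurable (PiM UNIV (\<lambda>_. P))"
  by (rule measurable_compose[OF _ Y_meas']) (intro measurable_PiM_single', auto simp: space_PiM)

lemma coord_path_meas:
  "(\<lambda>w t. Y (\<lambda>k. w (f (t - int k)))) \<in> measurable (PiM UNIV (\<lambda>_. P)) path_space"
  by (intro measurable_PiM_single' Y_coord_meas) (auto simp: space_PiM)

lemma distr_eps: "distr M (PiM UNIV (\<lambda>_. P)) (\<lambda>\<omega> t. eps t \<omega>) = PiM UNIV (\<lambda>_. P)"
proof -
  have "distr M (PiM UNIV (\<lambda>_. E)) (\<lambda>\<omega> t. eps t \<omega>) = PiM UNIV (\<lambda>t. distr M E (eps t))"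
    using eps_indep by (subst (asm) indep_vars_iff_distr_eq_PiM) (auto simp: restrict_UNIV)
  also have "\<dots> = PiM UNIV (\<lambda>_. P)"
    by (subst eps_ident) simp
  also have "distr M (PiM UNIV (\<lambda>_. E)) (\<lambda>\<omega> t. eps t \<omega>) = distr M (PiM UNIV (\<lambda>_. P)) (\<lambda>\<omega> t. eps t \<omega>)"
    by (intro distr_cong sets_PiM_cong) auto
  finally show ?thesis .
qed

lemma eps_path_meas: "(\<lambda>\<omega> t. eps t \<omega>) \<in> measurable M (PiM UNIV (\<lambda>_. P))"
  by (intro measurable_PiM_single') (auto simp: measurable_space[OF eps_meas])

text \<open>Any injective relabelling of the innovations leaves the law of the path unchanged; shifts, the
  passage to the coupling space and the coupled process are all of this form.\<close>

lemma law_relabel: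
  fixes f :: "int \<Rightarrow> 'i"
  assumes f: "inj f"
  shows "distr (PiM UNIV (\<lambda>_::'i. P)) path_space (\<lambda>w t. Y (\<lambda>k. w (f (t - int k)))) = distr M path_space (\<lambda>\<omega> t. X t \<omega>)"
proof -
  let ?y = "\<lambda>v t. Y (\<lambda>k. v (t - int k))"
  have y: "?y \<in> measurable (PiM UNIV (\<lambda>_. P)) path_space"
    using coord_path_meas[of "\<lambda>t. t"] by simp
  have r: "distr (PiM UNIV (\<lambda>_::'i. P)) (PiM UNIV (\<lambda>_. P)) (\<lambda>w t. w (f t)) = PiM UNIV (\<lambda>_. P)"
    using distr_PiM_reindex[of UNIV "\<lambda>_. P" f UNIV] f P by (simp add: restrict_UNIV)
  have rm: "(\<lambda>w t. w (f t)) \<in> measurable (PiM UNIV (\<lambda>_::'i. P)) (PiM UNIV (\<lambda>_. P))"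
    by (intro measurable_PiM_single') (auto simp: space_PiM)
  have "distr (PiM UNIV (\<lambda>_::'i. P)) path_space (\<lambda>w t. Y (\<lambda>k. w (f (t - int k))))
      = distr (distr (PiM UNIV (\<lambda>_::'i. P)) (PiM UNIV (\<lambda>_. P)) (\<lambda>w t. w (f t))) path_space ?y"
    by (subst distr_distr[OF y rm]) (simp add: comp_def)
  also have "\<dots> = distr (distr M (PiM UNIV (\<lambda>_. P)) (\<lambda>\<omega> t. eps t \<omega>)) path_space ?y"
    by (simp add: r distr_eps)
  also have "\<dots> = distr M path_space (\<lambda>\<omega> t. X t \<omega>)"
    by (subst distr_distr[OF y eps_path_meas]) (simp add: comp_def Xproc_def)
  finally show ?thesis .
qed

lemma X_shift: "distr M path_space (\<lambda>\<omega> t. X (t + s) \<omega>) = distr M path_space (\<lambda>\<omega> t. X t \<omega>)"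
proof -
  have y: "(\<lambda>v t. Y (\<lambda>k. v (t - int k + s))) \<in> measurable (PiM UNIV (\<lambda>_. P)) path_space"
    using coord_path_meas[of "\<lambda>t. t + s"] by simp
  have "distr M path_space (\<lambda>\<omega> t. X (t + s) \<omega>)
      = distr (distr M (PiM UNIV (\<lambda>_. P)) (\<lambda>\<omega> t. eps t \<omega>)) path_space (\<lambda>v t. Y (\<lambda>k. v (t - int k + s)))"
    by (subst distr_distr[OF y eps_path_meas]) (simp add: comp_def Xproc_def algebra_simps)
  also have "\<dots> = distr M path_space (\<lambda>\<omega> t. X t \<omega>)"
    using law_relabel[of "\<lambda>t. t + s"] by (simp add: distr_eps inj_def)
  finally show ?thesis .
qed

lemma expectation_shift:
  fixes a :: "(int \<Rightarrow> real) \<Rightarrow> 'b::{banach,second_countable_topology}"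
  assumes a: "a \<in> borel_measurable path_space"
  shows "(\<integral>\<omega>. a (\<lambda>t. X (t + s) \<omega>) \<partial>M) = (\<integral>\<omega>. a (\<lambda>t. X t \<omega>) \<partial>M)"
  using X_shift[of s] integral_distr[OF path_meas[of "\<lambda>t. t + s"] a] integral_distr[OF path_meas[of "\<lambda>t. t"] a]
  by simp

abbreviation "C \<equiv> PiM UNIV (\<lambda>_::bool\<times>int. P)"

lemma coupling_space_eq: "coupling_space M E eps = C"
  by (simp add: coupling_space_def)

lemma prob_space_C: "prob_space C" by (intro prob_space_PiM P)

text \<open>Which copy of an innovation is used depends only on its own time index t - k, not on t
  and k separately. This makes the coupled process an injective relabelling, although its definition
  distinguishes cases in k.\<close>

lemma Xc'_relabel: "Xc' Y t w = Y (\<lambda>k. w (t - int k \<le> 0, t - int k))"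
  unfolding Xc'_def by (rule arg_cong[of _ _ Y]) (auto simp: fun_eq_iff)

lemma Xc_path_meas[measurable]: "(\<lambda>w t. Xc Y t w) \<in> measurable C path_space"
  unfolding Xc_def using coord_path_meas[of "\<lambda>t. (False, t)"] by simp
lemma Xc'_path_meas[measurable]: "(\<lambda>w t. Xc' Y t w) \<in> measurable C path_space"
  unfolding Xc'_relabel using coord_path_meas[of "\<lambda>t. (t \<le> 0, t)"] by simp

lemma Xc_meas[measurable]: "Xc Y t \<in> borel_measurable C"
  by (rule measurable_compose[OF Xc_path_meas, of "\<lambda>x. x t", simplified]) auto
lemma Xc'_meas[measurable]: "Xc' Y t \<in> borel_measurable C"
  by (rule measurable_compose[OF Xc'_path_meas, of "\<lambda>x. x t", simplified]) auto

lemma expectation_Xc: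
  fixes a :: "(int \<Rightarrow> real) \<Rightarrow> complex"
  assumes a: "a \<in> borel_measurable path_space"
  shows "(\<integral>w. a (\<lambda>t. Xc Y t w) \<partial>C) = (\<integral>\<omega>. a (\<lambda>t. X t \<omega>) \<partial>M)"
    and "(\<integral>w. a (\<lambda>t. Xc' Y t w) \<partial>C) = (\<integral>\<omega>. a (\<lambda>t. X t \<omega>) \<partial>M)"
proof -
  have "distr C path_space (\<lambda>w t. Xc Y t w) = distr M path_space (\<lambda>\<omega> t. X t \<omega>)"
    using law_relabel[of "\<lambda>t. (False, t)"] by (simp add: Xc_def inj_def)
  moreover have "distr C path_space (\<lambda>w t. Xc' Y t w) = distr M path_space (\<lambda>\<omega> t. X t \<omega>)"
    using law_relabel[of "\<lambda>t. (t \<le> 0, t)"] by (simp add: Xc'_relabel inj_def)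
  ultimately show "(\<integral>w. a (\<lambda>t. Xc Y t w) \<partial>C) = (\<integral>\<omega>. a (\<lambda>t. X t \<omega>) \<partial>M)"
    "(\<integral>w. a (\<lambda>t. Xc' Y t w) \<partial>C) = (\<integral>\<omega>. a (\<lambda>t. X t \<omega>) \<partial>M)"
    using integral_distr[OF path_meas[of "\<lambda>t. t"] a] integral_distr[OF Xc_path_meas a]
      integral_distr[OF Xc'_path_meas a] by simp_all
qed

text \<open>A difference of two indicators takes values in {-1, 0, 1}, so its square is its absolute
  value. The squared L2 distance of condition (A) is thus an L1 distance, the quantity that
  Lipschitz estimates produce.\<close>

lemma coupling_dist_sq:
  "(\<integral>w. \<bar>of_bool (Xc Y (int n) w < \<xi>) - of_bool (Xc' Y (int n) w < \<xi>)\<bar> \<partial>C) = (coupling_dist M E eps Y n \<xi>)\<^sup>2"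
proof -
  have "coupling_dist M E eps Y n \<xi> ^ 2 = (\<integral>w. ((if Xc Y (int n) w < \<xi> then 1 else 0) - (if Xc' Y (int n) w < \<xi> then 1 else 0))\<^sup>2 \<partial>C)"
    unfolding coupling_dist_def coupling_space_eq by (subst real_sqrt_pow2) auto
  also have "\<dots> = (\<integral>w. \<bar>of_bool (Xc Y (int n) w < \<xi>) - of_bool (Xc' Y (int n) w < \<xi>)\<bar> \<partial>C)"
    by (intro Bochner_Integration.integral_cong) auto
  finally show ?thesis ..
qed

text \<open>On the coupling space \<open>a\<close> of the original path reads the innovations up to
  time 0, while \<open>b\<close> of the coupled path reads the later ones and the independent copy.
  These two are exactly independent, and passing from the coupled to the original path inside
  \<open>b\<close> costs only the L1 distance of the indicators.\<close>

lemma decorrelation_0: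
  fixes a b :: "(int \<Rightarrow> real) \<Rightarrow> complex" and t :: "'j \<Rightarrow> int"
  assumes a[measurable]: "a \<in> borel_measurable path_space" and b[measurable]: "b \<in> borel_measurable path_space"
    and a1: "\<And>x. norm (a x) \<le> 1" and b1: "\<And>x. norm (b x) \<le> 1"
    and past: "\<And>x y. (\<And>t. t \<le> 0 \<Longrightarrow> x t = y t) \<Longrightarrow> a x = a y"
    and J: "finite J" and t: "\<And>i. i \<in> J \<Longrightarrow> t i > 0"
    and lip: "\<And>x y. norm (b x - b y) \<le> c * (\<Sum>i\<in>J. \<bar>of_bool (x (t i) < \<xi> i) - of_bool (y (t i) < \<xi> i)\<bar>)"
  shows "norm ((\<integral>\<omega>. a (\<lambda>t. X t \<omega>) * b (\<lambda>t. X t \<omega>) \<partial>M) - (\<integral>\<omega>. a (\<lambda>t. X t \<omega>) \<partial>M) * (\<integral>\<omega>. b (\<lambda>t. X t \<omega>) \<partial>M))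
     \<le> c * (\<Sum>i\<in>J. (coupling_dist M E eps Y (nat (t i)) (\<xi> i))\<^sup>2)"
proof -
  interpret C: prob_space C by (rule prob_space_C)
  let ?x = "\<lambda>w t. Xc Y t w" and ?x' = "\<lambda>w t. Xc' Y t w"
  have ia: "integrable C (\<lambda>w. a (?x w))" "integrable C (\<lambda>w. b (?x' w))" "integrable C (\<lambda>w. b (?x w))"
    by (intro C.integrable_const_bound[where B=1]; simp add: a1 b1)+
  have iab: "integrable C (\<lambda>w. a (?x w) * b (?x w))" "integrable C (\<lambda>w. a (?x w) * b (?x' w))"
    by (intro C.integrable_const_bound[where B=1];
        simp add: a1 b1 norm_mult mult_le_one)+
  \<comment> \<open>The Lipschitz bound also forces \<open>b\<close> to ignore the path up to time
    0, since all the times \<open>t i\<close> are positive.\<close>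
  have b_dep: "b x = b y" if "\<And>t. t > 0 \<Longrightarrow> x t = y t" for x y
  proof -
    have "norm (b x - b y) \<le> 0"
      using lip[of x y] that t by (simp cong: sum.cong)
    then show ?thesis by simp
  qed
  have prod: "(\<integral>w. a (?x w) * b (?x' w) \<partial>C) = (\<integral>w. a (?x w) \<partial>C) * (\<integral>w. b (?x' w) \<partial>C)"
  proof (rule integral_mult_disjoint_coords[OF P, where S="{(False, i) |i. i \<le> 0}"
       and T="{(False, i) |i. i > 0} \<union> {(True, i) |i. i \<le> 0}"])
    fix w w' :: "bool \<times> int \<Rightarrow> 'e" assume eq: "\<And>i. i \<in> {(False, i) |i. i \<le> 0} \<Longrightarrow> w i = w' i"
    show "a (?x w) = a (?x w')"
      by (rule past, unfold Xc_def, rule arg_cong[of _ _ Y]) (auto simp: fun_eq_iff intro!: eq)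
  next
    fix w w' :: "bool \<times> int \<Rightarrow> 'e" assume eq: "\<And>i. i \<in> {(False, i) |i. i > 0} \<union> {(True, i) |i. i \<le> 0} \<Longrightarrow> w i = w' i"
    show "b (?x' w) = b (?x' w')"
      by (rule b_dep, unfold Xc'_relabel, rule arg_cong[of _ _ Y]) (auto simp: fun_eq_iff intro!: eq)
  qed (auto simp: a1 b1)
  have "norm ((\<integral>w. a (?x w) * b (?x w) \<partial>C) - (\<integral>w. a (?x w) * b (?x' w) \<partial>C))
     = norm (\<integral>w. a (?x w) * b (?x w) - a (?x w) * b (?x' w) \<partial>C)"
    by (subst Bochner_Integration.integral_diff[OF iab]) simp
  also have "\<dots> \<le> (\<integral>w. norm (a (?x w) * b (?x w) - a (?x w) * b (?x' w)) \<partial>C)"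
    by (rule integral_norm_bound)
  also have "\<dots> \<le> (\<integral>w. c * (\<Sum>i\<in>J. \<bar>of_bool (Xc Y (t i) w < \<xi> i) - of_bool (Xc' Y (t i) w < \<xi> i)\<bar>) \<partial>C)"
  proof (rule integral_mono)
    show "integrable C (\<lambda>w. c * (\<Sum>i\<in>J. \<bar>of_bool (Xc Y (t i) w < \<xi> i) - of_bool (Xc' Y (t i) w < \<xi> i)\<bar>))"
      by (intro integrable_mult_right Bochner_Integration.integrable_sum C.integrable_const_bound[where B=1]) (auto split: split_of_bool)
    show "integrable C (\<lambda>w. norm (a (?x w) * b (?x w) - a (?x w) * b (?x' w)))"
      by (intro integrable_norm Bochner_Integration.integrable_diff iab)
    fix w
    have "norm (a (?x w) * b (?x w) - a (?x w) * b (?x' w)) = norm (a (?x w)) * norm (b (?x w) - b (?x' w))"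
      by (simp add: right_diff_distrib[symmetric] norm_mult)
    also have "\<dots> \<le> 1 * norm (b (?x w) - b (?x' w))" by (intro mult_right_mono a1) auto
    also have "\<dots> \<le> c * (\<Sum>i\<in>J. \<bar>of_bool (Xc Y (t i) w < \<xi> i) - of_bool (Xc' Y (t i) w < \<xi> i)\<bar>)"
      using lip[of "?x w" "?x' w"] by simp
    finally show "norm (a (?x w) * b (?x w) - a (?x w) * b (?x' w))
      \<le> c * (\<Sum>i\<in>J. \<bar>of_bool (Xc Y (t i) w < \<xi> i) - of_bool (Xc' Y (t i) w < \<xi> i)\<bar>)" .
  qed
  also have "\<dots> = c * (\<Sum>i\<in>J. (\<integral>w. \<bar>of_bool (Xc Y (t i) w < \<xi> i) - of_bool (Xc' Y (t i) w < \<xi> i)\<bar> \<partial>C))"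
    by (subst integral_mult_right_zero, subst Bochner_Integration.integral_sum)
       (auto intro!: C.integrable_const_bound[where B=1] split: split_of_bool)
  also have "\<dots> = c * (\<Sum>i\<in>J. (coupling_dist M E eps Y (nat (t i)) (\<xi> i))\<^sup>2)"
  proof (intro arg_cong[of _ _ "\<lambda>x. c * x"] sum.cong refl)
    fix i assume "i \<in> J"
    then have "int (nat (t i)) = t i" using t[of i] by simp
    then show "(\<integral>w. \<bar>of_bool (Xc Y (t i) w < \<xi> i) - of_bool (Xc' Y (t i) w < \<xi> i)\<bar> \<partial>C)
        = (coupling_dist M E eps Y (nat (t i)) (\<xi> i))\<^sup>2"
      using coupling_dist_sq[of "nat (t i)" "\<xi> i"] by simp
  qed
  finally show ?thesis
    using prod expectation_Xc[OF a] expectation_Xc[OF b] expectation_Xc(1)[of "\<lambda>x. a x * b x"] by simp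
qed

text \<open>Reduces to a cut at time 0: both functions are translated along the path and
  stationarity restores the expectations.\<close>

lemma decorrelation:
  fixes a b :: "(int \<Rightarrow> real) \<Rightarrow> complex" and t :: "'j \<Rightarrow> int"
  assumes a[measurable]: "a \<in> borel_measurable path_space" and b[measurable]: "b \<in> borel_measurable path_space"
    and a1: "\<And>x. norm (a x) \<le> 1" and b1: "\<And>x. norm (b x) \<le> 1"
    and past: "\<And>x y. (\<And>t. t \<le> s \<Longrightarrow> x t = y t) \<Longrightarrow> a x = a y"
    and J: "finite J" and t: "\<And>i. i \<in> J \<Longrightarrow> t i > s"
    and lip: "\<And>x y. norm (b x - b y) \<le> c * (\<Sum>i\<in>J. \<bar>of_bool (x (t i) < \<xi> i) - of_bool (y (t i) < \<xi> i)\<bar>)"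
  shows "norm ((\<integral>\<omega>. a (\<lambda>t. X t \<omega>) * b (\<lambda>t. X t \<omega>) \<partial>M) - (\<integral>\<omega>. a (\<lambda>t. X t \<omega>) \<partial>M) * (\<integral>\<omega>. b (\<lambda>t. X t \<omega>) \<partial>M))
     \<le> c * (\<Sum>i\<in>J. (coupling_dist M E eps Y (nat (t i - s)) (\<xi> i))\<^sup>2)"
proof -
  have sh: "(\<lambda>x t. x (t - s)) \<in> measurable path_space path_space"
    by (intro measurable_PiM_single') (auto simp: space_PiM)
  define a' b' where "a' = (\<lambda>x. a (\<lambda>t. x (t - s)))" and "b' = (\<lambda>x. b (\<lambda>t. x (t - s)))"
  have m: "a' \<in> borel_measurable path_space" "b' \<in> borel_measurable path_space"
    unfolding a'_def b'_def by (rule measurable_compose[OF sh]; simp)+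
  have "norm ((\<integral>\<omega>. a' (\<lambda>t. X t \<omega>) * b' (\<lambda>t. X t \<omega>) \<partial>M) - (\<integral>\<omega>. a' (\<lambda>t. X t \<omega>) \<partial>M) * (\<integral>\<omega>. b' (\<lambda>t. X t \<omega>) \<partial>M))
     \<le> c * (\<Sum>i\<in>J. (coupling_dist M E eps Y (nat (t i - s)) (\<xi> i))\<^sup>2)"
    by (rule decorrelation_0[OF m]) (auto simp: a'_def b'_def J t intro!: a1 b1 past order_trans[OF lip])
  moreover have "(\<integral>\<omega>. a' (\<lambda>t. X t \<omega>) * b' (\<lambda>t. X t \<omega>) \<partial>M) = (\<integral>\<omega>. a (\<lambda>t. X t \<omega>) * b (\<lambda>t. X t \<omega>) \<partial>M)"
    using expectation_shift[of "\<lambda>x. a x * b x" "- s"] by (simp add: a'_def b'_def)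
  moreover have "(\<integral>\<omega>. a' (\<lambda>t. X t \<omega>) \<partial>M) = (\<integral>\<omega>. a (\<lambda>t. X t \<omega>) \<partial>M)" "(\<integral>\<omega>. b' (\<lambda>t. X t \<omega>) \<partial>M) = (\<integral>\<omega>. b (\<lambda>t. X t \<omega>) \<partial>M)"
    using expectation_shift[OF a, of "- s"] expectation_shift[OF b, of "- s"] by (simp_all add: a'_def b'_def)
  ultimately show ?thesis by simp
qed

end

subsection \<open>Mixed moments\<close>

lemma sum_geometric_int_le:
  fixes \<theta> :: real
  assumes \<theta>: "0 \<le> \<theta>" "\<theta> < 1" and A: "finite (A :: int set)"
  shows "(\<Sum>t\<in>A. \<theta> ^ nat \<bar>t - s\<bar>) \<le> 2 / (1 - \<theta>)"
proof -
  \<comment> \<open>The distance to s is injective on each side of s, so each half is a sum of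
    distinct powers of \<theta>.\<close>
  have half: "(\<Sum>t\<in>B. \<theta> ^ nat \<bar>t - s\<bar>) \<le> 1 / (1 - \<theta>)" if B: "finite B" "inj_on (\<lambda>t. nat \<bar>t - s\<bar>) B" for B
  proof -
    have "(\<Sum>t\<in>B. \<theta> ^ nat \<bar>t - s\<bar>) = (\<Sum>n\<in>(\<lambda>t. nat \<bar>t - s\<bar>) ` B. \<theta> ^ n)"
      by (subst sum.reindex[OF B(2)]) simp
    also have "\<dots> \<le> (\<Sum>n. \<theta> ^ n)"
      using \<theta> B(1) by (intro sum_le_suminf summable_geometric) auto
    also have "\<dots> = 1 / (1 - \<theta>)" using \<theta> by (intro suminf_geometric) auto
    finally show ?thesis .
  qed
  have "(\<Sum>t\<in>A. \<theta> ^ nat \<bar>t - s\<bar>) = (\<Sum>t\<in>{t\<in>A. t \<ge> s}. \<theta> ^ nat \<bar>t - s\<bar>) + (\<Sum>t\<in>{t\<in>A. t < s}. \<theta> ^ nat \<bar>t - s\<bar>)"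
    using A by (subst sum.union_disjoint[symmetric]) (auto intro!: sum.cong)
  also have "\<dots> \<le> 1 / (1 - \<theta>) + 1 / (1 - \<theta>)"
    by (intro add_mono half) (auto simp: A inj_on_def)
  finally show ?thesis by simp
qed

lemma summable_on_geometric_int:
  fixes \<theta> :: real
  assumes \<theta>: "0 \<le> \<theta>" "\<theta> < 1" and f: "\<And>l. \<bar>f l\<bar> \<le> C * \<theta> ^ nat \<bar>l :: int\<bar>"
  shows "(\<lambda>l. norm (f l)) summable_on A" "\<bar>infsum f A\<bar> \<le> C * (2 / (1 - \<theta>))"
proof -
  have "0 \<le> C * \<theta> ^ nat \<bar>0::int\<bar>" using f[of 0] by linarith
  then have C: "C \<ge> 0" by simp
  have bd: "(\<Sum>l\<in>F. \<bar>f l\<bar>) \<le> C * (2 / (1 - \<theta>))" if "finite F" for F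
  proof -
    have "(\<Sum>l\<in>F. \<bar>f l\<bar>) \<le> C * (\<Sum>l\<in>F. \<theta> ^ nat \<bar>l - 0\<bar>)"
      unfolding sum_distrib_left by (intro sum_mono) (use f in auto)
    also have "\<dots> \<le> C * (2 / (1 - \<theta>))" by (intro mult_left_mono sum_geometric_int_le \<theta> that C)
    finally show ?thesis .
  qed
  show *: "(\<lambda>l. norm (f l)) summable_on A"
    by (rule nonneg_bdd_above_summable_on) (auto intro!: bdd_aboveI2 bd)
  have "\<bar>infsum f A\<bar> \<le> infsum (\<lambda>l. \<bar>f l\<bar>) A"
    using norm_infsum_bound[OF *] by simp
  also have "\<dots> \<le> C * (2 / (1 - \<theta>))"
    using * by (intro infsum_le_finite_sums bd) auto
  finally show "\<bar>infsum f A\<bar> \<le> C * (2 / (1 - \<theta>))" .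
qed

lemma (in prob_space) integrable_bounded:
  fixes f :: "'a \<Rightarrow> 'b :: {banach, second_countable_topology}"
  assumes "f \<in> borel_measurable M" "\<And>\<omega>. norm (f \<omega>) \<le> B"
  shows "integrable M f"
  using assms by (intro integrable_const_bound[where B=B]) auto

lemma (in prob_space) abs_expectation_le:
  fixes f :: "'a \<Rightarrow> real"
  assumes "f \<in> borel_measurable M" "\<And>\<omega>. \<bar>f \<omega>\<bar> \<le> B"
  shows "\<bar>expectation f\<bar> \<le> B"
proof -
  have i: "integrable M f" using assms by (intro integrable_bounded[where B=B]) auto
  have "expectation f \<le> B" using assms(2) by (intro integral_le_const i) (auto simp: abs_le_iff)
  moreover have "- B \<le> expectation f"
    using assms(2) by (intro integral_ge_const i AE_I2) (metis abs_le_D2 minus_le_iff)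
  ultimately show ?thesis by auto
qed

text \<open>After expanding the square, each row of the double sum is dominated by a geometric
  series, so the bound is linear in the cardinality. The index set may have gaps, which is what the
  blocking argument and the shifted lag ranges require.\<close>

lemma (in prob_space) second_moment_sum_le:
  fixes T :: "int \<Rightarrow> 'a \<Rightarrow> real"
  assumes meas[measurable]: "\<And>t. T t \<in> borel_measurable M" and bd: "\<And>t \<omega>. \<bar>T t \<omega>\<bar> \<le> B"
    and cov: "\<And>s t. s \<in> A \<Longrightarrow> t \<in> A \<Longrightarrow> s \<le> t \<Longrightarrow> \<bar>expectation (\<lambda>\<omega>. T s \<omega> * T t \<omega>)\<bar> \<le> C * \<theta> ^ nat (t - s)"
    and \<theta>: "0 \<le> \<theta>" "\<theta> < 1" and A: "finite A" and C: "C \<ge> 0"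
  shows "expectation (\<lambda>\<omega>. (\<Sum>t\<in>A. T t \<omega>)\<^sup>2) \<le> real (card A) * (C * (2 / (1 - \<theta>)))"
proof -
  have B: "B \<ge> 0" using bd[of 0 undefined] by linarith
  have i: "integrable M (\<lambda>\<omega>. T s \<omega> * T t \<omega>)" for s t
    using bd B by (intro integrable_bounded[where B="B * B"]) (auto simp: abs_mult intro!: mult_mono)
  have cov': "expectation (\<lambda>\<omega>. T s \<omega> * T t \<omega>) \<le> C * \<theta> ^ nat \<bar>t - s\<bar>" if "s \<in> A" "t \<in> A" for s t
    using cov[of s t] cov[of t s] that by (cases "s \<le> t") (auto simp: mult.commute abs_le_iff)
  have "expectation (\<lambda>\<omega>. (\<Sum>t\<in>A. T t \<omega>)\<^sup>2) = (\<Sum>s\<in>A. \<Sum>t\<in>A. expectation (\<lambda>\<omega>. T s \<omega> * T t \<omega>))"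
    unfolding power2_eq_square sum_product using i by (subst Bochner_Integration.integral_sum, force)+ simp
  also have "\<dots> \<le> (\<Sum>s\<in>A. C * (\<Sum>t\<in>A. \<theta> ^ nat \<bar>t - s\<bar>))"
    unfolding sum_distrib_left by (intro sum_mono cov')
  also have "\<dots> \<le> (\<Sum>s\<in>A. C * (2 / (1 - \<theta>)))"
    by (intro sum_mono mult_left_mono sum_geometric_int_le \<theta> A C)
  finally show ?thesis by simp
qed

lemma Vfun_abs_le: "0 \<le> c \<Longrightarrow> c \<le> 1 \<Longrightarrow> \<bar>Vfun c \<xi> x\<bar> \<le> 1"
  by (auto simp: Vfun_def)

lemma Vfun_of_bool: "Vfun c \<xi> x = c - of_bool (x < \<xi>)"
  by (simp add: Vfun_def)

lemma Vfun_diff: "\<bar>Vfun c \<xi> x - Vfun c \<xi> y\<bar> = \<bar>of_bool (x < \<xi>) - of_bool (y < \<xi>)\<bar>"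
  by (auto simp: Vfun_def)

lemma Vfun_measurable[measurable]: "Vfun c \<xi> \<in> borel_measurable borel"
  unfolding Vfun_def by measurable

text \<open>The only consequences of the Bernoulli shift structure that matter: stationarity and
  geometric decorrelation of Lipschitz functions of future indicators from the past.\<close>

locale stationary_gmc = prob_space M for M :: "'a measure" +
  fixes X :: "int \<Rightarrow> 'a \<Rightarrow> real" and \<xi>0 \<delta> K r :: real
  assumes X_meas[measurable]: "\<And>t. X t \<in> borel_measurable M"
    and shift: "\<And>s. distr M path_space (\<lambda>\<omega> t. X (t + s) \<omega>) = distr M path_space (\<lambda>\<omega> t. X t \<omega>)"
    and \<delta>_pos: "\<delta> > 0" and K_ge: "K \<ge> 2" and r: "0 < r" "r < 1"
    and decor: "\<And>(a :: (int \<Rightarrow> real) \<Rightarrow> complex) b s (J :: int set) t \<xi> c.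
      a \<in> borel_measurable path_space \<Longrightarrow> b \<in> borel_measurable path_space \<Longrightarrow>
      (\<And>x. norm (a x) \<le> 1) \<Longrightarrow> (\<And>x. norm (b x) \<le> 1) \<Longrightarrow>
      (\<And>x y. (\<And>t. t \<le> s \<Longrightarrow> x t = y t) \<Longrightarrow> a x = a y) \<Longrightarrow>
      finite J \<Longrightarrow> (\<And>i. i \<in> J \<Longrightarrow> t i > s \<and> \<bar>\<xi>0 - \<xi> i\<bar> \<le> \<delta>) \<Longrightarrow> 0 \<le> c \<Longrightarrow>
      (\<And>x y. norm (b x - b y) \<le> c * (\<Sum>i\<in>J. \<bar>of_bool (x (t i) < \<xi> i) - of_bool (y (t i) < \<xi> i)\<bar>)) \<Longrightarrow>
      norm ((\<integral>\<omega>. a (\<lambda>t. X t \<omega>) * b (\<lambda>t. X t \<omega>) \<partial>M) - (\<integral>\<omega>. a (\<lambda>t. X t \<omega>) \<partial>M) * (\<integral>\<omega>. b (\<lambda>t. X t \<omega>) \<partial>M))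
        \<le> c * (\<Sum>i\<in>J. K * r ^ nat (t i - s))"
begin

definition near :: "real \<Rightarrow> bool" where "near \<xi> \<longleftrightarrow> \<bar>\<xi>0 - \<xi>\<bar> \<le> \<delta>"

abbreviation V :: "real \<Rightarrow> real \<Rightarrow> int \<Rightarrow> 'a \<Rightarrow> real" where "V c \<xi> t \<omega> \<equiv> Vfun c \<xi> (X t \<omega>)"

lemma near_\<xi>0[simp]: "near \<xi>0" using \<delta>_pos by (simp add: near_def)

lemma path_meas[measurable]: "(\<lambda>\<omega> t. X (h t) \<omega>) \<in> measurable M path_space"
  by (intro measurable_PiM_single') auto

lemma expectation_shift:
  fixes a :: "(int \<Rightarrow> real) \<Rightarrow> 'b::{banach,second_countable_topology}"
  assumes a: "a \<in> borel_measurable path_space"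
  shows "(\<integral>\<omega>. a (\<lambda>t. X (t + s) \<omega>) \<partial>M) = (\<integral>\<omega>. a (\<lambda>t. X t \<omega>) \<partial>M)"
  using shift[of s] integral_distr[OF path_meas[of "\<lambda>t. t + s"] a] integral_distr[OF path_meas[of "\<lambda>t. t"] a]
  by simp

text \<open>A product of factors bounded by 1 changes by at most the sum of the changes of its
  factors. So the product over the future times satisfies the Lipschitz condition of
  \<open>decor\<close> with constant 1, and each future factor contributes one error term.\<close>

lemma prod_split:
  fixes t :: "int \<Rightarrow> int"
  assumes J: "finite J1" "finite J2" "J1 \<inter> J2 = {}"
    and t1: "\<And>i. i \<in> J1 \<Longrightarrow> t i \<le> s" and t2: "\<And>i. i \<in> J2 \<Longrightarrow> s + int g \<le> t i" and g: "g \<ge> 1"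
    and c: "\<And>i. 0 \<le> c i" "\<And>i. c i \<le> 1" and near: "\<And>i. i \<in> J2 \<Longrightarrow> near (\<xi> i)"
  shows "\<bar>expectation (\<lambda>\<omega>. (\<Prod>i\<in>J1. V (c i) (\<xi> i) (t i) \<omega>) * (\<Prod>i\<in>J2. V (c i) (\<xi> i) (t i) \<omega>))
     - expectation (\<lambda>\<omega>. \<Prod>i\<in>J1. V (c i) (\<xi> i) (t i) \<omega>) * expectation (\<lambda>\<omega>. \<Prod>i\<in>J2. V (c i) (\<xi> i) (t i) \<omega>)\<bar>
     \<le> real (card J2) * (K * r ^ g)"
proof -
  define a b where "a x = complex_of_real (\<Prod>i\<in>J1. Vfun (c i) (\<xi> i) (x (t i)))"
    and "b x = complex_of_real (\<Prod>i\<in>J2. Vfun (c i) (\<xi> i) (x (t i)))" for x :: "int \<Rightarrow> real"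
  have [measurable]: "a \<in> borel_measurable path_space" "b \<in> borel_measurable path_space"
    unfolding a_def b_def by measurable
  have V1: "norm (Vfun (c i) \<xi>' x) \<le> 1" for i \<xi>' x using Vfun_abs_le c by simp
  have bd: "norm (a x) \<le> 1" "norm (b x) \<le> 1" for x
    unfolding a_def b_def norm_of_real abs_prod
    by (intro prod_le_1; use V1 in auto)+
  have "norm ((\<integral>\<omega>. a (\<lambda>t. X t \<omega>) * b (\<lambda>t. X t \<omega>) \<partial>M) - (\<integral>\<omega>. a (\<lambda>t. X t \<omega>) \<partial>M) * (\<integral>\<omega>. b (\<lambda>t. X t \<omega>) \<partial>M))
        \<le> 1 * (\<Sum>i\<in>J2. K * r ^ nat (t i - s))"
  proof (rule decor[where \<xi>=\<xi>])
    show "t i > s \<and> \<bar>\<xi>0 - \<xi> i\<bar> \<le> \<delta>" if "i \<in> J2" for i using t2[OF that] near[OF that] g by (auto simp: near_def)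
    show "a x = a y" if "\<And>t. t \<le> s \<Longrightarrow> x t = y t" for x y
      unfolding a_def using that t1 by (simp cong: prod.cong)
    show "norm (b x - b y) \<le> 1 * (\<Sum>i\<in>J2. \<bar>of_bool (x (t i) < \<xi> i) - of_bool (y (t i) < \<xi> i)\<bar>)" for x y
    proof -
      have "norm (b x - b y) = norm ((\<Prod>i\<in>J2. Vfun (c i) (\<xi> i) (x (t i))) - (\<Prod>i\<in>J2. Vfun (c i) (\<xi> i) (y (t i))))"
        unfolding b_def of_real_diff[symmetric] norm_of_real by simp
      also have "\<dots> \<le> (\<Sum>i\<in>J2. norm (Vfun (c i) (\<xi> i) (x (t i)) - Vfun (c i) (\<xi> i) (y (t i))))"
        by (intro norm_prod_diff V1)
      finally show ?thesis by (simp add: Vfun_diff)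
    qed
  qed (auto simp: bd J)
  also have "\<dots> \<le> (\<Sum>i\<in>J2. K * r ^ g)"
    unfolding mult_1 using r K_ge t2 by (intro sum_mono mult_left_mono power_decreasing) (force)+
  finally have "norm ((\<integral>\<omega>. a (\<lambda>t. X t \<omega>) * b (\<lambda>t. X t \<omega>) \<partial>M) - (\<integral>\<omega>. a (\<lambda>t. X t \<omega>) \<partial>M) * (\<integral>\<omega>. b (\<lambda>t. X t \<omega>) \<partial>M))
    \<le> real (card J2) * (K * r ^ g)" by simp
  then show ?thesis
    unfolding a_def b_def of_real_mult[symmetric] integral_complex_of_real of_real_diff[symmetric] norm_of_real .
qed

text \<open>Mixed moments as functions of triples (centring constant, threshold, time), so that
  factors are reordered by permuting arguments and the integral need not be unfolded.\<close>

definition E1 :: "(real \<times> real \<times> int) \<Rightarrow> real" where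
  "E1 u = expectation (\<lambda>\<omega>. case u of (c, \<xi>, t) \<Rightarrow> V c \<xi> t \<omega>)"
definition E2 :: "(real \<times> real \<times> int) \<Rightarrow> (real \<times> real \<times> int) \<Rightarrow> real" where
  "E2 u1 u2 = expectation (\<lambda>\<omega>. (case u1 of (c, \<xi>, t) \<Rightarrow> V c \<xi> t \<omega>) * (case u2 of (c, \<xi>, t) \<Rightarrow> V c \<xi> t \<omega>))"
definition E3 :: "(real \<times> real \<times> int) \<Rightarrow> (real \<times> real \<times> int) \<Rightarrow> (real \<times> real \<times> int) \<Rightarrow> real" where
  "E3 u1 u2 u3 = expectation (\<lambda>\<omega>. (case u1 of (c, \<xi>, t) \<Rightarrow> V c \<xi> t \<omega>) * (case u2 of (c, \<xi>, t) \<Rightarrow> V c \<xi> t \<omega>) * (case u3 of (c, \<xi>, t) \<Rightarrow> V c \<xi> t \<omega>))"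
definition E4 :: "(real \<times> real \<times> int) \<Rightarrow> (real \<times> real \<times> int) \<Rightarrow> (real \<times> real \<times> int) \<Rightarrow> (real \<times> real \<times> int) \<Rightarrow> real" where
  "E4 u1 u2 u3 u4 = expectation (\<lambda>\<omega>. (case u1 of (c, \<xi>, t) \<Rightarrow> V c \<xi> t \<omega>) * (case u2 of (c, \<xi>, t) \<Rightarrow> V c \<xi> t \<omega>) * (case u3 of (c, \<xi>, t) \<Rightarrow> V c \<xi> t \<omega>) * (case u4 of (c, \<xi>, t) \<Rightarrow> V c \<xi> t \<omega>))"

definition ok :: "(real \<times> real \<times> int) \<Rightarrow> bool" where
  "ok u \<longleftrightarrow> 0 \<le> fst u \<and> fst u \<le> 1 \<and> near (fst (snd u))"

abbreviation tm :: "(real \<times> real \<times> int) \<Rightarrow> int" where "tm u \<equiv> snd (snd u)"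

lemma E_perm: "E2 u1 u2 = E2 u2 u1" "E4 u1 u2 u3 u4 = E4 u3 u1 u2 u4" "E4 u1 u2 u3 u4 = E4 u3 u4 u1 u2"
  "E4 u1 u2 u3 u4 = E4 u2 u1 u3 u4" "E4 u1 u2 u3 u4 = E4 u1 u2 u4 u3"
  by (simp_all add: E2_def E4_def mult_ac)

lemma E_bounds:
  shows "ok u1 \<Longrightarrow> \<bar>E1 u1\<bar> \<le> 1"
    and "ok u1 \<Longrightarrow> ok u2 \<Longrightarrow> \<bar>E2 u1 u2\<bar> \<le> 1"
    and "ok u1 \<Longrightarrow> ok u2 \<Longrightarrow> ok u3 \<Longrightarrow> \<bar>E3 u1 u2 u3\<bar> \<le> 1"
    and "ok u1 \<Longrightarrow> ok u2 \<Longrightarrow> ok u3 \<Longrightarrow> ok u4 \<Longrightarrow> \<bar>E4 u1 u2 u3 u4\<bar> \<le> 1"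
  unfolding E1_def E2_def E3_def E4_def ok_def
  by (auto intro!: abs_expectation_le mult_le_one Vfun_abs_le simp: abs_mult split: prod.splits)

text \<open>At gap 0 no decorrelation is available, but the error of quantities bounded by 1 is at
  most 2. The requirement K >= 2 makes the bound hold there as well, so the splitting rules are
  valid for every natural gap.\<close>

lemma split_aux:
  assumes "\<bar>e\<bar> \<le> 1" "\<bar>e1\<bar> \<le> 1" "\<bar>e2\<bar> \<le> 1" "m \<ge> 1" "g \<ge> 1 \<Longrightarrow> \<bar>e - e1 * e2\<bar> \<le> m * (K * r ^ g)"
  shows "\<bar>e - e1 * e2\<bar> \<le> m * (K * r ^ g)"
proof (cases "g \<ge> 1")
  case False
  then have "g = 0" by simp
  have "\<bar>e1 * e2\<bar> \<le> 1" using assms by (simp add: abs_mult mult_le_one)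
  then have "\<bar>e - e1 * e2\<bar> \<le> 2" using assms by linarith
  also have "\<dots> \<le> m * K" using mult_mono[of 1 m 2 K] assms K_ge by simp
  finally show ?thesis using \<open>g = 0\<close> by simp
qed (use assms in auto)

text \<open>In \<open>split11\<close>, \<open>split31\<close>, \<open>split22\<close> and
  \<open>split13\<close> the digits count the factors before and after the cut; the constant in the
  bound is the number of factors after it.\<close>

lemma split11:
  assumes "ok u1" "ok u2" "tm u1 + int g \<le> tm u2"
  shows "\<bar>E2 u1 u2 - E1 u1 * E1 u2\<bar> \<le> 1 * (K * r ^ g)"
proof (rule split_aux)
  assume g: "g \<ge> 1"
  obtain c1 x1 t1 c2 x2 t2 where u: "u1 = (c1,x1,t1)" "u2 = (c2,x2,t2)" by (metis prod.exhaust)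
  \<comment> \<open>\<open>prod_split\<close> takes families indexed by integers, so the triples are
    listed as functions of an integer index.\<close>
  define c where "c = (\<lambda>i::int. if i = 0 then c1 else c2)"
  define x where "x = (\<lambda>i::int. if i = 0 then x1 else x2)"
  define t where "t = (\<lambda>i::int. if i = 0 then t1 else t2)"
  have vals: "c 0 = c1" "c 1 = c2" "x 0 = x1" "x 1 = x2" "t 0 = t1" "t 1 = t2" by (auto simp: c_def x_def t_def)
  have cb: "0 \<le> c i" "c i \<le> 1" "near (x i)" for i using assms by (auto simp: u ok_def c_def x_def)
  note P = prod_split[of "{0}" "{1}" t t1 g c x, OF _ _ _ _ _ g cb]
  have "\<bar>expectation (\<lambda>\<omega>. (\<Prod>i\<in>{0}. V (c i) (x i) (t i) \<omega>) * (\<Prod>i\<in>{1}. V (c i) (x i) (t i) \<omega>))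
     - expectation (\<lambda>\<omega>. \<Prod>i\<in>{0}. V (c i) (x i) (t i) \<omega>) * expectation (\<lambda>\<omega>. \<Prod>i\<in>{1}. V (c i) (x i) (t i) \<omega>)\<bar>
     \<le> real (card ({1} :: int set)) * (K * r ^ g)"
    by (rule P) (use assms in \<open>auto simp: u vals\<close>)
  then show "\<bar>E2 u1 u2 - E1 u1 * E1 u2\<bar> \<le> 1 * (K * r ^ g)"
    by (simp add: u E1_def E2_def vals)
qed (auto simp: E_bounds assms)

lemma split31:
  assumes "ok u1" "ok u2" "ok u3" "ok u4" "tm u1 + int g \<le> tm u4" "tm u2 + int g \<le> tm u4" "tm u3 + int g \<le> tm u4"
  shows "\<bar>E4 u1 u2 u3 u4 - E3 u1 u2 u3 * E1 u4\<bar> \<le> 1 * (K * r ^ g)"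
proof (rule split_aux)
  assume g: "g \<ge> 1"
  obtain c1 x1 t1 c2 x2 t2 c3 x3 t3 c4 x4 t4 where u: "u1 = (c1,x1,t1)" "u2 = (c2,x2,t2)" "u3 = (c3,x3,t3)" "u4 = (c4,x4,t4)"
    by (metis prod.exhaust)
  define c where "c = (\<lambda>i::int. if i = 0 then c1 else if i = 1 then c2 else if i = 2 then c3 else c4)"
  define x where "x = (\<lambda>i::int. if i = 0 then x1 else if i = 1 then x2 else if i = 2 then x3 else x4)"
  define t where "t = (\<lambda>i::int. if i = 0 then t1 else if i = 1 then t2 else if i = 2 then t3 else t4)"
  have vals: "c 0 = c1" "c 1 = c2" "c 2 = c3" "c 3 = c4" "x 0 = x1" "x 1 = x2" "x 2 = x3" "x 3 = x4"
    "t 0 = t1" "t 1 = t2" "t 2 = t3" "t 3 = t4" by (auto simp: c_def x_def t_def)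
  have cb: "0 \<le> c i" "c i \<le> 1" "near (x i)" for i using assms by (auto simp: u ok_def c_def x_def)
  note P = prod_split[of "{0,1,2}" "{3}" t "t4 - int g" g c x, OF _ _ _ _ _ g cb]
  have "\<bar>expectation (\<lambda>\<omega>. (\<Prod>i\<in>{0,1,2}. V (c i) (x i) (t i) \<omega>) * (\<Prod>i\<in>{3}. V (c i) (x i) (t i) \<omega>))
     - expectation (\<lambda>\<omega>. \<Prod>i\<in>{0,1,2}. V (c i) (x i) (t i) \<omega>) * expectation (\<lambda>\<omega>. \<Prod>i\<in>{3}. V (c i) (x i) (t i) \<omega>)\<bar>
     \<le> real (card ({3} :: int set)) * (K * r ^ g)"
    by (rule P) (use assms in \<open>auto simp: u vals\<close>)
  then show "\<bar>E4 u1 u2 u3 u4 - E3 u1 u2 u3 * E1 u4\<bar> \<le> 1 * (K * r ^ g)"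
    by (simp add: u E1_def E2_def E3_def E4_def vals[unfolded One_nat_def] mult.assoc)
qed (auto simp: E_bounds assms)

lemma split22:
  assumes "ok u1" "ok u2" "ok u3" "ok u4" "tm u1 + int g \<le> tm u3" "tm u2 + int g \<le> tm u3" "tm u1 + int g \<le> tm u4" "tm u2 + int g \<le> tm u4"
  shows "\<bar>E4 u1 u2 u3 u4 - E2 u1 u2 * E2 u3 u4\<bar> \<le> 2 * (K * r ^ g)"
proof (rule split_aux)
  assume g: "g \<ge> 1"
  obtain c1 x1 t1 c2 x2 t2 c3 x3 t3 c4 x4 t4 where u: "u1 = (c1,x1,t1)" "u2 = (c2,x2,t2)" "u3 = (c3,x3,t3)" "u4 = (c4,x4,t4)"
    by (metis prod.exhaust)
  define c where "c = (\<lambda>i::int. if i = 0 then c1 else if i = 1 then c2 else if i = 2 then c3 else c4)"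
  define x where "x = (\<lambda>i::int. if i = 0 then x1 else if i = 1 then x2 else if i = 2 then x3 else x4)"
  define t where "t = (\<lambda>i::int. if i = 0 then t1 else if i = 1 then t2 else if i = 2 then t3 else t4)"
  have vals: "c 0 = c1" "c 1 = c2" "c 2 = c3" "c 3 = c4" "x 0 = x1" "x 1 = x2" "x 2 = x3" "x 3 = x4"
    "t 0 = t1" "t 1 = t2" "t 2 = t3" "t 3 = t4" by (auto simp: c_def x_def t_def)
  have cb: "0 \<le> c i" "c i \<le> 1" "near (x i)" for i using assms by (auto simp: u ok_def c_def x_def)
  note P = prod_split[of "{0,1}" "{2,3}" t "max t1 t2" g c x, OF _ _ _ _ _ g cb]
  have "\<bar>expectation (\<lambda>\<omega>. (\<Prod>i\<in>{0,1}. V (c i) (x i) (t i) \<omega>) * (\<Prod>i\<in>{2,3}. V (c i) (x i) (t i) \<omega>))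
     - expectation (\<lambda>\<omega>. \<Prod>i\<in>{0,1}. V (c i) (x i) (t i) \<omega>) * expectation (\<lambda>\<omega>. \<Prod>i\<in>{2,3}. V (c i) (x i) (t i) \<omega>)\<bar>
     \<le> real (card ({2,3} :: int set)) * (K * r ^ g)"
    by (rule P) (use assms in \<open>auto simp: u vals\<close>)
  then show "\<bar>E4 u1 u2 u3 u4 - E2 u1 u2 * E2 u3 u4\<bar> \<le> 2 * (K * r ^ g)"
    by (simp add: u E1_def E2_def E3_def E4_def vals[unfolded One_nat_def] mult.assoc)
qed (auto simp: E_bounds assms)

lemma split13:
  assumes "ok u1" "ok u2" "ok u3" "ok u4" "tm u1 + int g \<le> tm u2" "tm u1 + int g \<le> tm u3" "tm u1 + int g \<le> tm u4"
  shows "\<bar>E4 u1 u2 u3 u4 - E1 u1 * E3 u2 u3 u4\<bar> \<le> 3 * (K * r ^ g)"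
proof (rule split_aux)
  assume g: "g \<ge> 1"
  obtain c1 x1 t1 c2 x2 t2 c3 x3 t3 c4 x4 t4 where u: "u1 = (c1,x1,t1)" "u2 = (c2,x2,t2)" "u3 = (c3,x3,t3)" "u4 = (c4,x4,t4)"
    by (metis prod.exhaust)
  define c where "c = (\<lambda>i::int. if i = 0 then c1 else if i = 1 then c2 else if i = 2 then c3 else c4)"
  define x where "x = (\<lambda>i::int. if i = 0 then x1 else if i = 1 then x2 else if i = 2 then x3 else x4)"
  define t where "t = (\<lambda>i::int. if i = 0 then t1 else if i = 1 then t2 else if i = 2 then t3 else t4)"
  have vals: "c 0 = c1" "c 1 = c2" "c 2 = c3" "c 3 = c4" "x 0 = x1" "x 1 = x2" "x 2 = x3" "x 3 = x4"
    "t 0 = t1" "t 1 = t2" "t 2 = t3" "t 3 = t4" by (auto simp: c_def x_def t_def)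
  have cb: "0 \<le> c i" "c i \<le> 1" "near (x i)" for i using assms by (auto simp: u ok_def c_def x_def)
  note P = prod_split[of "{0}" "{1,2,3}" t "t1" g c x, OF _ _ _ _ _ g cb]
  have "\<bar>expectation (\<lambda>\<omega>. (\<Prod>i\<in>{0}. V (c i) (x i) (t i) \<omega>) * (\<Prod>i\<in>{1,2,3}. V (c i) (x i) (t i) \<omega>))
     - expectation (\<lambda>\<omega>. \<Prod>i\<in>{0}. V (c i) (x i) (t i) \<omega>) * expectation (\<lambda>\<omega>. \<Prod>i\<in>{1,2,3}. V (c i) (x i) (t i) \<omega>)\<bar>
     \<le> real (card ({1,2,3} :: int set)) * (K * r ^ g)"
    by (rule P) (use assms in \<open>auto simp: u vals\<close>)
  then show "\<bar>E4 u1 u2 u3 u4 - E1 u1 * E3 u2 u3 u4\<bar> \<le> 3 * (K * r ^ g)"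
    by (simp add: u E1_def E2_def E3_def E4_def vals[unfolded One_nat_def] mult.assoc)
qed (auto simp: E_bounds assms)

lemma E4_shift: "E4 (c1,x1,t1+s) (c2,x2,t2+s) (c3,x3,t3+s) (c4,x4,t4+s) = E4 (c1,x1,t1) (c2,x2,t2) (c3,x3,t3) (c4,x4,t4)"
  using expectation_shift[of "\<lambda>x. Vfun c1 x1 (x t1) * Vfun c2 x2 (x t2) * Vfun c3 x3 (x t3) * Vfun c4 x4 (x t4)" s]
  by (simp add: E4_def)

lemma E2_shift: "E2 (c1,x1,t1+s) (c2,x2,t2+s) = E2 (c1,x1,t1) (c2,x2,t2)"
  using expectation_shift[of "\<lambda>x. Vfun c1 x1 (x t1) * Vfun c2 x2 (x t2)" s]
  by (simp add: E2_def)

lemma E1_shift: "E1 (c1,x1,t1) = E1 (c1,x1,0)"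
  using expectation_shift[of "\<lambda>x. Vfun c1 x1 (x 0)" t1]
  by (simp add: E1_def)

definition p :: "real \<Rightarrow> real" where "p \<xi> = prob {\<omega> \<in> space M. X 0 \<omega> < \<xi>}"

lemma p_bounds: "0 \<le> p \<xi>" "p \<xi> \<le> 1" by (auto simp: p_def)

lemma E1_p: "E1 (c, \<xi>, t) = c - p \<xi>"
proof -
  have "E1 (c, \<xi>, t) = expectation (\<lambda>\<omega>. c - indicator {\<omega> \<in> space M. X 0 \<omega> < \<xi>} \<omega>)"
    unfolding E1_shift[of c \<xi> t] unfolding E1_def
    by (intro Bochner_Integration.integral_cong) (auto simp: Vfun_def indicator_def)
  also have "\<dots> = c - p \<xi>"
    by (subst Bochner_Integration.integral_diff) (auto simp: p_def prob_space intro!: integrable_bounded[where B=1])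
  finally show ?thesis .
qed

text \<open>The fifth root turns a bound in the length of one gap into a bound in the sum of the lag
  difference and the time shift; \<open>quad\<close> shows that five times a usable gap dominates
  that sum.\<close>

definition \<theta> :: real where "\<theta> = root 5 r"

lemma \<theta>: "0 < \<theta>" "\<theta> < 1" "\<theta> ^ 5 = r"
  unfolding \<theta>_def using r by (simp_all only: real_root_gt_zero real_root_lt_1_iff real_root_pow_pos2 zero_less_numeral less_imp_le)

lemma r_pow_le: "m \<le> 5 * g \<Longrightarrow> r ^ g \<le> \<theta> ^ m"
proof -
  assume "m \<le> 5 * g"
  then have "\<theta> ^ (5 * g) \<le> \<theta> ^ m" using \<theta> by (intro power_decreasing) auto
  then show ?thesis by (simp only: power_mult \<theta>(3))
qed

end

lemma abs_mult_le: "\<bar>a\<bar> \<le> A \<Longrightarrow> \<bar>b\<bar> \<le> B \<Longrightarrow> \<bar>a * b\<bar> \<le> A * (B::real)"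
  unfolding abs_mult by (rule mult_mono) auto

section \<open>Moments under pairwise independence\<close>

locale stationary_gmc_indep = stationary_gmc +
  assumes pair: "\<And>j \<xi> \<xi>'. j > 0 \<Longrightarrow> near \<xi> \<Longrightarrow> near \<xi>' \<Longrightarrow>
    prob {\<omega> \<in> space M. X 0 \<omega> < \<xi> \<and> X j \<omega> < \<xi>'} = p \<xi> * p \<xi>'"
begin

text \<open>Centring at the true probability makes the first moment vanish at every threshold, not
  only at the quantile; thresholds near the quantile are needed because it is estimated.\<close>

definition w :: "real \<Rightarrow> int \<Rightarrow> real \<times> real \<times> int" where "w \<xi> t = (p \<xi>, \<xi>, t)"
abbreviation W :: "real \<Rightarrow> int \<Rightarrow> 'a \<Rightarrow> real" where "W \<xi> t \<omega> \<equiv> V (p \<xi>) \<xi> t \<omega>"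

lemma W_bound: "\<bar>W \<xi> t \<omega>\<bar> \<le> 1" by (rule Vfun_abs_le) (auto simp: p_bounds)

lemma W_w: "(case w \<xi> t of (c, \<xi>, t) \<Rightarrow> V c \<xi> t \<omega>) = W \<xi> t \<omega>" by (simp add: w_def)

lemma ok_w[simp]: "ok (w \<xi> t) = near \<xi>" by (auto simp: w_def ok_def p_bounds)
lemma tm_w[simp]: "snd (snd (w \<xi> t)) = t" by (simp add: w_def)
lemma E1_w[simp]: "E1 (w \<xi> t) = 0" by (simp add: w_def E1_p)

lemma E2_less:
  assumes "near \<xi>" "near \<xi>'" "s < t"
  shows "E2 (c, \<xi>, s) (c', \<xi>', t) = (c - p \<xi>) * (c' - p \<xi>')"
proof -
  let ?A = "{\<omega> \<in> space M. X 0 \<omega> < \<xi>}" and ?B = "{\<omega> \<in> space M. X (t - s) \<omega> < \<xi>'}"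
  have i: "integrable M (indicator A :: 'a \<Rightarrow> real)" if "A \<in> sets M" for A
    using that by (intro integrable_bounded[where B=1]) auto
  have sh: "prob ?B = p \<xi>'"
    using E1_p[of 0 \<xi>' "t - s"] unfolding E1_def
  proof -
    assume "expectation (\<lambda>\<omega>. case (0, \<xi>', t - s) of (c, \<xi>, t) \<Rightarrow> V c \<xi> t \<omega>) = 0 - p \<xi>'"
    moreover have "expectation (\<lambda>\<omega>. case (0, \<xi>', t - s) of (c, \<xi>, t) \<Rightarrow> V c \<xi> t \<omega>) = expectation (\<lambda>\<omega>. - indicator ?B \<omega>)"
      by (intro Bochner_Integration.integral_cong) (auto simp: Vfun_def indicator_def)
    ultimately show ?thesis by simp
  qed
  have "E2 (c, \<xi>, s) (c', \<xi>', t) = E2 (c, \<xi>, 0) (c', \<xi>', t - s)"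
    using E2_shift[of c \<xi> 0 s c' \<xi>' "t - s"] by simp
  also have "\<dots> = expectation (\<lambda>\<omega>. c * c' - c * indicator ?B \<omega> - c' * indicator ?A \<omega> + indicator (?A \<inter> ?B) \<omega>)"
    unfolding E2_def by (intro Bochner_Integration.integral_cong) (auto simp: Vfun_def indicator_def algebra_simps)
  also have "\<dots> = c * c' - c * prob ?B - c' * prob ?A + prob (?A \<inter> ?B)"
    by (simp add: i prob_space Bochner_Integration.integrable_diff)
  also have "?A \<inter> ?B = {\<omega> \<in> space M. X 0 \<omega> < \<xi> \<and> X (t - s) \<omega> < \<xi>'}" by auto
  also have "prob \<dots> = p \<xi> * p \<xi>'" using assms by (intro pair) auto
  finally show ?thesis unfolding sh by (simp add: p_def[symmetric] algebra_simps)
qed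

lemma E2_p:
  assumes "near \<xi>" "near \<xi>'" "s \<noteq> t"
  shows "E2 (c, \<xi>, s) (c', \<xi>', t) = (c - p \<xi>) * (c' - p \<xi>')"
proof (cases "s < t")
  case False
  then have "E2 (c', \<xi>', t) (c, \<xi>, s) = (c' - p \<xi>') * (c - p \<xi>)" using assms by (intro E2_less) auto
  then show ?thesis by (subst E_perm(1)) (simp only: mult.commute)
qed (use E2_less assms in auto)

lemma E2_w: "near \<xi> \<Longrightarrow> near \<xi>' \<Longrightarrow> s \<noteq> t \<Longrightarrow> E2 (w \<xi> s) (w \<xi>' t) = 0"
  by (simp add: w_def E2_p)

text \<open>The four times are -j, 0, h - k and h. Cutting off h, or -j, or h - k when it comes
  first, leaves a vanishing first moment; cutting between the two pairs leaves a second moment at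
  distinct times, which vanishes by pairwise independence. So every cut bounds the whole moment, and
  the longest available one is taken.\<close>

lemma quad:
  assumes n: "near \<xi>1" "near \<xi>2" "near \<xi>3" "near \<xi>4" and jk: "j \<ge> 1" "k \<ge> 1"
  shows "\<bar>E4 (w \<xi>1 (- int j)) (w \<xi>2 0) (w \<xi>3 (int h - int k)) (w \<xi>4 (int h))\<bar>
    \<le> 3 * K * \<theta> ^ (nat \<bar>int j - int k\<bar> + h)" (is "\<bar>?E\<bar> \<le> _")
proof -
  have up: "m * (K * r ^ g) \<le> 3 * K * r ^ g" if "m \<le> 3" for m g
    using that K_ge r by (simp add: mult_right_mono)
  have mn: "int (min h k) \<le> int h" "int (min h k) \<le> int k" by simp_all
  have E: "\<bar>?E\<bar> \<le> 3 * K * r ^ min h k"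
    using split31[of "w \<xi>1 (- int j)" "w \<xi>2 0" "w \<xi>3 (int h - int k)" "w \<xi>4 (int h)" "min h k"] n up[of 1 "min h k"] mn
    by (simp del: of_nat_min of_nat_le_iff)
  have M: "\<bar>?E\<bar> \<le> 3 * K * r ^ (h - k)" if "k \<le> h"
    using split22[of "w \<xi>1 (- int j)" "w \<xi>2 0" "w \<xi>3 (int h - int k)" "w \<xi>4 (int h)" "h - k"] n that up[of 2 "h - k"] jk
    by (simp add: E2_w of_nat_diff)
  have F1: "\<bar>?E\<bar> \<le> 3 * K * r ^ (j - k)" if "k \<le> j"
    using split13[of "w \<xi>1 (- int j)" "w \<xi>2 0" "w \<xi>3 (int h - int k)" "w \<xi>4 (int h)" "j - k"] n that up[of 3 "j - k"]
    by (simp add: of_nat_diff)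
  have F2: "\<bar>?E\<bar> \<le> 3 * K * r ^ (k - j - h)" if "j + h \<le> k"
    using split13[of "w \<xi>3 (int h - int k)" "w \<xi>1 (- int j)" "w \<xi>2 0" "w \<xi>4 (int h)" "k - j - h"] n that up[of 3 "k - j - h"]
    by (simp add: of_nat_diff E_perm(2)[of "w \<xi>1 (- int j)"])
  let ?d = "nat \<bar>int j - int k\<bar> + h"
  \<comment> \<open>The four alternatives are the gaps used in \<open>E\<close>, \<open>M\<close>,
    \<open>F1\<close> and \<open>F2\<close>: whatever the order of the times, one of them is at
    least a fifth of |j - k| + h.\<close>
  have "?d \<le> 5 * min h k \<or> k \<le> h \<and> ?d \<le> 5 * (h - k) \<or> k \<le> j \<and> ?d \<le> 5 * (j - k) \<or> j + h \<le> k \<and> ?d \<le> 5 * (k - j - h)"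
  proof (cases "k \<le> j")
    case True
    then obtain d where d: "j = k + d" using le_Suc_ex by blast
    show ?thesis
    proof (cases "h \<le> k")
      case False
      then obtain e where "h = k + e" using le_Suc_ex nat_le_linear by blast
      then show ?thesis using d by (auto simp: min_def)
    qed (use d in auto)
  next
    case False
    then obtain d where d: "k = j + d" using le_Suc_ex nat_le_linear by blast
    show ?thesis
    proof (cases "h \<le> k")
      case True
      then obtain e where e: "k = h + e" using le_Suc_ex by blast
      show ?thesis
      proof (cases "h \<le> d")
        case True
        then obtain f where "d = h + f" using le_Suc_ex by blast
        then show ?thesis using d by auto
      qed (use d e in auto)
    next
      case False
      then obtain e where "h = k + e" using le_Suc_ex nat_le_linear by blast
      then show ?thesis using d by (auto simp: min_def)
    qed
  qed
  moreover have "\<bar>?E\<bar> \<le> 3 * K * \<theta> ^ ?d" if "\<bar>?E\<bar> \<le> 3 * K * r ^ g" "?d \<le> 5 * g" for g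
    by (rule order_trans[OF that(1)], intro mult_left_mono r_pow_le that(2)) (use K_ge in simp)
  ultimately show ?thesis using E M F1 F2 by metis
qed

text \<open>For j > 0 this is the covariance occurring in the kernel of the limit: the lagged
  products have mean zero, so subtracting the product of their means changes nothing.\<close>

definition cv :: "int \<Rightarrow> int \<Rightarrow> int \<Rightarrow> real" where
  "cv j k l = E4 (w \<xi>0 0) (w \<xi>0 j) (w \<xi>0 (j - l)) (w \<xi>0 (j - l - k))"

lemma E4_w_shift: "E4 (w x1 (t1+s)) (w x2 (t2+s)) (w x3 (t3+s)) (w x4 (t4+s)) = E4 (w x1 t1) (w x2 t2) (w x3 t3) (w x4 t4)"
  unfolding w_def by (rule E4_shift)

lemma cv_eq: "cv j k l = E4 (w \<xi>0 (s - j)) (w \<xi>0 s) (w \<xi>0 (s - l)) (w \<xi>0 (s - l - k))"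
  using E4_w_shift[of \<xi>0 0 "s - j" \<xi>0 j \<xi>0 "j - l" \<xi>0 "j - l - k"] by (simp add: cv_def algebra_simps)

text \<open>Exchanging the two lagged products and translating back by stationarity reverses the
  sign of the shift.\<close>

lemma cv_sym: "cv j k l = cv k j (- l)"
  unfolding cv_eq[of j k l 0] cv_eq[of k j "-l" "-l"]
proof -
  have "E4 (w \<xi>0 (0 - j)) (w \<xi>0 0) (w \<xi>0 (0 - l)) (w \<xi>0 (0 - l - k)) = E4 (w \<xi>0 (0 - l)) (w \<xi>0 (0 - l - k)) (w \<xi>0 (0 - j)) (w \<xi>0 0)"
    by (rule E_perm(3))
  also have "\<dots> = E4 (w \<xi>0 (0 - l - k)) (w \<xi>0 (0 - l)) (w \<xi>0 (0 - j)) (w \<xi>0 0)" by (rule E_perm(4))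
  also have "\<dots> = E4 (w \<xi>0 (0 - l - k)) (w \<xi>0 (0 - l)) (w \<xi>0 0) (w \<xi>0 (0 - j))" by (rule E_perm(5))
  also have "\<dots> = E4 (w \<xi>0 (- l - k)) (w \<xi>0 (- l)) (w \<xi>0 (- l - (- l))) (w \<xi>0 (- l - (- l) - j))" by simp
  finally show "E4 (w \<xi>0 (0 - j)) (w \<xi>0 0) (w \<xi>0 (0 - l)) (w \<xi>0 (0 - l - k)) = E4 (w \<xi>0 (- l - k)) (w \<xi>0 (- l)) (w \<xi>0 (- l - (- l))) (w \<xi>0 (- l - (- l) - j))" .
qed

lemma cv_bound:
  assumes jk: "j \<ge> 1" "k \<ge> 1"
  shows "\<bar>cv (int j) (int k) l\<bar> \<le> 3 * K * \<theta> ^ (nat \<bar>int j - int k\<bar> + nat \<bar>l\<bar>)"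
proof -
  \<comment> \<open>\<open>quad\<close> treats the case in which the second product lies later, that
    is l <= 0. A positive l is reduced to it by exchanging the two products.\<close>
  have neg: "\<bar>cv (int j) (int k) l\<bar> \<le> 3 * K * \<theta> ^ (nat \<bar>int j - int k\<bar> + nat \<bar>l\<bar>)"
    if "l \<le> 0" "j \<ge> 1" "k \<ge> 1" for j k l
    using quad[of \<xi>0 \<xi>0 \<xi>0 \<xi>0 j k "nat (- l)"] that
      E_perm(5)[of "w \<xi>0 (- int j)" "w \<xi>0 0" "w \<xi>0 (- l)" "w \<xi>0 (- l - int k)"]
    by (simp add: cv_eq[of _ _ _ 0])
  show ?thesis
  proof (cases "l \<le> 0")
    case False
    then show ?thesis using neg[of "- l" k j] jk cv_sym[of "int j" "int k" l] by (simp add: abs_minus_commute)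
  qed (use neg jk in auto)
qed

text \<open>The limiting covariance of the normalised autocovariances at lags j + 1 and k +
  1.\<close>

definition cc :: "nat \<Rightarrow> nat \<Rightarrow> real" where
  "cc j k = infsum (cv (int (Suc j)) (int (Suc k))) UNIV"

lemma cv_bound': "\<bar>cv (int (Suc j)) (int (Suc k)) l\<bar> \<le> (3 * K * \<theta> ^ nat \<bar>int j - int k\<bar>) * \<theta> ^ nat \<bar>l\<bar>"
  using cv_bound[of "Suc j" "Suc k" l] by (simp add: power_add mult.assoc)

lemma cv_summable: "cv (int (Suc j)) (int (Suc k)) summable_on A"
  by (rule abs_summable_summable, rule summable_on_geometric_int(1)[of \<theta>, OF _ _ cv_bound'])
     (simp_all add: \<theta>(1,2) less_imp_le)

lemma cc_bound: "\<bar>cc j k\<bar> \<le> (6 * K / (1 - \<theta>)) * \<theta> ^ nat \<bar>int j - int k\<bar>"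
proof -
  have "\<bar>cc j k\<bar> \<le> 3 * K * \<theta> ^ nat \<bar>int j - int k\<bar> * (2 / (1 - \<theta>))"
    unfolding cc_def
    by (rule summable_on_geometric_int(2)[of \<theta>, OF _ _ cv_bound']) (simp_all add: \<theta>(1,2) less_imp_le)
  then show ?thesis by (simp add: mult_ac)
qed

lemma cc_sym: "cc j k = cc k j"
proof -
  have "cc j k = infsum (\<lambda>l. cv (int (Suc k)) (int (Suc j)) (- l)) UNIV"
    unfolding cc_def by (intro infsum_cong cv_sym)
  also have "\<dots> = infsum (cv (int (Suc k)) (int (Suc j))) (uminus ` UNIV)"
    by (subst infsum_reindex) (auto simp: o_def)
  finally show ?thesis by (simp add: cc_def)
qed

lemma E2_expectation: "expectation (\<lambda>\<omega>. W x1 t1 \<omega> * W x2 t2 \<omega>) = E2 (w x1 t1) (w x2 t2)"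
  by (simp add: E2_def W_w)
lemma E4_expectation: "expectation (\<lambda>\<omega>. W x1 t1 \<omega> * W x2 t2 \<omega> * (W x3 t3 \<omega> * W x4 t4 \<omega>)) = E4 (w x1 t1) (w x2 t2) (w x3 t3) (w x4 t4)"
  by (simp add: E4_def W_w mult.assoc)

lemma integrable_W[simp]: "integrable M (W x1 t1)" "integrable M (\<lambda>\<omega>. W x1 t1 \<omega> * W x2 t2 \<omega>)"
  "integrable M (\<lambda>\<omega>. W x1 t1 \<omega> * W x2 t2 \<omega> * (W x3 t3 \<omega> * W x4 t4 \<omega>))"
  by (intro integrable_bounded[where B=1]; auto intro!: mult_le_one W_bound simp: abs_mult)+

lemma quad_st:
  assumes n: "near \<xi>1" "near \<xi>2" and j: "j \<ge> 1" and st: "s \<le> t"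
  shows "\<bar>expectation (\<lambda>\<omega>. W \<xi>1 s \<omega> * W \<xi>1 (s - int j) \<omega> * (W \<xi>2 t \<omega> * W \<xi>2 (t - int j) \<omega>))\<bar> \<le> 3 * K * \<theta> ^ nat (t - s)"
proof -
  have "expectation (\<lambda>\<omega>. W \<xi>1 s \<omega> * W \<xi>1 (s - int j) \<omega> * (W \<xi>2 t \<omega> * W \<xi>2 (t - int j) \<omega>))
     = E4 (w \<xi>1 (s - int j)) (w \<xi>1 s) (w \<xi>2 (t - int j)) (w \<xi>2 t)"
    unfolding E4_expectation
    by (rule trans[OF E_perm(4) E_perm(5)])
  also have "\<dots> = E4 (w \<xi>1 (- int j)) (w \<xi>1 0) (w \<xi>2 (int (nat (t - s)) - int j)) (w \<xi>2 (int (nat (t - s))))"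
    using E4_w_shift[of \<xi>1 "- int j" s \<xi>1 0 \<xi>2 "t - s - int j" \<xi>2 "t - s"] st by simp
  finally show ?thesis using quad[OF n(1) n(1) n(2) n(2) j j, of "nat (t - s)"] by simp
qed

text \<open>The bound is the same for all lags, since for equal lags only the time shift remains in
  the exponent of \<open>quad\<close>. The tail of the sum over lags is controlled by this
  uniformity.\<close>

lemma WW_second_moment:
  assumes n: "near \<xi>" and j: "j \<ge> 1" and A: "finite A"
  shows "expectation (\<lambda>\<omega>. (\<Sum>t\<in>A. W \<xi> t \<omega> * W \<xi> (t - int j) \<omega>)\<^sup>2) \<le> real (card A) * (6 * K / (1 - \<theta>))"
proof -
  have "expectation (\<lambda>\<omega>. (\<Sum>t\<in>A. W \<xi> t \<omega> * W \<xi> (t - int j) \<omega>)\<^sup>2) \<le> real (card A) * (3 * K * (2 / (1 - \<theta>)))"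
    using \<theta>(1,2) K_ge quad_st[OF n n j] A
    by (intro second_moment_sum_le[where B=1]) (auto intro!: mult_le_one W_bound simp: abs_mult)
  then show ?thesis by (simp add: mult_ac)
qed

lemma expectation_of_bool_diff: "expectation (\<lambda>\<omega>. \<bar>of_bool (X t \<omega> < u) - of_bool (X t \<omega> < v)\<bar>) = \<bar>p u - p v\<bar>"
proof -
  have *: "expectation (\<lambda>\<omega>. \<bar>of_bool (X t \<omega> < u) - of_bool (X t \<omega> < v)\<bar>) = p v - p u" if "u \<le> v" for u v
  proof -
    have "expectation (\<lambda>\<omega>. \<bar>of_bool (X t \<omega> < u) - of_bool (X t \<omega> < v)\<bar>) = expectation (\<lambda>\<omega>. V 0 u t \<omega> - V 0 v t \<omega>)"
      using that by (intro Bochner_Integration.integral_cong) (auto simp: Vfun_def split: split_of_bool)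
    also have "\<dots> = E1 (0, u, t) - E1 (0, v, t)"
      unfolding E1_def by (simp, intro Bochner_Integration.integral_diff integrable_bounded[where B=1])
        (auto simp: Vfun_def)
    finally show ?thesis by (simp add: E1_p)
  qed
  have mono: "p u \<le> p v" if "u \<le> v" for u v
    unfolding p_def using that by (intro finite_measure_mono) auto
  show ?thesis
    using *[of u v] *[of v u] mono[of u v] mono[of v u] by (cases "u \<le> v") (auto simp: abs_minus_commute)
qed

lemma W_diff_L1: "expectation (\<lambda>\<omega>. \<bar>W u t \<omega> - W v t \<omega>\<bar>) \<le> 2 * \<bar>p u - p v\<bar>"
proof -
  have "expectation (\<lambda>\<omega>. \<bar>W u t \<omega> - W v t \<omega>\<bar>) \<le> expectation (\<lambda>\<omega>. \<bar>p u - p v\<bar> + \<bar>of_bool (X t \<omega> < u) - of_bool (X t \<omega> < v)\<bar>)"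
    using p_bounds[of u] p_bounds[of v]
    by (intro integral_mono integrable_bounded[where B=2]) (auto simp: Vfun_of_bool split: split_of_bool)
  also have "\<dots> = \<bar>p u - p v\<bar> + \<bar>p u - p v\<bar>"
    by (subst Bochner_Integration.integral_add) (auto simp: expectation_of_bool_diff prob_space intro!: integrable_bounded[where B=1])
  finally show ?thesis by simp
qed

text \<open>Each covariance of increments has two bounds: one decays geometrically in the distance
  of the times but is not small for close thresholds, the other is proportional to |p u - p v| but
  does not decay. Their geometric mean has both properties, at the price of the square
  roots.\<close>

lemma WW_diff_second_moment:
  assumes n: "near u" "near v" and j: "j \<ge> 1" and A: "finite A"
  shows "expectation (\<lambda>\<omega>. (\<Sum>t\<in>A. W u t \<omega> * W u (t - int j) \<omega> - W v t \<omega> * W v (t - int j) \<omega>)\<^sup>2)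
     \<le> real (card A) * (sqrt (96 * K * \<bar>p u - p v\<bar>) * (2 / (1 - sqrt \<theta>)))"
proof (rule second_moment_sum_le[where B=2])
  let ?D = "\<lambda>t \<omega>. W u t \<omega> * W u (t - int j) \<omega> - W v t \<omega> * W v (t - int j) \<omega>"
  have b1: "\<bar>W x1 t1 \<omega> * W x2 t2 \<omega>\<bar> \<le> 1" for x1 x2 t1 t2 \<omega>
    by (auto intro!: mult_le_one W_bound simp: abs_mult)
  show b: "\<bar>?D t \<omega>\<bar> \<le> 2" for t \<omega>
    using b1[of u t \<omega> u "t - int j"] b1[of v t \<omega> v "t - int j"] by linarith
  fix s t assume st: "s \<in> A" "t \<in> A" "s \<le> t"
  have q: "\<bar>expectation (\<lambda>\<omega>. ?D s \<omega> * ?D t \<omega>)\<bar> \<le> 12 * K * \<theta> ^ nat (t - s)"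
  proof -
    have "expectation (\<lambda>\<omega>. ?D s \<omega> * ?D t \<omega>) =
       expectation (\<lambda>\<omega>. W u s \<omega> * W u (s - int j) \<omega> * (W u t \<omega> * W u (t - int j) \<omega>))
     - expectation (\<lambda>\<omega>. W u s \<omega> * W u (s - int j) \<omega> * (W v t \<omega> * W v (t - int j) \<omega>))
     - expectation (\<lambda>\<omega>. W v s \<omega> * W v (s - int j) \<omega> * (W u t \<omega> * W u (t - int j) \<omega>))
     + expectation (\<lambda>\<omega>. W v s \<omega> * W v (s - int j) \<omega> * (W v t \<omega> * W v (t - int j) \<omega>))"
      by (simp add: left_diff_distrib right_diff_distrib)
    then show ?thesis
      using quad_st[OF n(1) n(1) j st(3)] quad_st[OF n(1) n(2) j st(3)] quad_st[OF n(2) n(1) j st(3)] quad_st[OF n(2) n(2) j st(3)]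
      by linarith
  qed
  have l: "\<bar>expectation (\<lambda>\<omega>. ?D s \<omega> * ?D t \<omega>)\<bar> \<le> 8 * \<bar>p u - p v\<bar>"
  proof -
    have "\<bar>expectation (\<lambda>\<omega>. ?D s \<omega> * ?D t \<omega>)\<bar> \<le> expectation (\<lambda>\<omega>. \<bar>?D s \<omega> * ?D t \<omega>\<bar>)"
      using integral_norm_bound[of M "\<lambda>\<omega>. ?D s \<omega> * ?D t \<omega>"] by simp
    also have "\<dots> \<le> expectation (\<lambda>\<omega>. 2 * \<bar>W u s \<omega> - W v s \<omega>\<bar> + 2 * \<bar>W u (s - int j) \<omega> - W v (s - int j) \<omega>\<bar>)"
    proof (rule integral_mono)
      show "integrable M (\<lambda>\<omega>. \<bar>?D s \<omega> * ?D t \<omega>\<bar>)"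
        unfolding real_norm_def by (intro integrable_bounded[where B="2 * 2"]) (measurable, unfold real_norm_def abs_abs, rule abs_mult_le[OF b b])
      show "integrable M (\<lambda>\<omega>. 2 * \<bar>W u s \<omega> - W v s \<omega>\<bar> + 2 * \<bar>W u (s - int j) \<omega> - W v (s - int j) \<omega>\<bar>)"
        by (intro Bochner_Integration.integrable_add integrable_mult_right integrable_abs Bochner_Integration.integrable_diff) auto
      fix \<omega>
      have "\<bar>?D s \<omega>\<bar> \<le> \<bar>W u s \<omega> - W v s \<omega>\<bar> + \<bar>W u (s - int j) \<omega> - W v (s - int j) \<omega>\<bar>"
      proof -
        have "?D s \<omega> = (W u s \<omega> - W v s \<omega>) * W u (s - int j) \<omega> + W v s \<omega> * (W u (s - int j) \<omega> - W v (s - int j) \<omega>)"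
          by (simp add: algebra_simps)
        also have "\<bar>\<dots>\<bar> \<le> \<bar>W u s \<omega> - W v s \<omega>\<bar> * \<bar>W u (s - int j) \<omega>\<bar> + \<bar>W v s \<omega>\<bar> * \<bar>W u (s - int j) \<omega> - W v (s - int j) \<omega>\<bar>"
          unfolding abs_mult[symmetric] by (rule abs_triangle_ineq)
        also have "\<dots> \<le> \<bar>W u s \<omega> - W v s \<omega>\<bar> * 1 + 1 * \<bar>W u (s - int j) \<omega> - W v (s - int j) \<omega>\<bar>"
          by (intro add_mono mult_mono W_bound) auto
        finally show ?thesis by simp
      qed
      then have "\<bar>?D s \<omega>\<bar> * \<bar>?D t \<omega>\<bar> \<le> (\<bar>W u s \<omega> - W v s \<omega>\<bar> + \<bar>W u (s - int j) \<omega> - W v (s - int j) \<omega>\<bar>) * 2"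
        using b by (intro mult_mono) auto
      then show "\<bar>?D s \<omega> * ?D t \<omega>\<bar> \<le> 2 * \<bar>W u s \<omega> - W v s \<omega>\<bar> + 2 * \<bar>W u (s - int j) \<omega> - W v (s - int j) \<omega>\<bar>"
        by (simp add: abs_mult)
    qed
    also have "\<dots> = 2 * expectation (\<lambda>\<omega>. \<bar>W u s \<omega> - W v s \<omega>\<bar>) + 2 * expectation (\<lambda>\<omega>. \<bar>W u (s - int j) \<omega> - W v (s - int j) \<omega>\<bar>)"
      by (subst Bochner_Integration.integral_add) (auto intro!: integrable_mult_right integrable_abs Bochner_Integration.integrable_diff)
    finally show ?thesis using W_diff_L1[of u s v] W_diff_L1[of u "s - int j" v] by linarith
  qed
  let ?e = "\<bar>expectation (\<lambda>\<omega>. ?D s \<omega> * ?D t \<omega>)\<bar>"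
  have "?e = sqrt (?e * ?e)" by simp
  also have "\<dots> \<le> sqrt ((12 * K * \<theta> ^ nat (t - s)) * (8 * \<bar>p u - p v\<bar>))"
    using q l K_ge \<theta>(1,2) by (intro real_sqrt_le_mono mult_mono) auto
  also have "\<dots> = sqrt (96 * K * \<bar>p u - p v\<bar>) * sqrt \<theta> ^ nat (t - s)"
    by (simp only: real_sqrt_power[symmetric] real_sqrt_mult[symmetric]) (simp add: mult_ac)
  finally show "?e \<le> sqrt (96 * K * \<bar>p u - p v\<bar>) * sqrt \<theta> ^ nat (t - s)" .
next
  show "0 \<le> sqrt \<theta>" "sqrt \<theta> < 1" using \<theta>(1,2) by simp_all
  show "0 \<le> sqrt (96 * K * \<bar>p u - p v\<bar>)" using K_ge by simp
  show "finite A" by (rule A)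
  show "(\<lambda>\<omega>. W u t \<omega> * W u (t - int j) \<omega> - W v t \<omega> * W v (t - int j) \<omega>) \<in> borel_measurable M" for t
    by measurable
qed

lemma W_second_moment:
  assumes n: "near u" and A: "finite A"
  shows "expectation (\<lambda>\<omega>. (\<Sum>t\<in>A. W u t \<omega>)\<^sup>2) \<le> 2 * real (card A)"
proof -
  \<comment> \<open>Distinct times are uncorrelated, which is geometric decay with ratio 0; the
    diagonal is covered by 0 ^ 0 = 1.\<close>
  have "expectation (\<lambda>\<omega>. (\<Sum>t\<in>A. W u t \<omega>)\<^sup>2) \<le> real (card A) * (1 * (2 / (1 - 0)))"
  proof (rule second_moment_sum_le[where B=1])
    fix s t :: int assume "s \<le> t"
    show "\<bar>expectation (\<lambda>\<omega>. W u s \<omega> * W u t \<omega>)\<bar> \<le> 1 * 0 ^ nat (t - s)"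
    proof (cases "s = t")
      case True
      then show ?thesis using E_bounds(2)[of "w u s" "w u t"] n by (simp add: E2_expectation)
    next
      case False
      then show ?thesis using n by (simp add: E2_expectation E2_w)
    qed
  qed (auto simp: W_bound A)
  then show ?thesis by simp
qed

lemma W_diff_second_moment:
  assumes n: "near u" "near v" and A: "finite A"
  shows "expectation (\<lambda>\<omega>. (\<Sum>t\<in>A. W u t \<omega> - W v t \<omega>)\<^sup>2) \<le> real (card A) * (8 * \<bar>p u - p v\<bar>)"
proof -
  have b: "\<bar>W u t \<omega> - W v t \<omega>\<bar> \<le> 2" for t \<omega> using W_bound[of u t \<omega>] W_bound[of v t \<omega>] by linarith
  have "expectation (\<lambda>\<omega>. (\<Sum>t\<in>A. W u t \<omega> - W v t \<omega>)\<^sup>2) \<le> real (card A) * ((4 * \<bar>p u - p v\<bar>) * (2 / (1 - 0)))"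
  proof (rule second_moment_sum_le[where B=2])
    fix s t :: int assume "s \<le> t"
    show "\<bar>expectation (\<lambda>\<omega>. (W u s \<omega> - W v s \<omega>) * (W u t \<omega> - W v t \<omega>))\<bar> \<le> 4 * \<bar>p u - p v\<bar> * 0 ^ nat (t - s)"
    proof (cases "s = t")
      case True
      have "\<bar>expectation (\<lambda>\<omega>. (W u s \<omega> - W v s \<omega>) * (W u s \<omega> - W v s \<omega>))\<bar> \<le> expectation (\<lambda>\<omega>. 2 * \<bar>W u s \<omega> - W v s \<omega>\<bar>)"
      proof -
        have "\<bar>expectation (\<lambda>\<omega>. (W u s \<omega> - W v s \<omega>) * (W u s \<omega> - W v s \<omega>))\<bar> \<le> expectation (\<lambda>\<omega>. \<bar>(W u s \<omega> - W v s \<omega>) * (W u s \<omega> - W v s \<omega>)\<bar>)"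
          using integral_norm_bound[of M "\<lambda>\<omega>. (W u s \<omega> - W v s \<omega>) * (W u s \<omega> - W v s \<omega>)"] by simp
        also have "\<dots> \<le> expectation (\<lambda>\<omega>. 2 * \<bar>W u s \<omega> - W v s \<omega>\<bar>)"
        proof (rule integral_mono)
          show "integrable M (\<lambda>\<omega>. \<bar>(W u s \<omega> - W v s \<omega>) * (W u s \<omega> - W v s \<omega>)\<bar>)"
            by (intro integrable_bounded[where B="2 * 2"]) (measurable, unfold real_norm_def abs_abs, rule abs_mult_le[OF b b])
          show "\<bar>(W u s \<omega> - W v s \<omega>) * (W u s \<omega> - W v s \<omega>)\<bar> \<le> 2 * \<bar>W u s \<omega> - W v s \<omega>\<bar>" for \<omega>
            unfolding abs_mult by (intro mult_right_mono b) auto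
        qed auto
        finally show ?thesis .
      qed
      then show ?thesis using True W_diff_L1[of u s v] by simp
    next
      case False
      then show ?thesis using n by (simp add: left_diff_distrib right_diff_distrib E2_expectation E2_w)
    qed
  qed (auto simp: b A)
  then show ?thesis by simp
qed

end

subsection \<open>A central limit theorem by blocking\<close>

lemma iexp_lipschitz: "cmod (iexp x - iexp y) \<le> \<bar>x - y\<bar>"
proof -
  have "iexp x - iexp y = iexp y * (iexp (x - y) - 1)"
    by (simp add: algebra_simps flip: exp_add)
  then have "cmod (iexp x - iexp y) = cmod (iexp (x - y) - 1)"
    by (simp add: norm_mult)
  also have "\<dots> \<le> \<bar>x - y\<bar>"
    using iexp_approx1[of "x - y" 0] by simp
  finally show ?thesis .
qed

lemma (in prob_space) expectation_abs_le_sqrt: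
  fixes f :: "'a \<Rightarrow> real"
  assumes "integrable M f" "integrable M (\<lambda>\<omega>. (f \<omega>)\<^sup>2)"
  shows "expectation (\<lambda>\<omega>. \<bar>f \<omega>\<bar>) \<le> sqrt (expectation (\<lambda>\<omega>. (f \<omega>)\<^sup>2))"
proof -
  have v: "0 \<le> variance (\<lambda>\<omega>. \<bar>f \<omega>\<bar>)" by (intro integral_nonneg_AE) auto
  have "variance (\<lambda>\<omega>. \<bar>f \<omega>\<bar>) = expectation (\<lambda>\<omega>. \<bar>f \<omega>\<bar>\<^sup>2) - (expectation (\<lambda>\<omega>. \<bar>f \<omega>\<bar>))\<^sup>2"
    by (rule variance_eq) (use assms in auto)
  with v have "(expectation (\<lambda>\<omega>. \<bar>f \<omega>\<bar>))\<^sup>2 \<le> expectation (\<lambda>\<omega>. (f \<omega>)\<^sup>2)" by simp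
  then show ?thesis by (rule real_le_rsqrt)
qed

text \<open>The row of s misses only autocovariances at distances reaching beyond an end of the
  block, so its defect is geometrically small in the distance of s to the ends, and the defects add
  up to a constant independent of p. Writing \<theta> as \<eta> * \<eta> spends one factor on the
  distance to the ends and keeps the other for summing over l.\<close>

lemma autocovariance_block_sum:
  fixes \<gamma> :: "int \<Rightarrow> real"
  assumes \<theta>: "0 < \<theta>" "\<theta> < 1" and \<gamma>: "\<And>h. \<bar>\<gamma> h\<bar> \<le> C * \<theta> ^ nat \<bar>h\<bar>"
  obtains D where "D \<ge> 0" "\<And>p. \<bar>(\<Sum>s\<in>{1..int p}. \<Sum>t\<in>{1..int p}. \<gamma> (t - s)) - real p * infsum \<gamma> UNIV\<bar> \<le> D"
proof -
  define \<eta> where "\<eta> = sqrt \<theta>"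
  have \<eta>: "0 \<le> \<eta>" "\<eta> < 1" "\<eta> * \<eta> = \<theta>" using \<theta> by (auto simp: \<eta>_def)
  have "0 \<le> C * \<theta> ^ nat \<bar>0::int\<bar>" using \<gamma>[of 0] by linarith
  then have C: "C \<ge> 0" by simp
  let ?E = "C * (2 / (1 - \<eta>))"
  have E: "?E \<ge> 0" using C \<eta> by simp
  have row: "\<bar>(\<Sum>t\<in>{1..int p}. \<gamma> (t - s)) - infsum \<gamma> UNIV\<bar> \<le> ?E * (\<eta> ^ nat \<bar>s - 0\<bar> + \<eta> ^ nat \<bar>s - (int p + 1)\<bar>)"
    if s: "s \<in> {1..int p}" for p s
  proof -
    let ?A = "(\<lambda>t. t - s) ` {1..int p}"
    have sm: "\<gamma> summable_on B" for B
      by (rule abs_summable_summable, rule summable_on_geometric_int(1)[of \<theta>, OF _ _ \<gamma>]) (use \<theta> in auto)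
    have "infsum \<gamma> UNIV = infsum \<gamma> ?A + infsum \<gamma> (- ?A)"
      using infsum_Un_disjoint[OF sm[of ?A] sm[of "- ?A"]] by (simp add: Compl_partition)
    moreover have "infsum \<gamma> ?A = (\<Sum>t\<in>{1..int p}. \<gamma> (t - s))"
      by (subst infsum_finite, simp, subst sum.reindex) (simp_all add: inj_on_def)
    moreover have "\<bar>infsum \<gamma> (- ?A)\<bar> \<le> (C * (\<eta> ^ nat \<bar>s - 0\<bar> + \<eta> ^ nat \<bar>s - (int p + 1)\<bar>)) * (2 / (1 - \<eta>))"
    proof -
      define f where "f l = (if l \<in> ?A then 0 else \<gamma> l)" for l
      have "infsum \<gamma> (- ?A) = infsum f UNIV"
        by (rule infsum_cong_neutral) (auto simp: f_def)
      also have "\<bar>\<dots>\<bar> \<le> (C * (\<eta> ^ nat \<bar>s - 0\<bar> + \<eta> ^ nat \<bar>s - (int p + 1)\<bar>)) * (2 / (1 - \<eta>))"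
      proof (rule summable_on_geometric_int(2)[OF \<eta>(1,2)])
        fix l
        show "\<bar>f l\<bar> \<le> C * (\<eta> ^ nat \<bar>s - 0\<bar> + \<eta> ^ nat \<bar>s - (int p + 1)\<bar>) * \<eta> ^ nat \<bar>l\<bar>"
        proof (cases "l \<in> ?A")
          case True
          then show ?thesis using C \<eta> by (simp add: f_def)
        next
          case False
          have "l + s \<notin> {1..int p}"
          proof
            assume "l + s \<in> {1..int p}"
            then have "(l + s) - s \<in> ?A" by (rule imageI)
            then show False using False by simp
          qed
          \<comment> \<open>Leaving the block to the left requires |l| >= s, leaving it to the right
            requires |l| >= p + 1 - s.\<close>
          then have "nat \<bar>s - 0\<bar> \<le> nat \<bar>l\<bar> \<or> nat \<bar>s - (int p + 1)\<bar> \<le> nat \<bar>l\<bar>" using s by auto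
          then have "\<eta> ^ nat \<bar>l\<bar> \<le> \<eta> ^ nat \<bar>s - 0\<bar> + \<eta> ^ nat \<bar>s - (int p + 1)\<bar>"
          proof
            assume "nat \<bar>s - 0\<bar> \<le> nat \<bar>l\<bar>"
            then have "\<eta> ^ nat \<bar>l\<bar> \<le> \<eta> ^ nat \<bar>s - 0\<bar>" using \<eta> by (intro power_decreasing) auto
            moreover have "0 \<le> \<eta> ^ nat \<bar>s - (int p + 1)\<bar>" using \<eta> by simp
            ultimately show ?thesis by linarith
          next
            assume "nat \<bar>s - (int p + 1)\<bar> \<le> nat \<bar>l\<bar>"
            then have "\<eta> ^ nat \<bar>l\<bar> \<le> \<eta> ^ nat \<bar>s - (int p + 1)\<bar>" using \<eta> by (intro power_decreasing) auto
            moreover have "0 \<le> \<eta> ^ nat \<bar>s - 0\<bar>" using \<eta> by simp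
            ultimately show ?thesis by linarith
          qed
          then have "C * (\<eta> ^ nat \<bar>l\<bar> * \<eta> ^ nat \<bar>l\<bar>) \<le> C * ((\<eta> ^ nat \<bar>s - 0\<bar> + \<eta> ^ nat \<bar>s - (int p + 1)\<bar>) * \<eta> ^ nat \<bar>l\<bar>)"
            using C \<eta> by (intro mult_left_mono mult_right_mono) auto
          moreover have "\<eta> ^ nat \<bar>l\<bar> * \<eta> ^ nat \<bar>l\<bar> = \<theta> ^ nat \<bar>l\<bar>"
            unfolding power_mult_distrib[symmetric] \<eta>(3) ..
          moreover have "f l = \<gamma> l" unfolding f_def by (rule if_not_P[OF False])
          ultimately show ?thesis using \<gamma>[of l] by (simp add: mult.assoc)
        qed
      qed
      finally show ?thesis .
    qed
    ultimately show ?thesis by (simp add: mult_ac)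
  qed
  show thesis
  proof (rule that[of "?E * (2 / (1 - \<eta>) + 2 / (1 - \<eta>))"])
    fix p
    have "\<bar>(\<Sum>s\<in>{1..int p}. \<Sum>t\<in>{1..int p}. \<gamma> (t - s)) - real p * infsum \<gamma> UNIV\<bar>
      = \<bar>\<Sum>s\<in>{1..int p}. ((\<Sum>t\<in>{1..int p}. \<gamma> (t - s)) - infsum \<gamma> UNIV)\<bar>"
      by (simp add: sum_subtractf)
    also have "\<dots> \<le> (\<Sum>s\<in>{1..int p}. ?E * (\<eta> ^ nat \<bar>s - 0\<bar> + \<eta> ^ nat \<bar>s - (int p + 1)\<bar>))"
      by (rule order_trans[OF sum_abs]) (intro sum_mono row, simp)
    also have "\<dots> = ?E * ((\<Sum>s\<in>{1..int p}. \<eta> ^ nat \<bar>s - 0\<bar>) + (\<Sum>s\<in>{1..int p}. \<eta> ^ nat \<bar>s - (int p + 1)\<bar>))"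
      unfolding sum_distrib_left[symmetric] sum.distrib ..
    also have "\<dots> \<le> ?E * (2 / (1 - \<eta>) + 2 / (1 - \<eta>))"
      by (intro mult_left_mono add_mono sum_geometric_int_le \<eta> E) auto
    finally show "\<bar>(\<Sum>s\<in>{1..int p}. \<Sum>t\<in>{1..int p}. \<gamma> (t - s)) - real p * infsum \<gamma> UNIV\<bar> \<le> ?E * (2 / (1 - \<eta>) + 2 / (1 - \<eta>))" .
    show "0 \<le> ?E * (2 / (1 - \<eta>) + 2 / (1 - \<eta>))"
      using \<eta> by (intro mult_nonneg_nonneg[OF E]) auto
  qed
qed

lemma exp_quadratic_bound: "x \<ge> 0 \<Longrightarrow> \<bar>exp (- x) - (1 - x)\<bar> \<le> x\<^sup>2 / (2::real)"
proof -
  assume x: "x \<ge> 0"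
  have "1 - x \<le> exp (- x)" using exp_ge_add_one_self[of "- x"] by simp
  moreover have "exp (- x) \<le> 1 - x + x\<^sup>2 / 2"
  proof (cases "x = 0")
    case False
    then have "\<exists>t. 0 < t \<and> t < x \<and> (1 - x + x\<^sup>2 / 2 - exp (- x)) - (1 - 0 + 0\<^sup>2 / 2 - exp (- 0)) = (x - 0) * (- 1 + t + exp (- t))"
      using x by (intro MVT2) (auto intro!: derivative_eq_intros)
    then obtain t where t: "0 < t" "1 - x + x\<^sup>2 / 2 - exp (- x) = x * (- 1 + t + exp (- t))" by auto
    moreover have "- 1 + t + exp (- t) \<ge> 0" using exp_ge_add_one_self[of "- t"] by simp
    ultimately show ?thesis using x by (smt (verit) mult_nonneg_nonneg)
  qed simp
  ultimately show ?thesis by simp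
qed

text \<open>The blocking argument sees the sequence only through its second moments and the
  characteristic functions of its partial sums, so stationarity and decorrelation are stated for
  these. Decorrelation starts at gap m because in the application a term looks back over m time
  steps.\<close>

locale weakly_dependent = prob_space M for M :: "'a measure" +
  fixes T :: "int \<Rightarrow> 'a \<Rightarrow> real" and \<gamma> :: "int \<Rightarrow> real" and B C D \<theta> :: real and m :: nat
  assumes T_meas[measurable]: "\<And>t. T t \<in> borel_measurable M"
    and T_bd: "\<And>t \<omega>. \<bar>T t \<omega>\<bar> \<le> B"
    and T_mean: "\<And>t. expectation (T t) = 0"
    and T_cov: "\<And>s t. expectation (\<lambda>\<omega>. T s \<omega> * T t \<omega>) = \<gamma> (t - s)"
    and \<gamma>_bd: "\<And>h. \<bar>\<gamma> h\<bar> \<le> C * \<theta> ^ nat \<bar>h\<bar>"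
    and \<theta>01: "0 < \<theta>" "\<theta> < 1"
    and T_stat: "\<And>c s p. expectation (\<lambda>\<omega>. iexp (c * (\<Sum>t\<in>{s + 1..s + int p}. T t \<omega>))) = expectation (\<lambda>\<omega>. iexp (c * (\<Sum>t\<in>{1..int p}. T t \<omega>)))"
    and T_dec: "\<And>c A s g p. c \<ge> 0 \<Longrightarrow> m \<le> g \<Longrightarrow> finite A \<Longrightarrow> A \<subseteq> {..s} \<Longrightarrow>
      cmod (expectation (\<lambda>\<omega>. iexp (c * (\<Sum>t\<in>A. T t \<omega>)) * iexp (c * (\<Sum>t\<in>{s + int g + 1..s + int g + int p}. T t \<omega>)))
        - expectation (\<lambda>\<omega>. iexp (c * (\<Sum>t\<in>A. T t \<omega>))) * expectation (\<lambda>\<omega>. iexp (c * (\<Sum>t\<in>{s + int g + 1..s + int g + int p}. T t \<omega>))))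
      \<le> D * c * \<theta> ^ g"
begin

lemma B0: "B \<ge> 0" using T_bd[of 0 undefined] by linarith
lemma C0: "C \<ge> 0"
proof -
  have "0 \<le> C * \<theta> ^ nat \<bar>0::int\<bar>" using \<gamma>_bd[of 0] by linarith
  then show ?thesis by simp
qed
lemma D0: "D \<ge> 0"
proof -
  have "0 \<le> D * 1 * \<theta> ^ m" by (rule order_trans[OF norm_ge_zero T_dec[of 1 m "{}" 0 0]]) auto
  then show ?thesis using zero_less_power[OF \<theta>01(1), of m] by (simp add: zero_le_mult_iff)
qed

definition S :: "int set \<Rightarrow> 'a \<Rightarrow> real" where "S A \<omega> = (\<Sum>t\<in>A. T t \<omega>)"

lemma S_meas[measurable]: "S A \<in> borel_measurable M" unfolding S_def by measurable

lemma S_bd: "\<bar>S A \<omega>\<bar> \<le> real (card A) * B"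
  unfolding S_def using T_bd by (intro order_trans[OF sum_abs] sum_bounded_above)

lemma S_int: "integrable M (S A)" "integrable M (\<lambda>\<omega>. (S A \<omega>)\<^sup>2)" "integrable M (\<lambda>\<omega>. \<bar>S A \<omega>\<bar> ^ 3)" "integrable M (\<lambda>\<omega>. iexp (c * S A \<omega>))"
proof -
  show "integrable M (S A)" by (rule integrable_bounded[where B="real (card A) * B"]) (auto simp: S_bd)
  show "integrable M (\<lambda>\<omega>. (S A \<omega>)\<^sup>2)"
    by (rule integrable_bounded[where B="(real (card A) * B)\<^sup>2"]) (measurable, metis S_bd abs_ge_zero power2_abs power_mono real_norm_def abs_power2)
  show "integrable M (\<lambda>\<omega>. \<bar>S A \<omega>\<bar> ^ 3)"
    by (rule integrable_bounded[where B="(real (card A) * B) ^ 3"]) (auto intro!: power_mono S_bd)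
  show "integrable M (\<lambda>\<omega>. iexp (c * S A \<omega>))" by (rule integrable_bounded[where B=1]) auto
qed

definition CC where "CC = C * (2 / (1 - \<theta>))"

lemma CC0: "CC \<ge> 0" using C0 \<theta>01 by (simp add: CC_def)

lemma S_second_moment: "finite A \<Longrightarrow> expectation (\<lambda>\<omega>. (S A \<omega>)\<^sup>2) \<le> real (card A) * CC"
  unfolding S_def CC_def
proof (rule second_moment_sum_le[OF T_meas T_bd])
  fix s t :: int assume "s \<le> t"
  then show "\<bar>expectation (\<lambda>\<omega>. T s \<omega> * T t \<omega>)\<bar> \<le> C * \<theta> ^ nat (t - s)"
    unfolding T_cov using \<gamma>_bd[of "t - s"] by simp
qed (use \<theta>01 C0 in simp_all)

definition m2 where "m2 p = expectation (\<lambda>\<omega>. (S {1..int p} \<omega>)\<^sup>2)"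
definition phi where "phi c p = expectation (\<lambda>\<omega>. iexp (c * S {1..int p} \<omega>))"

lemma m2_sum: "m2 p = (\<Sum>s\<in>{1..int p}. \<Sum>t\<in>{1..int p}. \<gamma> (t - s))"
proof -
  have i: "integrable M (\<lambda>\<omega>. T s \<omega> * T t \<omega>)" for s t
    by (rule integrable_bounded[where B="B * B"]) (use T_bd abs_mult_le in auto)
  show ?thesis unfolding m2_def S_def power2_eq_square sum_product
    using i by (subst Bochner_Integration.integral_sum, force)+ (simp add: T_cov)
qed

lemma m2_bounds: "0 \<le> m2 p" "m2 p \<le> real p * CC"
  using S_second_moment[of "{1..int p}"] by (auto simp: m2_def)

lemma phi_le_1: "cmod (phi c p) \<le> 1"
proof -
  have "cmod (phi c p) \<le> expectation (\<lambda>\<omega>. cmod (iexp (c * S {1..int p} \<omega>)))"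
    unfolding phi_def by (rule integral_norm_bound)
  then show ?thesis by (simp add: prob_space)
qed

text \<open>The cube of a block sum is bounded by its supremum times its square, so the second
  moment bound also controls the third moment in the Taylor remainder.\<close>

lemma phi_approx:
  assumes c: "c \<ge> 0"
  shows "cmod (phi c p - (1 - c\<^sup>2 * m2 p / 2)) \<le> c ^ 3 * (real p * B) * (real p * CC)"
proof -
  let ?S = "S {1..int p}"
  have mean: "expectation ?S = 0"
    unfolding S_def using integrable_bounded[OF T_meas, of _ B] T_bd
    by (subst Bochner_Integration.integral_sum) (auto simp: T_mean)
  have "cmod (char (distr M borel ?S) c - (1 - c\<^sup>2 * m2 p / 2)) \<le>
      (c\<^sup>2 / 6) * expectation (\<lambda>x. min (6 * (?S x)\<^sup>2) (\<bar>c\<bar> * \<bar>?S x\<bar> ^ 3))"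
    by (rule char_approx3'[where X="?S"]) (auto simp: S_int mean m2_def)
  also have "\<dots> \<le> c\<^sup>2 * (c * (real p * B) * (real p * CC))"
  proof -
    have "expectation (\<lambda>x. min (6 * (?S x)\<^sup>2) (\<bar>c\<bar> * \<bar>?S x\<bar> ^ 3)) \<le> expectation (\<lambda>x. c * (real p * B) * (?S x)\<^sup>2)"
    proof (rule integral_mono)
      show "integrable M (\<lambda>x. min (6 * (?S x)\<^sup>2) (\<bar>c\<bar> * \<bar>?S x\<bar> ^ 3))"
        by (intro integrable_min integrable_mult_right S_int)
      show "integrable M (\<lambda>x. c * (real p * B) * (?S x)\<^sup>2)" by (intro integrable_mult_right S_int)
      fix x
      have "\<bar>?S x\<bar> ^ 3 = \<bar>?S x\<bar> * (?S x)\<^sup>2" by (simp add: power3_eq_cube power2_eq_square)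
      also have "\<dots> \<le> (real p * B) * (?S x)\<^sup>2"
        using S_bd[of "{1..int p}" x] by (intro mult_right_mono) auto
      finally have "\<bar>c\<bar> * \<bar>?S x\<bar> ^ 3 \<le> c * (real p * B) * (?S x)\<^sup>2"
        using c by (simp add: mult.assoc mult_left_mono)
      then show "min (6 * (?S x)\<^sup>2) (\<bar>c\<bar> * \<bar>?S x\<bar> ^ 3) \<le> c * (real p * B) * (?S x)\<^sup>2" by simp
    qed
    also have "\<dots> \<le> c * (real p * B) * (real p * CC)"
      using m2_bounds[of p] c B0 by (simp add: m2_def mult_left_mono)
    finally have "(c\<^sup>2 / 6) * expectation (\<lambda>x. min (6 * (?S x)\<^sup>2) (\<bar>c\<bar> * \<bar>?S x\<bar> ^ 3)) \<le> c\<^sup>2 * (c * (real p * B) * (real p * CC))"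
      by (intro mult_mono) auto
    then show ?thesis .
  qed
  also have "\<dots> = c ^ 3 * (real p * B) * (real p * CC)" by (simp add: power3_eq_cube power2_eq_square)
  also have "char (distr M borel ?S) c = phi c p" unfolding char_def phi_def by (subst integral_distr) auto
  finally show ?thesis .
qed

definition block :: "nat \<Rightarrow> nat \<Rightarrow> nat \<Rightarrow> int set" where
  "block p q b = {int (b * (p + q)) + 1..int (b * (p + q)) + int p}"
definition blocks :: "nat \<Rightarrow> nat \<Rightarrow> nat \<Rightarrow> int set" where
  "blocks p q k = (\<Union>b<k. block p q b)"

lemma blocks_subset: "blocks p q k \<subseteq> {1..int (k * (p + q)) - int q}"
proof
  fix t assume "t \<in> blocks p q k"
  then obtain b where b: "b < k" "int (b * (p + q)) + 1 \<le> t" "t \<le> int (b * (p + q)) + int p"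
    by (auto simp: blocks_def block_def)
  have "(b + 1) * (p + q) \<le> k * (p + q)" using b by (intro mult_right_mono) auto
  then have "int ((b + 1) * (p + q)) \<le> int (k * (p + q))" by (simp only: of_nat_le_iff)
  then have "int (b * (p + q)) + int p + int q \<le> int (k * (p + q))" by (simp add: algebra_simps)
  moreover have "0 \<le> int (b * (p + q))" by (rule of_nat_0_le_iff)
  ultimately show "t \<in> {1..int (k * (p + q)) - int q}" using b by (simp del: of_nat_mult)
qed

lemma finite_blocks[simp]: "finite (blocks p q k)" by (simp add: blocks_def block_def)

lemma blocks_Suc: "blocks p q (Suc k) = blocks p q k \<union> block p q k" "blocks p q k \<inter> block p q k = {}"
proof -
  show "blocks p q (Suc k) = blocks p q k \<union> block p q k" by (auto simp: blocks_def lessThan_Suc)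
  show "blocks p q k \<inter> block p q k = {}" using blocks_subset[of p q k] by (fastforce simp: block_def)
qed

lemma card_blocks: "card (blocks p q k) = k * p"
proof (induction k)
  case (Suc k)
  have "card (block p q k) = p" by (simp add: block_def)
  moreover have "finite (block p q k)" by (simp add: block_def)
  ultimately show ?case using Suc blocks_Suc[of p q k] by (simp add: card_Un_disjoint)
qed (simp add: blocks_def)

text \<open>The last block is separated from all the earlier ones by a gap q, so splitting it off
  costs one decorrelation error. Earlier errors are multiplied by characteristic functions of
  modulus at most 1 and hence only add up.\<close>

lemma blocks_factor:
  assumes c: "c \<ge> 0" and q: "m \<le> q"
  shows "cmod (expectation (\<lambda>\<omega>. iexp (c * S (blocks p q k) \<omega>)) - phi c p ^ k) \<le> real k * (D * c * \<theta> ^ q)"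
proof (induction k)
  case 0
  then show ?case by (simp add: blocks_def S_def prob_space)
next
  case (Suc k)
  let ?e = "expectation (\<lambda>\<omega>. iexp (c * S (blocks p q k) \<omega>))"
  let ?s = "int (k * (p + q)) - int q"
  have blk: "block p q k = {?s + int q + 1..?s + int q + int p}" by (simp add: block_def)
  have ph: "expectation (\<lambda>\<omega>. iexp (c * S (block p q k) \<omega>)) = phi c p"
    unfolding phi_def S_def block_def by (rule T_stat)
  have "expectation (\<lambda>\<omega>. iexp (c * S (blocks p q (Suc k)) \<omega>)) = expectation (\<lambda>\<omega>. iexp (c * S (blocks p q k) \<omega>) * iexp (c * S (block p q k) \<omega>))"
  proof -
    have "finite (block p q k)" by (simp add: block_def)
    then have "S (blocks p q (Suc k)) \<omega> = S (blocks p q k) \<omega> + S (block p q k) \<omega>" for \<omega>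
      unfolding S_def blocks_Suc(1) using blocks_Suc(2) by (intro sum.union_disjoint) auto
    then show ?thesis by (simp add: distrib_left exp_add)
  qed
  moreover have "cmod (expectation (\<lambda>\<omega>. iexp (c * S (blocks p q k) \<omega>) * iexp (c * S (block p q k) \<omega>)) - ?e * phi c p) \<le> D * c * \<theta> ^ q"
    unfolding ph[symmetric] unfolding S_def blk
    by (rule T_dec[OF c q]) (use blocks_subset[of p q k] in auto)
  moreover have "cmod (?e * phi c p - phi c p ^ Suc k) \<le> real k * (D * c * \<theta> ^ q)"
  proof -
    have "?e * phi c p - phi c p ^ Suc k = (?e - phi c p ^ k) * phi c p" by (simp add: algebra_simps)
    then have "cmod (?e * phi c p - phi c p ^ Suc k) = cmod (?e - phi c p ^ k) * cmod (phi c p)"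
      by (simp add: norm_mult)
    also have "\<dots> \<le> cmod (?e - phi c p ^ k) * 1" by (intro mult_left_mono phi_le_1) auto
    finally show ?thesis using Suc by simp
  qed
  ultimately have "cmod (expectation (\<lambda>\<omega>. iexp (c * S (blocks p q (Suc k)) \<omega>)) - phi c p ^ Suc k) \<le> D * c * \<theta> ^ q + real k * (D * c * \<theta> ^ q)"
    using norm_triangle_ineq[of "expectation (\<lambda>\<omega>. iexp (c * S (blocks p q k) \<omega>) * iexp (c * S (block p q k) \<omega>)) - ?e * phi c p" "?e * phi c p - phi c p ^ Suc k"]
    by simp
  then show ?case by (simp add: algebra_simps)
qed

text \<open>Dropping terms changes the characteristic function by at most c times the L1 norm of the
  dropped sum, which is bounded by the root of its second moment.\<close>

lemma small_blocks:
  assumes c: "c \<ge> 0" and sub: "A \<subseteq> A'" "finite A'"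
  shows "cmod (expectation (\<lambda>\<omega>. iexp (c * S A' \<omega>)) - expectation (\<lambda>\<omega>. iexp (c * S A \<omega>))) \<le> c * sqrt (real (card A' - card A) * CC)"
proof -
  have fin: "finite A" using sub finite_subset by auto
  have d: "S A' \<omega> - S A \<omega> = S (A' - A) \<omega>" for \<omega>
    unfolding S_def using sum_diff[OF sub(2,1), of "\<lambda>t. T t \<omega>"] by simp
  have "cmod (expectation (\<lambda>\<omega>. iexp (c * S A' \<omega>)) - expectation (\<lambda>\<omega>. iexp (c * S A \<omega>)))
     = cmod (expectation (\<lambda>\<omega>. iexp (c * S A' \<omega>) - iexp (c * S A \<omega>)))"
    by (simp only: Bochner_Integration.integral_diff[OF S_int(4) S_int(4)])
  also have "\<dots> \<le> expectation (\<lambda>\<omega>. cmod (iexp (c * S A' \<omega>) - iexp (c * S A \<omega>)))"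
    by (rule integral_norm_bound)
  also have "\<dots> \<le> expectation (\<lambda>\<omega>. c * \<bar>S (A' - A) \<omega>\<bar>)"
  proof (rule integral_mono)
    show "integrable M (\<lambda>\<omega>. cmod (iexp (c * S A' \<omega>) - iexp (c * S A \<omega>)))"
      by (intro integrable_norm Bochner_Integration.integrable_diff S_int)
    show "integrable M (\<lambda>\<omega>. c * \<bar>S (A' - A) \<omega>\<bar>)" by (intro integrable_mult_right integrable_abs S_int)
    show "cmod (iexp (c * S A' \<omega>) - iexp (c * S A \<omega>)) \<le> c * \<bar>S (A' - A) \<omega>\<bar>" for \<omega>
      by (rule order_trans[OF iexp_lipschitz]) (simp add: c abs_mult flip: right_diff_distrib d)
  qed
  also have "\<dots> = c * expectation (\<lambda>\<omega>. \<bar>S (A' - A) \<omega>\<bar>)" by simp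
  also have "\<dots> \<le> c * sqrt (expectation (\<lambda>\<omega>. (S (A' - A) \<omega>)\<^sup>2))"
    by (intro mult_left_mono c expectation_abs_le_sqrt S_int)
  also have "\<dots> \<le> c * sqrt (real (card A' - card A) * CC)"
    using S_second_moment[of "A' - A"] sub fin by (intro mult_left_mono c real_sqrt_le_mono) (auto simp: card_Diff_subset)
  finally show ?thesis .
qed

lemma phi_power_approx:
  assumes c: "c \<ge> 0"
  shows "cmod (phi c p ^ k - exp (- (real k * (c\<^sup>2 * m2 p / 2)))) \<le> real k * (c ^ 3 * (real p * B) * (real p * CC) + (c\<^sup>2 * (real p * CC))\<^sup>2)"
proof -
  define x where "x = c\<^sup>2 * m2 p / 2"
  have x: "0 \<le> x" "x \<le> c\<^sup>2 * (real p * CC)"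
  proof -
    have "0 \<le> c\<^sup>2 * (real p * CC)" using CC0 by simp
    moreover have "c\<^sup>2 * m2 p \<le> c\<^sup>2 * (real p * CC)" by (intro mult_left_mono m2_bounds) simp
    ultimately show "0 \<le> x" "x \<le> c\<^sup>2 * (real p * CC)" unfolding x_def
      using m2_bounds(1)[of p] by (simp, linarith)
  qed
  \<comment> \<open>Powers of two numbers in the unit disc differ by at most k times the difference
    of the numbers.\<close>
  have "cmod (phi c p ^ k - exp (- x) ^ k) \<le> real k * cmod (phi c p - exp (- x))"
    unfolding of_real_power by (rule norm_power_diff[OF phi_le_1]) (simp add: x(1))
  also have "\<dots> \<le> real k * (c ^ 3 * (real p * B) * (real p * CC) + (c\<^sup>2 * (real p * CC))\<^sup>2)"
  proof (intro mult_left_mono)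
    have "cmod (phi c p - exp (- x)) \<le> cmod (phi c p - (1 - x)) + cmod (complex_of_real (1 - x) - exp (- x))"
      using norm_triangle_ineq[of "phi c p - (1 - x)" "complex_of_real (1 - x) - exp (- x)"] by simp
    also have "cmod (complex_of_real (1 - x) - exp (- x)) = \<bar>exp (- x) - (1 - x)\<bar>"
      unfolding of_real_diff[symmetric] norm_of_real by simp
    also have "\<dots> \<le> x\<^sup>2 / 2" by (rule exp_quadratic_bound[OF x(1)])
    also have "\<dots> \<le> (c\<^sup>2 * (real p * CC))\<^sup>2"
      using power_mono[OF x(2) x(1), of 2] zero_le_power2[of x] by linarith
    finally show "cmod (phi c p - exp (- x)) \<le> c ^ 3 * (real p * B) * (real p * CC) + (c\<^sup>2 * (real p * CC))\<^sup>2"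
      using phi_approx[OF c, of p] by (simp add: x_def)
  qed simp
  finally have "cmod (phi c p ^ k - complex_of_real (exp (- x) ^ k)) \<le> real k * (c ^ 3 * (real p * B) * (real p * CC) + (c\<^sup>2 * (real p * CC))\<^sup>2)" .
  moreover have "exp (- x) ^ k = exp (- (real k * x))"
    using exp_of_nat_mult[of k "- x"] by (simp only: mult_minus_right)
  ultimately show ?thesis by (simp only: x_def)
qed

text \<open>The three summands are the cost of discarding gaps and remainder, of making the blocks
  independent, and of replacing the characteristic function of one block by a Gaussian one. The
  other two claims compare the number of blocks with n / p.\<close>

lemma clt_bound:
  fixes n p q :: nat
  assumes n: "n \<ge> 1" and p: "p \<ge> 1" and q: "m \<le> q"
  defines "k \<equiv> n div (p + q)"
  shows "cmod (expectation (\<lambda>\<omega>. iexp (1 / sqrt (real n) * S {1..int n} \<omega>)) - exp (- (real k / real n * m2 p) / 2))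
    \<le> sqrt ((real q / real p + real (p + q) / real n) * CC) + D * (sqrt (real n) * \<theta> ^ q / real p)
      + (B * CC * (real p / sqrt (real n)) + CC\<^sup>2 * (real p / real n))"
    and "\<bar>1 - real k * real p / real n\<bar> \<le> real q / real p + real (p + q) / real n"
    and "real k / real n \<le> 1 / real p"
proof -
  define c where "c = 1 / sqrt (real n)"
  have c: "c \<ge> 0" "c\<^sup>2 = 1 / real n" "c ^ 3 = 1 / (real n * sqrt (real n))"
    using n by (auto simp: c_def power_divide power3_eq_cube)
  have "k * (p + q) \<le> n" by (simp add: k_def)
  then have "k * p + k * q \<le> n" by (simp add: algebra_simps)
  then have kp: "k * p \<le> n" by simp
  then have kp': "real k * real p \<le> real n" by (metis of_nat_mult of_nat_le_iff)
  then show kn: "real k / real n \<le> 1 / real p" using n p by (simp add: field_simps)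
  \<comment> \<open>What the blocks leave uncovered is k gaps of length q and less than one full
    period.\<close>
  have "n < p + q + k * (p + q)" unfolding k_def using p
    by (metis add.commute dividend_less_div_times div_mult_mod_eq mod_less_divisor add_less_cancel_left add_gr_0 less_le_trans zero_less_one)
  then have rest: "n - k * p \<le> k * q + (p + q)" by (simp add: algebra_simps)
  have "real (n - k * p) / real n \<le> real (k * q + (p + q)) / real n"
    using rest by (intro divide_right_mono) (auto simp only: of_nat_le_iff of_nat_0_le_iff)
  also have "\<dots> = real k / real n * real q + real (p + q) / real n"
    by (simp add: add_divide_distrib)
  also have "\<dots> \<le> 1 / real p * real q + real (p + q) / real n"
    by (intro add_right_mono mult_right_mono kn) auto
  finally have rest': "real (n - k * p) / real n \<le> real q / real p + real (p + q) / real n" by simp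
  have "\<bar>1 - real k * real p / real n\<bar> = real (n - k * p) / real n"
    using kp kp' n by (simp add: field_simps of_nat_diff)
  with rest' show "\<bar>1 - real k * real p / real n\<bar> \<le> real q / real p + real (p + q) / real n" by simp
  let ?e1 = "expectation (\<lambda>\<omega>. iexp (c * S {1..int n} \<omega>))"
  let ?e2 = "expectation (\<lambda>\<omega>. iexp (c * S (blocks p q k) \<omega>))"
  have sub: "blocks p q k \<subseteq> {1..int n}"
  proof -
    have "int (k * (p + q)) \<le> int n" using \<open>k * (p + q) \<le> n\<close> by (simp only: of_nat_le_iff)
    then show ?thesis using blocks_subset[of p q k] by fastforce
  qed
  have "cmod (?e1 - ?e2) \<le> c * sqrt (real (n - k * p) * CC)"
    using small_blocks[OF c(1) sub] by (simp add: card_blocks)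
  also have "\<dots> = sqrt (real (n - k * p) / real n * CC)"
    unfolding c_def by (simp add: real_sqrt_mult real_sqrt_divide)
  also have "\<dots> \<le> sqrt ((real q / real p + real (p + q) / real n) * CC)"
    using rest' CC0 by (intro real_sqrt_le_mono mult_right_mono)
  finally have 1: "cmod (?e1 - ?e2) \<le> sqrt ((real q / real p + real (p + q) / real n) * CC)" .
  have kn': "real k \<le> real n / real p" using kp' p by (simp add: field_simps)
  have "cmod (?e2 - phi c p ^ k) \<le> real k * (D * c * \<theta> ^ q)" by (rule blocks_factor[OF c(1) q])
  also have "\<dots> \<le> (real n / real p) * (D * c * \<theta> ^ q)"
    using D0 c(1) \<theta>01 by (intro mult_right_mono kn') auto
  also have "\<dots> = D * ((real n / sqrt (real n)) * \<theta> ^ q / real p)" by (simp add: c_def mult_ac)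
  also have "real n / sqrt (real n) = sqrt (real n)" using n by (simp add: real_div_sqrt)
  finally have 2: "cmod (?e2 - phi c p ^ k) \<le> D * (sqrt (real n) * \<theta> ^ q / real p)" .
  have "cmod (phi c p ^ k - exp (- (real k * (c\<^sup>2 * m2 p / 2)))) \<le> real k * (c ^ 3 * (real p * B) * (real p * CC) + (c\<^sup>2 * (real p * CC))\<^sup>2)"
    by (rule phi_power_approx[OF c(1)])
  also have "\<dots> \<le> (real n / real p) * (c ^ 3 * (real p * B) * (real p * CC) + (c\<^sup>2 * (real p * CC))\<^sup>2)"
    using B0 CC0 c(1) by (intro mult_right_mono kn') auto
  also have "\<dots> = B * CC * (real p / sqrt (real n)) + CC\<^sup>2 * (real p / real n)"
    unfolding c(2,3) using n p by (simp add: field_simps power2_eq_square)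
  also have "- (real k * (c\<^sup>2 * m2 p / 2)) = - (real k / real n * m2 p) / 2" by (simp add: c(2))
  finally have 3: "cmod (phi c p ^ k - exp (- (real k / real n * m2 p) / 2)) \<le> B * CC * (real p / sqrt (real n)) + CC\<^sup>2 * (real p / real n)" .
  have "cmod (?e1 - exp (- (real k / real n * m2 p) / 2)) \<le> cmod (?e1 - ?e2) + cmod (?e2 - phi c p ^ k) + cmod (phi c p ^ k - exp (- (real k / real n * m2 p) / 2))"
    using norm_triangle_ineq[of "?e1 - ?e2" "?e2 - phi c p ^ k"]
      norm_triangle_ineq[of "?e1 - phi c p ^ k" "phi c p ^ k - exp (- (real k / real n * m2 p) / 2)"] by simp
  then show "cmod (expectation (\<lambda>\<omega>. iexp (1 / sqrt (real n) * S {1..int n} \<omega>)) - exp (- (real k / real n * m2 p) / 2))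
    \<le> sqrt ((real q / real p + real (p + q) / real n) * CC) + D * (sqrt (real n) * \<theta> ^ q / real p)
      + (B * CC * (real p / sqrt (real n)) + CC\<^sup>2 * (real p / real n))"
    using 1 2 3 unfolding c_def by linarith
qed

text \<open>Bernstein blocks of length about n^(1/4) separated by gaps of length about n^(1/8).\<close>

theorem clt: "(\<lambda>n. expectation (\<lambda>\<omega>. iexp (1 / sqrt (real n) * S {1..int n} \<omega>))) \<longlonglongrightarrow> exp (- infsum \<gamma> UNIV / 2)"
proof -
  let ?v = "infsum \<gamma> UNIV"
  obtain D2 where D2: "D2 \<ge> 0" "\<And>p. \<bar>m2 p - real p * ?v\<bar> \<le> D2"
    using autocovariance_block_sum[OF \<theta>01 \<gamma>_bd] unfolding m2_sum by blast
  define p q where "p n = nat \<lfloor>real n powr (1/4)\<rfloor>" and "q n = nat \<lfloor>real n powr (1/8)\<rfloor>" for n :: nat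
  define a where "a = - ln \<theta>"
  have a: "a > 0" "\<theta> = exp (- a)" using \<theta>01 by (auto simp: a_def)
  have rp: "real (p n) = of_int \<lfloor>real n powr (1/4)\<rfloor>" and rq: "real (q n) = of_int \<lfloor>real n powr (1/8)\<rfloor>" for n
    by (auto simp: p_def q_def)
  have \<theta>q: "\<theta> ^ q n = exp (- a * of_int \<lfloor>real n powr (1/8)\<rfloor>)" for n
    unfolding a(2) exp_of_nat_mult[symmetric] rq by (simp add: mult.commute)
  have l1: "(\<lambda>n. real (q n) / real (p n) + real (p n + q n) / real n) \<longlonglongrightarrow> 0"
    unfolding of_nat_add rp rq by real_asymp
  have l2: "(\<lambda>n. sqrt (real n) * \<theta> ^ q n / real (p n)) \<longlonglongrightarrow> 0"
    unfolding \<theta>q rp using a(1) by real_asymp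
  have l3: "(\<lambda>n. real (p n) / sqrt (real n)) \<longlonglongrightarrow> 0" unfolding rp by real_asymp
  have l4: "(\<lambda>n. real (p n) / real n) \<longlonglongrightarrow> 0" unfolding rp by real_asymp
  have l5: "(\<lambda>n. 1 / real (p n)) \<longlonglongrightarrow> 0" unfolding rp by real_asymp
  have ev: "eventually (\<lambda>n. n \<ge> 1 \<and> p n \<ge> 1 \<and> m \<le> q n) sequentially"
  proof -
    have "eventually (\<lambda>n. real (p n) \<ge> 1) sequentially" unfolding rp by real_asymp
    moreover have "eventually (\<lambda>n. real (q n) \<ge> real m) sequentially" unfolding rq by real_asymp
    ultimately show ?thesis using eventually_ge_at_top[of 1] by eventually_elim auto
  qed
  define k where "k n = n div (p n + q n)" for n
  have e1: "(\<lambda>n. expectation (\<lambda>\<omega>. iexp (1 / sqrt (real n) * S {1..int n} \<omega>)) - exp (- (real (k n) / real n * m2 (p n)) / 2)) \<longlonglongrightarrow> 0"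
  proof (rule Lim_null_comparison)
    show "eventually (\<lambda>n. cmod (expectation (\<lambda>\<omega>. iexp (1 / sqrt (real n) * S {1..int n} \<omega>)) - exp (- (real (k n) / real n * m2 (p n)) / 2))
      \<le> sqrt ((real (q n) / real (p n) + real (p n + q n) / real n) * CC) + D * (sqrt (real n) * \<theta> ^ q n / real (p n))
      + (B * CC * (real (p n) / sqrt (real n)) + CC\<^sup>2 * (real (p n) / real n))) sequentially"
      using ev unfolding k_def by eventually_elim (intro clt_bound(1), auto)
    show "(\<lambda>n. sqrt ((real (q n) / real (p n) + real (p n + q n) / real n) * CC) + D * (sqrt (real n) * \<theta> ^ q n / real (p n))
      + (B * CC * (real (p n) / sqrt (real n)) + CC\<^sup>2 * (real (p n) / real n))) \<longlonglongrightarrow> 0"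
      using tendsto_add[OF tendsto_add[OF tendsto_real_sqrt[OF tendsto_mult[OF l1 tendsto_const[of CC]]] tendsto_mult[OF tendsto_const[of D] l2]]
          tendsto_add[OF tendsto_mult[OF tendsto_const[of "B * CC"] l3] tendsto_mult[OF tendsto_const[of "CC\<^sup>2"] l4]]]
      by simp
  qed
  have e2: "(\<lambda>n. real (k n) / real n * m2 (p n) - ?v) \<longlonglongrightarrow> 0"
  proof (rule Lim_null_comparison)
    show "eventually (\<lambda>n. norm (real (k n) / real n * m2 (p n) - ?v) \<le> (1 / real (p n)) * D2 + \<bar>?v\<bar> * (real (q n) / real (p n) + real (p n + q n) / real n)) sequentially"
      using ev
    proof eventually_elim
      case (elim n)
      \<comment> \<open>The second moment of a block is p times the limit variance up to a bounded
        error, and the blocks fill a proportion k p / n of the sample that tends to 1.\<close>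
      have "real (k n) / real n * m2 (p n) - ?v = real (k n) / real n * (m2 (p n) - real (p n) * ?v) - ?v * (1 - real (k n) * real (p n) / real n)"
        by (simp add: algebra_simps)
      also have "norm \<dots> \<le> \<bar>real (k n) / real n\<bar> * \<bar>m2 (p n) - real (p n) * ?v\<bar> + \<bar>?v\<bar> * \<bar>1 - real (k n) * real (p n) / real n\<bar>"
        unfolding real_norm_def abs_mult[symmetric] by (rule abs_triangle_ineq4)
      also have "\<dots> \<le> (1 / real (p n)) * D2 + \<bar>?v\<bar> * (real (q n) / real (p n) + real (p n + q n) / real n)"
        unfolding k_def using elim clt_bound(2,3)[of n "p n" "q n"] D2
        by (intro add_mono mult_mono) auto
      finally show ?case .
    qed
    show "(\<lambda>n. (1 / real (p n)) * D2 + \<bar>?v\<bar> * (real (q n) / real (p n) + real (p n + q n) / real n)) \<longlonglongrightarrow> 0"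
      using tendsto_add[OF tendsto_mult[OF l5 tendsto_const[of D2]] tendsto_mult[OF tendsto_const[of "\<bar>?v\<bar>"] l1]] by simp
  qed
  have "(\<lambda>n. real (k n) / real n * m2 (p n)) \<longlonglongrightarrow> ?v" using e2 by (simp add: LIM_zero_iff)
  then have "(\<lambda>n. complex_of_real (exp (- (real (k n) / real n * m2 (p n)) / 2))) \<longlonglongrightarrow> complex_of_real (exp (- ?v / 2))"
    by (intro tendsto_of_real tendsto_exp tendsto_divide tendsto_minus) auto
  from tendsto_add[OF e1 this] show ?thesis by simp
qed

text \<open>The second moment of a block of length p stays within a constant of p times this number,
  so a negative value would make it negative for long blocks.\<close>

lemma asymptotic_variance_nonneg: "infsum \<gamma> UNIV \<ge> 0"
proof -
  obtain D2 where D2: "\<And>p. \<bar>m2 p - real p * infsum \<gamma> UNIV\<bar> \<le> D2"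
    using autocovariance_block_sum[OF \<theta>01 \<gamma>_bd] unfolding m2_sum by blast
  show ?thesis
  proof (rule ccontr)
    assume "\<not> ?thesis"
    then have neg: "infsum \<gamma> UNIV < 0" by simp
    obtain p where "real p * (- infsum \<gamma> UNIV) > D2" using reals_Archimedean3[of "- infsum \<gamma> UNIV"] neg by auto
    moreover have "m2 p \<ge> 0" by (rule m2_bounds)
    ultimately show False using D2[of p] by auto
  qed
qed

end

lemma has_sum_sum_family:
  fixes f :: "'i \<Rightarrow> 'b \<Rightarrow> real"
  assumes "\<And>i. i \<in> I \<Longrightarrow> (f i has_sum s i) A"
  shows "((\<lambda>x. \<Sum>i\<in>I. f i x) has_sum (\<Sum>i\<in>I. s i)) A"
  using assms
proof (induction I rule: infinite_finite_induct)
  case (insert i I)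
  then show ?case by (simp add: has_sum_add)
qed simp_all

section \<open>Joint limit of finitely many autocovariances\<close>

context stationary_gmc_indep
begin

text \<open>By the Cramer-Wold device the joint limit is reduced to arbitrary linear combinations of
  the lagged products at lags 1 to m, to which the scalar limit theorem applies.\<close>

definition T :: "(nat \<Rightarrow> real) \<Rightarrow> nat \<Rightarrow> int \<Rightarrow> 'a \<Rightarrow> real" where
  "T a m t \<omega> = (\<Sum>j<m. a j * (W \<xi>0 t \<omega> * W \<xi>0 (t - int (Suc j)) \<omega>))"

text \<open>\<open>T\<close> as a functional of the whole path, the form in which stationarity and
  \<open>decor\<close> can be applied.\<close>

definition \<tau>path :: "(nat \<Rightarrow> real) \<Rightarrow> nat \<Rightarrow> int \<Rightarrow> (int \<Rightarrow> real) \<Rightarrow> real" where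
  "\<tau>path a m t x = (\<Sum>j<m. a j * (Vfun (p \<xi>0) \<xi>0 (x t) * Vfun (p \<xi>0) \<xi>0 (x (t - int (Suc j)))))"

lemma T_path: "T a m t \<omega> = \<tau>path a m t (\<lambda>t. X t \<omega>)"
  by (simp add: T_def \<tau>path_def)

lemma \<tau>path_measurable[measurable]: "\<tau>path a m t \<in> borel_measurable path_space"
  unfolding \<tau>path_def by measurable

lemma T_measurable[measurable]: "T a m t \<in> borel_measurable M"
  unfolding T_def by measurable

definition acov :: "(nat \<Rightarrow> real) \<Rightarrow> nat \<Rightarrow> int \<Rightarrow> real" where
  "acov a m h = (\<Sum>j<m. \<Sum>k<m. a j * a k * cv (int (Suc j)) (int (Suc k)) h)"

definition avar :: "(nat \<Rightarrow> real) \<Rightarrow> nat \<Rightarrow> real" where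
  "avar a m = (\<Sum>j<m. \<Sum>k<m. a j * a k * cc j k)"

lemma infsum_acov: "infsum (acov a m) UNIV = avar a m"
proof -
  have "(cv (int (Suc j)) (int (Suc k)) has_sum cc j k) UNIV" for j k
    unfolding cc_def by (intro has_sum_infsum cv_summable)
  then have "((\<lambda>h. \<Sum>j<m. \<Sum>k<m. a j * a k * cv (int (Suc j)) (int (Suc k)) h) has_sum avar a m) UNIV"
    unfolding avar_def by (intro has_sum_sum_family has_sum_cmult_right)
  then show ?thesis unfolding acov_def[abs_def] by (rule infsumI)
qed

lemma acov_bound: "\<bar>acov a m h\<bar> \<le> ((\<Sum>j<m. \<Sum>k<m. \<bar>a j * a k\<bar>) * (3 * K)) * \<theta> ^ nat \<bar>h\<bar>"
proof -
  have "\<bar>acov a m h\<bar> \<le> (\<Sum>j<m. \<Sum>k<m. \<bar>a j * a k\<bar> * (3 * K * \<theta> ^ nat \<bar>h\<bar>))"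
    unfolding acov_def
  proof (rule order_trans[OF sum_abs], rule sum_mono, rule order_trans[OF sum_abs], rule sum_mono)
    fix j k
    have "\<bar>cv (int (Suc j)) (int (Suc k)) h\<bar> \<le> (3 * K * \<theta> ^ nat \<bar>int j - int k\<bar>) * \<theta> ^ nat \<bar>h\<bar>" by (rule cv_bound')
    also have "\<dots> \<le> (3 * K * 1) * \<theta> ^ nat \<bar>h\<bar>"
      using \<theta>(1,2) K_ge by (intro mult_right_mono mult_left_mono power_le_one) auto
    finally show "\<bar>a j * a k * cv (int (Suc j)) (int (Suc k)) h\<bar> \<le> \<bar>a j * a k\<bar> * (3 * K * \<theta> ^ nat \<bar>h\<bar>)"
      unfolding abs_mult[of "a j * a k"] by (intro mult_left_mono) auto
  qed
  then show ?thesis by (simp add: sum_distrib_right mult.assoc)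
qed

lemma T_covariance: "expectation (\<lambda>\<omega>. T a m s \<omega> * T a m t \<omega>) = acov a m (t - s)"
proof -
  have "expectation (\<lambda>\<omega>. T a m s \<omega> * T a m t \<omega>) = expectation (\<lambda>\<omega>. T a m t \<omega> * T a m s \<omega>)"
    by (simp add: mult.commute)
  also have "\<dots> = expectation (\<lambda>\<omega>. \<Sum>j<m. \<Sum>k<m. a j * a k * (W \<xi>0 t \<omega> * W \<xi>0 (t - int (Suc j)) \<omega> * (W \<xi>0 s \<omega> * W \<xi>0 (s - int (Suc k)) \<omega>)))"
    unfolding T_def sum_product by (simp add: mult_ac)
  also have "\<dots> = (\<Sum>j<m. \<Sum>k<m. a j * a k * E4 (w \<xi>0 t) (w \<xi>0 (t - int (Suc j))) (w \<xi>0 s) (w \<xi>0 (s - int (Suc k))))"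
    unfolding E4_expectation[symmetric]
    by (subst Bochner_Integration.integral_sum, force intro!: Bochner_Integration.integrable_sum integrable_mult_right integrable_W(3),
        subst Bochner_Integration.integral_sum, force intro!: integrable_mult_right integrable_W(3)) simp
  also have "\<dots> = acov a m (t - s)"
    unfolding acov_def
    by (intro sum.cong refl arg_cong[of _ _ "\<lambda>x. _ * x"], subst cv_eq[of _ _ _ t], subst E_perm(4)) simp
  finally show ?thesis .
qed

lemma T_expectation: "expectation (T a m t) = 0"
proof -
  have "expectation (T a m t) = (\<Sum>j<m. expectation (\<lambda>\<omega>. a j * (W \<xi>0 t \<omega> * W \<xi>0 (t - int (Suc j)) \<omega>)))"
    unfolding T_def by (rule Bochner_Integration.integral_sum) (rule integrable_mult_right[OF integrable_W(2)])
  also have "\<dots> = (\<Sum>j<m. a j * E2 (w \<xi>0 t) (w \<xi>0 (t - int (Suc j))))"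
    by (simp only: integral_mult_right_zero E2_expectation)
  also have "\<dots> = 0" by (simp add: E2_w)
  finally show ?thesis .
qed

lemma T_abs_le: "\<bar>T a m t \<omega>\<bar> \<le> (\<Sum>j<m. \<bar>a j\<bar>)"
  unfolding T_def
proof (rule order_trans[OF sum_abs], rule sum_mono)
  fix j
  have "\<bar>W \<xi>0 t \<omega> * W \<xi>0 (t - int (Suc j)) \<omega>\<bar> \<le> 1 * 1" by (intro abs_mult_le W_bound)
  then show "\<bar>a j * (W \<xi>0 t \<omega> * W \<xi>0 (t - int (Suc j)) \<omega>)\<bar> \<le> \<bar>a j\<bar>"
    unfolding abs_mult[of "a j"] using mult_left_mono[of "\<bar>W \<xi>0 t \<omega> * W \<xi>0 (t - int (Suc j)) \<omega>\<bar>" 1 "\<bar>a j\<bar>"] by simp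
qed

text \<open>For each lag a time u enters at most twice, once as the later and once as the earlier
  factor of a product; hence the 2.\<close>

lemma \<tau>path_lipschitz:
  assumes A: "finite J" "A \<subseteq> J" "\<And>t j. t \<in> A \<Longrightarrow> j < m \<Longrightarrow> t - int (Suc j) \<in> J"
  shows "\<bar>(\<Sum>t\<in>A. \<tau>path a m t x) - (\<Sum>t\<in>A. \<tau>path a m t y)\<bar>
    \<le> 2 * (\<Sum>j<m. \<bar>a j\<bar>) * (\<Sum>u\<in>J. \<bar>of_bool (x u < \<xi>0) - of_bool (y u < \<xi>0)\<bar>)"
proof -
  define d where "d u = \<bar>of_bool (x u < \<xi>0) - (of_bool (y u < \<xi>0) :: real)\<bar>" for u
  have d0: "d u \<ge> 0" for u by (simp add: d_def)
  let ?v = "\<lambda>z t. Vfun (p \<xi>0) \<xi>0 (z t)"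
  have fin: "finite A" using A finite_subset by auto
  have v: "\<bar>?v z t\<bar> \<le> 1" for z t by (rule Vfun_abs_le) (auto simp: p_bounds)
  have vv: "\<bar>?v x t * ?v x t' - ?v y t * ?v y t'\<bar> \<le> d t + d t'" for t t'
  proof -
    have "?v x t * ?v x t' - ?v y t * ?v y t' = (?v x t - ?v y t) * ?v x t' + ?v y t * (?v x t' - ?v y t')"
      by (simp add: algebra_simps)
    also have "\<bar>\<dots>\<bar> \<le> \<bar>?v x t - ?v y t\<bar> * 1 + 1 * \<bar>?v x t' - ?v y t'\<bar>"
      by (intro order_trans[OF abs_triangle_ineq] add_mono abs_mult_le v) auto
    finally show ?thesis by (simp only: Vfun_diff d_def mult_1_right mult_1_left)
  qed
  have "\<bar>(\<Sum>t\<in>A. \<tau>path a m t x) - (\<Sum>t\<in>A. \<tau>path a m t y)\<bar>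
     = \<bar>\<Sum>j<m. a j * (\<Sum>t\<in>A. ?v x t * ?v x (t - int (Suc j)) - ?v y t * ?v y (t - int (Suc j)))\<bar>"
    unfolding \<tau>path_def sum_subtractf[symmetric] sum_distrib_left by (subst sum.swap) (simp add: algebra_simps)
  also have "\<dots> \<le> (\<Sum>j<m. \<bar>a j\<bar> * (2 * (\<Sum>u\<in>J. d u)))"
  proof (rule order_trans[OF sum_abs], rule sum_mono)
    fix j assume j: "j \<in> {..<m}"
    have "\<bar>\<Sum>t\<in>A. ?v x t * ?v x (t - int (Suc j)) - ?v y t * ?v y (t - int (Suc j))\<bar> \<le> (\<Sum>t\<in>A. d t + d (t - int (Suc j)))"
      by (rule order_trans[OF sum_abs]) (intro sum_mono vv)
    also have "\<dots> = (\<Sum>t\<in>A. d t) + (\<Sum>t\<in>(\<lambda>t. t - int (Suc j)) ` A. d t)"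
      by (simp add: sum.distrib sum.reindex inj_on_def)
    also have "\<dots> \<le> (\<Sum>u\<in>J. d u) + (\<Sum>u\<in>J. d u)"
      using A j d0 by (intro add_mono sum_mono2) auto
    finally show "\<bar>a j * (\<Sum>t\<in>A. ?v x t * ?v x (t - int (Suc j)) - ?v y t * ?v y (t - int (Suc j)))\<bar> \<le> \<bar>a j\<bar> * (2 * (\<Sum>u\<in>J. d u))"
      unfolding abs_mult[of "a j"] by (intro mult_left_mono) auto
  qed
  also have "\<dots> = 2 * (\<Sum>j<m. \<bar>a j\<bar>) * (\<Sum>u\<in>J. d u)" by (simp add: sum_distrib_right sum_distrib_left mult_ac)
  finally show ?thesis by (simp add: d_def)
qed

lemma T_decorrelation:
  fixes q :: nat
  assumes c: "c \<ge> 0" and g: "m \<le> g" and A: "finite A" "A \<subseteq> {..s}"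
  defines "Bl \<equiv> {s + int g + 1..s + int g + int q}"
  shows "cmod (expectation (\<lambda>\<omega>. iexp (c * (\<Sum>t\<in>A. T a m t \<omega>)) * iexp (c * (\<Sum>t\<in>Bl. T a m t \<omega>)))
        - expectation (\<lambda>\<omega>. iexp (c * (\<Sum>t\<in>A. T a m t \<omega>))) * expectation (\<lambda>\<omega>. iexp (c * (\<Sum>t\<in>Bl. T a m t \<omega>))))
      \<le> (2 * (\<Sum>j<m. \<bar>a j\<bar>) * K * (2 / (1 - r)) / \<theta> ^ m) * c * \<theta> ^ g"
proof -
  \<comment> \<open>The terms of the later block look back over m steps, so only the gap g - m is
    effective. The lost power is compensated by the factor 1 / \<theta> ^ m in the constant.\<close>
  let ?J = "{s + int g + 1 - int m..s + int g + int q}"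
  have "cmod (expectation (\<lambda>\<omega>. iexp (c * (\<Sum>t\<in>A. T a m t \<omega>)) * iexp (c * (\<Sum>t\<in>Bl. T a m t \<omega>)))
        - expectation (\<lambda>\<omega>. iexp (c * (\<Sum>t\<in>A. T a m t \<omega>))) * expectation (\<lambda>\<omega>. iexp (c * (\<Sum>t\<in>Bl. T a m t \<omega>))))
      \<le> (c * (2 * (\<Sum>j<m. \<bar>a j\<bar>))) * (\<Sum>u\<in>?J. K * r ^ nat (u - s))"
    unfolding T_path
  proof (rule decor[of "\<lambda>x. iexp (c * (\<Sum>t\<in>A. \<tau>path a m t x))" "\<lambda>x. iexp (c * (\<Sum>t\<in>Bl. \<tau>path a m t x))" s ?J "\<lambda>u. u" "\<lambda>_. \<xi>0"])
    show "iexp (c * (\<Sum>t\<in>A. \<tau>path a m t x)) = iexp (c * (\<Sum>t\<in>A. \<tau>path a m t y))" if "\<And>t. t \<le> s \<Longrightarrow> x t = y t" for x y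
    proof -
      have "\<tau>path a m t x = \<tau>path a m t y" if "t \<in> A" for t
        using A that \<open>\<And>t. t \<le> s \<Longrightarrow> x t = y t\<close> unfolding \<tau>path_def
        by (intro sum.cong refl arg_cong2[of _ _ _ _ "\<lambda>u v. _ * (Vfun _ _ u * Vfun _ _ v)"]) (auto simp: subset_iff)
      then show ?thesis by simp
    qed
    show "u > s \<and> \<bar>\<xi>0 - \<xi>0\<bar> \<le> \<delta>" if "u \<in> ?J" for u using that g \<delta>_pos by auto
    show "0 \<le> c * (2 * (\<Sum>j<m. \<bar>a j\<bar>))" using c by (simp add: sum_nonneg)
    fix x y
    have "\<bar>c * (\<Sum>t\<in>Bl. \<tau>path a m t x) - c * (\<Sum>t\<in>Bl. \<tau>path a m t y)\<bar> = c * \<bar>(\<Sum>t\<in>Bl. \<tau>path a m t x) - (\<Sum>t\<in>Bl. \<tau>path a m t y)\<bar>"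
      using c by (simp add: right_diff_distrib[symmetric] abs_mult)
    also have "\<dots> \<le> c * (2 * (\<Sum>j<m. \<bar>a j\<bar>) * (\<Sum>u\<in>?J. \<bar>of_bool (x u < \<xi>0) - of_bool (y u < \<xi>0)\<bar>))"
      by (intro mult_left_mono c \<tau>path_lipschitz) (auto simp: Bl_def)
    finally show "cmod (iexp (c * (\<Sum>t\<in>Bl. \<tau>path a m t x)) - iexp (c * (\<Sum>t\<in>Bl. \<tau>path a m t y)))
       \<le> c * (2 * (\<Sum>j<m. \<bar>a j\<bar>)) * (\<Sum>u\<in>?J. \<bar>of_bool (x u < \<xi>0) - of_bool (y u < \<xi>0)\<bar>)"
      by (intro order_trans[OF iexp_lipschitz]) (simp add: mult.assoc)
  qed (auto simp: Bl_def)
  also have "\<dots> \<le> (c * (2 * (\<Sum>j<m. \<bar>a j\<bar>))) * (K * (\<theta> ^ (g - m) * (2 / (1 - r))))"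
  proof (intro mult_left_mono)
    have "(\<Sum>u\<in>?J. K * r ^ nat (u - s)) = K * (r ^ (g - m) * (\<Sum>u\<in>?J. r ^ nat \<bar>u - (s + int (g - m))\<bar>))"
      unfolding sum_distrib_left power_add[symmetric] mult.assoc[symmetric]
      unfolding mult.assoc power_add[symmetric]
      by (intro sum.cong refl arg_cong[of _ _ "\<lambda>n. K * r ^ n"]) (use g in auto)
    also have "\<dots> \<le> K * (\<theta> ^ (g - m) * (2 / (1 - r)))"
      using r K_ge \<theta>(1) by (intro mult_left_mono mult_mono sum_geometric_int_le r_pow_le sum_nonneg) auto
    finally show "(\<Sum>u\<in>?J. K * r ^ nat (u - s)) \<le> K * (\<theta> ^ (g - m) * (2 / (1 - r)))" .
  qed (use c in \<open>simp add: sum_nonneg\<close>)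
  also have "\<theta> ^ (g - m) = \<theta> ^ g / \<theta> ^ m" using \<theta>(1) g by (simp add: power_diff)
  also have "c * (2 * (\<Sum>j<m. \<bar>a j\<bar>)) * (K * (\<theta> ^ g / \<theta> ^ m * (2 / (1 - r)))) = (2 * (\<Sum>j<m. \<bar>a j\<bar>) * K * (2 / (1 - r)) / \<theta> ^ m) * c * \<theta> ^ g"
    by (simp add: mult_ac)
  finally show ?thesis .
qed

lemma weakly_dependent_T:
  "weakly_dependent M (T a m) (acov a m) (\<Sum>j<m. \<bar>a j\<bar>) ((\<Sum>j<m. \<Sum>k<m. \<bar>a j * a k\<bar>) * (3 * K))
    (2 * (\<Sum>j<m. \<bar>a j\<bar>) * K * (2 / (1 - r)) / \<theta> ^ m) \<theta> m"
proof
  fix c :: real and s p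
  show "expectation (\<lambda>\<omega>. iexp (c * (\<Sum>t\<in>{s + 1..s + int p}. T a m t \<omega>))) = expectation (\<lambda>\<omega>. iexp (c * (\<Sum>t\<in>{1..int p}. T a m t \<omega>)))"
  proof -
    have "(\<Sum>t\<in>{s + 1..s + int p}. T a m t \<omega>) = (\<Sum>t\<in>{1..int p}. T a m (t + s) \<omega>)" for \<omega>
      by (rule sum.reindex_bij_witness[of _ "\<lambda>t. t + s" "\<lambda>t. t - s"]) auto
    moreover have "T a m (t + s) \<omega> = \<tau>path a m t (\<lambda>t. X (t + s) \<omega>)" for t \<omega>
      unfolding T_def \<tau>path_def by (simp add: algebra_simps)
    ultimately show ?thesis
      using expectation_shift[of "\<lambda>x. iexp (c * (\<Sum>t\<in>{1..int p}. \<tau>path a m t x))" s] by (simp add: T_path)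
  qed
next
  fix c s A g p assume "0 \<le> (c::real)" "m \<le> g" "finite (A :: int set)" "A \<subseteq> {..s}"
  then show "cmod (expectation (\<lambda>\<omega>. iexp (c * (\<Sum>t\<in>A. T a m t \<omega>)) * iexp (c * (\<Sum>t\<in>{s + int g + 1..s + int g + int p}. T a m t \<omega>)))
        - expectation (\<lambda>\<omega>. iexp (c * (\<Sum>t\<in>A. T a m t \<omega>))) * expectation (\<lambda>\<omega>. iexp (c * (\<Sum>t\<in>{s + int g + 1..s + int g + int p}. T a m t \<omega>))))
      \<le> (2 * (\<Sum>j<m. \<bar>a j\<bar>) * K * (2 / (1 - r)) / \<theta> ^ m) * c * \<theta> ^ g"
    by (rule T_decorrelation)
qed (auto simp: T_abs_le T_expectation T_covariance acov_bound \<theta>(1,2) simp del: of_real_sum of_real_mult)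

text \<open>Indices are shifted: G n j belongs to lag j + 1.\<close>

definition G :: "nat \<Rightarrow> nat \<Rightarrow> 'a \<Rightarrow> real" where
  "G n j \<omega> = (\<Sum>t\<in>{1..int n}. W \<xi>0 t \<omega> * W \<xi>0 (t - int (Suc j)) \<omega>) / sqrt (real n)"

lemma G_measurable[measurable]: "G n j \<in> borel_measurable M" unfolding G_def by measurable

theorem autocovariance_clt:
  "(\<lambda>n. expectation (\<lambda>\<omega>. iexp (\<Sum>j<m. a j * G n j \<omega>))) \<longlonglongrightarrow> exp (- avar a m / 2)"
proof -
  interpret wd: weakly_dependent M "T a m" "acov a m" "\<Sum>j<m. \<bar>a j\<bar>" "(\<Sum>j<m. \<Sum>k<m. \<bar>a j * a k\<bar>) * (3 * K)"
    "2 * (\<Sum>j<m. \<bar>a j\<bar>) * K * (2 / (1 - r)) / \<theta> ^ m" \<theta> m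
    by (rule weakly_dependent_T)
  have "1 / sqrt (real n) * wd.S {1..int n} \<omega> = (\<Sum>j<m. a j * G n j \<omega>)" for n \<omega>
    unfolding wd.S_def T_def G_def
    by (subst sum.swap) (simp add: sum_divide_distrib sum_distrib_left)
  then show ?thesis using wd.clt unfolding infsum_acov by simp
qed

text \<open>As asymptotic variances are nonnegative, \<open>cc\<close> is positive semidefinite,
  which the construction of the Gaussian limit requires.\<close>

lemma avar_nonneg: "avar a m \<ge> 0"
proof -
  interpret wd: weakly_dependent M "T a m" "acov a m" "\<Sum>j<m. \<bar>a j\<bar>" "(\<Sum>j<m. \<Sum>k<m. \<bar>a j * a k\<bar>) * (3 * K)"
    "2 * (\<Sum>j<m. \<bar>a j\<bar>) * K * (2 / (1 - r)) / \<theta> ^ m" \<theta> m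
    by (rule weakly_dependent_T)
  show ?thesis using wd.asymptotic_variance_nonneg unfolding infsum_acov .
qed

end

subsection \<open>Gaussian sequences and elements\<close>

definition pos_semidef :: "(nat \<Rightarrow> nat \<Rightarrow> real) \<Rightarrow> bool" where
  "pos_semidef C \<longleftrightarrow> (\<forall>j k. C j k = C k j) \<and> (\<forall>A x. finite A \<longrightarrow> (\<Sum>j\<in>A. \<Sum>k\<in>A. x j * x k * C j k) \<ge> 0)"

lemma pos_semidefI:
  assumes sym: "\<And>j k. C j k = C k j" and nn: "\<And>n x. (\<Sum>j<n. \<Sum>k<n. x j * x k * C j k) \<ge> 0"
  shows "pos_semidef C"
  unfolding pos_semidef_def
proof (intro conjI allI impI sym)
  fix A :: "nat set" and x :: "nat \<Rightarrow> real" assume A: "finite A"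
  then obtain n where n: "A \<subseteq> {..<n}" using finite_nat_iff_bounded by blast
  define y where "y j = (if j \<in> A then x j else 0)" for j
  have "(\<Sum>j\<in>A. \<Sum>k\<in>A. x j * x k * C j k) = (\<Sum>j\<in>A. \<Sum>k<n. y j * y k * C j k)"
    by (intro sum.cong refl sum.mono_neutral_cong_left) (use n in \<open>auto simp: y_def\<close>)
  also have "\<dots> = (\<Sum>j<n. \<Sum>k<n. y j * y k * C j k)"
    by (intro sum.mono_neutral_left) (use n in \<open>auto simp: y_def\<close>)
  finally show "(\<Sum>j\<in>A. \<Sum>k\<in>A. x j * x k * C j k) \<ge> 0" using nn by simp
qed

text \<open>The quadratic form evaluated at x + t e_i, with e_i the i-th unit vector: a polynomial
  in t of degree at most two. Its nonnegativity yields all that is used about pivots and Schur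
  complements.\<close>

lemma pos_semidef_line:
  assumes C: "pos_semidef C" and A: "finite A"
  shows "(\<Sum>j\<in>A. \<Sum>k\<in>A. x j * x k * C j k) + 2 * t * (\<Sum>j\<in>A. x j * C j i) + t\<^sup>2 * C i i \<ge> 0"
proof -
  define B where "B = insert i A"
  have B: "finite B" "i \<in> B" "A \<subseteq> B" using A by (auto simp: B_def)
  define y where "y j = (if j \<in> A then x j else 0)" for j
  define e where "e j = (if j = i then t else 0)" for j
  have sym: "C j k = C k j" for j k using C by (simp add: pos_semidef_def)
  have 1: "(\<Sum>j\<in>B. \<Sum>k\<in>B. y j * y k * C j k) = (\<Sum>j\<in>A. \<Sum>k\<in>A. x j * x k * C j k)"
  proof -
    have "(\<Sum>j\<in>A. \<Sum>k\<in>A. x j * x k * C j k) = (\<Sum>j\<in>A. \<Sum>k\<in>B. y j * y k * C j k)"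
      by (intro sum.cong refl sum.mono_neutral_cong_left) (use B in \<open>auto simp: y_def\<close>)
    also have "\<dots> = (\<Sum>j\<in>B. \<Sum>k\<in>B. y j * y k * C j k)"
      by (intro sum.mono_neutral_left) (use B in \<open>auto simp: y_def\<close>)
    finally show ?thesis ..
  qed
  have 2: "(\<Sum>j\<in>B. y j * C j i) = (\<Sum>j\<in>A. x j * C j i)"
    by (intro sum.mono_neutral_cong_right) (use B in \<open>auto simp: y_def\<close>)
  have ed: "(\<Sum>j\<in>B. e j * f j) = t * f i" for f
    unfolding e_def using B by (simp add: if_distrib[of "\<lambda>x. x * _"] cong: if_cong)
  have "0 \<le> (\<Sum>j\<in>B. \<Sum>k\<in>B. (y j + e j) * (y k + e k) * C j k)"
    by (rule C[unfolded pos_semidef_def, THEN conjunct2, rule_format, OF B(1)])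
  also have "\<dots> = (\<Sum>j\<in>B. \<Sum>k\<in>B. y j * y k * C j k) + (\<Sum>j\<in>B. y j * (\<Sum>k\<in>B. e k * C j k))
      + (\<Sum>j\<in>B. e j * (\<Sum>k\<in>B. y k * C j k)) + (\<Sum>j\<in>B. e j * (\<Sum>k\<in>B. e k * C j k))"
  proof -
    have "(y j + e j) * (y k + e k) * C j k = y j * y k * C j k + y j * (e k * C j k) + e j * (y k * C j k) + e j * (e k * C j k)" for j k
      by (simp add: algebra_simps)
    then show ?thesis by (simp only: sum.distrib sum_distrib_left)
  qed
  also have "(\<Sum>j\<in>B. y j * (\<Sum>k\<in>B. e k * C j k)) = t * (\<Sum>j\<in>B. y j * C j i)"
    unfolding ed by (simp add: sum_distrib_left mult_ac)
  also have "(\<Sum>j\<in>B. e j * (\<Sum>k\<in>B. y k * C j k)) = t * (\<Sum>j\<in>B. y j * C j i)"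
    unfolding ed by (simp add: sym[of i])
  also have "(\<Sum>j\<in>B. e j * (\<Sum>k\<in>B. e k * C j k)) = t\<^sup>2 * C i i"
    unfolding ed by (simp add: power2_eq_square)
  finally show ?thesis unfolding 1 2 by simp
qed

lemma pos_semidef_diag: "pos_semidef C \<Longrightarrow> C i i \<ge> 0"
  using pos_semidef_line[of C "{}" "\<lambda>_. 0" 1 i] by simp

lemma pos_semidef_diag_zero:
  assumes C: "pos_semidef C" and 0: "C i i = 0"
  shows "C k i = 0"
proof (rule ccontr)
  assume ne: "C k i \<noteq> 0"
  have "C k k + 2 * t * C k i \<ge> 0" for t
    using pos_semidef_line[OF C, of "{k}" "\<lambda>_. 1" t i] 0 by simp
  \<comment> \<open>Without a quadratic term the polynomial is affine in t, and at this t it equals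
    -1.\<close>
  from this[of "- (C k k + 1) / (2 * C k i)"] ne show False by (simp add: field_simps)
qed

text \<open>The conditional covariance given coordinate i, in Gaussian terms. If the pivot is 0,
  division by zero subtracts nothing, which is correct since the whole row is 0 by
  \<open>pos_semidef_diag_zero\<close>.\<close>

definition schur_complement :: "nat \<Rightarrow> (nat \<Rightarrow> nat \<Rightarrow> real) \<Rightarrow> nat \<Rightarrow> nat \<Rightarrow> real" where
  "schur_complement i C j k = C j k - C j i * C k i / C i i"

lemma pos_semidef_schur_complement:
  assumes C: "pos_semidef C"
  shows "pos_semidef (schur_complement i C)"
  unfolding pos_semidef_def
proof (intro conjI allI impI)
  show "schur_complement i C j k = schur_complement i C k j" for j k
    using C by (simp add: schur_complement_def pos_semidef_def)
  fix A :: "nat set" and x :: "nat \<Rightarrow> real" assume A: "finite A"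
  define \<beta> where "\<beta> = (\<Sum>j\<in>A. x j * C j i)"
  have "(\<Sum>j\<in>A. \<Sum>k\<in>A. x j * x k * schur_complement i C j k)
     = (\<Sum>j\<in>A. \<Sum>k\<in>A. x j * x k * C j k) - (\<Sum>j\<in>A. \<Sum>k\<in>A. (x j * C j i) * (x k * C k i)) / C i i"
    unfolding schur_complement_def by (simp add: right_diff_distrib sum_subtractf sum_divide_distrib mult_ac)
  also have "(\<Sum>j\<in>A. \<Sum>k\<in>A. (x j * C j i) * (x k * C k i)) = \<beta>\<^sup>2"
    unfolding \<beta>_def power2_eq_square sum_product ..
  \<comment> \<open>The value of t inserted into \<open>pos_semidef_line\<close> is the minimiser of
    the quadratic polynomial; for a zero pivot it is 0.\<close>
  also have "(\<Sum>j\<in>A. \<Sum>k\<in>A. x j * x k * C j k) - \<beta>\<^sup>2 / C i i \<ge> 0"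
    using pos_semidef_line[OF C A, of x "- \<beta> / C i i" i]
    by (cases "C i i = 0") (auto simp: \<beta>_def[symmetric] power2_eq_square field_simps)
  finally show "0 \<le> (\<Sum>j\<in>A. \<Sum>k\<in>A. x j * x k * schur_complement i C j k)" .
qed

primrec schur_iterate :: "(nat \<Rightarrow> nat \<Rightarrow> real) \<Rightarrow> nat \<Rightarrow> nat \<Rightarrow> nat \<Rightarrow> real" where
  "schur_iterate C 0 = C"
| "schur_iterate C (Suc n) = schur_complement n (schur_iterate C n)"

text \<open>Row i stems from the i-th elimination step and vanishes when its pivot is 0. The factor
  is triangular, so each variable of the Gaussian field built from an infinite covariance matrix is
  a finite combination of independent normals.\<close>

definition cholesky :: "(nat \<Rightarrow> nat \<Rightarrow> real) \<Rightarrow> nat \<Rightarrow> nat \<Rightarrow> real" where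
  "cholesky C i j = schur_iterate C i j i / sqrt (schur_iterate C i i i)"

lemma pos_semidef_schur_iterate: "pos_semidef C \<Longrightarrow> pos_semidef (schur_iterate C n)"
  by (induction n) (auto intro: pos_semidef_schur_complement)

lemma schur_iterate_zero: "pos_semidef C \<Longrightarrow> j < n \<Longrightarrow> schur_iterate C n j k = 0"
proof (induction n arbitrary: j k)
  case (Suc n)
  let ?S = "schur_iterate C n"
  have psd: "pos_semidef ?S" using Suc by (intro pos_semidef_schur_iterate)
  then have sym: "?S j k = ?S k j" for j k by (simp add: pos_semidef_def)
  show ?case
  proof (cases "j = n")
    case True
    then show ?thesis
      using pos_semidef_diag_zero[OF psd, of n k] sym[of n k]
      by (cases "?S n n = 0") (simp_all add: schur_complement_def)
  next
    case False
    then show ?thesis using Suc by (simp add: schur_complement_def)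
  qed
qed simp

lemma cholesky_upper: "pos_semidef C \<Longrightarrow> j < i \<Longrightarrow> cholesky C i j = 0"
  by (simp add: cholesky_def schur_iterate_zero)

lemma cholesky_decomposition:
  assumes C: "pos_semidef C" and j: "j < n"
  shows "(\<Sum>i<n. cholesky C i j * cholesky C i k) = C j k"
proof -
  have "C j k = (\<Sum>i<n. cholesky C i j * cholesky C i k) + schur_iterate C n j k"
  proof (induction n)
    case (Suc n)
    have "schur_iterate C n n n \<ge> 0" by (intro pos_semidef_diag pos_semidef_schur_iterate C)
    then have "cholesky C n j * cholesky C n k = schur_iterate C n j n * schur_iterate C n k n / schur_iterate C n n n"
      by (simp add: cholesky_def)
    then show ?case using Suc by (simp add: schur_complement_def)
  qed simp
  then show ?thesis using schur_iterate_zero[OF C j] by simp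
qed

section \<open>Independent normals and Gaussian fields with prescribed covariance\<close>

abbreviation gauss_seq :: "(nat \<Rightarrow> real) measure" where
  "gauss_seq \<equiv> PiM UNIV (\<lambda>_::nat. std_normal_distribution)"

lemma prob_space_std_normal: "prob_space std_normal_distribution"
  using real_dist_normal_dist by (simp add: real_distribution_def)

lemma prob_space_gauss_seq: "prob_space gauss_seq"
  by (intro prob_space_PiM prob_space_std_normal)

lemma gauss_seq_component[measurable]: "(\<lambda>z. z i) \<in> borel_measurable gauss_seq"
proof -
  have "(\<lambda>z. z i) \<in> measurable gauss_seq std_normal_distribution" by measurable
  then show ?thesis by simp
qed

lemma gauss_seq_distr: "distr gauss_seq borel (\<lambda>z. z i) = std_normal_distribution"
proof -
  have "distr gauss_seq borel (\<lambda>z. z i) = distr gauss_seq std_normal_distribution (\<lambda>z. z i)"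
    by (intro distr_cong) auto
  then show ?thesis using distr_PiM_component[of UNIV "\<lambda>_. std_normal_distribution" i] prob_space_std_normal by simp
qed

lemma gauss_seq_indep: "prob_space.indep_vars gauss_seq (\<lambda>_. borel) (\<lambda>i z. z i) UNIV"
proof -
  interpret prob_space gauss_seq by (rule prob_space_gauss_seq)
  have "indep_vars (\<lambda>_. std_normal_distribution) (\<lambda>i z. z i) UNIV"
    by (rule indep_vars_PiM_coords[OF prob_space_std_normal])
  from indep_vars_compose2[OF this, where Y="\<lambda>_ x. x" and N="\<lambda>_. borel"] show ?thesis by simp
qed

lemma gauss_seq_char:
  "(\<integral>z. iexp (\<Sum>i<n. d i * z i) \<partial>gauss_seq) = exp (- (\<Sum>i<n. (d i)\<^sup>2) / 2)"
proof -
  interpret prob_space gauss_seq by (rule prob_space_gauss_seq)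
  have ind: "indep_vars (\<lambda>_. borel) (\<lambda>i z. iexp (d i * z i)) {..<n}"
    using indep_vars_compose2[OF indep_vars_subset[OF gauss_seq_indep subset_UNIV], where Y= "\<lambda>i x. iexp (d i * x)" and N="\<lambda>_. borel" and I="{..<n}"] by simp
  have "(\<integral>z. iexp (\<Sum>i<n. d i * z i) \<partial>gauss_seq) = (\<integral>z. (\<Prod>i<n. iexp (d i * z i)) \<partial>gauss_seq)"
    by (simp add: sum_distrib_left exp_sum)
  also have "\<dots> = (\<Prod>i<n. \<integral>z. iexp (d i * z i) \<partial>gauss_seq)"
    by (rule indep_vars_lebesgue_integral[OF _ ind]) (auto intro!: integrable_const_bound[where B=1])
  also have "\<dots> = (\<Prod>i<n. char std_normal_distribution (d i))"
  proof (intro prod.cong refl)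
    fix i
    have "char (distr gauss_seq borel (\<lambda>z. z i)) (d i) = (\<integral>z. iexp (d i * z i) \<partial>gauss_seq)"
      unfolding char_def by (subst integral_distr) auto
    then show "(\<integral>z. iexp (d i * z i) \<partial>gauss_seq) = char std_normal_distribution (d i)"
      by (simp only: gauss_seq_distr)
  qed
  also have "\<dots> = (\<Prod>i<n. complex_of_real (exp (- (d i)\<^sup>2 / 2)))"
    by (simp add: char_std_normal_distribution)
  also have "\<dots> = complex_of_real (exp (\<Sum>i<n. - (d i)\<^sup>2 / 2))"
    by (simp add: exp_sum)
  also have "(\<Sum>i<n. - (d i)\<^sup>2 / 2) = - (\<Sum>i<n. (d i)\<^sup>2) / 2"
    by (simp add: sum_negf sum_divide_distrib)
  finally show ?thesis .
qed

lemma gauss_seq_moments: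
  shows "integrable gauss_seq (\<lambda>z. z i * z k)" "(\<integral>z. z i * z k \<partial>gauss_seq) = (if i = k then 1 else 0)"
proof -
  interpret prob_space gauss_seq by (rule prob_space_gauss_seq)
  have int: "integrable gauss_seq (\<lambda>z. z i ^ n)" for i n
  proof -
    have "integrable (distr gauss_seq borel (\<lambda>z. z i)) (\<lambda>x. x ^ n)"
      unfolding gauss_seq_distr by (rule integrable_std_normal_distribution_moment)
    then show ?thesis by (subst (asm) integrable_distr_eq) auto
  qed
  have mom: "(\<integral>z. z i ^ n \<partial>gauss_seq) = (\<integral>x. x ^ n \<partial>std_normal_distribution)" for i n
  proof -
    have "(\<integral>x. x ^ n \<partial>distr gauss_seq borel (\<lambda>z. z i)) = (\<integral>z. z i ^ n \<partial>gauss_seq)"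
      by (subst integral_distr) auto
    then show ?thesis by (simp only: gauss_seq_distr)
  qed
  have i1: "integrable gauss_seq (\<lambda>z. z i)" for i using int[of i 1] by simp
  have m1: "(\<integral>z. z i \<partial>gauss_seq) = 0" for i
    using mom[of i 1] integral_std_normal_distribution_moment_odd[of 1] by simp
  have i2: "integrable gauss_seq (\<lambda>z. z i ^ 2)" for i by (rule int)
  have m2: "(\<integral>z. z i ^ 2 \<partial>gauss_seq) = 1" for i
    using mom[of i 2] std_normal_distribution_even_moments(1)[of 1] by (simp add: fact_numeral)
  have ind: "indep_vars (\<lambda>_. borel) (\<lambda>i z. z i) {i, k}"
    by (rule indep_vars_subset[OF gauss_seq_indep subset_UNIV])
  show "integrable gauss_seq (\<lambda>z. z i * z k)"
  proof (cases "i = k")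
    case True then show ?thesis using i2[of i] by (simp add: power2_eq_square)
  next
    case False then show ?thesis using indep_vars_integrable[OF _ ind] i1 by simp
  qed
  show "(\<integral>z. z i * z k \<partial>gauss_seq) = (if i = k then 1 else 0)"
  proof (cases "i = k")
    case True then show ?thesis using m2[of i] by (simp add: power2_eq_square)
  next
    case False then show ?thesis using indep_vars_lebesgue_integral[OF _ ind] i1 m1 by simp
  qed
qed

definition gauss_field :: "(nat \<Rightarrow> nat \<Rightarrow> real) \<Rightarrow> nat \<Rightarrow> (nat \<Rightarrow> real) \<Rightarrow> real" where
  "gauss_field C j z = (\<Sum>i<Suc j. cholesky C i j * z i)"

lemma gauss_field_measurable[measurable]: "gauss_field C j \<in> borel_measurable gauss_seq"
  unfolding gauss_field_def by measurable

lemma gauss_field_eq: "pos_semidef C \<Longrightarrow> j < n \<Longrightarrow> gauss_field C j z = (\<Sum>i<n. cholesky C i j * z i)"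
  unfolding gauss_field_def by (intro sum.mono_neutral_left) (auto simp: cholesky_upper)

lemma gauss_field_char:
  assumes C: "pos_semidef C"
  shows "(\<integral>z. iexp (\<Sum>j<n. a j * gauss_field C j z) \<partial>gauss_seq) = exp (- (\<Sum>j<n. \<Sum>k<n. a j * a k * C j k) / 2)"
proof -
  have "(\<Sum>j<n. a j * gauss_field C j z) = (\<Sum>i<n. (\<Sum>j<n. a j * cholesky C i j) * z i)" for z
  proof -
    have "(\<Sum>j<n. a j * gauss_field C j z) = (\<Sum>j<n. \<Sum>i<n. a j * cholesky C i j * z i)"
      by (intro sum.cong refl) (simp add: gauss_field_eq[OF C] sum_distrib_left mult.assoc)
    also have "\<dots> = (\<Sum>i<n. \<Sum>j<n. a j * cholesky C i j * z i)" by (rule sum.swap)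
    finally show ?thesis by (simp add: sum_distrib_right)
  qed
  then have "(\<integral>z. iexp (\<Sum>j<n. a j * gauss_field C j z) \<partial>gauss_seq) = exp (- (\<Sum>i<n. (\<Sum>j<n. a j * cholesky C i j)\<^sup>2) / 2)"
    by (simp only: gauss_seq_char)
  also have "(\<Sum>i<n. (\<Sum>j<n. a j * cholesky C i j)\<^sup>2) = (\<Sum>i<n. \<Sum>j<n. \<Sum>k<n. a j * a k * (cholesky C i j * cholesky C i k))"
    unfolding power2_eq_square sum_product by (simp add: mult_ac)
  also have "\<dots> = (\<Sum>j<n. \<Sum>i<n. \<Sum>k<n. a j * a k * (cholesky C i j * cholesky C i k))" by (rule sum.swap)
  also have "\<dots> = (\<Sum>j<n. \<Sum>k<n. \<Sum>i<n. a j * a k * (cholesky C i j * cholesky C i k))" by (intro sum.cong refl sum.swap)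
  also have "\<dots> = (\<Sum>j<n. \<Sum>k<n. a j * a k * C j k)"
    unfolding sum_distrib_left[symmetric] by (intro sum.cong refl) (simp add: cholesky_decomposition[OF C])
  finally show ?thesis .
qed

lemma gauss_field_second_moment:
  assumes C: "pos_semidef C"
  shows "integrable gauss_seq (\<lambda>z. (gauss_field C j z)\<^sup>2)" "(\<integral>z. (gauss_field C j z)\<^sup>2 \<partial>gauss_seq) = C j j"
proof -
  have eq: "(gauss_field C j z)\<^sup>2 = (\<Sum>i<Suc j. \<Sum>k<Suc j. cholesky C i j * cholesky C k j * (z i * z k))" for z
    unfolding gauss_field_def power2_eq_square sum_product by (intro sum.cong refl) (simp add: mult_ac)
  show "integrable gauss_seq (\<lambda>z. (gauss_field C j z)\<^sup>2)"
    unfolding eq by (intro Bochner_Integration.integrable_sum integrable_mult_right gauss_seq_moments)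
  have "(\<integral>z. (gauss_field C j z)\<^sup>2 \<partial>gauss_seq) = (\<Sum>i<Suc j. \<Sum>k<Suc j. cholesky C i j * cholesky C k j * (\<integral>z. z i * z k \<partial>gauss_seq))"
    unfolding eq
    by (subst Bochner_Integration.integral_sum, intro Bochner_Integration.integrable_sum integrable_mult_right gauss_seq_moments,
        subst Bochner_Integration.integral_sum, intro integrable_mult_right gauss_seq_moments) (simp only: integral_mult_right_zero)
  also have "\<dots> = (\<Sum>i<Suc j. cholesky C i j * cholesky C i j)"
    unfolding gauss_seq_moments(2) by (intro sum.cong refl) (simp add: if_distrib[of "\<lambda>x. _ * x"] sum.delta del: sum.lessThan_Suc cong: if_cong)
  also have "\<dots> = C j j" by (rule cholesky_decomposition[OF C]) simp
  finally show "(\<integral>z. (gauss_field C j z)\<^sup>2 \<partial>gauss_seq) = C j j" .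
qed

text \<open>Hubbard-Stratonovich: an exponential of a quadratic form is a Gaussian mixture of
  characteristic functions, so Cramer-Wold convergence gives convergence of Laplace transforms.\<close>

lemma gaussian_linearization:
  fixes H :: "nat \<Rightarrow> 'a \<Rightarrow> real"
  assumes M: "prob_space M" and H[measurable]: "\<And>j. H j \<in> borel_measurable M" and b: "\<And>j. b j \<ge> 0"
  shows "(\<integral>z. (\<integral>\<omega>. iexp (\<Sum>j<m. (sqrt (2 * b j) * z j) * H j \<omega>) \<partial>M) \<partial>gauss_seq)
    = complex_of_real (\<integral>\<omega>. exp (- (\<Sum>j<m. b j * (H j \<omega>)\<^sup>2)) \<partial>M)"
proof -
  interpret M: prob_space M by fact
  interpret N: prob_space gauss_seq by (rule prob_space_gauss_seq)
  interpret pair_prob_space M gauss_seq ..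
  let ?f = "\<lambda>\<omega> z. iexp (\<Sum>j<m. (sqrt (2 * b j) * z j) * H j \<omega>)"
  have "integrable (M \<Otimes>\<^sub>M gauss_seq) (\<lambda>(\<omega>, z). ?f \<omega> z)"
    by (intro P.integrable_const_bound[where B=1]) (auto simp: case_prod_beta)
  then have "(\<integral>z. (\<integral>\<omega>. ?f \<omega> z \<partial>M) \<partial>gauss_seq) = (\<integral>\<omega>. (\<integral>z. ?f \<omega> z \<partial>gauss_seq) \<partial>M)"
    by (rule Fubini_integral)
  also have "\<dots> = (\<integral>\<omega>. complex_of_real (exp (- (\<Sum>j<m. b j * (H j \<omega>)\<^sup>2))) \<partial>M)"
  proof (intro Bochner_Integration.integral_cong refl)
    fix \<omega>
    have "(\<integral>z. ?f \<omega> z \<partial>gauss_seq) = (\<integral>z. iexp (\<Sum>j<m. (sqrt (2 * b j) * H j \<omega>) * z j) \<partial>gauss_seq)"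
      by (simp only: mult.assoc mult.commute[of "H _ \<omega>"])
    also have "\<dots> = exp (- (\<Sum>j<m. (sqrt (2 * b j) * H j \<omega>)\<^sup>2) / 2)" by (rule gauss_seq_char)
    also have "(\<Sum>j<m. (sqrt (2 * b j) * H j \<omega>)\<^sup>2) = 2 * (\<Sum>j<m. b j * (H j \<omega>)\<^sup>2)"
      using b by (simp add: power_mult_distrib sum_distrib_left mult.assoc)
    finally show "(\<integral>z. ?f \<omega> z \<partial>gauss_seq) = complex_of_real (exp (- (\<Sum>j<m. b j * (H j \<omega>)\<^sup>2)))" by simp
  qed
  finally show ?thesis by simp
qed

lemma quadratic_form_laplace_limit:
  fixes H :: "nat \<Rightarrow> nat \<Rightarrow> 'a \<Rightarrow> real" and Z :: "nat \<Rightarrow> 'b \<Rightarrow> real"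
  assumes M: "prob_space M" and N: "prob_space N"
    and H[measurable]: "\<And>n j. H n j \<in> borel_measurable M" and Z[measurable]: "\<And>j. Z j \<in> borel_measurable N"
    and b: "\<And>j. b j \<ge> 0"
    and lim: "\<And>a. (\<lambda>n. \<integral>\<omega>. iexp (\<Sum>j<m. a j * H n j \<omega>) \<partial>M) \<longlonglongrightarrow> (\<integral>\<omega>. iexp (\<Sum>j<m. a j * Z j \<omega>) \<partial>N)"
  shows "(\<lambda>n. \<integral>\<omega>. exp (- (\<Sum>j<m. b j * (H n j \<omega>)\<^sup>2)) \<partial>M) \<longlonglongrightarrow> (\<integral>\<omega>. exp (- (\<Sum>j<m. b j * (Z j \<omega>)\<^sup>2)) \<partial>N)"
proof -
  interpret M: prob_space M by fact
  interpret N: prob_space N by fact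
  interpret Q: prob_space gauss_seq by (rule prob_space_gauss_seq)
  have bd: "cmod (\<integral>\<omega>. iexp (h \<omega>) \<partial>M') \<le> 1" if "prob_space M'" for M' :: "'c measure" and h
  proof -
    interpret prob_space M' by fact
    show ?thesis by (rule order_trans[OF integral_norm_bound]) (simp add: prob_space)
  qed
  \<comment> \<open>For fixed z the inner integral is a characteristic function at a fixed argument,
    so the hypothesis applies pointwise and the constant 1 dominates.\<close>
  have "(\<lambda>n. \<integral>z. (\<integral>\<omega>. iexp (\<Sum>j<m. (sqrt (2 * b j) * z j) * H n j \<omega>) \<partial>M) \<partial>gauss_seq)
     \<longlonglongrightarrow> (\<integral>z. (\<integral>\<omega>. iexp (\<Sum>j<m. (sqrt (2 * b j) * z j) * Z j \<omega>) \<partial>N) \<partial>gauss_seq)"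
    by (rule integral_dominated_convergence[where w="\<lambda>_. 1"]) (auto intro!: lim bd M N simp del: of_real_sum of_real_mult)
  then have "(\<lambda>n. complex_of_real (\<integral>\<omega>. exp (- (\<Sum>j<m. b j * (H n j \<omega>)\<^sup>2)) \<partial>M))
     \<longlonglongrightarrow> complex_of_real (\<integral>\<omega>. exp (- (\<Sum>j<m. b j * (Z j \<omega>)\<^sup>2)) \<partial>N)"
    by (simp only: gaussian_linearization[OF M H b] gaussian_linearization[OF N Z b])
  then show ?thesis by (simp only: tendsto_of_real_iff)
qed

text \<open>Functions of a nonnegative variable that vanish near infinity are uniform limits of polynomials
  in exp (- x).\<close>

lemma laplace_imp_weak_conv:
  fixes f :: "nat \<Rightarrow> 'a \<Rightarrow> real" and g :: "'b \<Rightarrow> real"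
  assumes M: "prob_space M" and N: "prob_space N"
    and f[measurable]: "\<And>n. f n \<in> borel_measurable M" and g[measurable]: "g \<in> borel_measurable N"
    and f0: "\<And>n \<omega>. f n \<omega> \<ge> 0" and g0: "\<And>\<omega>. g \<omega> \<ge> 0"
    and lim: "\<And>k::nat. (\<lambda>n. \<integral>\<omega>. exp (- (real k * f n \<omega>)) \<partial>M) \<longlonglongrightarrow> (\<integral>\<omega>. exp (- (real k * g \<omega>)) \<partial>N)"
  shows "weak_conv_m (\<lambda>n. distr M borel (f n)) (distr N borel g)"
proof -
  interpret M: prob_space M by fact
  interpret N: prob_space N by fact
  have rd: "real_distribution (distr M borel (f n))" for n by (rule M.real_distribution_distr) simp
  have rd': "real_distribution (distr N borel g)" by (rule N.real_distribution_distr) simp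
  show ?thesis
  proof (rule integral_cts_step_conv_imp_weak_conv[OF rd rd'])
    fix x y :: real assume xy: "x < y"
    \<comment> \<open>The test function in the variable u = exp (- v). Cutting off at exp (- y)
      keeps the logarithm away from 0 and changes nothing, because \<open>cts_step x y\<close> is 0
      from y onwards.\<close>
    define h where "h u = cts_step x y (- ln (max u (exp (- y))))" for u
    have cc: "continuous_on UNIV (cts_step x y)"
      by (intro uniformly_continuous_imp_continuous cts_step_uniformly_continuous xy)
    have hc: "continuous_on {0..1} h"
    proof -
      have pos: "max u (exp (- y)) > 0" for u by (simp add: less_max_iff_disj)
      have "continuous_on {0..1} (\<lambda>u. - ln (max u (exp (- y))))"
        by (intro continuous_intros) (use pos in \<open>metis less_irrefl\<close>)
      then show ?thesis unfolding h_def by (rule continuous_on_compose2[OF cc]) auto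
    qed
    have hf: "cts_step x y v = h (exp (- v))" if "v \<ge> 0" for v
    proof (cases "v \<le> y")
      case True then show ?thesis by (simp add: h_def max_def)
    next
      case False then show ?thesis using xy by (simp add: h_def max_def cts_step_def)
    qed
    have [measurable]: "cts_step x y \<in> borel_measurable borel"
      by (intro borel_measurable_continuous_onI cc)
    have "(\<lambda>n. \<integral>\<omega>. cts_step x y (f n \<omega>) \<partial>M) \<longlonglongrightarrow> (\<integral>\<omega>. cts_step x y (g \<omega>) \<partial>N)"
    proof (rule LIMSEQ_I)
      fix e :: real assume e: "e > 0"
      obtain q where "real_polynomial_function q" and q: "\<And>u. u \<in> {0..1} \<Longrightarrow> \<bar>h u - q u\<bar> < e / 4"
        using Stone_Weierstrass_real_polynomial_function[OF _ hc, of "e / 4"] e by auto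
      then obtain c d where qe: "q = (\<lambda>u. \<Sum>i\<le>d. c i * u ^ i)"
        by (auto simp: real_polynomial_function_iff_sum)
      have qexp: "q (exp (- v)) = (\<Sum>i\<le>d. c i * exp (- (real i * v)))" for v
        unfolding qe by (simp add: exp_of_nat_mult[symmetric])
      have iM: "integrable M (\<lambda>\<omega>. exp (- (real i * f n \<omega>)))" for i n
        using f0 by (intro M.integrable_const_bound[where B=1]) auto
      have iN: "integrable N (\<lambda>\<omega>. exp (- (real i * g \<omega>)))" for i
        using g0 by (intro N.integrable_const_bound[where B=1]) auto
      have qM: "(\<integral>\<omega>. q (exp (- f n \<omega>)) \<partial>M) = (\<Sum>i\<le>d. c i * (\<integral>\<omega>. exp (- (real i * f n \<omega>)) \<partial>M))" for n
        unfolding qexp using iM by (subst Bochner_Integration.integral_sum) auto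
      have qN: "(\<integral>\<omega>. q (exp (- g \<omega>)) \<partial>N) = (\<Sum>i\<le>d. c i * (\<integral>\<omega>. exp (- (real i * g \<omega>)) \<partial>N))"
        unfolding qexp using iN by (subst Bochner_Integration.integral_sum) auto
      have "(\<lambda>n. \<integral>\<omega>. q (exp (- f n \<omega>)) \<partial>M) \<longlonglongrightarrow> (\<integral>\<omega>. q (exp (- g \<omega>)) \<partial>N)"
        unfolding qM qN by (intro tendsto_sum tendsto_mult tendsto_const lim)
      then obtain n0 where n0: "\<And>n. n \<ge> n0 \<Longrightarrow> norm ((\<integral>\<omega>. q (exp (- f n \<omega>)) \<partial>M) - (\<integral>\<omega>. q (exp (- g \<omega>)) \<partial>N)) < e / 4"
        using LIMSEQ_D[of _ _ "e / 4"] e by (metis divide_pos_pos zero_less_numeral)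
      have approx: "\<bar>(\<integral>\<omega>. cts_step x y (F \<omega>) \<partial>L) - (\<integral>\<omega>. q (exp (- F \<omega>)) \<partial>L)\<bar> \<le> e / 4"
        if L: "prob_space L" and F[measurable]: "F \<in> borel_measurable L" and F0: "\<And>\<omega>. F \<omega> \<ge> 0" for L :: "'c measure" and F
      proof -
        interpret L: prob_space L by fact
        have "integrable L (\<lambda>\<omega>. cts_step x y (F \<omega>))"
          by (intro L.integrable_const_bound[where B=1]) (auto simp: cts_step_def)
        moreover have "integrable L (\<lambda>\<omega>. q (exp (- F \<omega>)))"
          unfolding qexp using F0 by (intro Bochner_Integration.integrable_sum integrable_mult_right L.integrable_const_bound[where B=1]) auto
        ultimately have "(\<integral>\<omega>. cts_step x y (F \<omega>) \<partial>L) - (\<integral>\<omega>. q (exp (- F \<omega>)) \<partial>L) = (\<integral>\<omega>. cts_step x y (F \<omega>) - q (exp (- F \<omega>)) \<partial>L)"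
          by simp
        also have "\<bar>\<dots>\<bar> \<le> e / 4"
        proof (rule L.abs_expectation_le)
          show "(\<lambda>\<omega>. cts_step x y (F \<omega>) - q (exp (- F \<omega>))) \<in> borel_measurable L" unfolding qexp by measurable
          show "\<bar>cts_step x y (F \<omega>) - q (exp (- F \<omega>))\<bar> \<le> e / 4" for \<omega>
            using q[of "exp (- F \<omega>)"] F0[of \<omega>] hf[of "F \<omega>"] by auto
        qed
        finally show ?thesis .
      qed
      show "\<exists>no. \<forall>n\<ge>no. norm ((\<integral>\<omega>. cts_step x y (f n \<omega>) \<partial>M) - (\<integral>\<omega>. cts_step x y (g \<omega>) \<partial>N)) < e"
      proof (intro exI[of _ n0] allI impI)
        fix n assume "n \<ge> n0"
        from n0[OF this] approx[OF M f f0, of n] approx[OF N g g0] e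
        show "norm ((\<integral>\<omega>. cts_step x y (f n \<omega>) \<partial>M) - (\<integral>\<omega>. cts_step x y (g \<omega>) \<partial>N)) < e"
          unfolding real_norm_def by linarith
      qed
    qed
    then show "(\<lambda>n. integral\<^sup>L (distr M borel (f n)) (cts_step x y)) \<longlonglongrightarrow> integral\<^sup>L (distr N borel g) (cts_step x y)"
      by (simp add: integral_distr)
  qed
qed

section \<open>Square-integrable functions and mean-square limits\<close>

lemma integral_cauchy_schwarz:
  fixes u f :: "'x \<Rightarrow> real"
  assumes [measurable]: "u \<in> borel_measurable \<nu>" "f \<in> borel_measurable \<nu>"
    and u: "integrable \<nu> (\<lambda>x. (u x)\<^sup>2)" and f: "integrable \<nu> (\<lambda>x. (f x)\<^sup>2)"
  shows "integrable \<nu> (\<lambda>x. u x * f x)" "\<bar>\<integral>x. u x * f x \<partial>\<nu>\<bar> \<le> sqrt (\<integral>x. (u x)\<^sup>2 \<partial>\<nu>) * sqrt (\<integral>x. (f x)\<^sup>2 \<partial>\<nu>)"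
proof -
  show i: "integrable \<nu> (\<lambda>x. u x * f x)"
  proof (rule Bochner_Integration.integrable_bound[OF Bochner_Integration.integrable_add[OF u f]])
    show "AE x in \<nu>. norm (u x * f x) \<le> norm ((u x)\<^sup>2 + (f x)\<^sup>2)"
    proof (rule AE_I2)
      fix x
      have "0 \<le> (\<bar>u x\<bar> - \<bar>f x\<bar>)\<^sup>2" by simp
      then have "2 * (\<bar>u x\<bar> * \<bar>f x\<bar>) \<le> (u x)\<^sup>2 + (f x)\<^sup>2"
        by (simp add: power2_diff mult.assoc)
      moreover have "0 \<le> \<bar>u x\<bar> * \<bar>f x\<bar>" by simp
      ultimately have "\<bar>u x\<bar> * \<bar>f x\<bar> \<le> (u x)\<^sup>2 + (f x)\<^sup>2" by linarith
      then show "norm (u x * f x) \<le> norm ((u x)\<^sup>2 + (f x)\<^sup>2)" by (simp add: abs_mult)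
    qed
  qed measurable
  define a b c where "a = (\<integral>x. (u x)\<^sup>2 \<partial>\<nu>)" and "b = (\<integral>x. u x * f x \<partial>\<nu>)" and "c = (\<integral>x. (f x)\<^sup>2 \<partial>\<nu>)"
  have a0: "a \<ge> 0" and c0: "c \<ge> 0" unfolding a_def c_def by simp_all
  have q: "t\<^sup>2 * a - 2 * t * b + c \<ge> 0" for t
  proof -
    have "0 \<le> (\<integral>x. (t * u x - f x)\<^sup>2 \<partial>\<nu>)" by simp
    also have "\<dots> = (\<integral>x. t\<^sup>2 * (u x)\<^sup>2 - (2 * t) * (u x * f x) + (f x)\<^sup>2 \<partial>\<nu>)"
      by (intro Bochner_Integration.integral_cong refl) (simp add: power2_eq_square algebra_simps)
    also have "\<dots> = t\<^sup>2 * a - 2 * t * b + c"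
      unfolding a_def b_def c_def
      by (simp add: u f i Bochner_Integration.integrable_diff)
    finally show ?thesis .
  qed
  have "b\<^sup>2 \<le> a * c"
  proof (cases "a = 0")
    case False
    with q[of "b / a"] a0 show ?thesis by (simp add: power2_eq_square field_simps)
  next
    case True
    have "b = 0"
    proof (rule ccontr)
      assume "b \<noteq> 0"
      with q[of "(c + 1) / (2 * b)"] True show False by simp
    qed
    then show ?thesis using True by simp
  qed
  then have "\<bar>b\<bar> \<le> sqrt (a * c)" by (intro real_le_rsqrt) simp
  then show "\<bar>\<integral>x. u x * f x \<partial>\<nu>\<bar> \<le> sqrt (\<integral>x. (u x)\<^sup>2 \<partial>\<nu>) * sqrt (\<integral>x. (f x)\<^sup>2 \<partial>\<nu>)"
    by (simp add: a_def b_def c_def real_sqrt_mult)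
qed

lemma integrable_square_diff:
  fixes u f :: "'x \<Rightarrow> real"
  assumes [measurable]: "u \<in> borel_measurable \<nu>" "f \<in> borel_measurable \<nu>"
    and u: "integrable \<nu> (\<lambda>x. (u x)\<^sup>2)" and f: "integrable \<nu> (\<lambda>x. (f x)\<^sup>2)"
  shows "integrable \<nu> (\<lambda>x. (u x - f x)\<^sup>2)" "integrable \<nu> (\<lambda>x. (u x + f x)\<^sup>2)"
    "(\<integral>x. (u x + f x)\<^sup>2 \<partial>\<nu>) = (\<integral>x. (u x)\<^sup>2 \<partial>\<nu>) + 2 * (\<integral>x. u x * f x \<partial>\<nu>) + (\<integral>x. (f x)\<^sup>2 \<partial>\<nu>)"
proof -
  have i: "integrable \<nu> (\<lambda>x. u x * f x)" by (rule integral_cauchy_schwarz) (use assms in auto)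
  have e1: "(\<lambda>x. (u x - f x)\<^sup>2) = (\<lambda>x. (u x)\<^sup>2 - 2 * (u x * f x) + (f x)\<^sup>2)"
    and e2: "(\<lambda>x. (u x + f x)\<^sup>2) = (\<lambda>x. (u x)\<^sup>2 + 2 * (u x * f x) + (f x)\<^sup>2)"
    by (auto simp: power2_eq_square algebra_simps)
  show "integrable \<nu> (\<lambda>x. (u x - f x)\<^sup>2)" "integrable \<nu> (\<lambda>x. (u x + f x)\<^sup>2)"
    unfolding e1 e2 by (intro Bochner_Integration.integrable_add Bochner_Integration.integrable_diff integrable_mult_right i u f)+
  show "(\<integral>x. (u x + f x)\<^sup>2 \<partial>\<nu>) = (\<integral>x. (u x)\<^sup>2 \<partial>\<nu>) + 2 * (\<integral>x. u x * f x \<partial>\<nu>) + (\<integral>x. (f x)\<^sup>2 \<partial>\<nu>)"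
    unfolding e2 by (simp add: i u f)
qed

text \<open>The candidate S is already given as an almost everywhere limit. Fatou's lemma turns the
  Cauchy bound between P k and P m into a bound on the distance from P m to S, and the
  Cauchy-Schwarz inequality then gives convergence of norms and inner products.\<close>

lemma L2_limit:
  fixes P :: "nat \<Rightarrow> 'x \<Rightarrow> real" and S :: "'x \<Rightarrow> real"
  assumes P[measurable]: "\<And>m. P m \<in> borel_measurable \<nu>" and S[measurable]: "S \<in> borel_measurable \<nu>"
    and P2: "\<And>m. integrable \<nu> (\<lambda>x. (P m x)\<^sup>2)"
    and cauchy: "\<And>m k. m \<le> k \<Longrightarrow> (\<integral>x. (P k x - P m x)\<^sup>2 \<partial>\<nu>) \<le> \<epsilon> m" and \<epsilon>: "\<epsilon> \<longlonglongrightarrow> 0" and \<epsilon>0: "\<And>m. \<epsilon> m \<ge> 0"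
    and conv: "AE x in \<nu>. (\<lambda>m. P m x) \<longlonglongrightarrow> S x"
  shows "integrable \<nu> (\<lambda>x. (S x)\<^sup>2)"
    and "(\<lambda>m. \<integral>x. (P m x)\<^sup>2 \<partial>\<nu>) \<longlonglongrightarrow> (\<integral>x. (S x)\<^sup>2 \<partial>\<nu>)"
    and "f \<in> borel_measurable \<nu> \<Longrightarrow> integrable \<nu> (\<lambda>x. (f x)\<^sup>2) \<Longrightarrow> (\<lambda>m. \<integral>x. P m x * f x \<partial>\<nu>) \<longlonglongrightarrow> (\<integral>x. S x * f x \<partial>\<nu>)"
proof -
  have diff: "integrable \<nu> (\<lambda>x. (P k x - P m x)\<^sup>2)" for k m
    by (rule integrable_square_diff) (auto simp: P2)
  have nn: "(\<integral>\<^sup>+x. ennreal ((S x - P m x)\<^sup>2) \<partial>\<nu>) \<le> ennreal (\<epsilon> m)" for m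
  proof -
    have "(\<integral>\<^sup>+x. ennreal ((S x - P m x)\<^sup>2) \<partial>\<nu>) = (\<integral>\<^sup>+x. liminf (\<lambda>k. ennreal ((P k x - P m x)\<^sup>2)) \<partial>\<nu>)"
    proof (rule nn_integral_cong_AE, use conv in eventually_elim)
      case (elim x)
      then have "(\<lambda>k. ennreal ((P k x - P m x)\<^sup>2)) \<longlonglongrightarrow> ennreal ((S x - P m x)\<^sup>2)"
        by (intro tendsto_ennrealI tendsto_intros)
      then show ?case by (intro lim_imp_Liminf[symmetric]) auto
    qed
    also have "\<dots> \<le> liminf (\<lambda>k. \<integral>\<^sup>+x. ennreal ((P k x - P m x)\<^sup>2) \<partial>\<nu>)"
      by (rule nn_integral_liminf) measurable
    also have "\<dots> \<le> ennreal (\<epsilon> m)"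
    proof -
      have "eventually (\<lambda>k. (\<integral>\<^sup>+x. ennreal ((P k x - P m x)\<^sup>2) \<partial>\<nu>) \<le> ennreal (\<epsilon> m)) sequentially"
        using eventually_ge_at_top[of m]
      proof eventually_elim
        case (elim k)
        have "(\<integral>\<^sup>+x. ennreal ((P k x - P m x)\<^sup>2) \<partial>\<nu>) = ennreal (\<integral>x. (P k x - P m x)\<^sup>2 \<partial>\<nu>)"
          by (rule nn_integral_eq_integral[OF diff]) simp
        then show ?case using cauchy[OF elim] by (simp add: ennreal_leI)
      qed
      then have "liminf (\<lambda>k. \<integral>\<^sup>+x. ennreal ((P k x - P m x)\<^sup>2) \<partial>\<nu>) \<le> liminf (\<lambda>k. ennreal (\<epsilon> m))"
        by (rule Liminf_mono)
      then show ?thesis by (simp add: Liminf_const)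
    qed
    finally show ?thesis .
  qed
  have iSP: "integrable \<nu> (\<lambda>x. (S x - P m x)\<^sup>2)" for m
    using nn[of m] by (intro integrableI_nonneg) (auto simp: le_less_trans[OF _ ennreal_less_top])
  have bSP: "(\<integral>x. (S x - P m x)\<^sup>2 \<partial>\<nu>) \<le> \<epsilon> m" for m
  proof -
    have "ennreal (\<integral>x. (S x - P m x)\<^sup>2 \<partial>\<nu>) \<le> ennreal (\<epsilon> m)"
      using nn[of m] nn_integral_eq_integral[OF iSP[of m]] by simp
    then show ?thesis using \<epsilon>0[of m] by (simp add: ennreal_le_iff)
  qed
  show S2: "integrable \<nu> (\<lambda>x. (S x)\<^sup>2)"
    using integrable_square_diff(2)[OF _ _ iSP[of 0] P2[of 0]] by simp
  have se: "(\<lambda>m. sqrt (\<epsilon> m)) \<longlonglongrightarrow> 0" using tendsto_real_sqrt[OF \<epsilon>] by simp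
  have prod: "(\<lambda>m. \<integral>x. (S x - P m x) * f x \<partial>\<nu>) \<longlonglongrightarrow> 0"
    if [measurable]: "f \<in> borel_measurable \<nu>" and f2: "integrable \<nu> (\<lambda>x. (f x)\<^sup>2)" for f
  proof (rule Lim_null_comparison)
    show "eventually (\<lambda>m. norm (\<integral>x. (S x - P m x) * f x \<partial>\<nu>) \<le> sqrt (\<epsilon> m) * sqrt (\<integral>x. (f x)\<^sup>2 \<partial>\<nu>)) sequentially"
    proof (rule always_eventually, rule allI)
      fix m
      have "norm (\<integral>x. (S x - P m x) * f x \<partial>\<nu>) \<le> sqrt (\<integral>x. (S x - P m x)\<^sup>2 \<partial>\<nu>) * sqrt (\<integral>x. (f x)\<^sup>2 \<partial>\<nu>)"
        unfolding real_norm_def by (rule integral_cauchy_schwarz(2)[OF _ _ iSP f2]) auto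
      also have "\<dots> \<le> sqrt (\<epsilon> m) * sqrt (\<integral>x. (f x)\<^sup>2 \<partial>\<nu>)"
        by (intro mult_right_mono real_sqrt_le_mono bSP) auto
      finally show "norm (\<integral>x. (S x - P m x) * f x \<partial>\<nu>) \<le> sqrt (\<epsilon> m) * sqrt (\<integral>x. (f x)\<^sup>2 \<partial>\<nu>)" .
    qed
    show "(\<lambda>m. sqrt (\<epsilon> m) * sqrt (\<integral>x. (f x)\<^sup>2 \<partial>\<nu>)) \<longlonglongrightarrow> 0" using tendsto_mult[OF se tendsto_const] by simp
  qed
  show "(\<lambda>m. \<integral>x. P m x * f x \<partial>\<nu>) \<longlonglongrightarrow> (\<integral>x. S x * f x \<partial>\<nu>)"
    if f[measurable]: "f \<in> borel_measurable \<nu>" and f2: "integrable \<nu> (\<lambda>x. (f x)\<^sup>2)" for f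
  proof -
    have "(\<integral>x. (S x - P m x) * f x \<partial>\<nu>) = (\<integral>x. S x * f x \<partial>\<nu>) - (\<integral>x. P m x * f x \<partial>\<nu>)" for m
      using integral_cauchy_schwarz(1)[OF S f S2 f2] integral_cauchy_schwarz(1)[OF P f P2 f2]
      by (simp add: left_diff_distrib)
    with prod[OF f f2] have "(\<lambda>m. (\<integral>x. S x * f x \<partial>\<nu>) - (\<integral>x. P m x * f x \<partial>\<nu>)) \<longlonglongrightarrow> 0" by simp
    from tendsto_diff[OF tendsto_const[of "\<integral>x. S x * f x \<partial>\<nu>"] this] show ?thesis by simp
  qed
  have eq: "(\<integral>x. (P m x)\<^sup>2 \<partial>\<nu>) = (\<integral>x. (S x)\<^sup>2 \<partial>\<nu>) - 2 * (\<integral>x. (S x - P m x) * S x \<partial>\<nu>) + (\<integral>x. (S x - P m x)\<^sup>2 \<partial>\<nu>)" for m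
  proof -
    have m: "(\<lambda>x. S x - P m x) \<in> borel_measurable \<nu>" by measurable
    have "(\<lambda>x. (P m x)\<^sup>2) = (\<lambda>x. (S x)\<^sup>2 - 2 * ((S x - P m x) * S x) + (S x - P m x)\<^sup>2)"
      by (auto simp: power2_eq_square algebra_simps)
    then show ?thesis using integral_cauchy_schwarz(1)[OF m S iSP S2] by (simp add: S2 iSP)
  qed
  have "(\<lambda>m. \<integral>x. (S x - P m x)\<^sup>2 \<partial>\<nu>) \<longlonglongrightarrow> 0"
    by (rule Lim_null_comparison[OF _ \<epsilon>]) (auto simp: bSP)
  from tendsto_add[OF tendsto_diff[OF tendsto_const[of "\<integral>x. (S x)\<^sup>2 \<partial>\<nu>"] tendsto_mult[OF tendsto_const[of 2] prod[OF S S2]]] this]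
  show "(\<lambda>m. \<integral>x. (P m x)\<^sup>2 \<partial>\<nu>) \<longlonglongrightarrow> (\<integral>x. (S x)\<^sup>2 \<partial>\<nu>)" unfolding eq by simp
qed

lemma AE_summable:
  fixes f :: "nat \<Rightarrow> 'x \<Rightarrow> real"
  assumes f: "\<And>i. integrable \<nu> (f i)" and f0: "\<And>i x. f i x \<ge> 0" and s: "summable (\<lambda>i. \<integral>x. f i x \<partial>\<nu>)"
  shows "AE x in \<nu>. summable (\<lambda>i. f i x)"
proof -
  have [measurable]: "f i \<in> borel_measurable \<nu>" for i using f by auto
  have "(\<integral>\<^sup>+x. (\<Sum>i. ennreal (f i x)) \<partial>\<nu>) = (\<Sum>i. \<integral>\<^sup>+x. ennreal (f i x) \<partial>\<nu>)"
    by (rule nn_integral_suminf) measurable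
  also have "\<dots> = (\<Sum>i. ennreal (\<integral>x. f i x \<partial>\<nu>))"
    using f f0 by (simp add: nn_integral_eq_integral)
  also have "\<dots> = ennreal (\<Sum>i. \<integral>x. f i x \<partial>\<nu>)"
    using f0 s by (intro suminf_ennreal2) (auto intro!: integral_nonneg_AE)
  finally have "(\<integral>\<^sup>+x. (\<Sum>i. ennreal (f i x)) \<partial>\<nu>) \<noteq> \<infinity>" by simp
  then have "AE x in \<nu>. (\<Sum>i. ennreal (f i x)) \<noteq> \<infinity>"
    by (intro nn_integral_PInf_AE) measurable
  then show ?thesis by eventually_elim (intro summable_suminf_not_top f0, simp)
qed

section \<open>The sine system on [0, pi]\<close>

definition \<pi>measure :: "real measure" where "\<pi>measure = restrict_space lborel PiI"

lemma set_integral_\<pi>measure: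
  fixes f :: "real \<Rightarrow> real"
  shows "set_lebesgue_integral lborel PiI f = (\<integral>x. f x \<partial>\<pi>measure)"
  unfolding \<pi>measure_def set_lebesgue_integral_def using integral_restrict_space[of PiI lborel f] by simp

lemma set_integrable_\<pi>measure:
  fixes f :: "real \<Rightarrow> real"
  shows "set_integrable lborel PiI f = integrable \<pi>measure f"
  unfolding \<pi>measure_def set_integrable_def using integrable_restrict_space[of PiI lborel f] by simp

lemma \<pi>measure_measurable: "f \<in> borel_measurable borel \<Longrightarrow> f \<in> borel_measurable \<pi>measure"
  unfolding \<pi>measure_def by (intro measurable_restrict_space1) simp

lemma finite_\<pi>measure: "finite_measure \<pi>measure"
  unfolding \<pi>measure_def by (rule finite_measureI) (simp add: emeasure_restrict_space space_restrict_space)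

lemma \<pi>measure_total: "measure \<pi>measure (space \<pi>measure) = pi"
  unfolding \<pi>measure_def by (simp add: measure_restrict_space space_restrict_space)

lemma psi_measurable[measurable]: "psi j \<in> borel_measurable borel"
  unfolding psi_def[abs_def] by measurable

lemma psi_abs_le: "\<bar>psi (Suc j) x\<bar> \<le> 1 / real (Suc j)"
proof -
  have "\<bar>psi (Suc j) x\<bar> = \<bar>sin (real (Suc j) * x)\<bar> / (pi * real (Suc j))" by (simp add: psi_def abs_mult)
  also have "\<dots> \<le> 1 / (1 * real (Suc j))"
    using pi_gt3 by (intro frac_le mult_right_mono abs_sin_le_one) auto
  finally show ?thesis by simp
qed

text \<open>The index is shifted, so \<open>wt j\<close> belongs to lag j + 1.\<close>

definition wt :: "nat \<Rightarrow> real" where "wt j = 1 / (2 * pi * (real (Suc j))\<^sup>2)"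

lemma wt_nonneg: "wt j \<ge> 0" by (simp add: wt_def)

lemma wt_summable: "summable wt"
proof -
  have "summable (\<lambda>j. 1 / real (Suc j) ^ 2)"
    using inverse_power_summable[of 2, where 'a=real] by (subst summable_Suc_iff) (simp add: inverse_eq_divide)
  from summable_mult[OF this, of "1 / (2 * pi)"] show ?thesis by (simp add: wt_def[abs_def])
qed

lemma sin_orthogonal:
  fixes j k :: nat
  assumes "j \<ge> 1" "k \<ge> 1"
  shows "(\<integral>x. sin (real j * x) * sin (real k * x) \<partial>\<pi>measure) = (if j = k then pi / 2 else 0)"
proof -
  \<comment> \<open>The antiderivative from the product-to-sum formula. For j = k the difference
    frequency is 0, and its sine quotient is replaced by the linear term.\<close>
  define F where "F x = (if j = k then x / 2 - sin (2 * real j * x) / (4 * real j)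
     else sin ((real j - real k) * x) / (2 * (real j - real k)) - sin ((real j + real k) * x) / (2 * (real j + real k)))" for x
  have "(\<integral>x. sin (real j * x) * sin (real k * x) \<partial>\<pi>measure) = (\<integral>x. (sin (real j * x) * sin (real k * x)) * indicator {0..pi} x \<partial>lborel)"
    unfolding set_integral_\<pi>measure[symmetric] set_lebesgue_integral_def by (simp add: mult.commute)
  also have "\<dots> = F pi - F 0"
  proof (rule integral_FTC_Icc_real)
    fix x :: real
    show "(F has_real_derivative sin (real j * x) * sin (real k * x)) (at x)"
    proof (cases "j = k")
      case True
      have "(F has_real_derivative 1 / 2 - cos (2 * real j * x) / 2) (at x)"
        unfolding F_def[abs_def] using True assms by (auto intro!: derivative_eq_intros simp: field_simps)
      also have "1 / 2 - cos (2 * real j * x) / 2 = sin (real j * x) * sin (real k * x)"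
        using True cos_double_sin[of "real j * x"] by (simp add: power2_eq_square mult.assoc field_simps)
      finally show ?thesis .
    next
      case False
      then have "real j - real k \<noteq> 0" "real j + real k \<noteq> 0" using assms by auto
      then have "(F has_real_derivative cos ((real j - real k) * x) / 2 - cos ((real j + real k) * x) / 2) (at x)"
      proof -
        have d: "((\<lambda>x. sin (d * x) / (2 * d)) has_real_derivative cos (d * x) / 2) (at x)" if "d \<noteq> 0" for d :: real
          using that by (auto intro!: derivative_eq_intros simp: field_simps)
        have "F = (\<lambda>x. sin ((real j - real k) * x) / (2 * (real j - real k)) - sin ((real j + real k) * x) / (2 * (real j + real k)))"
          using False by (auto simp: F_def fun_eq_iff)
        then show ?thesis
          using DERIV_diff[OF d[OF \<open>real j - real k \<noteq> 0\<close>] d[OF \<open>real j + real k \<noteq> 0\<close>]] by (simp only:)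
      qed
      also have "cos ((real j - real k) * x) / 2 - cos ((real j + real k) * x) / 2 = sin (real j * x) * sin (real k * x)"
        by (simp add: left_diff_distrib distrib_right cos_diff cos_add) (simp add: field_simps)
      finally show ?thesis .
    qed
  qed (auto intro!: continuous_intros)
  also have "\<dots> = (if j = k then pi / 2 else 0)"
  proof -
    have "sin (2 * real j * pi) = 0" using sin_npi[of "2 * j"] by simp
    moreover have "sin ((real j - real k) * pi) = 0" by (simp add: left_diff_distrib sin_diff)
    moreover have "sin ((real j + real k) * pi) = 0" by (simp add: distrib_right sin_add)
    ultimately show ?thesis by (simp add: F_def)
  qed
  finally show ?thesis .
qed

lemma psi_orthogonal: "(\<integral>x. psi (Suc j) x * psi (Suc k) x \<partial>\<pi>measure) = (if j = k then wt j else 0)"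
proof -
  have "(\<integral>x. psi (Suc j) x * psi (Suc k) x \<partial>\<pi>measure)
     = (\<integral>x. (1 / (pi * real (Suc j) * (pi * real (Suc k)))) * (sin (real (Suc j) * x) * sin (real (Suc k) * x)) \<partial>\<pi>measure)"
    unfolding psi_def by (intro Bochner_Integration.integral_cong) (simp_all add: field_simps del: of_nat_Suc)
  also have "\<dots> = (1 / (pi * real (Suc j) * (pi * real (Suc k)))) * (if Suc j = Suc k then pi / 2 else 0)"
    by (subst integral_mult_right_zero, subst sin_orthogonal) auto
  also have "\<dots> = (if j = k then wt j else 0)"
    by (cases "j = k") (simp_all add: wt_def power2_eq_square field_simps del: of_nat_Suc)
  finally show ?thesis .
qed

lemma \<pi>measure_integrable_bounded:
  fixes f :: "real \<Rightarrow> real"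
  assumes "f \<in> borel_measurable borel" "\<And>x. \<bar>f x\<bar> \<le> B"
  shows "integrable \<pi>measure f"
proof -
  interpret finite_measure \<pi>measure by (rule finite_\<pi>measure)
  show ?thesis using assms by (intro integrable_const_bound[where B=B] \<pi>measure_measurable) auto
qed

lemma psi_sum_norm:
  fixes g :: "nat \<Rightarrow> real"
  assumes A: "finite A"
  shows "integrable \<pi>measure (\<lambda>x. (\<Sum>j\<in>A. g j * psi (Suc j) x)\<^sup>2)"
    "(\<integral>x. (\<Sum>j\<in>A. g j * psi (Suc j) x)\<^sup>2 \<partial>\<pi>measure) = (\<Sum>j\<in>A. wt j * (g j)\<^sup>2)"
proof -
  have i: "integrable \<pi>measure (\<lambda>x. psi (Suc j) x * psi (Suc k) x)" for j k
  proof (rule \<pi>measure_integrable_bounded[where B="1 * 1"])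
    show "\<bar>psi (Suc j) x * psi (Suc k) x\<bar> \<le> 1 * 1" for x
      by (intro abs_mult_le order_trans[OF psi_abs_le]) auto
  qed measurable
  have eq: "(\<Sum>j\<in>A. g j * psi (Suc j) x)\<^sup>2 = (\<Sum>j\<in>A. \<Sum>k\<in>A. (g j * g k) * (psi (Suc j) x * psi (Suc k) x))" for x
    unfolding power2_eq_square sum_product by (intro sum.cong refl) (simp add: mult_ac)
  show "integrable \<pi>measure (\<lambda>x. (\<Sum>j\<in>A. g j * psi (Suc j) x)\<^sup>2)"
    unfolding eq by (intro Bochner_Integration.integrable_sum integrable_mult_right i)
  have "(\<integral>x. (\<Sum>j\<in>A. g j * psi (Suc j) x)\<^sup>2 \<partial>\<pi>measure) = (\<Sum>j\<in>A. \<Sum>k\<in>A. (g j * g k) * (if j = k then wt j else 0))"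
    unfolding eq psi_orthogonal[symmetric]
    by (subst Bochner_Integration.integral_sum, intro Bochner_Integration.integrable_sum integrable_mult_right i,
        subst Bochner_Integration.integral_sum, intro integrable_mult_right i) (simp only: integral_mult_right_zero)
  also have "\<dots> = (\<Sum>j\<in>A. wt j * (g j)\<^sup>2)"
    using A by (intro sum.cong refl) (simp add: if_distrib[of "\<lambda>x. _ * x"] power2_eq_square mult_ac cong: if_cong)
  finally show "(\<integral>x. (\<Sum>j\<in>A. g j * psi (Suc j) x)\<^sup>2 \<partial>\<pi>measure) = (\<Sum>j\<in>A. wt j * (g j)\<^sup>2)" .
qed

lemma L2Pi_iff: "L2Pi f \<longleftrightarrow> f \<in> borel_measurable borel \<and> integrable \<pi>measure (\<lambda>x. (f x)\<^sup>2)"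
  unfolding L2Pi_def set_integrable_\<pi>measure by simp

lemma \<pi>measure_const: "integrable \<pi>measure (\<lambda>x. (1::real)\<^sup>2)" "(\<integral>x. (1::real)\<^sup>2 \<partial>\<pi>measure) = pi"
  using finite_measure.integrable_const[OF finite_\<pi>measure] \<pi>measure_total by simp_all

section \<open>The Gaussian element as a random sine series\<close>

locale gauss_series =
  fixes C :: "nat \<Rightarrow> nat \<Rightarrow> real" and c0 \<theta> :: real
  assumes psd: "pos_semidef C" and C_bound: "\<And>j k. \<bar>C j k\<bar> \<le> c0 * \<theta> ^ nat \<bar>int j - int k\<bar>" and \<theta>: "0 < \<theta>" "\<theta> < 1"
begin

abbreviation "G \<equiv> gauss_field C"

lemma C_diag: "0 \<le> C j j" "C j j \<le> c0" using C_bound[of j j] pos_semidef_diag[OF psd, of j] by auto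

lemma c0: "c0 \<ge> 0" using C_diag[of 0] by linarith

definition kernel :: "real \<Rightarrow> real \<Rightarrow> real" where
  "kernel x y = (\<Sum>j. \<Sum>k. C j k * psi (Suc j) x * psi (Suc k) y)"

definition part :: "nat \<Rightarrow> (nat \<Rightarrow> real) \<Rightarrow> real \<Rightarrow> real" where
  "part m z x = (\<Sum>j<2 ^ m - 1. G j z * psi (Suc j) x)"

text \<open>With the index shift of \<open>psi\<close>, block i collects the frequencies from 2^i to
  2^(i+1) - 1.\<close>

definition dyad :: "nat \<Rightarrow> (nat \<Rightarrow> real) \<Rightarrow> real \<Rightarrow> real" where
  "dyad i z x = (\<Sum>j = 2 ^ i - 1..<2 ^ Suc i - 1. G j z * psi (Suc j) x)"

definition dnorm :: "nat \<Rightarrow> (nat \<Rightarrow> real) \<Rightarrow> real" where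
  "dnorm i z = (\<Sum>j = 2 ^ i - 1..<2 ^ Suc i - 1. wt j * (G j z)\<^sup>2)"

lemma part_eq: "(\<Sum>i<m. dyad i z x) = part m z x"
proof (induction m)
  case (Suc m)
  have "(\<Sum>j\<in>{0..<2 ^ m - 1}. G j z * psi (Suc j) x) + (\<Sum>j = 2 ^ m - 1..<2 ^ Suc m - 1. G j z * psi (Suc j) x) = (\<Sum>j = 0..<2 ^ Suc m - 1. G j z * psi (Suc j) x)"
    by (rule sum.atLeastLessThan_concat) (auto intro: diff_le_mono)
  with Suc show ?case by (simp add: part_def dyad_def lessThan_atLeast0)
qed (simp add: part_def)

lemma dyad_norm: "integrable \<pi>measure (\<lambda>x. (dyad i z x)\<^sup>2)" "(\<integral>x. (dyad i z x)\<^sup>2 \<partial>\<pi>measure) = dnorm i z"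
  unfolding dyad_def dnorm_def by (intro psi_sum_norm; simp)+

lemma dnorm_nonneg: "dnorm i z \<ge> 0"
  unfolding dnorm_def by (intro sum_nonneg mult_nonneg_nonneg wt_nonneg) auto

lemma dyad_measurable[measurable]: "(\<lambda>(z, x). dyad i z x) \<in> borel_measurable (gauss_seq \<Otimes>\<^sub>M borel)" "dyad i z \<in> borel_measurable borel"
  unfolding dyad_def by measurable

lemma part_measurable[measurable]: "part m z \<in> borel_measurable borel"
  unfolding part_def by measurable

text \<open>Block i has 2^i terms of weight at most 4^(-i), so its squared norm has mean at most c0
  / 2^i. The norms themselves then have means decaying like 2^(-i/2), which is summable; single
  terms, whose norms decay only like 1/j, would not give this.\<close>

lemma AE_good: "AE z in gauss_seq. summable (\<lambda>j. wt j * (G j z)\<^sup>2) \<and> summable (\<lambda>i. sqrt (dnorm i z))"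
proof (intro AE_conjI)
  interpret prob_space gauss_seq by (rule prob_space_gauss_seq)
  note G2 = gauss_field_second_moment[OF psd]
  show "AE z in gauss_seq. summable (\<lambda>j. wt j * (G j z)\<^sup>2)"
  proof (rule AE_summable)
    show "summable (\<lambda>j. \<integral>z. wt j * (G j z)\<^sup>2 \<partial>gauss_seq)"
    proof (rule summable_comparison_test[OF _ summable_mult[OF wt_summable, of c0]], intro exI[of _ 0] allI impI)
      fix j
      have "C j j * wt j \<le> c0 * wt j" by (intro mult_right_mono C_diag wt_nonneg)
      then show "norm (\<integral>z. wt j * (G j z)\<^sup>2 \<partial>gauss_seq) \<le> c0 * wt j"
        using C_diag(1)[of j] wt_nonneg[of j] by (simp add: G2(2) abs_mult mult.commute)
    qed
  qed (auto intro!: integrable_mult_right G2(1) mult_nonneg_nonneg wt_nonneg)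
  have dint: "integrable gauss_seq (dnorm i)" for i
    unfolding dnorm_def[abs_def] by (intro Bochner_Integration.integrable_sum integrable_mult_right G2(1))
  have [measurable]: "dnorm i \<in> borel_measurable gauss_seq" for i using dint by auto
  have sint: "integrable gauss_seq (\<lambda>z. sqrt (dnorm i z))" for i
  proof (rule Bochner_Integration.integrable_bound[where f="\<lambda>z. 1 + dnorm i z"])
    show "AE z in gauss_seq. norm (sqrt (dnorm i z)) \<le> norm (1 + dnorm i z)"
    proof (rule AE_I2)
      fix z
      have "dnorm i z \<le> (1 + dnorm i z)\<^sup>2" using dnorm_nonneg[of i z] by (simp add: power2_eq_square algebra_simps)
      then have "sqrt (dnorm i z) \<le> 1 + dnorm i z" using dnorm_nonneg[of i z] by (intro real_le_lsqrt) auto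
      then show "norm (sqrt (dnorm i z)) \<le> norm (1 + dnorm i z)" using dnorm_nonneg[of i z] by simp
    qed
  qed (auto intro: dint)
  have dE: "expectation (dnorm i) \<le> c0 * (1 / 2) ^ i" for i
  proof -
    have "expectation (dnorm i) = (\<Sum>j = 2 ^ i - 1..<2 ^ Suc i - 1. wt j * C j j)"
      unfolding dnorm_def[abs_def] by (subst Bochner_Integration.integral_sum) (auto intro!: integrable_mult_right G2(1) simp: G2(2))
    also have "\<dots> \<le> (\<Sum>j\<in>{2 ^ i - 1..<2 ^ Suc i - 1 :: nat}. (1 / (2 ^ i)\<^sup>2) * c0)"
    proof (intro sum_mono mult_mono C_diag)
      fix j :: nat assume j: "j \<in> {2 ^ i - 1..<2 ^ Suc i - 1}"
      then have "2 ^ i \<le> Suc j" by auto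
      then have "real (2 ^ i) \<le> real (Suc j)" by (simp only: of_nat_le_iff)
      then have "(2 ^ i)\<^sup>2 \<le> (real (Suc j))\<^sup>2" by (intro power_mono) auto
      then have "1 * (2 ^ i)\<^sup>2 \<le> 2 * pi * (real (Suc j))\<^sup>2" using pi_gt3 by (intro mult_mono) auto
      then show "wt j \<le> 1 / (2 ^ i)\<^sup>2" unfolding wt_def by (intro divide_left_mono) auto
    qed auto
    also have "\<dots> = real (2 ^ Suc i - 1 - (2 ^ i - 1)) * ((1 / (2 ^ i)\<^sup>2) * c0)" by simp
    also have "real (2 ^ Suc i - 1 - (2 ^ i - 1)) = 2 ^ i" by (simp add: of_nat_diff)
    also have "2 ^ i * ((1 / (2 ^ i)\<^sup>2) * c0) = c0 * (1 / 2) ^ i" by (simp add: power2_eq_square power_divide)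
    finally show ?thesis .
  qed
  show "AE z in gauss_seq. summable (\<lambda>i. sqrt (dnorm i z))"
  proof (rule AE_summable[OF sint])
    show "summable (\<lambda>i. expectation (\<lambda>z. sqrt (dnorm i z)))"
    proof (rule summable_comparison_test)
      show "summable (\<lambda>i. sqrt c0 * sqrt (1 / 2) ^ i)" by (intro summable_mult summable_geometric) auto
      show "\<exists>N. \<forall>i\<ge>N. norm (expectation (\<lambda>z. sqrt (dnorm i z))) \<le> sqrt c0 * sqrt (1 / 2) ^ i"
      proof (intro exI[of _ 0] allI impI)
        fix i
        have sq: "(\<lambda>z. (sqrt (dnorm i z))\<^sup>2) = dnorm i" using dnorm_nonneg by auto
        have "expectation (\<lambda>z. \<bar>sqrt (dnorm i z)\<bar>) \<le> sqrt (expectation (\<lambda>z. (sqrt (dnorm i z))\<^sup>2))"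
          by (rule expectation_abs_le_sqrt) (auto simp: sq sint dint)
        also have "\<dots> \<le> sqrt (c0 * (1 / 2) ^ i)" unfolding sq by (intro real_sqrt_le_mono dE)
        also have "\<dots> = sqrt c0 * sqrt (1 / 2) ^ i" by (simp add: real_sqrt_mult real_sqrt_power)
        finally show "norm (expectation (\<lambda>z. sqrt (dnorm i z))) \<le> sqrt c0 * sqrt (1 / 2) ^ i"
          using dnorm_nonneg by (simp add: integral_nonneg_AE)
      qed
    qed
  qed (use dnorm_nonneg in auto)
qed

text \<open>On [0, pi] the L1 norm is at most sqrt pi times the L2 norm, so summable block norms
  force absolute convergence of the block series at almost every x. Summability of the squared
  coefficients makes the partial sums Cauchy in mean square, and \<open>L2_limit\<close> combines
  the two.\<close>

lemma good_limit:
  assumes s1: "summable (\<lambda>j. wt j * (G j z)\<^sup>2)" and s2: "summable (\<lambda>i. sqrt (dnorm i z))"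
  shows "integrable \<pi>measure (\<lambda>x. (\<Sum>i. dyad i z x)\<^sup>2)"
    and "(\<integral>x. (\<Sum>i. dyad i z x)\<^sup>2 \<partial>\<pi>measure) = (\<Sum>j. wt j * (G j z)\<^sup>2)"
    and "f \<in> borel_measurable borel \<Longrightarrow> integrable \<pi>measure (\<lambda>x. (f x)\<^sup>2) \<Longrightarrow>
      (\<lambda>m. \<Sum>j<2 ^ m - 1. G j z * (\<integral>x. psi (Suc j) x * f x \<partial>\<pi>measure)) \<longlonglongrightarrow> (\<integral>x. (\<Sum>i. dyad i z x) * f x \<partial>\<pi>measure)"
proof -
  note [measurable] = \<pi>measure_measurable
  let ?h = "\<lambda>j. wt j * (G j z)\<^sup>2"
  have h0: "?h j \<ge> 0" for j using wt_nonneg by simp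
  define \<epsilon> where "\<epsilon> m = suminf ?h - sum ?h {..<2 ^ m - 1}" for m :: nat
  have sub: "filterlim (\<lambda>m::nat. (2::nat) ^ m - 1) at_top sequentially"
  proof (rule filterlim_at_top_mono[OF filterlim_ident], rule always_eventually, rule allI)
    fix m :: nat
    have "m < 2 ^ m" by (rule less_exp)
    then show "m \<le> 2 ^ m - 1" by linarith
  qed
  have partial: "(\<lambda>m. sum ?h {..<2 ^ m - 1}) \<longlonglongrightarrow> suminf ?h"
    using filterlim_compose[OF summable_LIMSEQ[OF s1] sub] .
  have \<epsilon>lim: "\<epsilon> \<longlonglongrightarrow> 0" unfolding \<epsilon>_def[abs_def] using tendsto_diff[OF tendsto_const partial, of "suminf ?h"] by simp
  have \<epsilon>0: "\<epsilon> m \<ge> 0" for m unfolding \<epsilon>_def using sum_le_suminf[OF s1, of "{..<2 ^ m - 1}"] h0 by simp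
  have P2: "integrable \<pi>measure (\<lambda>x. (part m z x)\<^sup>2)" "(\<integral>x. (part m z x)\<^sup>2 \<partial>\<pi>measure) = sum ?h {..<2 ^ m - 1}" for m
    unfolding part_def by (intro psi_sum_norm; simp)+
  have cauchy: "(\<integral>x. (part k z x - part m z x)\<^sup>2 \<partial>\<pi>measure) \<le> \<epsilon> m" if "m \<le> k" for m k
  proof -
    have le: "(2::nat) ^ m - 1 \<le> 2 ^ k - 1" using that by (intro diff_le_mono power_increasing) auto
    have d: "sum F {..<2 ^ k - 1} - sum F {..<2 ^ m - 1} = sum F ({..<2 ^ k - 1} - {..<2 ^ m - 1})" for F :: "nat \<Rightarrow> real"
      using le by (intro sum_diff[symmetric]) auto
    have "(\<integral>x. (part k z x - part m z x)\<^sup>2 \<partial>\<pi>measure) = sum ?h ({..<2 ^ k - 1} - {..<2 ^ m - 1})"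
      unfolding part_def d by (rule psi_sum_norm) simp
    also have "\<dots> = sum ?h {..<2 ^ k - 1} - sum ?h {..<2 ^ m - 1}" by (rule d[symmetric])
    also have "\<dots> \<le> \<epsilon> m" unfolding \<epsilon>_def using sum_le_suminf[OF s1, of "{..<2 ^ k - 1}"] h0 by simp
    finally show ?thesis .
  qed
  have conv: "AE x in \<pi>measure. (\<lambda>m. part m z x) \<longlonglongrightarrow> (\<Sum>i. dyad i z x)"
  proof -
    have one: "(\<lambda>x. 1::real) \<in> borel_measurable \<pi>measure" by simp
    have dm: "dyad i z \<in> borel_measurable \<pi>measure" for i by measurable
    have am: "(\<lambda>x. \<bar>dyad i z x\<bar>) \<in> borel_measurable \<pi>measure" for i using dm by measurable
    have cs: "integrable \<pi>measure (\<lambda>x. \<bar>dyad i z x\<bar>)" "(\<integral>x. \<bar>dyad i z x\<bar> \<partial>\<pi>measure) \<le> sqrt (dnorm i z) * sqrt pi" for i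
      using integral_cauchy_schwarz[OF am[of i] one] dyad_norm[of i z] \<pi>measure_const by simp_all
    have "AE x in \<pi>measure. summable (\<lambda>i. \<bar>dyad i z x\<bar>)"
    proof (rule AE_summable[OF cs(1)])
      show "summable (\<lambda>i. \<integral>x. \<bar>dyad i z x\<bar> \<partial>\<pi>measure)"
        by (rule summable_comparison_test[OF _ summable_mult2[OF s2, of "sqrt pi"]])
          (auto intro!: exI[of _ 0] simp: integral_nonneg_AE cs(2))
    qed simp
    then show ?thesis
    proof eventually_elim
      case (elim x)
      then have "summable (\<lambda>i. dyad i z x)" by (rule summable_rabs_cancel)
      from summable_LIMSEQ[OF this] show ?case by (simp add: part_eq)
    qed
  qed
  have Pm: "part m z \<in> borel_measurable \<pi>measure" for m by measurable
  have Sm: "(\<lambda>x. \<Sum>i. dyad i z x) \<in> borel_measurable \<pi>measure" by measurable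
  note L = L2_limit[OF Pm Sm P2(1) cauchy \<epsilon>lim \<epsilon>0 conv]
  show "integrable \<pi>measure (\<lambda>x. (\<Sum>i. dyad i z x)\<^sup>2)" by (rule L(1))
  show "(\<integral>x. (\<Sum>i. dyad i z x)\<^sup>2 \<partial>\<pi>measure) = (\<Sum>j. wt j * (G j z)\<^sup>2)"
    using LIMSEQ_unique[OF L(2)] partial unfolding P2(2) by blast
  show "(\<lambda>m. \<Sum>j<2 ^ m - 1. G j z * (\<integral>x. psi (Suc j) x * f x \<partial>\<pi>measure)) \<longlonglongrightarrow> (\<integral>x. (\<Sum>i. dyad i z x) * f x \<partial>\<pi>measure)"
    if f: "f \<in> borel_measurable borel" "integrable \<pi>measure (\<lambda>x. (f x)\<^sup>2)" for f
  proof -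
    have fm: "f \<in> borel_measurable \<pi>measure" using f by measurable
    have pm: "psi (Suc j) \<in> borel_measurable \<pi>measure" for j by measurable
    have pf: "integrable \<pi>measure (\<lambda>x. psi (Suc j) x * f x)" for j
      using psi_sum_norm(1)[of "{j}" "\<lambda>_. 1"] by (intro integral_cauchy_schwarz(1)[OF pm fm _ f(2)]) simp
    have "(\<integral>x. part m z x * f x \<partial>\<pi>measure) = (\<Sum>j<2 ^ m - 1. G j z * (\<integral>x. psi (Suc j) x * f x \<partial>\<pi>measure))" for m
      unfolding part_def sum_distrib_right mult.assoc
      by (subst Bochner_Integration.integral_sum) (auto intro!: integrable_mult_right pf)
    moreover have "(\<lambda>m. \<integral>x. part m z x * f x \<partial>\<pi>measure) \<longlonglongrightarrow> (\<integral>x. (\<Sum>i. dyad i z x) * f x \<partial>\<pi>measure)"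
      by (rule L(3)[OF _ fm f(2)])
    ultimately show ?thesis by simp
  qed
qed

definition \<eta> :: real where "\<eta> = sqrt \<theta>"

lemma \<eta>: "0 \<le> \<eta>" "\<eta> < 1" "\<eta> * \<eta> = \<theta>" using \<theta> by (auto simp: \<eta>_def)

definition "rowc = c0 / (1 - \<eta>)"

text \<open>With d = |j - k|, 1 / (k + 1) is at most (1 + d) / (j + 1), and the factor 1 + d is
  absorbed by one of the two factors \<eta> ^ d in \<theta> ^ d. What remains is summable in both
  indices: 1 / (j + 1)^2 times a geometric term.\<close>

lemma term_bound:
  "\<bar>C j k * psi (Suc j) x * psi (Suc k) y\<bar> \<le> (rowc * (1 / (real (Suc j))\<^sup>2)) * \<eta> ^ nat \<bar>int j - int k\<bar>"
proof -
  let ?d = "nat \<bar>int j - int k\<bar>"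
  have geo: "(1 + real ?d) * \<eta> ^ ?d \<le> 1 / (1 - \<eta>)"
  proof -
    have "(1 + real ?d) * \<eta> ^ ?d = (\<Sum>i<Suc ?d. \<eta> ^ ?d)" by simp
    also have "\<dots> \<le> (\<Sum>i<Suc ?d. \<eta> ^ i)" using \<eta> by (intro sum_mono power_decreasing) auto
    also have "\<dots> \<le> (\<Sum>i. \<eta> ^ i)" using \<eta> by (intro sum_le_suminf summable_geometric) auto
    finally show ?thesis using \<eta> by (simp add: suminf_geometric)
  qed
  have inv: "1 / real (Suc k) \<le> (1 + real ?d) / real (Suc j)"
  proof -
    have "Suc j \<le> Suc k + ?d" by auto
    then have "real (Suc j) \<le> real (Suc k) + real ?d" by (metis of_nat_add of_nat_le_iff)
    also have "\<dots> \<le> real (Suc k) * (1 + real ?d)" by (simp add: algebra_simps)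
    finally show ?thesis by (simp add: field_simps del: of_nat_Suc)
  qed
  have "\<bar>C j k * psi (Suc j) x * psi (Suc k) y\<bar> \<le> (c0 * \<theta> ^ ?d) * (1 / real (Suc j)) * (1 / real (Suc k))"
    by (intro abs_mult_le C_bound psi_abs_le)
  also have "\<dots> \<le> (c0 * \<theta> ^ ?d) * (1 / real (Suc j)) * ((1 + real ?d) / real (Suc j))"
    using c0 \<theta> by (intro mult_left_mono inv) auto
  also have "\<theta> ^ ?d = \<eta> ^ ?d * \<eta> ^ ?d" unfolding power_mult_distrib[symmetric] \<eta>(3) ..
  also have "c0 * (\<eta> ^ ?d * \<eta> ^ ?d) * (1 / real (Suc j)) * ((1 + real ?d) / real (Suc j))
     = c0 * ((1 + real ?d) * \<eta> ^ ?d) * (1 / (real (Suc j))\<^sup>2) * \<eta> ^ ?d"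
    by (simp add: power2_eq_square)
  also have "\<dots> \<le> c0 * (1 / (1 - \<eta>)) * (1 / (real (Suc j))\<^sup>2) * \<eta> ^ ?d"
    using c0 \<eta> by (intro mult_right_mono mult_left_mono geo) auto
  finally show ?thesis by (simp add: rowc_def)
qed

lemma rowc: "rowc \<ge> 0" using c0 \<eta> by (simp add: rowc_def)

lemma row_bound:
  shows "summable (\<lambda>k. \<bar>C j k * psi (Suc j) x * psi (Suc k) y\<bar>)"
    and "(\<Sum>k<M. \<bar>C j k * psi (Suc j) x * psi (Suc k) y\<bar>) \<le> rowc * (2 / (1 - \<eta>)) * (1 / (real (Suc j))\<^sup>2)"
proof -
  have fin: "(\<Sum>k<M. \<bar>C j k * psi (Suc j) x * psi (Suc k) y\<bar>) \<le> rowc * (2 / (1 - \<eta>)) * (1 / (real (Suc j))\<^sup>2)" for M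
  proof -
    have "(\<Sum>k<M. \<bar>C j k * psi (Suc j) x * psi (Suc k) y\<bar>) \<le> (\<Sum>k<M. (rowc * (1 / (real (Suc j))\<^sup>2)) * \<eta> ^ nat \<bar>int j - int k\<bar>)"
      by (intro sum_mono term_bound)
    also have "\<dots> = (rowc * (1 / (real (Suc j))\<^sup>2)) * (\<Sum>t\<in>int ` {..<M}. \<eta> ^ nat \<bar>t - int j\<bar>)"
      unfolding sum_distrib_left by (subst sum.reindex) (auto simp: inj_on_def abs_minus_commute)
    also have "\<dots> \<le> (rowc * (1 / (real (Suc j))\<^sup>2)) * (2 / (1 - \<eta>))"
      using rowc by (intro mult_left_mono sum_geometric_int_le \<eta>) auto
    finally show ?thesis by (simp add: mult_ac)
  qed
  show "(\<Sum>k<M. \<bar>C j k * psi (Suc j) x * psi (Suc k) y\<bar>) \<le> rowc * (2 / (1 - \<eta>)) * (1 / (real (Suc j))\<^sup>2)" by (rule fin)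
  show "summable (\<lambda>k. \<bar>C j k * psi (Suc j) x * psi (Suc k) y\<bar>)"
    by (rule summableI_nonneg_bounded[OF _ fin]) auto
qed

definition ksum :: "nat \<Rightarrow> real \<Rightarrow> real \<Rightarrow> real" where
  "ksum M x y = (\<Sum>j<M. \<Sum>k<M. C j k * psi (Suc j) x * psi (Suc k) y)"

definition kbound :: real where "kbound = rowc * (2 / (1 - \<eta>)) * (\<Sum>j. 1 / (real (Suc j))\<^sup>2)"

lemma summable_inverse_squares: "summable (\<lambda>j. 1 / (real (Suc j))\<^sup>2)"
  using inverse_power_summable[of 2, where 'a=real] by (subst summable_Suc_iff) (simp add: inverse_eq_divide)

lemma inner_sum_bound: "\<bar>\<Sum>k<M. C j k * psi (Suc j) x * psi (Suc k) y\<bar> \<le> rowc * (2 / (1 - \<eta>)) * (1 / (real (Suc j))\<^sup>2)"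
  by (rule order_trans[OF sum_abs row_bound(2)])

lemma ksum_bound: "\<bar>ksum M x y\<bar> \<le> kbound"
proof -
  have "\<bar>ksum M x y\<bar> \<le> (\<Sum>j<M. rowc * (2 / (1 - \<eta>)) * (1 / (real (Suc j))\<^sup>2))"
    unfolding ksum_def by (rule order_trans[OF sum_abs]) (intro sum_mono inner_sum_bound)
  also have "\<dots> = rowc * (2 / (1 - \<eta>)) * (\<Sum>j<M. 1 / (real (Suc j))\<^sup>2)" by (rule sum_distrib_left[symmetric])
  also have "\<dots> \<le> kbound" unfolding kbound_def
    using rowc \<eta> by (intro mult_left_mono sum_le_suminf summable_inverse_squares) auto
  finally show ?thesis .
qed

text \<open>The kernel is an iterated series, whereas variances of partial sums involve square
  truncations. Tannery's theorem with the summable row bounds shows that the two agree in the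
  limit.\<close>

lemma ksum_limit: "(\<lambda>M. ksum M x y) \<longlonglongrightarrow> kernel x y"
proof -
  let ?T = "\<lambda>j k. C j k * psi (Suc j) x * psi (Suc k) y"
  let ?a = "\<lambda>j M. if j < M then \<Sum>k<M. ?T j k else 0"
  have lim: "(\<lambda>M. ?a j M) \<longlonglongrightarrow> (\<Sum>k. ?T j k)" for j
  proof -
    have "(\<lambda>M. \<Sum>k<M. ?T j k) \<longlonglongrightarrow> (\<Sum>k. ?T j k)"
      by (rule summable_LIMSEQ[OF summable_rabs_cancel[OF row_bound(1)]])
    moreover have "eventually (\<lambda>M. (\<Sum>k<M. ?T j k) = ?a j M) sequentially"
      using eventually_gt_at_top[of j] by eventually_elim simp
    ultimately show ?thesis by (rule Lim_transform_eventually)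
  qed
  have bd: "norm (?a j M) \<le> rowc * (2 / (1 - \<eta>)) * (1 / (real (Suc j))\<^sup>2)" for j M
    using inner_sum_bound[of j x y M] rowc \<eta> by (simp del: of_nat_Suc)
  have "(\<lambda>M. suminf (\<lambda>j. ?a j M)) \<longlonglongrightarrow> (\<Sum>j. \<Sum>k. ?T j k)"
    by (rule tannerys_theorem[where M="\<lambda>j. rowc * (2 / (1 - \<eta>)) * (1 / (real (Suc j))\<^sup>2)" and a="?a",
          OF lim _ summable_mult[OF summable_inverse_squares], THEN conjunct2, THEN conjunct2])
      (use bd in \<open>auto intro!: always_eventually simp del: of_nat_Suc\<close>)
  moreover have "suminf (\<lambda>j. ?a j M) = ksum M x y" for M
    unfolding ksum_def by (subst suminf_finite[of "{..<M}"]) auto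
  ultimately show ?thesis unfolding kernel_def by simp
qed

lemma ksum_measurable[measurable]: "ksum M x \<in> borel_measurable borel" "(\<lambda>x. ksum M x y) \<in> borel_measurable borel"
  unfolding ksum_def by measurable
lemma kernel_measurable[measurable]: "kernel x \<in> borel_measurable borel" "(\<lambda>(x, y). kernel x y) \<in> borel_measurable (borel \<Otimes>\<^sub>M borel)"
  unfolding kernel_def by measurable

text \<open>Identifies the limiting variance of the inner products of the partial sums with f as the
  double integral against the kernel. The square truncations are bounded by \<open>kbound\<close>,
  so dominated convergence applies first in y and then in x.\<close>

lemma quadratic_form_limit:
  assumes f: "f \<in> borel_measurable borel" "integrable \<pi>measure (\<lambda>x. (f x)\<^sup>2)"
  defines "fc \<equiv> \<lambda>j. \<integral>x. psi (Suc j) x * f x \<partial>\<pi>measure"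
  shows "(\<lambda>M. \<Sum>j<M. \<Sum>k<M. fc j * fc k * C j k) \<longlonglongrightarrow> (\<integral>x. (\<integral>y. kernel x y * f x * f y \<partial>\<pi>measure) \<partial>\<pi>measure)"
proof -
  note [measurable] = f(1)
  interpret finite_measure \<pi>measure by (rule finite_\<pi>measure)
  have one: "(\<lambda>x. 1::real) \<in> borel_measurable \<pi>measure" by simp
  have fm: "f \<in> borel_measurable \<pi>measure" by (rule \<pi>measure_measurable[OF f(1)])
  have f1: "integrable \<pi>measure f"
    using integral_cauchy_schwarz(1)[OF fm one f(2) \<pi>measure_const(1)] by simp
  have pf: "integrable \<pi>measure (\<lambda>x. psi (Suc j) x * f x)" for j
  proof (rule Bochner_Integration.integrable_bound[OF f1])
    show "(\<lambda>x. psi (Suc j) x * f x) \<in> borel_measurable \<pi>measure" by (rule \<pi>measure_measurable) measurable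
    show "AE x in \<pi>measure. norm (psi (Suc j) x * f x) \<le> norm (f x)"
    proof (rule AE_I2)
      fix x
      have "\<bar>psi (Suc j) x\<bar> \<le> 1" by (rule order_trans[OF psi_abs_le]) simp
      then have "\<bar>psi (Suc j) x * f x\<bar> \<le> 1 * \<bar>f x\<bar>" by (intro abs_mult_le) auto
      then show "norm (psi (Suc j) x * f x) \<le> norm (f x)" by simp
    qed
  qed
  have kb: "kbound \<ge> 0" using ksum_bound[of 0 0 0] by simp
  let ?h = "\<lambda>M x. \<integral>y. ksum M x y * f x * f y \<partial>\<pi>measure"
  have hbound: "norm (?h M x) \<le> kbound * (\<integral>y. \<bar>f y\<bar> \<partial>\<pi>measure) * \<bar>f x\<bar>" for M x
  proof -
    have "norm (?h M x) \<le> (\<integral>y. kbound * \<bar>f x\<bar> * \<bar>f y\<bar> \<partial>\<pi>measure)"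
    proof (rule order_trans[OF integral_norm_bound integral_mono])
      show "integrable \<pi>measure (\<lambda>y. kbound * \<bar>f x\<bar> * \<bar>f y\<bar>)" using f1 by simp
      show b: "norm (ksum M x y * f x * f y) \<le> kbound * \<bar>f x\<bar> * \<bar>f y\<bar>" for y
        unfolding real_norm_def by (intro abs_mult_le ksum_bound) auto
      show "integrable \<pi>measure (\<lambda>y. norm (ksum M x y * f x * f y))"
        by (intro integrable_norm Bochner_Integration.integrable_bound[OF \<open>integrable \<pi>measure (\<lambda>y. kbound * \<bar>f x\<bar> * \<bar>f y\<bar>)\<close>] AE_I2)
          (use b kb in \<open>auto intro!: \<pi>measure_measurable simp: abs_mult\<close>)
    qed
    then show ?thesis by (simp add: mult_ac)
  qed
  have hlim: "(\<lambda>M. ?h M x) \<longlonglongrightarrow> (\<integral>y. kernel x y * f x * f y \<partial>\<pi>measure)" for x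
  proof (rule integral_dominated_convergence[where w="\<lambda>y. kbound * \<bar>f x\<bar> * \<bar>f y\<bar>"])
    show "integrable \<pi>measure (\<lambda>y. kbound * \<bar>f x\<bar> * \<bar>f y\<bar>)" using f1 by simp
    show "AE y in \<pi>measure. norm (ksum M x y * f x * f y) \<le> kbound * \<bar>f x\<bar> * \<bar>f y\<bar>" for M
      unfolding real_norm_def by (intro AE_I2 abs_mult_le ksum_bound) auto
    show "AE y in \<pi>measure. (\<lambda>M. ksum M x y * f x * f y) \<longlonglongrightarrow> kernel x y * f x * f y"
      by (intro AE_I2 tendsto_intros ksum_limit)
    show "(\<lambda>y. kernel x y * f x * f y) \<in> borel_measurable \<pi>measure"
      by (intro \<pi>measure_measurable borel_measurable_times kernel_measurable(1) f(1) borel_measurable_const)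
    show "(\<lambda>y. ksum M x y * f x * f y) \<in> borel_measurable \<pi>measure" for M
      by (intro \<pi>measure_measurable borel_measurable_times ksum_measurable(1) f(1) borel_measurable_const)
  qed
  have heq: "?h M x = (\<Sum>j<M. \<Sum>k<M. C j k * (psi (Suc j) x * f x) * fc k)" for M x
  proof -
    have e: "ksum M x y * f x * f y = (\<Sum>j<M. \<Sum>k<M. C j k * (psi (Suc j) x * f x) * (psi (Suc k) y * f y))" for y
      unfolding ksum_def sum_distrib_right by (intro sum.cong refl) (simp add: mult_ac)
    show ?thesis unfolding e fc_def
      by (subst Bochner_Integration.integral_sum, intro Bochner_Integration.integrable_sum integrable_mult_right pf,
        subst Bochner_Integration.integral_sum, intro integrable_mult_right pf) (simp only: integral_mult_right_zero)
  qed
  have "(\<lambda>M. \<integral>x. ?h M x \<partial>\<pi>measure) \<longlonglongrightarrow> (\<integral>x. (\<integral>y. kernel x y * f x * f y \<partial>\<pi>measure) \<partial>\<pi>measure)"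
  proof (rule integral_dominated_convergence[where w="\<lambda>x. kbound * (\<integral>y. \<bar>f y\<bar> \<partial>\<pi>measure) * \<bar>f x\<bar>"])
    have hm: "?h M \<in> borel_measurable \<pi>measure" for M
      unfolding heq by (rule \<pi>measure_measurable) measurable
    then show "?h M \<in> borel_measurable \<pi>measure" for M .
    show "(\<lambda>x. \<integral>y. kernel x y * f x * f y \<partial>\<pi>measure) \<in> borel_measurable \<pi>measure"
      by (rule borel_measurable_LIMSEQ_real[OF hlim hm])
    show "integrable \<pi>measure (\<lambda>x. kbound * (\<integral>y. \<bar>f y\<bar> \<partial>\<pi>measure) * \<bar>f x\<bar>)" using f1 by simp
  qed (intro AE_I2 hlim hbound)+
  moreover have "(\<integral>x. ?h M x \<partial>\<pi>measure) = (\<Sum>j<M. \<Sum>k<M. fc j * fc k * C j k)" for M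
  proof -
    have "(\<integral>x. ?h M x \<partial>\<pi>measure) = (\<integral>x. (\<Sum>j<M. \<Sum>k<M. (C j k * fc k) * (psi (Suc j) x * f x)) \<partial>\<pi>measure)"
      unfolding heq by (intro Bochner_Integration.integral_cong sum.cong refl) (simp add: mult_ac)
    also have "\<dots> = (\<Sum>j<M. \<Sum>k<M. (C j k * fc k) * fc j)"
      unfolding fc_def
      by (subst Bochner_Integration.integral_sum, intro Bochner_Integration.integrable_sum integrable_mult_right pf,
        subst Bochner_Integration.integral_sum, intro integrable_mult_right pf) (simp only: integral_mult_right_zero)
    finally show ?thesis by (simp add: mult_ac)
  qed
  ultimately show ?thesis by simp
qed

text \<open>The series of the Gaussian element converges in mean square but not absolutely, so the
  jointly measurable version is obtained by summing dyadic blocks.\<close>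

theorem gaussian_element_exists:
  obtains S where "gaussian_L2Pi gauss_seq S kernel" "(\<lambda>z. normPi2 (S z)) \<in> borel_measurable gauss_seq"
    "AE z in gauss_seq. (\<lambda>m. \<Sum>j<m. wt j * (G j z)\<^sup>2) \<longlonglongrightarrow> normPi2 (S z)"
proof -
  interpret N: prob_space gauss_seq by (rule prob_space_gauss_seq)
  interpret nu: finite_measure \<pi>measure by (rule finite_\<pi>measure)
  obtain Bad where Bad0: "\<And>z. z \<in> space gauss_seq - Bad \<Longrightarrow> summable (\<lambda>j. wt j * (G j z)\<^sup>2) \<and> summable (\<lambda>i. sqrt (dnorm i z))"
    and Bad: "Bad \<in> null_sets gauss_seq"
    using AE_E3[OF AE_good] by metis
  have good: "summable (\<lambda>j. wt j * (G j z)\<^sup>2) \<and> summable (\<lambda>i. sqrt (dnorm i z))" if "z \<in> space gauss_seq" "z \<notin> Bad" for z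
    by (rule Bad0) (use that in simp)
  have [measurable]: "Bad \<in> sets gauss_seq" using Bad by (rule null_setsD2)
  \<comment> \<open>Setting S to 0 on the null set makes every path square integrable, since
    \<open>gaussian_L2Pi\<close> asks for this at every point of the space.\<close>
  define S where "S z x = (if z \<in> Bad then 0 else \<Sum>i. dyad i z x)" for z x
  have sp: "z \<in> space gauss_seq" for z by (simp add: space_PiM)
  have AEg: "AE z in gauss_seq. z \<notin> Bad" using Bad by (rule AE_not_in)
  have Sm: "(\<lambda>(z, x). S z x) \<in> borel_measurable (gauss_seq \<Otimes>\<^sub>M borel)"
    unfolding S_def case_prod_beta
    by (intro measurable_If borel_measurable_suminf measurable_compose[OF _ dyad_measurable(1)[unfolded case_prod_beta]]) (measurable)
  have Smx: "S z \<in> borel_measurable borel" for z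
    unfolding S_def by (cases "z \<in> Bad") simp_all
  have S\<nu>: "(\<lambda>(z, x). S z x * g x) \<in> borel_measurable (gauss_seq \<Otimes>\<^sub>M \<pi>measure)" if [measurable]: "g \<in> borel_measurable borel" for g
  proof -
    have "(\<lambda>w. (fst w, snd w)) \<in> measurable (gauss_seq \<Otimes>\<^sub>M \<pi>measure) (gauss_seq \<Otimes>\<^sub>M borel)"
      by (intro measurable_Pair measurable_fst measurable_compose[OF measurable_snd \<pi>measure_measurable]) simp
    from measurable_compose[OF this Sm] have a: "(\<lambda>w. S (fst w) (snd w)) \<in> borel_measurable (gauss_seq \<Otimes>\<^sub>M \<pi>measure)"
      by (simp add: case_prod_beta)
    have b: "(\<lambda>w. g (snd w)) \<in> borel_measurable (gauss_seq \<Otimes>\<^sub>M \<pi>measure)"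
      by (rule measurable_compose[OF measurable_snd \<pi>measure_measurable[OF that]])
    show ?thesis unfolding case_prod_beta by (rule borel_measurable_times[OF a b])
  qed
  have inner_m: "(\<lambda>z. \<integral>x. S z x * g x \<partial>\<pi>measure) \<in> borel_measurable gauss_seq" if "g \<in> borel_measurable borel" for g
    by (rule nu.borel_measurable_lebesgue_integral[OF S\<nu>[OF that]])
  have norm_m: "(\<lambda>z. normPi2 (S z)) \<in> borel_measurable gauss_seq"
  proof -
    have "(\<lambda>(z, x). (S z x)\<^sup>2) \<in> borel_measurable (gauss_seq \<Otimes>\<^sub>M \<pi>measure)"
      using borel_measurable_power[OF S\<nu>[of "\<lambda>_. 1"], of 2] by (simp add: case_prod_beta)
    from nu.borel_measurable_lebesgue_integral[OF this] show ?thesis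
      unfolding normPi2_def set_integral_\<pi>measure .
  qed
  have norm_lim: "AE z in gauss_seq. (\<lambda>m. \<Sum>j<m. wt j * (G j z)\<^sup>2) \<longlonglongrightarrow> normPi2 (S z)"
    using AEg
  proof eventually_elim
    case (elim z)
    note g = good[OF sp elim]
    have "normPi2 (S z) = (\<Sum>j. wt j * (G j z)\<^sup>2)"
      unfolding normPi2_def set_integral_\<pi>measure S_def using elim good_limit(2)[of z] g by simp
    then show ?case using summable_LIMSEQ[of "\<lambda>j. wt j * (G j z)\<^sup>2"] g by simp
  qed
  have "gaussian_L2Pi gauss_seq S kernel"
    unfolding gaussian_L2Pi_def set_integral_\<pi>measure
  proof (intro conjI allI impI ballI)
    show "prob_space gauss_seq" by (rule prob_space_gauss_seq)
    have "sets (gauss_seq \<Otimes>\<^sub>M lborel) = sets (gauss_seq \<Otimes>\<^sub>M (borel :: real measure))"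
      by (intro sets_pair_measure_cong) auto
    from measurable_cong_sets[OF this refl] Sm show "(\<lambda>(\<omega>, x). S \<omega> x) \<in> borel_measurable (gauss_seq \<Otimes>\<^sub>M lborel)" by simp
    show "L2Pi (S z)" for z
      unfolding L2Pi_iff using Smx[of z] good[OF sp] good_limit(1)[of z] by (cases "z \<in> Bad") (simp_all add: S_def)
    fix f assume "L2Pi f"
    then have f: "f \<in> borel_measurable borel" "integrable \<pi>measure (\<lambda>x. (f x)\<^sup>2)" by (auto simp: L2Pi_iff)
    show I: "(\<lambda>z. \<integral>x. S z x * f x \<partial>\<pi>measure) \<in> borel_measurable gauss_seq" by (rule inner_m[OF f(1)])
    let ?fc = "\<lambda>j. \<integral>x. psi (Suc j) x * f x \<partial>\<pi>measure"
    let ?V = "\<integral>x. (\<integral>y. kernel x y * f x * f y \<partial>\<pi>measure) \<partial>\<pi>measure"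
    show "char (distr gauss_seq borel (\<lambda>z. \<integral>x. S z x * f x \<partial>\<pi>measure)) = (\<lambda>t. complex_of_real (exp (- ?V * t\<^sup>2 / 2)))"
    proof
      fix t :: real
      \<comment> \<open>The characteristic functions of the dyadic partial sums are known
        explicitly. They converge to that of the inner product with S by dominated convergence, and
        to the required Gaussian one by convergence of the variances; uniqueness of limits then
        concludes.\<close>
      have lim1: "(\<lambda>m. \<integral>z. iexp (\<Sum>j<2 ^ m - 1. (t * ?fc j) * G j z) \<partial>gauss_seq) \<longlonglongrightarrow> (\<integral>z. iexp (t * (\<integral>x. S z x * f x \<partial>\<pi>measure)) \<partial>gauss_seq)"
      proof (rule integral_dominated_convergence[where w="\<lambda>_. 1"])
        show "(\<lambda>z. iexp (t * (\<integral>x. S z x * f x \<partial>\<pi>measure))) \<in> borel_measurable gauss_seq" using I by measurable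
        show "(\<lambda>z. iexp (\<Sum>j<2 ^ m - 1. (t * ?fc j) * G j z)) \<in> borel_measurable gauss_seq" for m by measurable
        show "AE z in gauss_seq. (\<lambda>m. iexp (\<Sum>j<2 ^ m - 1. (t * ?fc j) * G j z)) \<longlonglongrightarrow> iexp (t * (\<integral>x. S z x * f x \<partial>\<pi>measure))"
          using AEg
        proof eventually_elim
          case (elim z)
          have "(\<lambda>m. \<Sum>j<2 ^ m - 1. G j z * ?fc j) \<longlonglongrightarrow> (\<integral>x. S z x * f x \<partial>\<pi>measure)"
            using good_limit(3)[OF _ _ f, of z] good[OF sp elim] elim by (simp add: S_def)
          from tendsto_mult[OF tendsto_const[of t] this]
          have "(\<lambda>m. \<Sum>j<2 ^ m - 1. (t * ?fc j) * G j z) \<longlonglongrightarrow> t * (\<integral>x. S z x * f x \<partial>\<pi>measure)"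
            by (simp add: sum_distrib_left mult_ac)
          then show ?case by (intro tendsto_exp tendsto_mult tendsto_const tendsto_of_real)
        qed
      qed auto
      have sub: "filterlim (\<lambda>m::nat. (2::nat) ^ m - 1) at_top sequentially"
      proof (rule filterlim_at_top_mono[OF filterlim_ident], rule always_eventually, rule allI)
        show "m \<le> 2 ^ m - 1" for m :: nat using less_exp[of m] by linarith
      qed
      have "(\<lambda>m. - (t\<^sup>2 * (\<Sum>j<2 ^ m - 1. \<Sum>k<2 ^ m - 1. ?fc j * ?fc k * C j k)) / 2) \<longlonglongrightarrow> - (t\<^sup>2 * ?V) / 2"
        using filterlim_compose[OF quadratic_form_limit[OF f] sub] by (intro tendsto_intros) auto
      then have "(\<lambda>m. - (\<Sum>j<2 ^ m - 1. \<Sum>k<2 ^ m - 1. (t * ?fc j) * (t * ?fc k) * C j k) / 2) \<longlonglongrightarrow> - ?V * t\<^sup>2 / 2"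
        by (simp add: sum_distrib_left power2_eq_square mult_ac)
      then have "(\<lambda>m. complex_of_real (exp (- (\<Sum>j<2 ^ m - 1. \<Sum>k<2 ^ m - 1. (t * ?fc j) * (t * ?fc k) * C j k) / 2))) \<longlonglongrightarrow> complex_of_real (exp (- ?V * t\<^sup>2 / 2))"
        by (intro tendsto_of_real tendsto_exp)
      then have "(\<integral>z. iexp (t * (\<integral>x. S z x * f x \<partial>\<pi>measure)) \<partial>gauss_seq) = complex_of_real (exp (- ?V * t\<^sup>2 / 2))"
        using LIMSEQ_unique[OF lim1] unfolding gauss_field_char[OF psd] by blast
      then show "char (distr gauss_seq borel (\<lambda>z. \<integral>x. S z x * f x \<partial>\<pi>measure)) t = complex_of_real (exp (- ?V * t\<^sup>2 / 2))"
        unfolding char_def by (subst integral_distr[OF I]) auto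
    qed
  qed
  from that[OF this norm_m norm_lim] show thesis .
qed

end

lemma (in prob_space) prob_ge_le_second_moment:
  assumes [measurable]: "S \<in> borel_measurable M" and S2: "integrable M (\<lambda>\<omega>. (S \<omega>)\<^sup>2)"
    and a: "a > 0" and b: "expectation (\<lambda>\<omega>. (S \<omega>)\<^sup>2) \<le> b"
  shows "prob {\<omega> \<in> space M. \<bar>S \<omega>\<bar> \<ge> a} \<le> b / a\<^sup>2"
proof -
  let ?A = "{\<omega> \<in> space M. \<bar>S \<omega>\<bar> \<ge> a}"
  have "prob ?A = expectation (indicator ?A)" by simp
  also have "\<dots> \<le> expectation (\<lambda>\<omega>. (S \<omega>)\<^sup>2 / a\<^sup>2)"
  proof (rule integral_mono)
    show "integrable M (indicator ?A :: 'a \<Rightarrow> real)" by (rule integrable_bounded[where B=1]) auto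
    show "integrable M (\<lambda>\<omega>. (S \<omega>)\<^sup>2 / a\<^sup>2)" using S2 by simp
    show "indicator ?A \<omega> \<le> (S \<omega>)\<^sup>2 / a\<^sup>2" for \<omega>
      using a power_mono[of a "\<bar>S \<omega>\<bar>" 2] by (cases "\<omega> \<in> ?A") (auto simp: field_simps)
  qed
  also have "\<dots> \<le> b / a\<^sup>2" using b by (simp add: divide_right_mono)
  finally show ?thesis .
qed

subsection \<open>The sample quantile\<close>

text \<open>The subgradient inequalities of the convex function mapping y to \<open>rho\<close>
  \<tau> (x - y), taken at y = u and at y = v.\<close>

lemma rho_increment:
  assumes "u \<le> v" "0 < \<tau>" "\<tau> < 1"
  shows "rho \<tau> (x - v) - rho \<tau> (x - u) \<ge> (v - u) * (of_bool (x < u) - \<tau>)"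
    and "rho \<tau> (x - u) - rho \<tau> (x - v) \<ge> (v - u) * (\<tau> - of_bool (x < v))"
proof -
  show "rho \<tau> (x - v) - rho \<tau> (x - u) \<ge> (v - u) * (of_bool (x < u) - \<tau>)"
  proof (cases "x < u \<or> v \<le> x")
    case True
    then show ?thesis using assms by (auto simp: rho_def algebra_simps)
  next
    case False
    have "0 \<le> v - x" using False by simp
    then show ?thesis using False assms by (simp add: rho_def algebra_simps)
  qed
  show "rho \<tau> (x - u) - rho \<tau> (x - v) \<ge> (v - u) * (\<tau> - of_bool (x < v))"
  proof (cases "x < u \<or> v \<le> x")
    case True
    then show ?thesis using assms by (auto simp: rho_def algebra_simps)
  next
    case False
    then show ?thesis using False assms by (simp add: rho_def algebra_simps)
  qed
qed

text \<open>The lower slope \<kappa> of the distribution function yields the rate of the sample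
  quantile; the upper slope L limits the number of observations between nearby thresholds.\<close>

locale gmc_quantile = stationary_gmc M X \<xi>0 \<delta> K r
  for M :: "'a measure" and X :: "int \<Rightarrow> 'a \<Rightarrow> real" and \<xi>0 \<delta> K r :: real +
  fixes \<tau> \<kappa> L :: real and xh :: "nat \<Rightarrow> 'a \<Rightarrow> real"
  assumes \<tau>: "0 < \<tau>" "\<tau> < 1" and p_\<xi>0: "p \<xi>0 = \<tau>" and \<kappa>: "\<kappa> > 0"
    and p_incr: "\<And>u v. near u \<Longrightarrow> near v \<Longrightarrow> u \<le> v \<Longrightarrow> \<kappa> * (v - u) \<le> p v - p u \<and> p v - p u \<le> L * (v - u)"
    and xh_meas[measurable]: "\<And>n. xh n \<in> borel_measurable M"
    and xh_min: "\<And>n \<omega> x. \<omega> \<in> space M \<Longrightarrow>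
      (\<Sum>t\<in>{1..int n}. rho \<tau> (X t \<omega> - xh n \<omega>)) \<le> (\<Sum>t\<in>{1..int n}. rho \<tau> (X t \<omega> - x))"
begin

lemma L_nonneg: "L \<ge> 0"
proof -
  have n: "near (\<xi>0 + \<delta>)" using \<delta>_pos by (simp add: near_def)
  have "\<kappa> * \<delta> \<le> p (\<xi>0 + \<delta>) - p \<xi>0" "p (\<xi>0 + \<delta>) - p \<xi>0 \<le> L * \<delta>"
    using p_incr[OF near_\<xi>0 n] \<delta>_pos by simp_all
  then have "\<kappa> * \<delta> \<le> L * \<delta>" by (rule order_trans)
  then show ?thesis using \<kappa> \<delta>_pos by (simp add: mult_le_cancel_right)
qed

text \<open>The sum of the subgradients at b has the sign of the direction from the minimiser to b,
  by comparing the objective at both points. The argument covers every minimiser, so ties in the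
  sample need no special choice.\<close>

lemma xh_quantile:
  assumes \<omega>: "\<omega> \<in> space M"
  shows "xh n \<omega> > b \<Longrightarrow> (\<Sum>t\<in>{1..int n}. of_bool (X t \<omega> < b)) \<le> real n * \<tau>"
    and "xh n \<omega> < b \<Longrightarrow> (\<Sum>t\<in>{1..int n}. of_bool (X t \<omega> < b)) \<ge> real n * \<tau>"
proof -
  let ?N = "\<Sum>t\<in>{1..int n}. of_bool (X t \<omega> < b) :: real"
  let ?x = "xh n \<omega>"
  have m: "(\<Sum>t\<in>{1..int n}. rho \<tau> (X t \<omega> - b)) - (\<Sum>t\<in>{1..int n}. rho \<tau> (X t \<omega> - ?x)) \<ge> 0"
    using xh_min[OF \<omega>, of n b] by simp
  show "?N \<le> real n * \<tau>" if "?x > b"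
  proof -
    have "(?x - b) * (?N - real n * \<tau>) = (\<Sum>t\<in>{1..int n}. (?x - b) * (of_bool (X t \<omega> < b) - \<tau>))"
      by (simp add: sum_distrib_left[symmetric] sum_subtractf)
    also have "\<dots> \<le> (\<Sum>t\<in>{1..int n}. rho \<tau> (X t \<omega> - ?x) - rho \<tau> (X t \<omega> - b))"
      using that \<tau> by (intro sum_mono rho_increment) auto
    also have "\<dots> \<le> 0" using m by (simp add: sum_subtractf)
    finally show ?thesis using that by (simp add: mult_le_0_iff)
  qed
  show "?N \<ge> real n * \<tau>" if "?x < b"
  proof -
    have "(b - ?x) * (real n * \<tau> - ?N) = (\<Sum>t\<in>{1..int n}. (b - ?x) * (\<tau> - of_bool (X t \<omega> < b)))"
      by (simp add: sum_distrib_left[symmetric] sum_subtractf)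
    also have "\<dots> \<le> (\<Sum>t\<in>{1..int n}. rho \<tau> (X t \<omega> - ?x) - rho \<tau> (X t \<omega> - b))"
      using that \<tau> by (intro sum_mono rho_increment) auto
    also have "\<dots> \<le> 0" using m by (simp add: sum_subtractf)
    finally show ?thesis using that by (simp add: mult_le_0_iff)
  qed
qed

definition C1 :: real where "C1 = K * (2 / (1 - r))"

lemma C1: "C1 \<ge> 0" using K_ge r by (simp add: C1_def)

lemma V_sum_integrable: "finite A \<Longrightarrow> 0 \<le> c \<Longrightarrow> c \<le> 1 \<Longrightarrow> integrable M (\<lambda>\<omega>. (\<Sum>t\<in>A. V c u t \<omega>)\<^sup>2)"
proof (rule integrable_bounded[where B="(real (card A) * 1)\<^sup>2"])
  assume "finite A" and c: "0 \<le> c" "c \<le> 1"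
  fix \<omega>
  have "\<bar>\<Sum>t\<in>A. V c u t \<omega>\<bar> \<le> real (card A) * 1"
    by (rule order_trans[OF sum_abs]) (intro sum_bounded_above Vfun_abs_le c)
  then have "\<bar>\<Sum>t\<in>A. V c u t \<omega>\<bar>\<^sup>2 \<le> (real (card A) * 1)\<^sup>2" by (intro power_mono) auto
  then show "norm ((\<Sum>t\<in>A. V c u t \<omega>)\<^sup>2) \<le> (real (card A) * 1)\<^sup>2" by simp
qed measurable

lemma centred_count_second_moment:
  assumes u: "near u" and A: "finite A"
  shows "expectation (\<lambda>\<omega>. (\<Sum>t\<in>A. V (p u) u t \<omega>)\<^sup>2) \<le> real (card A) * C1"
  unfolding C1_def
proof (rule second_moment_sum_le[where B=1])
  show "\<bar>V (p u) u t \<omega>\<bar> \<le> 1" for t \<omega> by (rule Vfun_abs_le) (auto simp: p_bounds)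
  fix s t :: int assume st: "s \<le> t"
  have "ok (p u, u, s)" "ok (p u, u, t)" using u by (auto simp: ok_def p_bounds)
  from split11[OF this, of "nat (t - s)"] st
  have "\<bar>E2 (p u, u, s) (p u, u, t)\<bar> \<le> K * r ^ nat (t - s)" by (simp add: E1_p)
  then show "\<bar>expectation (\<lambda>\<omega>. V (p u) u s \<omega> * V (p u) u t \<omega>)\<bar> \<le> K * r ^ nat (t - s)"
    by (simp add: E2_def)
qed (use r K_ge A in auto)

lemma count_eq: "(\<Sum>t\<in>A. of_bool (X t \<omega> < u)) = real (card A) * p u - (\<Sum>t\<in>A. V (p u) u t \<omega>)"
  by (simp add: Vfun_of_bool sum_subtractf)

lemma deviation_prob:
  assumes u: "near u" and n: "n \<ge> 1" and a: "a > 0"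
  shows "prob {\<omega> \<in> space M. \<bar>\<Sum>t\<in>{1..int n}. V (p u) u t \<omega>\<bar> \<ge> real n * a} \<le> C1 / (real n * a\<^sup>2)"
proof -
  have "prob {\<omega> \<in> space M. \<bar>\<Sum>t\<in>{1..int n}. V (p u) u t \<omega>\<bar> \<ge> real n * a} \<le> (real n * C1) / (real n * a)\<^sup>2"
    by (rule prob_ge_le_second_moment[OF _ V_sum_integrable])
      (use centred_count_second_moment[OF u, of "{1..int n}"] n a p_bounds in auto)
  also have "\<dots> = C1 / (real n * a\<^sup>2)" using n by (simp add: power2_eq_square field_simps)
  finally show ?thesis .
qed

text \<open>If the sample quantile lies beyond \<xi>0 + h or below \<xi>0 - h, the count at that
  fixed threshold deviates from its mean by at least n * \<kappa> * h. Chebyshev's inequality at two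
  deterministic thresholds therefore suffices.\<close>

lemma quantile_rate:
  assumes h: "0 < h" "h \<le> \<delta>" and n: "n \<ge> 1"
  shows "prob {\<omega> \<in> space M. \<bar>xh n \<omega> - \<xi>0\<bar> > h} \<le> 2 * C1 / (real n * (\<kappa> * h)\<^sup>2)"
proof -
  have nr: "near (\<xi>0 + h)" "near (\<xi>0 - h)" using h by (auto simp: near_def)
  let ?B = "\<lambda>u. {\<omega> \<in> space M. \<bar>\<Sum>t\<in>{1..int n}. V (p u) u t \<omega>\<bar> \<ge> real n * (\<kappa> * h)}"
  have "{\<omega> \<in> space M. \<bar>xh n \<omega> - \<xi>0\<bar> > h} \<subseteq> ?B (\<xi>0 + h) \<union> ?B (\<xi>0 - h)"
  proof
    fix \<omega> assume "\<omega> \<in> {\<omega> \<in> space M. \<bar>xh n \<omega> - \<xi>0\<bar> > h}"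
    then have \<omega>: "\<omega> \<in> space M" "xh n \<omega> > \<xi>0 + h \<or> xh n \<omega> < \<xi>0 - h" by auto
    from \<omega>(2) show "\<omega> \<in> ?B (\<xi>0 + h) \<union> ?B (\<xi>0 - h)"
    proof
      assume "xh n \<omega> > \<xi>0 + h"
      from xh_quantile(1)[OF \<omega>(1) this] have "real n * (p (\<xi>0 + h) - \<tau>) \<le> (\<Sum>t\<in>{1..int n}. V (p (\<xi>0 + h)) (\<xi>0 + h) t \<omega>)"
        unfolding count_eq by (simp add: algebra_simps)
      moreover have "real n * (\<kappa> * h) \<le> real n * (p (\<xi>0 + h) - \<tau>)"
        using p_incr[of \<xi>0 "\<xi>0 + h"] nr h by (intro mult_left_mono) (auto simp: p_\<xi>0)
      ultimately show ?thesis using \<omega>(1) by auto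
    next
      assume "xh n \<omega> < \<xi>0 - h"
      from xh_quantile(2)[OF \<omega>(1) this] have "(\<Sum>t\<in>{1..int n}. V (p (\<xi>0 - h)) (\<xi>0 - h) t \<omega>) \<le> - (real n * (\<tau> - p (\<xi>0 - h)))"
        unfolding count_eq by (simp add: algebra_simps)
      moreover have "real n * (\<kappa> * h) \<le> real n * (\<tau> - p (\<xi>0 - h))"
        using p_incr[of "\<xi>0 - h" \<xi>0] nr h by (intro mult_left_mono) (auto simp: p_\<xi>0)
      ultimately show ?thesis using \<omega>(1) by auto
    qed
  qed
  then have "prob {\<omega> \<in> space M. \<bar>xh n \<omega> - \<xi>0\<bar> > h} \<le> prob (?B (\<xi>0 + h) \<union> ?B (\<xi>0 - h))"
    by (intro finite_measure_mono) measurable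
  also have "\<dots> \<le> prob (?B (\<xi>0 + h)) + prob (?B (\<xi>0 - h))"
    by (intro measure_Un_le) measurable
  also have "\<dots> \<le> C1 / (real n * (\<kappa> * h)\<^sup>2) + C1 / (real n * (\<kappa> * h)\<^sup>2)"
    using h \<kappa> by (intro add_mono deviation_prob nr n) auto
  finally show ?thesis by simp
qed

section \<open>Sample autocovariances at the estimated quantile and divergence of the
  statistic\<close>

definition R :: "nat \<Rightarrow> nat \<Rightarrow> real \<Rightarrow> 'a \<Rightarrow> real" where
  "R j n u \<omega> = (\<Sum>t\<in>{int j + 1..int n}. V \<tau> u t \<omega> * V \<tau> u (t - int j) \<omega>)"

lemma R_measurable[measurable]: "R j n u \<in> borel_measurable M" unfolding R_def by measurable
lemma R_xh_measurable[measurable]: "(\<lambda>\<omega>. R j n (xh n \<omega>) \<omega>) \<in> borel_measurable M"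
  unfolding R_def Vfun_def by measurable

definition lagcov :: "nat \<Rightarrow> real" where "lagcov j = E2 (\<tau>, \<xi>0, 0) (\<tau>, \<xi>0, int j)"

lemma VV_expectation: "expectation (\<lambda>\<omega>. V \<tau> \<xi>0 t \<omega> * V \<tau> \<xi>0 (t - int j) \<omega>) = lagcov j"
proof -
  have "expectation (\<lambda>\<omega>. V \<tau> \<xi>0 t \<omega> * V \<tau> \<xi>0 (t - int j) \<omega>) = E2 (\<tau>, \<xi>0, t - int j) (\<tau>, \<xi>0, t)"
    by (simp add: E2_def mult.commute)
  also have "\<dots> = lagcov j" using E2_shift[of \<tau> \<xi>0 0 "t - int j" \<tau> \<xi>0 "int j"] by (simp add: lagcov_def)
  finally show ?thesis .
qed

lemma VV_bound: "\<bar>V \<tau> u s \<omega> * V \<tau> v t \<omega>\<bar> \<le> 1"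
  using abs_mult_le[OF Vfun_abs_le Vfun_abs_le, of \<tau> \<tau> u "X s \<omega>" v "X t \<omega>"] \<tau> by simp

lemma lagcov_bound: "\<bar>lagcov j\<bar> \<le> 1"
  unfolding VV_expectation[of 0 j, symmetric] by (rule abs_expectation_le) (auto simp: VV_bound)

lemma ok_\<tau>: "ok (\<tau>, \<xi>0, t)" using \<tau> by (simp add: ok_def)

text \<open>Two lagged products are separated only once their distance exceeds the lag, so decay
  starts there and the constant carries 1 / r ^ j. This is harmless for a single fixed lag.\<close>

lemma VV_second_moment:
  assumes A: "finite A"
  shows "expectation (\<lambda>\<omega>. (\<Sum>t\<in>A. V \<tau> \<xi>0 t \<omega> * V \<tau> \<xi>0 (t - int j) \<omega> - lagcov j)\<^sup>2) \<le> real (card A) * (2 * K / r ^ j * (2 / (1 - r)))"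
proof (rule second_moment_sum_le[where B=2])
  show "\<bar>V \<tau> \<xi>0 t \<omega> * V \<tau> \<xi>0 (t - int j) \<omega> - lagcov j\<bar> \<le> 2" for t \<omega>
    using VV_bound[of \<xi>0 t \<omega> \<xi>0 "t - int j"] lagcov_bound[of j] by linarith
  fix s t :: int assume st: "s \<le> t"
  have i: "integrable M (\<lambda>\<omega>. V \<tau> \<xi>0 t \<omega> * V \<tau> \<xi>0 (t - int j) \<omega>)" for t
    by (rule integrable_bounded[where B=1]) (auto simp: VV_bound)
  have ii: "integrable M (\<lambda>\<omega>. (V \<tau> \<xi>0 s \<omega> * V \<tau> \<xi>0 (s - int j) \<omega>) * (V \<tau> \<xi>0 t \<omega> * V \<tau> \<xi>0 (t - int j) \<omega>))"
    by (rule integrable_bounded[where B="1 * 1"]) (measurable, unfold real_norm_def, intro abs_mult_le VV_bound)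
  let ?E = "E4 (\<tau>, \<xi>0, s) (\<tau>, \<xi>0, s - int j) (\<tau>, \<xi>0, t) (\<tau>, \<xi>0, t - int j)"
  have "expectation (\<lambda>\<omega>. (V \<tau> \<xi>0 s \<omega> * V \<tau> \<xi>0 (s - int j) \<omega> - lagcov j) * (V \<tau> \<xi>0 t \<omega> * V \<tau> \<xi>0 (t - int j) \<omega> - lagcov j))
     = expectation (\<lambda>\<omega>. (V \<tau> \<xi>0 s \<omega> * V \<tau> \<xi>0 (s - int j) \<omega>) * (V \<tau> \<xi>0 t \<omega> * V \<tau> \<xi>0 (t - int j) \<omega>)
        - lagcov j * (V \<tau> \<xi>0 s \<omega> * V \<tau> \<xi>0 (s - int j) \<omega>) - lagcov j * (V \<tau> \<xi>0 t \<omega> * V \<tau> \<xi>0 (t - int j) \<omega>) + lagcov j * lagcov j)"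
    by (simp add: algebra_simps)
  also have "\<dots> = expectation (\<lambda>\<omega>. (V \<tau> \<xi>0 s \<omega> * V \<tau> \<xi>0 (s - int j) \<omega>) * (V \<tau> \<xi>0 t \<omega> * V \<tau> \<xi>0 (t - int j) \<omega>)) - lagcov j * lagcov j"
    using i ii by (simp add: Bochner_Integration.integrable_diff VV_expectation prob_space)
  also have "\<dots> = ?E - lagcov j * lagcov j" by (simp add: E4_def mult.assoc)
  finally have eq: "expectation (\<lambda>\<omega>. (V \<tau> \<xi>0 s \<omega> * V \<tau> \<xi>0 (s - int j) \<omega> - lagcov j) * (V \<tau> \<xi>0 t \<omega> * V \<tau> \<xi>0 (t - int j) \<omega> - lagcov j)) = ?E - lagcov j * lagcov j" .
  have l: "E2 (\<tau>, \<xi>0, t) (\<tau>, \<xi>0, t - int j) = lagcov j" for t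
    using VV_expectation[of t j] by (simp add: E2_def)
  have "\<bar>?E - lagcov j * lagcov j\<bar> \<le> 2 * (K * r ^ (nat (t - s) - j))"
  proof (cases "int j \<le> t - s")
    case True
    then show ?thesis
      using split22[OF ok_\<tau> ok_\<tau> ok_\<tau> ok_\<tau>, of s "nat (t - s) - j" t "s - int j" "t - int j"] by (simp add: l of_nat_diff nat_le_iff)
  next
    case False
    then have "nat (t - s) - j = 0" using st by auto
    moreover have "\<bar>?E\<bar> \<le> 1" by (intro E_bounds ok_\<tau>)
    moreover have "\<bar>lagcov j * lagcov j\<bar> \<le> 1 * 1" by (intro abs_mult_le lagcov_bound)
    ultimately have "\<bar>?E - lagcov j * lagcov j\<bar> \<le> 2" by linarith
    then show ?thesis using \<open>nat (t - s) - j = 0\<close> K_ge by simp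
  qed
  also have "\<dots> \<le> 2 * K / r ^ j * r ^ nat (t - s)"
  proof -
    have "r ^ (nat (t - s) - j) * r ^ j \<le> r ^ nat (t - s)" if "j \<le> nat (t - s)"
      using that by (simp add: power_add[symmetric])
    then have a: "K * (r ^ (nat (t - s) - j) * r ^ j) \<le> K * r ^ nat (t - s)" if "j \<le> nat (t - s)"
      using that K_ge by (intro mult_left_mono) auto
    show ?thesis
    proof (cases "j \<le> nat (t - s)")
      case True
      then show ?thesis using a r by (simp add: field_simps)
    next
      case False
      then have "r ^ j \<le> r ^ nat (t - s)" using r by (intro power_decreasing) auto
      then show ?thesis using False K_ge r by (simp add: field_simps)
    qed
  qed
  finally show "\<bar>expectation (\<lambda>\<omega>. (V \<tau> \<xi>0 s \<omega> * V \<tau> \<xi>0 (s - int j) \<omega> - lagcov j) * (V \<tau> \<xi>0 t \<omega> * V \<tau> \<xi>0 (t - int j) \<omega> - lagcov j))\<bar> \<le> 2 * K / r ^ j * r ^ nat (t - s)"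
    unfolding eq .
qed (use r K_ge A in auto)

text \<open>A product can change only if one of its two observations lies between \<xi>0 - h and
  \<xi>0 + h, and each observation occurs in at most two products. Counting observations in a window
  of fixed width is precise enough for a law of large numbers.\<close>

lemma R_crude_difference:
  assumes h: "\<bar>u - \<xi>0\<bar> \<le> h"
  shows "\<bar>R j n u \<omega> - R j n \<xi>0 \<omega>\<bar> \<le> 2 * (\<Sum>t\<in>{1..int n}. of_bool (X t \<omega> < \<xi>0 + h) - of_bool (X t \<omega> < \<xi>0 - h))"
proof -
  define d where "d t = of_bool (X t \<omega> < \<xi>0 + h) - (of_bool (X t \<omega> < \<xi>0 - h) :: real)" for t
  have h0: "h \<ge> 0" using h by linarith
  have d0: "d t \<ge> 0" for t using h0 by (auto simp: d_def)
  have vd: "\<bar>V \<tau> u t \<omega> - V \<tau> \<xi>0 t \<omega>\<bar> \<le> d t" for t using h by (auto simp: d_def Vfun_def)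
  have v1: "\<bar>V \<tau> u t \<omega>\<bar> \<le> 1" for u t using \<tau> by (intro Vfun_abs_le) auto
  have "\<bar>R j n u \<omega> - R j n \<xi>0 \<omega>\<bar> \<le> (\<Sum>t\<in>{int j + 1..int n}. d t + d (t - int j))"
    unfolding R_def sum_subtractf[symmetric]
  proof (rule order_trans[OF sum_abs], rule sum_mono)
    fix t
    have "V \<tau> u t \<omega> * V \<tau> u (t - int j) \<omega> - V \<tau> \<xi>0 t \<omega> * V \<tau> \<xi>0 (t - int j) \<omega>
      = (V \<tau> u t \<omega> - V \<tau> \<xi>0 t \<omega>) * V \<tau> u (t - int j) \<omega> + V \<tau> \<xi>0 t \<omega> * (V \<tau> u (t - int j) \<omega> - V \<tau> \<xi>0 (t - int j) \<omega>)"
      by (simp add: algebra_simps)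
    also have "\<bar>\<dots>\<bar> \<le> d t * 1 + 1 * d (t - int j)"
      by (intro order_trans[OF abs_triangle_ineq] add_mono abs_mult_le v1 vd)
    finally show "\<bar>V \<tau> u t \<omega> * V \<tau> u (t - int j) \<omega> - V \<tau> \<xi>0 t \<omega> * V \<tau> \<xi>0 (t - int j) \<omega>\<bar> \<le> d t + d (t - int j)" by simp
  qed
  also have "\<dots> = (\<Sum>t\<in>{int j + 1..int n}. d t) + (\<Sum>t\<in>(\<lambda>t. t - int j) ` {int j + 1..int n}. d t)"
    by (subst sum.reindex) (auto simp: sum.distrib inj_on_def)
  also have "\<dots> \<le> (\<Sum>t\<in>{1..int n}. d t) + (\<Sum>t\<in>{1..int n}. d t)"
    using d0 by (intro add_mono sum_mono2) auto
  finally show ?thesis by (simp add: d_def)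
qed

text \<open>With l the population autocovariance, each error term is at most n |l| / 16 outside events of probability O(1/n).\<close>

lemma autocovariance_lower_bound:
  assumes j: "j \<ge> 1" and l: "lagcov j \<noteq> 0"
  obtains D where "\<And>n. n \<ge> 8 * j \<Longrightarrow> prob {\<omega> \<in> space M. \<bar>R j n (xh n \<omega>) \<omega>\<bar> < real n * \<bar>lagcov j\<bar> / 8} \<le> D / real n"
proof -
  define l where "l = \<bar>lagcov j\<bar>"
  have l0: "l > 0" using l by (simp add: l_def)
  \<comment> \<open>The window of width 2 h has probability at most 2 * L * h <= l / 16; the
    denominator has L + 1 because L may be 0.\<close>
  define h where "h = min \<delta> (l / (32 * (L + 1)))"
  have h: "0 < h" "h \<le> \<delta>" using \<delta>_pos l0 L_nonneg by (auto simp: h_def)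
  have Lh: "L * h \<le> l / 32"
  proof -
    have "L * h \<le> (L + 1) * (l / (32 * (L + 1)))" using L_nonneg h by (intro mult_mono) (auto simp: h_def)
    also have "\<dots> = l / 32" using L_nonneg by (simp add: divide_simps)
    finally show ?thesis .
  qed
  have nr: "near (\<xi>0 + h)" "near (\<xi>0 - h)" using h by (auto simp: near_def)
  define a where "a = l / 16"
  have a: "a > 0" using l0 by (simp add: a_def)
  define C3 where "C3 = 2 * K / r ^ j * (2 / (1 - r))"
  let ?Z = "\<lambda>n \<omega>. \<Sum>t\<in>{int j + 1..int n}. V \<tau> \<xi>0 t \<omega> * V \<tau> \<xi>0 (t - int j) \<omega> - lagcov j"
  show thesis
  proof (rule that[of "2 * C1 / (\<kappa> * h)\<^sup>2 + C1 / a\<^sup>2 + C1 / a\<^sup>2 + C3 / a\<^sup>2"])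
    fix n assume n: "n \<ge> 8 * j"
    with j have n1: "n \<ge> 1" and nj: "n \<ge> j" by auto
    let ?S = "\<lambda>u \<omega>. \<Sum>t\<in>{1..int n}. V (p u) u t \<omega>"
    let ?B0 = "{\<omega> \<in> space M. \<bar>xh n \<omega> - \<xi>0\<bar> > h}"
    let ?B1 = "{\<omega> \<in> space M. \<bar>?S (\<xi>0 + h) \<omega>\<bar> \<ge> real n * a}"
    let ?B2 = "{\<omega> \<in> space M. \<bar>?S (\<xi>0 - h) \<omega>\<bar> \<ge> real n * a}"
    let ?B3 = "{\<omega> \<in> space M. \<bar>?Z n \<omega>\<bar> \<ge> real n * a}"
    have cardJ: "real (card {int j + 1..int n}) = real n - real j" using nj by (simp add: of_nat_diff)
    have sub: "{\<omega> \<in> space M. \<bar>R j n (xh n \<omega>) \<omega>\<bar> < real n * l / 8} \<subseteq> ?B0 \<union> ?B1 \<union> ?B2 \<union> ?B3"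
    proof (rule subsetI, rule ccontr)
      fix \<omega> assume in1: "\<omega> \<in> {\<omega> \<in> space M. \<bar>R j n (xh n \<omega>) \<omega>\<bar> < real n * l / 8}"
        and out: "\<omega> \<notin> ?B0 \<union> ?B1 \<union> ?B2 \<union> ?B3"
      from in1 have \<omega>: "\<omega> \<in> space M" and small: "\<bar>R j n (xh n \<omega>) \<omega>\<bar> < real n * l / 8" by simp_all
      from out have "\<omega> \<notin> ?B0" "\<omega> \<notin> ?B1" "\<omega> \<notin> ?B2" "\<omega> \<notin> ?B3" by blast+
      with \<omega> have b0: "\<bar>xh n \<omega> - \<xi>0\<bar> \<le> h" and b1: "\<bar>?S (\<xi>0 + h) \<omega>\<bar> < real n * a"
        and b2: "\<bar>?S (\<xi>0 - h) \<omega>\<bar> < real n * a" and b3: "\<bar>?Z n \<omega>\<bar> < real n * a"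
        by (simp_all only: mem_Collect_eq not_le not_less simp_thms)
      have "R j n \<xi>0 \<omega> = ?Z n \<omega> + (real n - real j) * lagcov j"
        unfolding R_def sum_subtractf using cardJ by simp
      then have "\<bar>R j n \<xi>0 \<omega>\<bar> \<ge> (real n - real j) * l - real n * a"
      proof -
        assume e: "R j n \<xi>0 \<omega> = ?Z n \<omega> + (real n - real j) * lagcov j"
        have "(real n - real j) * l = \<bar>(real n - real j) * lagcov j\<bar>" using nj by (simp add: l_def abs_mult)
        also have "\<dots> \<le> \<bar>R j n \<xi>0 \<omega>\<bar> + \<bar>?Z n \<omega>\<bar>" unfolding e by linarith
        finally show ?thesis using b3 by linarith
      qed
      moreover have "(\<Sum>t\<in>{1..int n}. of_bool (X t \<omega> < \<xi>0 + h) - of_bool (X t \<omega> < \<xi>0 - h)) \<le> real n * (l / 16) + 2 * (real n * a)"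
      proof -
        have "(\<Sum>t\<in>{1..int n}. of_bool (X t \<omega> < \<xi>0 + h) - of_bool (X t \<omega> < \<xi>0 - h)) = real n * (p (\<xi>0 + h) - p (\<xi>0 - h)) - ?S (\<xi>0 + h) \<omega> + ?S (\<xi>0 - h) \<omega>"
          unfolding sum_subtractf count_eq by (simp add: algebra_simps)
        moreover have "real n * (p (\<xi>0 + h) - p (\<xi>0 - h)) \<le> real n * (l / 16)"
        proof (rule mult_left_mono)
          have "p (\<xi>0 + h) - p (\<xi>0 - h) \<le> L * (2 * h)" using p_incr[OF nr(2,1)] h by (simp add: algebra_simps)
          then show "p (\<xi>0 + h) - p (\<xi>0 - h) \<le> l / 16" using Lh by simp
        qed simp
        ultimately show ?thesis using b1 b2 by linarith
      qed
      moreover have "\<bar>R j n \<xi>0 \<omega>\<bar> \<le> \<bar>R j n (xh n \<omega>) \<omega>\<bar> + \<bar>R j n (xh n \<omega>) \<omega> - R j n \<xi>0 \<omega>\<bar>" by linarith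
      moreover have "x - 2 * y \<le> b" if "x \<le> a" "s \<le> y" "a \<le> b + d" "d \<le> 2 * s" for x y a b d s :: real
        using that by linarith
      ultimately have "\<bar>R j n (xh n \<omega>) \<omega>\<bar> \<ge> (real n - real j) * l - real n * a - 2 * (real n * (l / 16) + 2 * (real n * a))"
        using R_crude_difference[OF b0, of j n \<omega>] by blast
      moreover have "(real n - real j) * l \<ge> real n * (7 / 8) * l"
        using n l0 by (intro mult_right_mono) auto
      \<comment> \<open>From 14/16 of n l, left by n >= 8 j, the losses 1/16, 2/16 and 4/16 are
        subtracted, which leaves 7/16.\<close>
      ultimately have "\<bar>R j n (xh n \<omega>) \<omega>\<bar> \<ge> real n * (7 / 8) * l - real n * (l / 16) - 2 * (real n * (l / 16) + 2 * (real n * (l / 16)))"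
        unfolding a_def by linarith
      then have "\<bar>R j n (xh n \<omega>) \<omega>\<bar> \<ge> real n * l * (7 / 16)" by (simp add: algebra_simps)
      moreover have "real n * l * (7 / 16) \<ge> real n * l / 8" using l0 by simp
      ultimately show False using small by linarith
    qed
    have p3: "prob ?B3 \<le> C3 / (real n * a\<^sup>2)"
    proof -
      have bz: "\<bar>?Z n \<omega>\<bar> \<le> real (card {int j + 1..int n}) * 2" for \<omega>
      proof (rule order_trans[OF sum_abs], rule sum_bounded_above)
        fix t show "\<bar>V \<tau> \<xi>0 t \<omega> * V \<tau> \<xi>0 (t - int j) \<omega> - lagcov j\<bar> \<le> 2"
          using VV_bound[of \<xi>0 t \<omega> \<xi>0 "t - int j"] lagcov_bound[of j] by linarith
      qed
      have iz: "integrable M (\<lambda>\<omega>. (?Z n \<omega>)\<^sup>2)"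
        unfolding power2_eq_square
        by (rule integrable_bounded[where B="(real (card {int j + 1..int n}) * 2) * (real (card {int j + 1..int n}) * 2)"])
          (measurable, unfold real_norm_def, intro abs_mult_le bz)
      have m: "expectation (\<lambda>\<omega>. (?Z n \<omega>)\<^sup>2) \<le> real n * C3"
      proof -
        have C30: "C3 \<ge> 0" using K_ge r by (simp add: C3_def)
        have "expectation (\<lambda>\<omega>. (?Z n \<omega>)\<^sup>2) \<le> real (card {int j + 1..int n}) * C3"
          unfolding C3_def by (rule VV_second_moment) simp
        also have "\<dots> \<le> real n * C3" using C30 by (intro mult_right_mono) auto
        finally show ?thesis .
      qed
      have "prob ?B3 \<le> (real n * C3) / (real n * a)\<^sup>2"
        by (rule prob_ge_le_second_moment[OF _ iz _ m]) (use n1 a in auto)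
      also have "\<dots> = C3 / (real n * a\<^sup>2)" using n1 by (simp add: power2_eq_square field_simps)
      finally show ?thesis .
    qed
    have "prob {\<omega> \<in> space M. \<bar>R j n (xh n \<omega>) \<omega>\<bar> < real n * l / 8} \<le> prob (?B0 \<union> ?B1 \<union> ?B2 \<union> ?B3)"
      by (intro finite_measure_mono sub) measurable
    also have "\<dots> \<le> prob ?B0 + prob ?B1 + prob ?B2 + prob ?B3"
    proof -
      have "prob (?B0 \<union> ?B1 \<union> ?B2 \<union> ?B3) \<le> prob (?B0 \<union> ?B1 \<union> ?B2) + prob ?B3" by (intro measure_Un_le) measurable
      moreover have "prob (?B0 \<union> ?B1 \<union> ?B2) \<le> prob (?B0 \<union> ?B1) + prob ?B2" by (intro measure_Un_le) measurable
      moreover have "prob (?B0 \<union> ?B1) \<le> prob ?B0 + prob ?B1" by (intro measure_Un_le) measurable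
      ultimately show ?thesis by linarith
    qed
    also have "\<dots> \<le> 2 * C1 / (real n * (\<kappa> * h)\<^sup>2) + C1 / (real n * a\<^sup>2) + C1 / (real n * a\<^sup>2) + C3 / (real n * a\<^sup>2)"
      by (intro add_mono quantile_rate h n1 deviation_prob nr a p3)
    also have "\<dots> = (2 * C1 / (\<kappa> * h)\<^sup>2 + C1 / a\<^sup>2 + C1 / a\<^sup>2 + C3 / a\<^sup>2) / real n"
      by (simp add: add_divide_distrib mult.commute)
    finally show "prob {\<omega> \<in> space M. \<bar>R j n (xh n \<omega>) \<omega>\<bar> < real n * \<bar>lagcov j\<bar> / 8} \<le> (2 * C1 / (\<kappa> * h)\<^sup>2 + C1 / a\<^sup>2 + C1 / a\<^sup>2 + C3 / a\<^sup>2) / real n"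
      by (simp add: l_def)
  qed
qed

definition stat :: "nat \<Rightarrow> 'a \<Rightarrow> real" where
  "stat n \<omega> = (\<Sum>j<n - 1. wt j * (R (Suc j) n (xh n \<omega>) \<omega> / sqrt (real n))\<^sup>2)"

lemma stat_measurable[measurable]: "stat n \<in> borel_measurable M" unfolding stat_def by measurable

lemma stat_nonneg: "stat n \<omega> \<ge> 0"
  unfolding stat_def by (intro sum_nonneg mult_nonneg_nonneg wt_nonneg) auto

theorem stat_diverges:
  assumes l: "lagcov (Suc j) \<noteq> 0"
  shows "(\<lambda>n. prob {\<omega> \<in> space M. stat n \<omega> > B}) \<longlonglongrightarrow> 1"
proof -
  let ?l = "\<bar>lagcov (Suc j)\<bar>"
  obtain D where D: "\<And>n. n \<ge> 8 * Suc j \<Longrightarrow> prob {\<omega> \<in> space M. \<bar>R (Suc j) n (xh n \<omega>) \<omega>\<bar> < real n * ?l / 8} \<le> D / real n"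
    using autocovariance_lower_bound[OF _ l] by auto
  have w0: "wt j * (?l / 8)\<^sup>2 > 0" using l by (simp add: wt_def)
  obtain n0 :: nat where n0: "real n0 * (wt j * (?l / 8)\<^sup>2) > B" using reals_Archimedean3[OF w0] by auto
  have low: "1 - D / real n \<le> prob {\<omega> \<in> space M. stat n \<omega> > B}" if n: "n \<ge> 8 * Suc j" "n \<ge> n0" for n
  proof -
    let ?A = "{\<omega> \<in> space M. \<bar>R (Suc j) n (xh n \<omega>) \<omega>\<bar> < real n * ?l / 8}"
    have "space M - ?A \<subseteq> {\<omega> \<in> space M. stat n \<omega> > B}"
    proof safe
      fix \<omega> assume \<omega>: "\<omega> \<in> space M" and ge: "\<not> \<bar>R (Suc j) n (xh n \<omega>) \<omega>\<bar> < real n * ?l / 8"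
      have n1: "n \<ge> 1" using n by auto
      have "B < real n0 * (wt j * (?l / 8)\<^sup>2)" by (rule n0)
      also have "\<dots> \<le> real n * (wt j * (?l / 8)\<^sup>2)" using n w0 by (intro mult_right_mono) auto
      also have "\<dots> = wt j * ((real n * ?l / 8)\<^sup>2 / real n)" using n1 by (simp add: power2_eq_square)
      also have "\<dots> \<le> wt j * (\<bar>R (Suc j) n (xh n \<omega>) \<omega>\<bar>\<^sup>2 / real n)"
        using ge by (intro mult_left_mono divide_right_mono power_mono wt_nonneg) auto
      also have "\<dots> = wt j * (R (Suc j) n (xh n \<omega>) \<omega> / sqrt (real n))\<^sup>2" by (simp add: power_divide)
      also have "\<dots> \<le> stat n \<omega>"
        unfolding stat_def using n by (intro member_le_sum) (auto simp: wt_nonneg)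
      finally show "stat n \<omega> > B" .
    qed
    then have "prob (space M - ?A) \<le> prob {\<omega> \<in> space M. stat n \<omega> > B}" by (intro finite_measure_mono) measurable
    moreover have "prob (space M - ?A) = 1 - prob ?A" by (rule prob_compl) measurable
    ultimately show ?thesis using D[OF n(1)] by linarith
  qed
  show ?thesis
  proof (rule tendsto_sandwich[of "\<lambda>n. 1 - D / real n" _ _ "\<lambda>_. 1"])
    show "eventually (\<lambda>n. 1 - D / real n \<le> prob {\<omega> \<in> space M. stat n \<omega> > B}) sequentially"
      using eventually_ge_at_top[of "max (8 * Suc j) n0"] by eventually_elim (intro low, auto)
    show "(\<lambda>n. 1 - D / real n) \<longlonglongrightarrow> 1" by real_asymp
  qed auto
qed

end

subsection \<open>Replacing the sample quantile by the quantile\<close>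

lemma square_sum4_le: "(a + b + c + d)\<^sup>2 \<le> 4 * (a\<^sup>2 + b\<^sup>2 + c\<^sup>2 + (d::real)\<^sup>2)"
proof -
  have "0 \<le> (a - b)\<^sup>2 + (a - c)\<^sup>2 + (a - d)\<^sup>2 + (b - c)\<^sup>2 + (b - d)\<^sup>2 + (c - d)\<^sup>2" by simp
  then show ?thesis by (simp add: power2_eq_square algebra_simps)
qed

locale gmc_quantile_indep = gmc_quantile M X \<xi>0 \<delta> K r \<tau> \<kappa> L xh + stationary_gmc_indep M X \<xi>0 \<delta> K r
  for M :: "'a measure" and X :: "int \<Rightarrow> 'a \<Rightarrow> real" and \<xi>0 \<delta> K r \<tau> \<kappa> L :: real and xh :: "nat \<Rightarrow> 'a \<Rightarrow> real"
begin

definition lag_range :: "nat \<Rightarrow> nat \<Rightarrow> int set" where "lag_range j n = {int j + 1..int n}"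

lemma lag_range[simp]: "finite (lag_range j n)" "card (lag_range j n) = n - j"
  by (simp_all add: lag_range_def)

definition count :: "int set \<Rightarrow> real \<Rightarrow> 'a \<Rightarrow> real" where
  "count A u \<omega> = (\<Sum>t\<in>A. of_bool (X t \<omega> < u))"

lemma count_measurable[measurable]: "count A u \<in> borel_measurable M"
  unfolding count_def by measurable

lemma count_mono: "u \<le> v \<Longrightarrow> count A u \<omega> \<le> count A v \<omega>"
  unfolding count_def by (intro sum_mono) auto

lemma count_W: "finite A \<Longrightarrow> count A v \<omega> - count A u \<omega> = real (card A) * (p v - p u) - (\<Sum>t\<in>A. W v t \<omega> - W u t \<omega>)"
  unfolding count_def count_eq sum_subtractf by (simp add: algebra_simps)

lemma integrable_sum_sq:
  fixes f :: "int \<Rightarrow> 'a \<Rightarrow> real"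
  assumes "finite (A :: int set)" "\<And>t. (f t) \<in> borel_measurable M" "\<And>t \<omega>. \<bar>f t \<omega>\<bar> \<le> B"
  shows "integrable M (\<lambda>\<omega>. (\<Sum>t\<in>A. f t \<omega>)\<^sup>2)"
proof (rule integrable_bounded[where B="(real (card A) * B)\<^sup>2"])
  show "(\<lambda>\<omega>. (\<Sum>t\<in>A. f t \<omega>)\<^sup>2) \<in> borel_measurable M" using assms(2) by measurable
  fix \<omega>
  have "\<bar>\<Sum>t\<in>A. f t \<omega>\<bar> \<le> real (card A) * B"
    by (rule order_trans[OF sum_abs]) (intro sum_bounded_above assms(3))
  then have "\<bar>\<Sum>t\<in>A. f t \<omega>\<bar>\<^sup>2 \<le> (real (card A) * B)\<^sup>2" by (intro power_mono) auto
  then show "norm ((\<Sum>t\<in>A. f t \<omega>)\<^sup>2) \<le> (real (card A) * B)\<^sup>2" by simp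
qed

lemma W_diff_bound: "\<bar>W v t \<omega> - W u t \<omega>\<bar> \<le> 2"
  using W_bound[of v t \<omega>] W_bound[of u t \<omega>] by linarith

lemma WW_bound: "\<bar>W u s \<omega> * W v t \<omega>\<bar> \<le> 1"
  using abs_mult_le[OF W_bound W_bound] by simp

text \<open>The count splits into its mean, of size n D, and a centred part whose variance is only
  of order n D because distinct times are uncorrelated.\<close>

lemma count_increment:
  assumes n: "near u" "near v" and A: "finite A" "card A \<le> n" and D: "\<bar>p v - p u\<bar> \<le> D"
  shows "integrable M (\<lambda>\<omega>. (count A v \<omega> - count A u \<omega>)\<^sup>2)"
    "expectation (\<lambda>\<omega>. (count A v \<omega> - count A u \<omega>)\<^sup>2) \<le> 2 * ((real n * D)\<^sup>2 + real n * (8 * D))"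
proof -
  have D0: "D \<ge> 0" using D by linarith
  let ?N = "real (card A) * (p v - p u)" and ?S = "\<lambda>\<omega>. \<Sum>t\<in>A. W v t \<omega> - W u t \<omega>"
  have iS: "integrable M (\<lambda>\<omega>. (?S \<omega>)\<^sup>2)"
    by (rule integrable_sum_sq[where B=2]) (use A W_diff_bound in auto)
  show i: "integrable M (\<lambda>\<omega>. (count A v \<omega> - count A u \<omega>)\<^sup>2)"
    unfolding count_def sum_subtractf[symmetric] by (rule integrable_sum_sq[where B=1]) (use A in auto)
  have "expectation (\<lambda>\<omega>. (count A v \<omega> - count A u \<omega>)\<^sup>2) \<le> expectation (\<lambda>\<omega>. 2 * (?N\<^sup>2 + (?S \<omega>)\<^sup>2))"
  proof (rule integral_mono[OF i])
    fix \<omega>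
    have "(x - y)\<^sup>2 \<le> 2 * (x\<^sup>2 + y\<^sup>2)" for x y :: real
      using zero_le_power2[of "x + y"] by (simp add: power2_eq_square algebra_simps)
    then show "(count A v \<omega> - count A u \<omega>)\<^sup>2 \<le> 2 * (?N\<^sup>2 + (?S \<omega>)\<^sup>2)"
      unfolding count_W[OF A(1)] .
  qed (use iS in auto)
  also have "\<dots> = 2 * (?N\<^sup>2 + expectation (\<lambda>\<omega>. (?S \<omega>)\<^sup>2))"
    using iS by (simp add: prob_space)
  also have "\<dots> \<le> 2 * ((real n * D)\<^sup>2 + real n * (8 * D))"
  proof (intro mult_left_mono add_mono)
    have "\<bar>?N\<bar> \<le> real n * D" unfolding abs_mult using A D by (intro mult_mono) auto
    then show "?N\<^sup>2 \<le> (real n * D)\<^sup>2" using power_mono[of "\<bar>?N\<bar>" "real n * D" 2] by simp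
    have "expectation (\<lambda>\<omega>. (?S \<omega>)\<^sup>2) \<le> real (card A) * (8 * \<bar>p v - p u\<bar>)"
      by (rule W_diff_second_moment[OF n(2,1) A(1)])
    also have "\<dots> \<le> real n * (8 * D)" using A D by (intro mult_mono) auto
    finally show "expectation (\<lambda>\<omega>. (?S \<omega>)\<^sup>2) \<le> real n * (8 * D)" .
  qed simp
  finally show "expectation (\<lambda>\<omega>. (count A v \<omega> - count A u \<omega>)\<^sup>2) \<le> 2 * ((real n * D)\<^sup>2 + real n * (8 * D))" .
qed

definition C2 :: real where "C2 = sqrt (96 * K) * (2 / (1 - sqrt \<theta>))"

text \<open>Recentres the indicators from \<tau> to their true mean \<open>p u\<close>. The terms
  linear in \<tau> - p u multiply centred sums, and the only deterministic term is quadratic in it;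
  this is why a quantile error of order 1/sqrt n is negligible.\<close>

lemma R_decomp:
  "R j n u \<omega> = (\<Sum>t\<in>lag_range j n. W u t \<omega> * W u (t - int j) \<omega>) + (\<tau> - p u) * (\<Sum>t\<in>lag_range j n. W u t \<omega>)
    + (\<tau> - p u) * (\<Sum>t\<in>lag_range j n. W u (t - int j) \<omega>) + real (n - j) * (\<tau> - p u)\<^sup>2"
proof -
  have "V \<tau> u t \<omega> * V \<tau> u s \<omega> = W u t \<omega> * W u s \<omega> + (\<tau> - p u) * W u t \<omega> + (\<tau> - p u) * W u s \<omega> + (\<tau> - p u)\<^sup>2" for t s
    by (simp add: Vfun_of_bool power2_eq_square algebra_simps)
  then show ?thesis
    unfolding R_def lag_range_def[symmetric] by (simp add: sum.distrib sum_distrib_left)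
qed

text \<open>For D of order 1/sqrt n the three contributions are of order n^(3/4), 1 and 1, hence
  o(n), so at a fixed grid point the normalised autocovariance does not move in the limit.\<close>

lemma R_increment:
  assumes u: "near u" and j: "j \<ge> 1" and D: "\<bar>p u - \<tau>\<bar> \<le> D"
  shows "integrable M (\<lambda>\<omega>. (R j n u \<omega> - R j n \<xi>0 \<omega>)\<^sup>2)"
    "expectation (\<lambda>\<omega>. (R j n u \<omega> - R j n \<xi>0 \<omega>)\<^sup>2) \<le> 4 * (real n * (C2 * sqrt D) + real n * (4 * D\<^sup>2) + (real n * D\<^sup>2)\<^sup>2)"
proof -
  let ?A = "lag_range j n" and ?d = "\<tau> - p u"
  let ?Z = "\<lambda>\<omega>. \<Sum>t\<in>?A. W u t \<omega> * W u (t - int j) \<omega> - W \<xi>0 t \<omega> * W \<xi>0 (t - int j) \<omega>"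
  let ?S1 = "\<lambda>\<omega>. \<Sum>t\<in>?A. W u t \<omega>" and ?S2 = "\<lambda>\<omega>. \<Sum>t\<in>?A. W u (t - int j) \<omega>"
  have D0: "D \<ge> 0" using D by linarith
  have d2: "?d\<^sup>2 \<le> D\<^sup>2" using D power_mono[of "\<bar>?d\<bar>" D 2] by simp
  have eq: "R j n u \<omega> - R j n \<xi>0 \<omega> = ?Z \<omega> + ?d * ?S1 \<omega> + ?d * ?S2 \<omega> + real (n - j) * ?d\<^sup>2" for \<omega>
    unfolding R_decomp[of j n u] R_decomp[of j n \<xi>0] by (simp add: p_\<xi>0 sum_subtractf)
  have iZ: "integrable M (\<lambda>\<omega>. (?Z \<omega>)\<^sup>2)"
  proof (rule integrable_sum_sq[where B=2])
    show "\<bar>W u t \<omega> * W u (t - int j) \<omega> - W \<xi>0 t \<omega> * W \<xi>0 (t - int j) \<omega>\<bar> \<le> 2" for t \<omega>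
      using WW_bound[of u t \<omega> u "t - int j"] WW_bound[of \<xi>0 t \<omega> \<xi>0 "t - int j"] by linarith
  qed auto
  have iS: "integrable M (\<lambda>\<omega>. (?S1 \<omega>)\<^sup>2)" "integrable M (\<lambda>\<omega>. (?S2 \<omega>)\<^sup>2)"
    by (rule integrable_sum_sq[where B=1]; use W_bound in auto)+
  show i: "integrable M (\<lambda>\<omega>. (R j n u \<omega> - R j n \<xi>0 \<omega>)\<^sup>2)"
    unfolding R_def sum_subtractf[symmetric]
  proof (rule integrable_sum_sq[where B=2])
    show "\<bar>V \<tau> u t \<omega> * V \<tau> u (t - int j) \<omega> - V \<tau> \<xi>0 t \<omega> * V \<tau> \<xi>0 (t - int j) \<omega>\<bar> \<le> 2" for t \<omega>
      using VV_bound[of u t \<omega> u "t - int j"] VV_bound[of \<xi>0 t \<omega> \<xi>0 "t - int j"] by linarith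
  qed auto
  have "expectation (\<lambda>\<omega>. (R j n u \<omega> - R j n \<xi>0 \<omega>)\<^sup>2) \<le> expectation (\<lambda>\<omega>. 4 * ((?Z \<omega>)\<^sup>2 + ?d\<^sup>2 * (?S1 \<omega>)\<^sup>2 + ?d\<^sup>2 * (?S2 \<omega>)\<^sup>2 + (real (n - j) * ?d\<^sup>2)\<^sup>2))"
  proof (rule integral_mono[OF i])
    show "(R j n u \<omega> - R j n \<xi>0 \<omega>)\<^sup>2 \<le> 4 * ((?Z \<omega>)\<^sup>2 + ?d\<^sup>2 * (?S1 \<omega>)\<^sup>2 + ?d\<^sup>2 * (?S2 \<omega>)\<^sup>2 + (real (n - j) * ?d\<^sup>2)\<^sup>2)" for \<omega>
      unfolding eq using square_sum4_le[of "?Z \<omega>" "?d * ?S1 \<omega>" "?d * ?S2 \<omega>" "real (n - j) * ?d\<^sup>2"] by (simp only: power_mult_distrib)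
  qed (use iZ iS in auto)
  also have "\<dots> = 4 * (expectation (\<lambda>\<omega>. (?Z \<omega>)\<^sup>2) + ?d\<^sup>2 * expectation (\<lambda>\<omega>. (?S1 \<omega>)\<^sup>2) + ?d\<^sup>2 * expectation (\<lambda>\<omega>. (?S2 \<omega>)\<^sup>2) + (real (n - j) * ?d\<^sup>2)\<^sup>2)"
    using iZ iS by (simp add: prob_space)
  also have "\<dots> \<le> 4 * (real n * (C2 * sqrt D) + D\<^sup>2 * (2 * real n) + D\<^sup>2 * (2 * real n) + (real n * D\<^sup>2)\<^sup>2)"
  proof (rule mult_left_mono, intro add_mono mult_mono)
    have "expectation (\<lambda>\<omega>. (?Z \<omega>)\<^sup>2) \<le> real (n - j) * (sqrt (96 * K * \<bar>p u - p \<xi>0\<bar>) * (2 / (1 - sqrt \<theta>)))"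
      using WW_diff_second_moment[OF u near_\<xi>0 j, of ?A] by simp
    also have "\<dots> \<le> real n * (sqrt (96 * K * D) * (2 / (1 - sqrt \<theta>)))"
      using D K_ge \<theta>(1,2) by (intro mult_mono real_sqrt_le_mono) (auto simp: p_\<xi>0)
    also have "\<dots> = real n * (C2 * sqrt D)" by (simp add: C2_def real_sqrt_mult)
    finally show "expectation (\<lambda>\<omega>. (?Z \<omega>)\<^sup>2) \<le> real n * (C2 * sqrt D)" .
    have "expectation (\<lambda>\<omega>. (?S1 \<omega>)\<^sup>2) \<le> 2 * real (card ?A)" by (rule W_second_moment[OF u]) simp
    then show "expectation (\<lambda>\<omega>. (?S1 \<omega>)\<^sup>2) \<le> 2 * real n" by simp
    have re: "?S2 \<omega> = (\<Sum>t\<in>(\<lambda>t. t - int j) ` ?A. W u t \<omega>)" for \<omega>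
      by (subst sum.reindex) (auto simp: inj_on_def)
    have "expectation (\<lambda>\<omega>. (?S2 \<omega>)\<^sup>2) \<le> 2 * real (card ((\<lambda>t. t - int j) ` ?A))"
      unfolding re by (rule W_second_moment[OF u]) simp
    then show "expectation (\<lambda>\<omega>. (?S2 \<omega>)\<^sup>2) \<le> 2 * real n" by (simp add: card_image inj_on_def)
    show "(real (n - j) * ?d\<^sup>2)\<^sup>2 \<le> (real n * D\<^sup>2)\<^sup>2"
      by (rule power_mono, rule mult_mono[OF _ d2]) auto
  qed ((rule d2 | simp)+)
  also have "\<dots> = 4 * (real n * (C2 * sqrt D) + real n * (4 * D\<^sup>2) + (real n * D\<^sup>2)\<^sup>2)" by (simp add: algebra_simps)
  finally show "expectation (\<lambda>\<omega>. (R j n u \<omega> - R j n \<xi>0 \<omega>)\<^sup>2) \<le> 4 * (real n * (C2 * sqrt D) + real n * (4 * D\<^sup>2) + (real n * D\<^sup>2)\<^sup>2)" .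
qed

text \<open>R is a constant plus a difference of two monotone functions of u, so between grid points it
  is controlled by its increments and those of the counts.\<close>

lemma R_between:
  assumes "u \<le> x" "x \<le> v"
  shows "\<bar>R j n x \<omega> - R j n u \<omega>\<bar> \<le> \<bar>R j n v \<omega> - R j n u \<omega>\<bar> + (count (lag_range j n) v \<omega> - count (lag_range j n) u \<omega>)
    + (count ((\<lambda>t. t - int j) ` lag_range j n) v \<omega> - count ((\<lambda>t. t - int j) ` lag_range j n) u \<omega>)"
proof -
  let ?A = "lag_range j n"
  define N where "N u = count ?A u \<omega> + count ((\<lambda>t. t - int j) ` ?A) u \<omega>" for u
  define Q where "Q u = (\<Sum>t\<in>?A. of_bool (X t \<omega> < u) * of_bool (X (t - int j) \<omega> < u) :: real)" for u
  have R: "R j n u \<omega> = real (n - j) * \<tau>\<^sup>2 - \<tau> * N u + Q u" for u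
  proof -
    have "V \<tau> u t \<omega> * V \<tau> u s \<omega> = \<tau>\<^sup>2 - \<tau> * (of_bool (X t \<omega> < u) + of_bool (X s \<omega> < u)) + of_bool (X t \<omega> < u) * of_bool (X s \<omega> < u)" for t s
      unfolding Vfun_of_bool power2_eq_square by (simp add: algebra_simps)
    moreover have "count ((\<lambda>t. t - int j) ` ?A) u \<omega> = (\<Sum>t\<in>?A. of_bool (X (t - int j) \<omega> < u))"
      unfolding count_def by (subst sum.reindex) (auto simp: inj_on_def)
    ultimately show ?thesis
      unfolding R_def lag_range_def[symmetric] N_def Q_def count_def
      by (simp add: sum.distrib sum_subtractf sum_distrib_left[symmetric] )
  qed
  have mN: "N a \<le> N b" if "a \<le> b" for a b unfolding N_def using count_mono[OF that] by (intro add_mono)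
  have mQ: "Q a \<le> Q b" if "a \<le> b" for a b unfolding Q_def using that by (intro sum_mono) auto
  have tN: "\<tau> * N u \<le> \<tau> * N x" "\<tau> * N x \<le> \<tau> * N v" using mN assms \<tau> by simp_all
  have "(1 - \<tau>) * N u \<le> (1 - \<tau>) * N v" using mN[of u v] assms \<tau> by simp
  then have tN': "\<tau> * N v - \<tau> * N u \<le> N v - N u" by (simp add: algebra_simps)
  have "\<bar>R j n x \<omega> - R j n u \<omega>\<bar> \<le> \<bar>R j n v \<omega> - R j n u \<omega>\<bar> + (N v - N u)"
    unfolding R using tN tN' mQ[of u x] mQ[of x v] assms by linarith
  then show ?thesis by (simp add: N_def)
qed

definition grid :: "real \<Rightarrow> nat \<Rightarrow> nat \<Rightarrow> real" where
  "grid h g i = \<xi>0 - h + real i * (h / real g)"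

text \<open>A majorant of the squared increment of R over all thresholds within h of \<xi>0. The
  maximum over the cells is replaced by a sum so that expectations can be taken term by term. The
  outer 4 is that of \<open>square_sum4_le\<close>, the inner 4 comes from squaring twice the
  increment at the left end of the cell.\<close>

definition osc :: "nat \<Rightarrow> nat \<Rightarrow> real \<Rightarrow> nat \<Rightarrow> 'a \<Rightarrow> real" where
  "osc j n h g \<omega> = (\<Sum>i<2 * g. 4 * (4 * (R j n (grid h g i) \<omega> - R j n \<xi>0 \<omega>)\<^sup>2 + (R j n (grid h g (Suc i)) \<omega> - R j n \<xi>0 \<omega>)\<^sup>2
    + (count (lag_range j n) (grid h g (Suc i)) \<omega> - count (lag_range j n) (grid h g i) \<omega>)\<^sup>2
    + (count ((\<lambda>t. t - int j) ` lag_range j n) (grid h g (Suc i)) \<omega> - count ((\<lambda>t. t - int j) ` lag_range j n) (grid h g i) \<omega>)\<^sup>2))"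

lemma osc_measurable[measurable]: "osc j n h g \<in> borel_measurable M" unfolding osc_def by measurable

lemma osc_bound:
  assumes x: "\<bar>x - \<xi>0\<bar> \<le> h" and h: "h > 0" and g: "g \<ge> 1"
  shows "(R j n x \<omega> - R j n \<xi>0 \<omega>)\<^sup>2 \<le> osc j n h g \<omega>"
proof -
  define y where "y = (x - (\<xi>0 - h)) / (h / real g)"
  have y: "0 \<le> y" "y \<le> 2 * real g" "x = \<xi>0 - h + y * (h / real g)"
  proof -
    have e: "0 \<le> x - (\<xi>0 - h)" "x - (\<xi>0 - h) \<le> 2 * real g * (h / real g)" using x g by auto
    show "0 \<le> y" unfolding y_def using e(1) h by simp
    show "y \<le> 2 * real g" unfolding y_def using e(2) h g by (subst pos_divide_le_eq) auto
    show "x = \<xi>0 - h + y * (h / real g)" unfolding y_def using h g by simp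
  qed
  obtain i where i: "i < 2 * g" "real i \<le> y" "y \<le> real (Suc i)"
  proof (cases "y = 2 * real g")
    \<comment> \<open>The right end of the interval is assigned to the last cell, since its floor
      would point one cell too far.\<close>
    case True
    then show thesis using that[of "2 * g - 1"] g by (auto simp: of_nat_diff)
  next
    case False
    then have "nat \<lfloor>y\<rfloor> < 2 * g" using y by (simp add: nat_less_iff floor_less_iff)
    moreover have "real (nat \<lfloor>y\<rfloor>) \<le> y" "y \<le> real (Suc (nat \<lfloor>y\<rfloor>))" using y(1) by linarith+
    ultimately show thesis by (rule that)
  qed
  let ?u = "grid h g i" and ?v = "grid h g (Suc i)" and ?A = "lag_range j n"
  let ?B = "(\<lambda>t. t - int j) ` lag_range j n"
  have hg: "h / real g \<ge> 0" using h by simp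
  have uv: "?u \<le> x" "x \<le> ?v" unfolding y(3) grid_def using i(2,3) hg by (intro add_left_mono mult_right_mono; simp)+
  define a b c d where "a = R j n ?u \<omega> - R j n \<xi>0 \<omega>" and "b = R j n ?v \<omega> - R j n \<xi>0 \<omega>"
    and "c = count ?A ?v \<omega> - count ?A ?u \<omega>" and "d = count ?B ?v \<omega> - count ?B ?u \<omega>"
  have "\<bar>R j n x \<omega> - R j n \<xi>0 \<omega>\<bar> \<le> \<bar>a\<bar> + (\<bar>b - a\<bar> + c + d)"
    using R_between[OF uv, of j n \<omega>] unfolding a_def b_def c_def d_def by linarith
  also have "\<dots> \<le> 2 * \<bar>a\<bar> + \<bar>b\<bar> + c + d" by linarith
  finally have "\<bar>R j n x \<omega> - R j n \<xi>0 \<omega>\<bar>\<^sup>2 \<le> (2 * \<bar>a\<bar> + \<bar>b\<bar> + c + d)\<^sup>2" by (intro power_mono) auto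
  also have "\<dots> \<le> 4 * ((2 * \<bar>a\<bar>)\<^sup>2 + \<bar>b\<bar>\<^sup>2 + c\<^sup>2 + d\<^sup>2)" by (rule square_sum4_le)
  also have "\<dots> = 4 * (4 * a\<^sup>2 + b\<^sup>2 + c\<^sup>2 + d\<^sup>2)" by (simp add: power_mult_distrib)
  also have "\<dots> \<le> osc j n h g \<omega>"
    unfolding osc_def a_def b_def c_def d_def
    by (rule member_le_sum[of i "{..<2*g}" "\<lambda>i. 4 * (4 * (R j n (grid h g i) \<omega> - R j n \<xi>0 \<omega>)\<^sup>2 + (R j n (grid h g (Suc i)) \<omega> - R j n \<xi>0 \<omega>)\<^sup>2
    + (count (lag_range j n) (grid h g (Suc i)) \<omega> - count (lag_range j n) (grid h g i) \<omega>)\<^sup>2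
    + (count ((\<lambda>t. t - int j) ` lag_range j n) (grid h g (Suc i)) \<omega> - count ((\<lambda>t. t - int j) ` lag_range j n) (grid h g i) \<omega>)\<^sup>2)"])
      (use i in auto)
  finally show ?thesis by simp
qed

text \<open>2 g cells with outer factor 4 give 8 g; 5 = 4 + 1 counts the increments of R at the two
  ends of a cell, and two count increments with factor 2 each give the last 4.\<close>

definition osc_bd :: "nat \<Rightarrow> real \<Rightarrow> nat \<Rightarrow> real" where
  "osc_bd n h g = 8 * real g * (5 * (4 * (real n * (C2 * sqrt (L * h)) + real n * (4 * (L * h)\<^sup>2) + (real n * (L * h)\<^sup>2)\<^sup>2))
     + 4 * ((real n * (L * h / real g))\<^sup>2 + real n * (8 * (L * h / real g))))"

lemma osc_expectation:
  assumes j: "j \<ge> 1" and h: "0 < h" "h \<le> \<delta>" and g: "g \<ge> 1"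
  shows "integrable M (osc j n h g)" "expectation (osc j n h g) \<le> osc_bd n h g"
proof -
  let ?A = "lag_range j n" and ?B = "(\<lambda>t. t - int j) ` lag_range j n"
  have gb: "\<bar>grid h g i - \<xi>0\<bar> \<le> h" if "i \<le> 2 * g" for i
  proof -
    have "real i \<le> 2 * real g" using that by (metis of_nat_le_iff of_nat_mult of_nat_numeral)
    then have "real i * (h / real g) \<le> 2 * real g * (h / real g)" using h by (intro mult_right_mono) auto
    also have "\<dots> = 2 * h" using g by simp
    finally have "real i * (h / real g) \<le> 2 * h" .
    moreover have "0 \<le> real i * (h / real g)" using h by simp
    ultimately show ?thesis unfolding grid_def by linarith
  qed
  have nr: "near (grid h g i)" if "i \<le> 2 * g" for i using gb[OF that] h by (auto simp: near_def)
  have pl: "\<bar>p u - p v\<bar> \<le> L * \<bar>u - v\<bar>" if "near u" "near v" for u v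
  proof -
    have *: "\<bar>p u - p v\<bar> \<le> L * \<bar>u - v\<bar>" if "near u" "near v" "u \<le> v" for u v
    proof -
      have "0 \<le> \<kappa> * (v - u)" using \<kappa> that by simp
      then show ?thesis using p_incr[OF that] that(3) by (simp add: abs_if)
    qed
    show ?thesis using *[OF that] *[OF that(2,1)] by (cases "u \<le> v") (auto simp: abs_minus_commute)
  qed
  have p1: "\<bar>p (grid h g i) - \<tau>\<bar> \<le> L * h" if "i \<le> 2 * g" for i
    using pl[OF nr[OF that] near_\<xi>0] mult_left_mono[OF gb[OF that] L_nonneg] by (simp add: p_\<xi>0)
  have p2: "\<bar>p (grid h g (Suc i)) - p (grid h g i)\<bar> \<le> L * h / real g" if "i < 2 * g" for i
  proof -
    have "grid h g (Suc i) - grid h g i = h / real g" by (simp add: grid_def algebra_simps add_divide_distrib)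
    then show ?thesis using pl[OF nr nr, of "Suc i" i] that h by simp
  qed
  have cB: "finite ?B" "card ?B \<le> n" using card_image_le[of ?A "\<lambda>t. t - int j"] by auto
  note R1 = R_increment(1)[OF nr j p1] and R2 = R_increment(2)[OF nr j p1]
  note c1 = count_increment(1)[OF nr nr _ _ p2] and c2 = count_increment(2)[OF nr nr _ _ p2]
  show "integrable M (osc j n h g)"
    unfolding osc_def[abs_def]
    by (intro Bochner_Integration.integrable_sum integrable_mult_right Bochner_Integration.integrable_add R1 c1 cB) auto
  let ?r = "4 * (real n * (C2 * sqrt (L * h)) + real n * (4 * (L * h)\<^sup>2) + (real n * (L * h)\<^sup>2)\<^sup>2)"
  let ?c = "2 * ((real n * (L * h / real g))\<^sup>2 + real n * (8 * (L * h / real g)))"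
  have "expectation (osc j n h g) = (\<Sum>i<2 * g. 4 * (4 * expectation (\<lambda>\<omega>. (R j n (grid h g i) \<omega> - R j n \<xi>0 \<omega>)\<^sup>2) + expectation (\<lambda>\<omega>. (R j n (grid h g (Suc i)) \<omega> - R j n \<xi>0 \<omega>)\<^sup>2)
    + expectation (\<lambda>\<omega>. (count ?A (grid h g (Suc i)) \<omega> - count ?A (grid h g i) \<omega>)\<^sup>2)
    + expectation (\<lambda>\<omega>. (count ?B (grid h g (Suc i)) \<omega> - count ?B (grid h g i) \<omega>)\<^sup>2)))"
    unfolding osc_def[abs_def]
  proof (subst Bochner_Integration.integral_sum, goal_cases)
    case (1 i) then show ?case
      by (intro integrable_mult_right Bochner_Integration.integrable_add R1 c1 cB) auto
  next
    case 2 show ?case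
    proof (rule sum.cong[OF refl])
      fix i assume "i \<in> {..<2 * g}"
      then have i: "i \<le> 2 * g" "Suc i \<le> 2 * g" "i < 2 * g" by auto
      note ii = R1[OF i(1,1), where n=n] R1[OF i(2,2), where n=n] c1[OF i(1,2) _ _ i(3), of ?A n] c1[OF i(1,2) cB i(3)]
      show "expectation (\<lambda>\<omega>. 4 * (4 * (R j n (grid h g i) \<omega> - R j n \<xi>0 \<omega>)\<^sup>2 + (R j n (grid h g (Suc i)) \<omega> - R j n \<xi>0 \<omega>)\<^sup>2
    + (count ?A (grid h g (Suc i)) \<omega> - count ?A (grid h g i) \<omega>)\<^sup>2 + (count ?B (grid h g (Suc i)) \<omega> - count ?B (grid h g i) \<omega>)\<^sup>2))
    = 4 * (4 * expectation (\<lambda>\<omega>. (R j n (grid h g i) \<omega> - R j n \<xi>0 \<omega>)\<^sup>2) + expectation (\<lambda>\<omega>. (R j n (grid h g (Suc i)) \<omega> - R j n \<xi>0 \<omega>)\<^sup>2)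
    + expectation (\<lambda>\<omega>. (count ?A (grid h g (Suc i)) \<omega> - count ?A (grid h g i) \<omega>)\<^sup>2)
    + expectation (\<lambda>\<omega>. (count ?B (grid h g (Suc i)) \<omega> - count ?B (grid h g i) \<omega>)\<^sup>2))"
        using ii by simp
    qed
  qed
  also have "\<dots> \<le> (\<Sum>i<2 * g. 4 * (4 * ?r + ?r + ?c + ?c))"
    by (intro sum_mono mult_left_mono add_mono R2 c2 cB) auto
  also have "\<dots> = osc_bd n h g" by (simp add: osc_bd_def)
  finally show "expectation (osc j n h g) \<le> osc_bd n h g" .
qed

text \<open>With m fixed, the increments of R at the grid points and the fluctuations of the counts
  disappear after division by n. Only the squared mean counts of the cells survive, and with m^4 in
  place of g their total is 32 * L^2 / m^2 for m >= 1.\<close>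

lemma osc_bd_limit:
  "(\<lambda>n. osc_bd n (real m / sqrt (real n)) (m ^ 4) / real n) \<longlonglongrightarrow> 32 * (real (m ^ 4) * (L * real m / real (m ^ 4))\<^sup>2)"
proof -
  define q where "q = L * real m"
  have q: "q \<ge> 0" using L_nonneg by (simp add: q_def)
  define g where "g = real (m ^ 4)"
  have eq: "osc_bd n (real m / sqrt (real n)) (m ^ 4) / real n
    = 8 * g * (20 * (C2 * sqrt q * (1 / sqrt (sqrt (real n))) + 4 * q\<^sup>2 * (1 / real n) + q ^ 4 * (1 / real n))
     + 4 * ((q / g)\<^sup>2 + 8 * (q / g) * (1 / sqrt (real n))))" if n: "n \<ge> 1" for n
  proof -
    define s where "s = sqrt (real n)"
    have s: "s > 0" "real n = s * s" using n by (simp_all add: s_def)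
    have e: "L * (real m / s) = q / s" "q / s / g = (q / g) / s" by (simp_all add: q_def)
    have e2: "sqrt (q / s) = sqrt q * (1 / sqrt s)" by (simp add: real_sqrt_divide)
    have "osc_bd n (real m / sqrt (real n)) (m ^ 4) / real n
      = (8 * g * (5 * (4 * (s * s * (C2 * (sqrt q * (1 / sqrt s))) + s * s * (4 * (q / s)\<^sup>2) + (s * s * (q / s)\<^sup>2)\<^sup>2))
     + 4 * ((s * s * ((q / g) / s))\<^sup>2 + s * s * (8 * ((q / g) / s))))) / (s * s)"
      unfolding osc_bd_def s_def[symmetric] e g_def[symmetric] e2 unfolding s(2) e e2 ..
    also have "\<dots> = 8 * g * (20 * (C2 * sqrt q * (1 / sqrt s) + 4 * q\<^sup>2 * (1 / (s * s)) + q ^ 4 * (1 / (s * s)))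
     + 4 * ((q / g)\<^sup>2 + 8 * (q / g) * (1 / s)))"
    proof -
      define z where "z = q / g"
      define y where "y = 1 / sqrt s"
      show ?thesis unfolding z_def[symmetric] y_def[symmetric] using s(1)
        by (simp add: divide_simps power2_eq_square) (simp add: algebra_simps power4_eq_xxxx)
    qed
    finally show ?thesis unfolding s(2)[symmetric] unfolding s_def .
  qed
  have z: "(\<lambda>n. 1 / sqrt (sqrt (real n))) \<longlonglongrightarrow> 0" "(\<lambda>n. 1 / real n) \<longlonglongrightarrow> 0" "(\<lambda>n. 1 / sqrt (real n)) \<longlonglongrightarrow> 0"
    by real_asymp+
  have lim: "(\<lambda>n. 8 * g * (20 * (C2 * sqrt q * (1 / sqrt (sqrt (real n))) + 4 * q\<^sup>2 * (1 / real n) + q ^ 4 * (1 / real n))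
     + 4 * ((q / g)\<^sup>2 + 8 * (q / g) * (1 / sqrt (real n))))) \<longlonglongrightarrow> 8 * g * (20 * (C2 * sqrt q * 0 + 4 * q\<^sup>2 * 0 + q ^ 4 * 0)
     + 4 * ((q / g)\<^sup>2 + 8 * (q / g) * 0))"
    by (intro tendsto_mult tendsto_add tendsto_const z)
  have "(\<lambda>n. osc_bd n (real m / sqrt (real n)) (m ^ 4) / real n) \<longlonglongrightarrow> 8 * g * (20 * (C2 * sqrt q * 0 + 4 * q\<^sup>2 * 0 + q ^ 4 * 0)
     + 4 * ((q / g)\<^sup>2 + 8 * (q / g) * 0))"
  proof (rule Lim_transform_eventually[OF lim])
    show "eventually (\<lambda>n. 8 * g * (20 * (C2 * sqrt q * (1 / sqrt (sqrt (real n))) + 4 * q\<^sup>2 * (1 / real n) + q ^ 4 * (1 / real n))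
     + 4 * ((q / g)\<^sup>2 + 8 * (q / g) * (1 / sqrt (real n)))) = osc_bd n (real m / sqrt (real n)) (m ^ 4) / real n) sequentially"
      using eventually_ge_at_top[of 1] by eventually_elim (simp only: eq)
  qed
  then show ?thesis by (simp add: g_def q_def mult.assoc)
qed

end

subsection \<open>Convergence of Laplace transforms\<close>

text \<open>The truncation principle: for fixed m the error is bounded as n tends to infinity by a
  limit that itself tends to 0 as m grows.\<close>

lemma iterated_limit:
  fixes A :: "nat \<Rightarrow> real"
  assumes close: "\<And>m. m \<ge> 1 \<Longrightarrow> eventually (\<lambda>n. \<bar>A n - B n m\<bar> \<le> e n m) sequentially"
    and e: "\<And>m. m \<ge> 1 \<Longrightarrow> (\<lambda>n. e n m) \<longlonglongrightarrow> e' m" and e': "e' \<longlonglongrightarrow> 0"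
    and B: "\<And>m. (\<lambda>n. B n m) \<longlonglongrightarrow> Z m" and Z: "Z \<longlonglongrightarrow> z"
  shows "A \<longlonglongrightarrow> z"
proof (rule tendstoI)
  fix \<epsilon> :: real assume \<epsilon>: "\<epsilon> > 0"
  have "eventually (\<lambda>m. m \<ge> 1 \<and> \<bar>e' m\<bar> < \<epsilon> / 4 \<and> \<bar>Z m - z\<bar> < \<epsilon> / 4) sequentially"
    using tendstoD[OF e', of "\<epsilon> / 4"] tendstoD[OF Z, of "\<epsilon> / 4"] \<epsilon>
    by (intro eventually_conj eventually_ge_at_top) (auto simp: dist_real_def)
  then obtain m where m: "m \<ge> 1" "\<bar>e' m\<bar> < \<epsilon> / 4" "\<bar>Z m - z\<bar> < \<epsilon> / 4"
    by (auto dest: eventually_happens)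
  have "eventually (\<lambda>n. dist (e n m) (e' m) < \<epsilon> / 4) sequentially" "eventually (\<lambda>n. dist (B n m) (Z m) < \<epsilon> / 4) sequentially"
    using tendstoD[OF e[OF m(1)], of "\<epsilon> / 4"] tendstoD[OF B[of m], of "\<epsilon> / 4"] \<epsilon> by auto
  with close[OF m(1)] show "eventually (\<lambda>n. dist (A n) z < \<epsilon>) sequentially"
  proof eventually_elim
    case (elim n)
    then show ?case using m unfolding dist_real_def by linarith
  qed
qed

text \<open>AM-GM with weight m. The term b^2, which stays of order one, is divided by m, while the
  small difference may be multiplied by 1 + m.\<close>

lemma abs_square_diff_le:
  assumes "m > 0"
  shows "\<bar>a\<^sup>2 - b\<^sup>2\<bar> \<le> (1 + m) * (a - b)\<^sup>2 + b\<^sup>2 / (m::real)"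
proof -
  have 1: "2 * b * (a - b) \<le> m * (a - b)\<^sup>2 + b\<^sup>2 / m"
    using assms zero_le_power2[of "m * (a - b) - b"] by (simp add: field_simps power2_eq_square)
  have 2: "- (2 * b * (a - b)) \<le> m * (a - b)\<^sup>2 + b\<^sup>2 / m"
    using assms zero_le_power2[of "m * (a - b) + b"] by (simp add: field_simps power2_eq_square)
  have "a\<^sup>2 - b\<^sup>2 = (a - b)\<^sup>2 + 2 * b * (a - b)" by (simp add: power2_eq_square algebra_simps)
  moreover have "0 \<le> (a - b)\<^sup>2" by simp
  moreover have "(1 + m) * (a - b)\<^sup>2 = (a - b)\<^sup>2 + m * (a - b)\<^sup>2" by (simp add: algebra_simps)
  ultimately show ?thesis using 1 2 by linarith
qed

lemma square_diff_le: "(a - c)\<^sup>2 \<le> 2 * (a - b)\<^sup>2 + 2 * (b - c :: real)\<^sup>2"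
  using zero_le_power2[of "(a - b) - (b - c)"] by (simp add: power2_eq_square algebra_simps)

lemma exp_neg_lipschitz: "x \<ge> 0 \<Longrightarrow> y \<ge> 0 \<Longrightarrow> \<bar>exp (- x) - exp (- y)\<bar> \<le> \<bar>x - (y::real)\<bar>"
proof (induction x y rule: linorder_wlog)
  case (le x y)
  have "exp (- y) = exp (- x) * exp (- (y - x))" by (simp add: exp_add[symmetric])
  moreover have "1 - (y - x) \<le> exp (- (y - x))" by (rule order_trans[OF _ exp_ge_add_one_self]) simp
  moreover have "exp (- (y - x)) \<le> 1" using le by simp
  moreover have e: "0 < exp (- x)" "exp (- x) \<le> 1" using le by auto
  ultimately have "exp (- x) - exp (- y) = exp (- x) * (1 - exp (- (y - x)))" "0 \<le> 1 - exp (- (y - x))" "1 - exp (- (y - x)) \<le> y - x"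
    by (simp_all add: algebra_simps)
  moreover have "exp (- x) * (1 - exp (- (y - x))) \<le> 1 * (y - x)"
    by (rule mult_mono) (use e calculation in auto)
  moreover have "exp (- y) \<le> exp (- x)" using le by simp
  ultimately show ?case using le by simp
qed (simp add: abs_minus_commute)

context gmc_quantile_indep
begin

definition C3 :: real where "C3 = 6 * K / (1 - \<theta>)"

lemma C3: "C3 \<ge> 0" using K_ge \<theta>(1,2) by (simp add: C3_def)

lemma R_\<xi>0: "R j n \<xi>0 \<omega> = (\<Sum>t\<in>lag_range j n. W \<xi>0 t \<omega> * W \<xi>0 (t - int j) \<omega>)"
  by (simp add: R_decomp p_\<xi>0)

lemma R_second_moment:
  assumes "j \<ge> 1"
  shows "integrable M (\<lambda>\<omega>. (R j n \<xi>0 \<omega>)\<^sup>2)" "expectation (\<lambda>\<omega>. (R j n \<xi>0 \<omega>)\<^sup>2) \<le> real n * C3"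
proof -
  show "integrable M (\<lambda>\<omega>. (R j n \<xi>0 \<omega>)\<^sup>2)"
    unfolding R_\<xi>0 by (rule integrable_sum_sq[where B=1]) (auto intro: WW_bound)
  have "expectation (\<lambda>\<omega>. (R j n \<xi>0 \<omega>)\<^sup>2) \<le> real (card (lag_range j n)) * C3"
    unfolding R_\<xi>0 C3_def by (rule WW_second_moment) (use assms in auto)
  also have "\<dots> \<le> real n * C3" using C3 by (intro mult_right_mono) auto
  finally show "expectation (\<lambda>\<omega>. (R j n \<xi>0 \<omega>)\<^sup>2) \<le> real n * C3" .
qed

lemma G_second_moment:
  "integrable M (\<lambda>\<omega>. (G n j \<omega>)\<^sup>2)" "expectation (\<lambda>\<omega>. (G n j \<omega>)\<^sup>2) \<le> C3"
proof -
  let ?S = "\<lambda>\<omega>. \<Sum>t\<in>{1..int n}. W \<xi>0 t \<omega> * W \<xi>0 (t - int (Suc j)) \<omega>"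
  have eq: "(G n j \<omega>)\<^sup>2 = (?S \<omega>)\<^sup>2 / real n" for \<omega> by (simp add: G_def power_divide)
  have i: "integrable M (\<lambda>\<omega>. (?S \<omega>)\<^sup>2)" by (rule integrable_sum_sq[where B=1]) (auto intro: WW_bound)
  show "integrable M (\<lambda>\<omega>. (G n j \<omega>)\<^sup>2)" unfolding eq using i by simp
  have "expectation (\<lambda>\<omega>. (?S \<omega>)\<^sup>2) \<le> real n * C3"
    using WW_second_moment[OF near_\<xi>0, of "Suc j" "{1..int n}"] by (simp add: C3_def)
  then show "expectation (\<lambda>\<omega>. (G n j \<omega>)\<^sup>2) \<le> C3" unfolding eq using C3 by (cases "n = 0") (auto simp: field_simps)
qed

text \<open>The sums differ in at most the first j + 1 times, where the lagged observation has a
  nonpositive index; each term is bounded by 1.\<close>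

lemma R_G_close:
  assumes n: "n \<ge> 1"
  shows "(R (Suc j) n \<xi>0 \<omega> / sqrt (real n) - G n j \<omega>)\<^sup>2 \<le> (real (Suc j))\<^sup>2 / real n"
proof -
  let ?f = "\<lambda>t. W \<xi>0 t \<omega> * W \<xi>0 (t - int (Suc j)) \<omega>"
  have "(\<Sum>t\<in>{1..int n}. ?f t) - (\<Sum>t\<in>lag_range (Suc j) n. ?f t) = (\<Sum>t\<in>{1..int n} - lag_range (Suc j) n. ?f t)"
    by (rule sum_diff[symmetric]) (auto simp: lag_range_def)
  moreover have "\<bar>\<Sum>t\<in>{1..int n} - lag_range (Suc j) n. ?f t\<bar> \<le> real (card ({1..int n} - lag_range (Suc j) n)) * 1"
    by (rule order_trans[OF sum_abs]) (intro sum_bounded_above WW_bound)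
  moreover have "real (card ({1..int n} - lag_range (Suc j) n)) \<le> real (Suc j)"
  proof -
    have "card ({1..int n} - lag_range (Suc j) n) \<le> card {1..int (Suc j)}"
      by (rule card_mono) (auto simp: lag_range_def)
    then show ?thesis by simp
  qed
  ultimately have "\<bar>R (Suc j) n \<xi>0 \<omega> - (\<Sum>t\<in>{1..int n}. ?f t)\<bar> \<le> real (Suc j)"
    unfolding R_\<xi>0 by linarith
  then have "\<bar>R (Suc j) n \<xi>0 \<omega> - (\<Sum>t\<in>{1..int n}. ?f t)\<bar>\<^sup>2 / real n \<le> (real (Suc j))\<^sup>2 / real n"
    by (intro divide_right_mono power_mono) auto
  moreover have "(R (Suc j) n \<xi>0 \<omega> / sqrt (real n) - G n j \<omega>)\<^sup>2 = \<bar>R (Suc j) n \<xi>0 \<omega> - (\<Sum>t\<in>{1..int n}. ?f t)\<bar>\<^sup>2 / real n"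
    by (simp add: G_def diff_divide_distrib[symmetric] power_divide)
  ultimately show ?thesis by simp
qed

text \<open>Majorises the error of replacing the statistic by its first m terms at the true
  quantile, on the event that the sample quantile is within h. The first sum compares these terms
  with \<open>G\<close>; the second bounds all remaining lags, for which smallness will come from
  the tail of the weights.\<close>

definition dom :: "nat \<Rightarrow> nat \<Rightarrow> real \<Rightarrow> nat \<Rightarrow> 'a \<Rightarrow> real" where
  "dom n m h g \<omega> = (\<Sum>j<m. wt j * ((1 + real m) * (2 * (osc (Suc j) n h g \<omega> / real n) + 2 * ((real m)\<^sup>2 / real n)) + (G n j \<omega>)\<^sup>2 / real m))
    + (\<Sum>j\<in>{m..<n - 1}. wt j * (2 * (osc (Suc j) n h g \<omega> / real n) + 2 * ((R (Suc j) n \<xi>0 \<omega>)\<^sup>2 / real n)))"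

lemma stat_truncation:
  assumes x: "\<bar>xh n \<omega> - \<xi>0\<bar> \<le> h" and h: "h > 0" and g: "g \<ge> 1" and m: "m \<ge> 1" and n: "n \<ge> m + 1"
  shows "\<bar>stat n \<omega> - (\<Sum>j<m. wt j * (G n j \<omega>)\<^sup>2)\<bar> \<le> dom n m h g \<omega>"
proof -
  have n1: "n \<ge> 1" using n by simp
  define a where "a j = R (Suc j) n (xh n \<omega>) \<omega> / sqrt (real n)" for j
  define b where "b j = R (Suc j) n \<xi>0 \<omega> / sqrt (real n)" for j
  have ab: "(a j - b j)\<^sup>2 \<le> osc (Suc j) n h g \<omega> / real n" for j
  proof -
    have "(a j - b j)\<^sup>2 = (R (Suc j) n (xh n \<omega>) \<omega> - R (Suc j) n \<xi>0 \<omega>)\<^sup>2 / real n"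
      by (simp add: a_def b_def diff_divide_distrib[symmetric] power_divide)
    also have "\<dots> \<le> osc (Suc j) n h g \<omega> / real n" by (intro divide_right_mono osc_bound x h g) auto
    finally show ?thesis .
  qed
  have "stat n \<omega> = (\<Sum>j<m. wt j * (a j)\<^sup>2) + (\<Sum>j\<in>{m..<n - 1}. wt j * (a j)\<^sup>2)"
    unfolding stat_def a_def using n by (subst sum.union_disjoint[symmetric]) (auto intro!: sum.cong)
  then have "\<bar>stat n \<omega> - (\<Sum>j<m. wt j * (G n j \<omega>)\<^sup>2)\<bar>
     = \<bar>(\<Sum>j<m. wt j * ((a j)\<^sup>2 - (G n j \<omega>)\<^sup>2)) + (\<Sum>j\<in>{m..<n - 1}. wt j * (a j)\<^sup>2)\<bar>"
    by (simp add: sum_subtractf right_diff_distrib)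
  also have "\<dots> \<le> \<bar>\<Sum>j<m. wt j * ((a j)\<^sup>2 - (G n j \<omega>)\<^sup>2)\<bar> + \<bar>\<Sum>j\<in>{m..<n - 1}. wt j * (a j)\<^sup>2\<bar>" by (rule abs_triangle_ineq)
  also have "\<dots> \<le> dom n m h g \<omega>"
    unfolding dom_def
  proof (rule add_mono)
    show "\<bar>\<Sum>j<m. wt j * ((a j)\<^sup>2 - (G n j \<omega>)\<^sup>2)\<bar> \<le> (\<Sum>j<m. wt j * ((1 + real m) * (2 * (osc (Suc j) n h g \<omega> / real n) + 2 * ((real m)\<^sup>2 / real n)) + (G n j \<omega>)\<^sup>2 / real m))"
    proof (rule order_trans[OF sum_abs], rule sum_mono)
      fix j assume j: "j \<in> {..<m}"
      have "(b j - G n j \<omega>)\<^sup>2 \<le> (real m)\<^sup>2 / real n"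
      proof -
        have "(real (Suc j))\<^sup>2 / real n \<le> (real m)\<^sup>2 / real n" using j by (intro divide_right_mono power_mono) auto
        then show ?thesis using R_G_close[OF n1, of j \<omega>] unfolding b_def by linarith
      qed
      then have "(a j - G n j \<omega>)\<^sup>2 \<le> 2 * (osc (Suc j) n h g \<omega> / real n) + 2 * ((real m)\<^sup>2 / real n)"
        using square_diff_le[of "a j" "G n j \<omega>" "b j"] ab[of j] by linarith
      then have "(1 + real m) * (a j - G n j \<omega>)\<^sup>2 \<le> (1 + real m) * (2 * (osc (Suc j) n h g \<omega> / real n) + 2 * ((real m)\<^sup>2 / real n))"
        by (intro mult_left_mono) auto
      then have "\<bar>(a j)\<^sup>2 - (G n j \<omega>)\<^sup>2\<bar> \<le> (1 + real m) * (2 * (osc (Suc j) n h g \<omega> / real n) + 2 * ((real m)\<^sup>2 / real n)) + (G n j \<omega>)\<^sup>2 / real m"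
        using abs_square_diff_le[of "real m" "a j" "G n j \<omega>"] m by linarith
      then show "\<bar>wt j * ((a j)\<^sup>2 - (G n j \<omega>)\<^sup>2)\<bar> \<le> wt j * ((1 + real m) * (2 * (osc (Suc j) n h g \<omega> / real n) + 2 * ((real m)\<^sup>2 / real n)) + (G n j \<omega>)\<^sup>2 / real m)"
        unfolding abs_mult abs_of_nonneg[OF wt_nonneg] by (intro mult_left_mono wt_nonneg)
    qed
    show "\<bar>\<Sum>j\<in>{m..<n - 1}. wt j * (a j)\<^sup>2\<bar> \<le> (\<Sum>j\<in>{m..<n - 1}. wt j * (2 * (osc (Suc j) n h g \<omega> / real n) + 2 * ((R (Suc j) n \<xi>0 \<omega>)\<^sup>2 / real n)))"
    proof (rule order_trans[OF sum_abs], rule sum_mono)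
      fix j
      have "(b j)\<^sup>2 = (R (Suc j) n \<xi>0 \<omega>)\<^sup>2 / real n" by (simp add: b_def power_divide)
      then have "(a j)\<^sup>2 \<le> 2 * (osc (Suc j) n h g \<omega> / real n) + 2 * ((R (Suc j) n \<xi>0 \<omega>)\<^sup>2 / real n)"
        using square_diff_le[of "a j" 0 "b j"] ab[of j] by simp
      then show "\<bar>wt j * (a j)\<^sup>2\<bar> \<le> wt j * (2 * (osc (Suc j) n h g \<omega> / real n) + 2 * ((R (Suc j) n \<xi>0 \<omega>)\<^sup>2 / real n))"
        unfolding abs_mult abs_of_nonneg[OF wt_nonneg] abs_power2 by (intro mult_left_mono wt_nonneg)
    qed
  qed
  finally show ?thesis .
qed

definition wt_tail :: "nat \<Rightarrow> real" where "wt_tail m = suminf wt - (\<Sum>j<m. wt j)"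

lemma wt_tail: "wt_tail m \<ge> 0" "(\<Sum>j\<in>{m..<n}. wt j) \<le> wt_tail m" "wt_tail \<longlonglongrightarrow> 0"
proof -
  have le: "(\<Sum>j<i. wt j) \<le> suminf wt" for i by (intro sum_le_suminf wt_summable) (auto simp: wt_nonneg)
  show p: "wt_tail m \<ge> 0" using le[of m] by (simp add: wt_tail_def)
  show "(\<Sum>j\<in>{m..<n}. wt j) \<le> wt_tail m"
  proof (cases "m \<le> n")
    case True
    then have "(\<Sum>j\<in>{m..<n}. wt j) = (\<Sum>j<n. wt j) - (\<Sum>j<m. wt j)"
      by (metis lessThan_atLeast0 sum_diff_nat_ivl zero_le)
    then show ?thesis using le[of n] by (simp add: wt_tail_def)
  qed (use p in simp)
  have "(\<lambda>m. suminf wt - (\<Sum>j<m. wt j)) \<longlonglongrightarrow> suminf wt - suminf wt"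
    by (intro tendsto_intros summable_LIMSEQ wt_summable)
  then show "wt_tail \<longlonglongrightarrow> 0" by (simp add: wt_tail_def[abs_def])
qed

definition err :: "nat \<Rightarrow> nat \<Rightarrow> real \<Rightarrow> real" where
  "err n m \<beta> = suminf wt * ((1 + real m) * (2 * \<beta> + 2 * ((real m)\<^sup>2 / real n)) + C3 / real m) + wt_tail m * (2 * \<beta> + 2 * C3)"

lemma dom_expectation:
  assumes h: "0 < h" "h \<le> \<delta>" and g: "g \<ge> 1" and m: "m \<ge> 1" and n: "n \<ge> 1"
  shows "integrable M (dom n m h g)" "expectation (dom n m h g) \<le> err n m (osc_bd n h g / real n)" "dom n m h g \<omega> \<ge> 0"
proof -
  let ?\<beta> = "osc_bd n h g / real n"
  have osc0: "osc j n h g \<omega> \<ge> 0" for j \<omega> unfolding osc_def by (intro sum_nonneg) auto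
  note oi = osc_expectation(1)[OF _ h g] R_second_moment(1) G_second_moment(1)
  have \<beta>: "expectation (osc (Suc j) n h g) / real n \<le> ?\<beta>" for j
    by (intro divide_right_mono osc_expectation h g) auto
  have r: "expectation (\<lambda>\<omega>. (R (Suc j) n \<xi>0 \<omega>)\<^sup>2) / real n \<le> C3" for j
    using R_second_moment(2)[of "Suc j" n] n by (simp add: field_simps)
  have \<beta>0: "?\<beta> \<ge> 0"
    by (rule order_trans[OF _ \<beta>[of 0]]) (intro divide_nonneg_nonneg Bochner_Integration.integral_nonneg osc0, simp)
  show "integrable M (dom n m h g)"
    unfolding dom_def[abs_def]
    by (intro Bochner_Integration.integrable_add Bochner_Integration.integrable_sum integrable_mult_right integrable_divide_zero impI oi) auto
  have "expectation (dom n m h g) = (\<Sum>j<m. wt j * ((1 + real m) * (2 * (expectation (osc (Suc j) n h g) / real n) + 2 * ((real m)\<^sup>2 / real n)) + expectation (\<lambda>\<omega>. (G n j \<omega>)\<^sup>2) / real m))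
    + (\<Sum>j\<in>{m..<n - 1}. wt j * (2 * (expectation (osc (Suc j) n h g) / real n) + 2 * (expectation (\<lambda>\<omega>. (R (Suc j) n \<xi>0 \<omega>)\<^sup>2) / real n)))"
    unfolding dom_def[abs_def] using oi by (simp add: prob_space)
  also have "\<dots> \<le> (\<Sum>j<m. wt j * ((1 + real m) * (2 * ?\<beta> + 2 * ((real m)\<^sup>2 / real n)) + C3 / real m))
    + (\<Sum>j\<in>{m..<n - 1}. wt j * (2 * ?\<beta> + 2 * C3))"
    by (intro add_mono sum_mono mult_left_mono wt_nonneg \<beta> r order_refl divide_right_mono G_second_moment) auto
  also have "\<dots> = (\<Sum>j<m. wt j) * ((1 + real m) * (2 * ?\<beta> + 2 * ((real m)\<^sup>2 / real n)) + C3 / real m)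
    + (\<Sum>j\<in>{m..<n - 1}. wt j) * (2 * ?\<beta> + 2 * C3)"
    by (simp only: sum_distrib_right)
  also have "\<dots> \<le> err n m ?\<beta>"
    unfolding err_def using \<beta>0 C3
    by (intro add_mono mult_right_mono wt_tail sum_le_suminf wt_summable) (auto simp: wt_nonneg)
  finally show "expectation (dom n m h g) \<le> err n m ?\<beta>" .
  show "dom n m h g \<omega> \<ge> 0" unfolding dom_def
    by (intro add_nonneg_nonneg sum_nonneg mult_nonneg_nonneg wt_nonneg divide_nonneg_nonneg osc0) auto
qed

text \<open>The parameter m truncates the lags and also sets the radius m / sqrt n and the 2 m^4 cells of the
  grid; then the oscillation is O(1/m^2) as n tends to infinity, which beats the factor 1 + m from AM-GM.\<close>

lemma laplace_truncation:
  assumes m: "m \<ge> 1" and n: "n \<ge> m + 1" and small: "real m / sqrt (real n) \<le> \<delta>"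
  shows "\<bar>expectation (\<lambda>\<omega>. exp (- (real k * stat n \<omega>))) - expectation (\<lambda>\<omega>. exp (- (\<Sum>j<m. (real k * wt j) * (G n j \<omega>)\<^sup>2)))\<bar>
    \<le> 2 * C1 / (\<kappa> * real m)\<^sup>2 + real k * err n m (osc_bd n (real m / sqrt (real n)) (m ^ 4) / real n)"
proof -
  define h where "h = real m / sqrt (real n)"
  have h: "0 < h" "h \<le> \<delta>" using m n small by (auto simp: h_def)
  define g where "g = m ^ 4"
  have g: "g \<ge> 1" using m by (simp add: g_def)
  have n1: "n \<ge> 1" using n by simp
  define q where "q \<omega> = (\<Sum>j<m. wt j * (G n j \<omega>)\<^sup>2)" for \<omega>
  have q0: "q \<omega> \<ge> 0" for \<omega> unfolding q_def by (intro sum_nonneg mult_nonneg_nonneg wt_nonneg) auto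
  have [measurable]: "q \<in> borel_measurable M" unfolding q_def by measurable
  have kq: "(\<Sum>j<m. (real k * wt j) * (G n j \<omega>)\<^sup>2) = real k * q \<omega>" for \<omega>
    by (simp add: q_def sum_distrib_left mult.assoc)
  let ?Bad = "{\<omega> \<in> space M. \<bar>xh n \<omega> - \<xi>0\<bar> > h}"
  have i: "integrable M (\<lambda>\<omega>. exp (- (real k * stat n \<omega>)))" "integrable M (\<lambda>\<omega>. exp (- (real k * q \<omega>)))"
    by (rule integrable_bounded[where B=1]; use stat_nonneg q0 in auto)+
  have iB: "integrable M (indicator ?Bad :: 'a \<Rightarrow> real)" by (rule integrable_bounded[where B=1]) auto
  note d = dom_expectation[OF h g m n1]
  have "\<bar>expectation (\<lambda>\<omega>. exp (- (real k * stat n \<omega>))) - expectation (\<lambda>\<omega>. exp (- (real k * q \<omega>)))\<bar>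
    = \<bar>expectation (\<lambda>\<omega>. exp (- (real k * stat n \<omega>)) - exp (- (real k * q \<omega>)))\<bar>" using i by simp
  also have "\<dots> \<le> expectation (\<lambda>\<omega>. \<bar>exp (- (real k * stat n \<omega>)) - exp (- (real k * q \<omega>))\<bar>)" by (rule integral_abs_bound)
  also have "\<dots> \<le> expectation (\<lambda>\<omega>. indicator ?Bad \<omega> + real k * dom n m h g \<omega>)"
  proof (rule integral_mono)
    fix \<omega> assume \<omega>: "\<omega> \<in> space M"
    have kk: "0 \<le> real k * stat n \<omega>" "0 \<le> real k * q \<omega>" using stat_nonneg q0 by simp_all
    show "\<bar>exp (- (real k * stat n \<omega>)) - exp (- (real k * q \<omega>))\<bar> \<le> indicator ?Bad \<omega> + real k * dom n m h g \<omega>"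
    proof (cases "\<omega> \<in> ?Bad")
      case True
      have "0 < exp (- (real k * stat n \<omega>))" "exp (- (real k * stat n \<omega>)) \<le> 1" "0 < exp (- (real k * q \<omega>))" "exp (- (real k * q \<omega>)) \<le> 1"
        using kk by auto
      then have "\<bar>exp (- (real k * stat n \<omega>)) - exp (- (real k * q \<omega>))\<bar> \<le> 1" by linarith
      moreover have "0 \<le> real k * dom n m h g \<omega>" using d(3) by simp
      ultimately show ?thesis using True by simp
    next
      case False
      then have x: "\<bar>xh n \<omega> - \<xi>0\<bar> \<le> h" using \<omega> by auto
      have "\<bar>exp (- (real k * stat n \<omega>)) - exp (- (real k * q \<omega>))\<bar> \<le> \<bar>real k * stat n \<omega> - real k * q \<omega>\<bar>"
        by (rule exp_neg_lipschitz[OF kk])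
      also have "\<dots> = real k * \<bar>stat n \<omega> - q \<omega>\<bar>" by (simp add: right_diff_distrib[symmetric] abs_mult)
      also have "\<dots> \<le> real k * dom n m h g \<omega>"
        unfolding q_def by (intro mult_left_mono stat_truncation x h g m n) simp
      finally show ?thesis using False by simp
    qed
  qed (use i iB d in auto)
  also have "\<dots> = prob ?Bad + real k * expectation (dom n m h g)" using iB d by simp
  also have "\<dots> \<le> 2 * C1 / (\<kappa> * real m)\<^sup>2 + real k * err n m (osc_bd n h g / real n)"
  proof (intro add_mono mult_left_mono d)
    have "prob ?Bad \<le> 2 * C1 / (real n * (\<kappa> * h)\<^sup>2)" by (rule quantile_rate[OF h n1])
    \<comment> \<open>For the radius m / sqrt n the sample size cancels, so the exceptional event
      has probability O(1/m^2) uniformly in n.\<close>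
    also have "real n * (\<kappa> * h)\<^sup>2 = (\<kappa> * real m)\<^sup>2" using n1 by (simp add: h_def power_mult_distrib power_divide)
    finally show "prob ?Bad \<le> 2 * C1 / (\<kappa> * real m)\<^sup>2" .
  qed simp
  finally show ?thesis unfolding kq h_def g_def .
qed

lemma gauss_series_cc: "gauss_series cc C3 \<theta>"
proof
  show "pos_semidef cc"
    by (rule pos_semidefI[OF cc_sym]) (use avar_nonneg in \<open>simp add: avar_def\<close>)
  show "\<bar>cc j k\<bar> \<le> C3 * \<theta> ^ nat \<bar>int j - int k\<bar>" for j k using cc_bound by (simp add: C3_def)
qed (use \<theta> in auto)

lemma laplace_limit:
  assumes lim: "AE z in gauss_seq. (\<lambda>m. \<Sum>j<m. wt j * (gauss_field cc j z)\<^sup>2) \<longlonglongrightarrow> Q z"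
    and Q[measurable]: "Q \<in> borel_measurable gauss_seq"
  shows "(\<lambda>n. expectation (\<lambda>\<omega>. exp (- (real k * stat n \<omega>)))) \<longlonglongrightarrow> (\<integral>z. exp (- (real k * Q z)) \<partial>gauss_seq)"
proof (rule iterated_limit)
  interpret N: prob_space gauss_seq by (rule prob_space_gauss_seq)
  interpret gs: gauss_series cc C3 \<theta> by (rule gauss_series_cc)
  let ?\<beta> = "\<lambda>n m. osc_bd n (real m / sqrt (real n)) (m ^ 4) / real n"
  let ?\<beta>' = "\<lambda>m. 32 * (real (m ^ 4) * (L * real m / real (m ^ 4))\<^sup>2)"
  let ?e = "\<lambda>n m. 2 * C1 / (\<kappa> * real m)\<^sup>2 + real k * err n m (?\<beta> n m)"
  let ?e' = "\<lambda>m. 2 * C1 / (\<kappa> * real m)\<^sup>2 + real k * (suminf wt * ((1 + real m) * (2 * ?\<beta>' m + 2 * ((real m)\<^sup>2 * 0)) + C3 / real m) + wt_tail m * (2 * ?\<beta>' m + 2 * C3))"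
  show "eventually (\<lambda>n. \<bar>expectation (\<lambda>\<omega>. exp (- (real k * stat n \<omega>))) - expectation (\<lambda>\<omega>. exp (- (\<Sum>j<m. (real k * wt j) * (G n j \<omega>)\<^sup>2)))\<bar> \<le> ?e n m) sequentially"
    if m: "m \<ge> 1" for m
  proof -
    have "(\<lambda>n. real m / sqrt (real n)) \<longlonglongrightarrow> 0" by real_asymp
    then have "eventually (\<lambda>n. real m / sqrt (real n) < \<delta>) sequentially" using \<delta>_pos by (rule order_tendstoD(2))
    then show ?thesis using eventually_ge_at_top[of "m + 1"]
    proof eventually_elim
      case (elim n)
      then show ?case by (intro laplace_truncation m) auto
    qed
  qed
  show "(\<lambda>n. ?e n m) \<longlonglongrightarrow> ?e' m" for m
  proof -
    have z: "(\<lambda>n. 1 / real n) \<longlonglongrightarrow> 0" by real_asymp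
    have "(\<lambda>n. 2 * C1 / (\<kappa> * real m)\<^sup>2 + real k * (suminf wt * ((1 + real m) * (2 * ?\<beta> n m + 2 * ((real m)\<^sup>2 * (1 / real n))) + C3 / real m) + wt_tail m * (2 * ?\<beta> n m + 2 * C3))) \<longlonglongrightarrow> ?e' m"
      by (intro tendsto_add tendsto_mult tendsto_const osc_bd_limit z)
    then show ?thesis unfolding err_def by simp
  qed
  show "?e' \<longlonglongrightarrow> 0"
  proof -
    have e1: "(\<lambda>m. 2 * C1 / (\<kappa> * real m)\<^sup>2) \<longlonglongrightarrow> 0" using \<kappa> by real_asymp
    \<comment> \<open>\<open>?\<beta>' m\<close> equals 32 * L^2 / m^2 for m >= 1; at m = 0 both
      sides agree by the convention for division by zero.\<close>
    have eq: "(1 + real m) * (2 * ?\<beta>' m + 2 * ((real m)\<^sup>2 * 0)) + C3 / real m = 64 * L\<^sup>2 * ((1 + real m) / (real m)\<^sup>2) + C3 * (1 / real m)"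
      "2 * ?\<beta>' m + 2 * C3 = 64 * L\<^sup>2 * (1 / (real m)\<^sup>2) + 2 * C3" for m
      by (cases "m = 0"; simp add: field_simps power2_eq_square power4_eq_xxxx)+
    have z: "(\<lambda>m. (1 + real m) / (real m)\<^sup>2) \<longlonglongrightarrow> 0" "(\<lambda>m. 1 / real m) \<longlonglongrightarrow> 0" "(\<lambda>m. 1 / (real m)\<^sup>2) \<longlonglongrightarrow> 0" by real_asymp+
    have "?e' \<longlonglongrightarrow> 0 + real k * (suminf wt * (64 * L\<^sup>2 * 0 + C3 * 0) + 0 * (64 * L\<^sup>2 * 0 + 2 * C3))"
      unfolding eq by (intro tendsto_add tendsto_mult tendsto_const e1 z wt_tail(3))
    then show ?thesis by simp
  qed
  show "(\<lambda>n. expectation (\<lambda>\<omega>. exp (- (\<Sum>j<m. (real k * wt j) * (G n j \<omega>)\<^sup>2)))) \<longlonglongrightarrow> (\<integral>z. exp (- (\<Sum>j<m. (real k * wt j) * (gauss_field cc j z)\<^sup>2)) \<partial>gauss_seq)" for m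
  proof (rule quadratic_form_laplace_limit[OF prob_space_axioms prob_space_gauss_seq])
    show "(\<lambda>n. expectation (\<lambda>\<omega>. iexp (\<Sum>j<m. a j * G n j \<omega>))) \<longlonglongrightarrow> (\<integral>z. iexp (\<Sum>j<m. a j * gauss_field cc j z) \<partial>gauss_seq)" for a
      using autocovariance_clt[of a m] unfolding gauss_field_char[OF gs.psd] avar_def .
  qed (auto simp: wt_nonneg)
  show "(\<lambda>m. \<integral>z. exp (- (\<Sum>j<m. (real k * wt j) * (gauss_field cc j z)\<^sup>2)) \<partial>gauss_seq) \<longlonglongrightarrow> (\<integral>z. exp (- (real k * Q z)) \<partial>gauss_seq)"
  proof (rule integral_dominated_convergence[where w="\<lambda>_. 1"])
    show "AE z in gauss_seq. (\<lambda>m. exp (- (\<Sum>j<m. (real k * wt j) * (gauss_field cc j z)\<^sup>2))) \<longlonglongrightarrow> exp (- (real k * Q z))"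
      using lim
    proof eventually_elim
      case (elim z)
      then have "(\<lambda>m. exp (- (real k * (\<Sum>j<m. wt j * (gauss_field cc j z)\<^sup>2)))) \<longlonglongrightarrow> exp (- (real k * Q z))"
        by (intro tendsto_intros)
      then show ?case by (simp only: sum_distrib_left mult.assoc)
    qed
    show "AE z in gauss_seq. norm (exp (- (\<Sum>j<m. (real k * wt j) * (gauss_field cc j z)\<^sup>2))) \<le> 1" for m
      by (intro AE_I2) (auto intro!: sum_nonneg mult_nonneg_nonneg wt_nonneg)
  qed auto
qed

theorem stat_limit:
  obtains S where "gaussian_L2Pi gauss_seq S (gauss_series.kernel cc)"
    "weak_conv_m (\<lambda>n. distr M borel (stat n)) (distr gauss_seq borel (\<lambda>z. normPi2 (S z)))"
proof -
  interpret gs: gauss_series cc C3 \<theta> by (rule gauss_series_cc)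
  obtain S where S: "gaussian_L2Pi gauss_seq S gs.kernel" "(\<lambda>z. normPi2 (S z)) \<in> borel_measurable gauss_seq"
    "AE z in gauss_seq. (\<lambda>m. \<Sum>j<m. wt j * (gauss_field cc j z)\<^sup>2) \<longlonglongrightarrow> normPi2 (S z)"
    by (rule gs.gaussian_element_exists)
  have "weak_conv_m (\<lambda>n. distr M borel (stat n)) (distr gauss_seq borel (\<lambda>z. normPi2 (S z)))"
  proof (rule laplace_imp_weak_conv[OF prob_space_axioms prob_space_gauss_seq _ S(2)])
    show "0 \<le> normPi2 (S z)" for z
      unfolding normPi2_def set_lebesgue_integral_def by (intro integral_nonneg_AE AE_I2) auto
  qed (auto simp: stat_nonneg intro: laplace_limit[OF S(3,2)])
  then show thesis by (rule that[OF S(1)])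
qed

end

subsection \<open>The hypotheses of the theorem\<close>

lemma le_of_le_linear:
  fixes a b L \<eta> :: real
  assumes \<eta>: "\<eta> > 0" and le: "\<And>e. 0 < e \<Longrightarrow> e < \<eta> \<Longrightarrow> a \<le> b + L * e"
  shows "a \<le> b"
proof -
  have "((\<lambda>e. b + L * e) \<longlongrightarrow> b + L * 0) (at_right 0)" by (intro tendsto_intros)
  moreover have "eventually (\<lambda>e. a \<le> b + L * e) (at_right 0)"
    unfolding eventually_at_right_field using \<eta> le by blast
  ultimately have "a \<le> b + L * 0" by (rule tendsto_lowerbound) simp
  then show ?thesis by simp
qed

context bernoulli_shift
begin

lemma FX_cdf: "FX M eps Y x = cdf (distr M borel (X 0)) x"
  by (simp add: FX_def cdf_def measure_distr vimage_def Int_def conj_commute)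

lemma FX_mono: "x \<le> y \<Longrightarrow> FX M eps Y x \<le> FX M eps Y y"
  unfolding FX_def by (intro finite_measure_mono) auto

text \<open>The limits of the distribution function at the two infinities make the set in the
  definition of the quantile nonempty and bounded below, so the infimum is genuine. Both claims are
  for x different from the quantile; the value at it follows later from continuity.\<close>

lemma xi0_bracket:
  assumes \<tau>: "0 < \<tau>" "\<tau> < 1"
  shows "x < xi0 M eps Y \<tau> \<Longrightarrow> FX M eps Y x < \<tau>" and "xi0 M eps Y \<tau> < x \<Longrightarrow> \<tau> \<le> FX M eps Y x"
proof -
  interpret D: real_distribution "distr M borel (X 0)" by (rule real_distribution_distr) simp
  let ?A = "{x. \<tau> \<le> FX M eps Y x}"
  have "eventually (\<lambda>x. FX M eps Y x < \<tau>) at_bot"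
    unfolding FX_cdf by (rule order_tendstoD(2)[OF D.cdf_lim_at_bot]) (rule \<tau>)
  then obtain l where l: "\<And>x. x \<le> l \<Longrightarrow> FX M eps Y x < \<tau>" unfolding eventually_at_bot_linorder by auto
  then have bdd: "bdd_below ?A" by (intro bdd_belowI[of _ l]) (metis linear mem_Collect_eq not_le)
  have "eventually (\<lambda>x. \<tau> < FX M eps Y x) at_top"
    unfolding FX_cdf by (rule order_tendstoD(1)[OF D.cdf_lim_at_top_prob]) (rule \<tau>)
  then obtain u where "\<tau> < FX M eps Y u" unfolding eventually_at_top_linorder by auto
  then have ne: "?A \<noteq> {}" by (auto intro: less_imp_le)
  show "FX M eps Y x < \<tau>" if "x < xi0 M eps Y \<tau>"
  proof (rule ccontr)
    assume "\<not> FX M eps Y x < \<tau>"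
    then have "xi0 M eps Y \<tau> \<le> x" unfolding xi0_def by (intro cInf_lower bdd) auto
    with that show False by simp
  qed
  show "\<tau> \<le> FX M eps Y x" if lt: "xi0 M eps Y \<tau> < x"
  proof -
    obtain y where "y \<in> ?A" "y < x" using lt ne unfolding xi0_def by (metis cInf_lessD)
    then show ?thesis using FX_mono[of y x] by auto
  qed
qed

text \<open>The Lipschitz condition excludes atoms near the quantile, so strict and weak
  inequalities have the same probability and F takes the value \<tau> there. By continuity the
  density exceeds half its value at the quantile in a neighbourhood, which gives the lower
  slope.\<close>

lemma quantile_regularity:
  assumes \<tau>: "0 < \<tau>" "\<tau> < 1"
    and lip: "\<exists>\<eta> > 0. \<exists>L. L-lipschitz_on {xi0 M eps Y \<tau> - \<eta> .. xi0 M eps Y \<tau> + \<eta>} (FX M eps Y)"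
    and dens: "\<exists>f \<eta>. \<eta> > 0 \<and>
         (\<forall>x \<in> {xi0 M eps Y \<tau> - \<eta> .. xi0 M eps Y \<tau> + \<eta>}. \<forall>y \<in> {xi0 M eps Y \<tau> - \<eta> .. xi0 M eps Y \<tau> + \<eta>}.
             y \<le> x \<longrightarrow> (f has_integral (FX M eps Y x - FX M eps Y y)) {y..x})
         \<and> isCont f (xi0 M eps Y \<tau>) \<and> f (xi0 M eps Y \<tau>) > 0"
  obtains \<delta> \<kappa> L where "\<delta> > 0" "\<kappa> > 0" "prob {\<omega> \<in> space M. X 0 \<omega> < xi0 M eps Y \<tau>} = \<tau>"
    "\<And>u v. \<bar>xi0 M eps Y \<tau> - u\<bar> \<le> \<delta> \<Longrightarrow> \<bar>xi0 M eps Y \<tau> - v\<bar> \<le> \<delta> \<Longrightarrow> u \<le> v \<Longrightarrow>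
      \<kappa> * (v - u) \<le> prob {\<omega> \<in> space M. X 0 \<omega> < v} - prob {\<omega> \<in> space M. X 0 \<omega> < u} \<and>
      prob {\<omega> \<in> space M. X 0 \<omega> < v} - prob {\<omega> \<in> space M. X 0 \<omega> < u} \<le> L * (v - u)"
proof -
  let ?F = "FX M eps Y" and ?\<xi> = "xi0 M eps Y \<tau>" and ?p = "\<lambda>x. prob {\<omega> \<in> space M. X 0 \<omega> < x}"
  obtain \<eta> L where \<eta>: "\<eta> > 0" and L: "L-lipschitz_on {?\<xi> - \<eta> .. ?\<xi> + \<eta>} ?F" using lip by auto
  have FL: "\<bar>?F x - ?F y\<bar> \<le> L * \<bar>x - y\<bar>" if "\<bar>?\<xi> - x\<bar> \<le> \<eta>" "\<bar>?\<xi> - y\<bar> \<le> \<eta>" for x y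
  proof -
    have "x \<in> {?\<xi> - \<eta> .. ?\<xi> + \<eta>}" "y \<in> {?\<xi> - \<eta> .. ?\<xi> + \<eta>}" using that by auto
    from lipschitz_onD[OF L this] show ?thesis by (simp add: dist_real_def)
  qed
  have pF: "?p x = ?F x" if x: "\<bar>?\<xi> - x\<bar> < \<eta>" for x
  proof (rule antisym)
    show "?p x \<le> ?F x" unfolding FX_def by (intro finite_measure_mono) auto
    show "?F x \<le> ?p x"
    proof (rule le_of_le_linear)
      show "\<eta> - \<bar>?\<xi> - x\<bar> > 0" using x by simp
      fix e assume e: "0 < e" "e < \<eta> - \<bar>?\<xi> - x\<bar>"
      have "?F (x - e) \<le> ?p x" unfolding FX_def using e by (intro finite_measure_mono) auto
      moreover have "\<bar>?F x - ?F (x - e)\<bar> \<le> L * \<bar>x - (x - e)\<bar>" using e x by (intro FL) auto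
      ultimately show "?F x \<le> ?p x + L * e" using e by simp
    qed
  qed
  have F\<xi>: "?F ?\<xi> = \<tau>"
  proof (rule antisym)
    show "?F ?\<xi> \<le> \<tau>"
    proof (rule le_of_le_linear[OF \<eta>])
      fix e assume e: "0 < e" "e < \<eta>"
      then show "?F ?\<xi> \<le> \<tau> + L * e"
        using FL[of ?\<xi> "?\<xi> - e"] xi0_bracket(1)[OF \<tau>, of "?\<xi> - e"] by simp
    qed
    show "\<tau> \<le> ?F ?\<xi>"
    proof (rule le_of_le_linear[OF \<eta>])
      fix e assume e: "0 < e" "e < \<eta>"
      then show "\<tau> \<le> ?F ?\<xi> + L * e"
        using FL[of ?\<xi> "?\<xi> + e"] xi0_bracket(2)[OF \<tau>, of "?\<xi> + e"] by simp
    qed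
  qed
  obtain f \<eta>' where \<eta>': "\<eta>' > 0" and int: "\<And>x y. \<bar>?\<xi> - x\<bar> \<le> \<eta>' \<Longrightarrow> \<bar>?\<xi> - y\<bar> \<le> \<eta>' \<Longrightarrow> y \<le> x \<Longrightarrow> (f has_integral (?F x - ?F y)) {y..x}"
    and f: "isCont f ?\<xi>" "f ?\<xi> > 0"
  proof -
    from dens obtain f \<eta>' where *: "\<eta>' > 0" "isCont f ?\<xi>" "f ?\<xi> > 0"
      and i: "\<And>x y. x \<in> {?\<xi> - \<eta>'..?\<xi> + \<eta>'} \<Longrightarrow> y \<in> {?\<xi> - \<eta>'..?\<xi> + \<eta>'} \<Longrightarrow> y \<le> x \<Longrightarrow> (f has_integral (?F x - ?F y)) {y..x}"
      by blast
    show thesis by (rule that[OF *(1) _ *(2,3)], rule i) auto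
  qed
  obtain d where d: "d > 0" "\<And>x. \<bar>x - ?\<xi>\<bar> < d \<Longrightarrow> \<bar>f x - f ?\<xi>\<bar> < f ?\<xi> / 2"
    using f(1)[unfolded continuous_at_real_range, rule_format, of "f ?\<xi> / 2"] f(2) by auto
  \<comment> \<open>Halving \<eta> and d turns the closed \<delta>-neighbourhood into a subset of
    the open ones required by \<open>pF\<close> and by the continuity estimate.\<close>
  define \<delta> where "\<delta> = min (\<eta> / 2) (min \<eta>' (d / 2))"
  have \<delta>: "\<delta> > 0" "\<delta> < \<eta>" "\<delta> \<le> \<eta>'" "\<delta> < d" using \<eta> \<eta>' d by (auto simp: \<delta>_def)
  show thesis
  proof (rule that[OF \<delta>(1)])
    show "f ?\<xi> / 2 > 0" using f by simp
    show "?p ?\<xi> = \<tau>" using pF[of ?\<xi>] F\<xi> \<eta> by simp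
    fix u v assume u: "\<bar>?\<xi> - u\<bar> \<le> \<delta>" and v: "\<bar>?\<xi> - v\<bar> \<le> \<delta>" and uv: "u \<le> v"
    have e: "?p u = ?F u" "?p v = ?F v" using u v \<delta> by (auto intro!: pF)
    have i1: "(f has_integral (?F v - ?F u)) {u..v}" using u v uv \<delta> by (intro int) auto
    have i2: "((\<lambda>_. f ?\<xi> / 2) has_integral (v - u) *\<^sub>R (f ?\<xi> / 2)) {u..v}"
      using has_integral_const_real[of "f ?\<xi> / 2" u v] uv by simp
    have "f ?\<xi> / 2 \<le> f x" if "x \<in> {u..v}" for x
    proof -
      have "\<bar>f x - f ?\<xi>\<bar> < f ?\<xi> / 2" using that u v \<delta> by (intro d(2)) auto
      then show ?thesis by linarith
    qed
    then have "(v - u) *\<^sub>R (f ?\<xi> / 2) \<le> ?F v - ?F u" by (rule has_integral_le[OF i2 i1])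
    moreover have "?F v - ?F u \<le> L * (v - u)" using FL[of v u] u v uv \<delta> by simp
    ultimately show "f ?\<xi> / 2 * (v - u) \<le> ?p v - ?p u \<and> ?p v - ?p u \<le> L * (v - u)"
      unfolding e by (simp add: mult.commute)
  qed
qed

text \<open>Serves twice: the supremum in condition (A) is taken over a set bounded above, so it
  dominates each distance, and the finitely many n not covered by the asymptotic bound can be
  absorbed in a constant.\<close>

lemma coupling_dist_le_1: "coupling_dist M E eps Y n \<xi> \<le> 1"
proof -
  interpret C: prob_space C by (rule prob_space_C)
  have "\<bar>\<integral>w. \<bar>of_bool (Xc Y (int n) w < \<xi>) - (of_bool (Xc' Y (int n) w < \<xi>) :: real)\<bar> \<partial>C\<bar> \<le> 1"
    by (rule C.abs_expectation_le) (auto split: split_of_bool)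
  then have "(coupling_dist M E eps Y n \<xi>)\<^sup>2 \<le> 1\<^sup>2" unfolding coupling_dist_sq by simp
  then show ?thesis by (rule power2_le_imp_le) simp
qed

text \<open>Passes from an asymptotic bound on the supremum to a bound for every n and every
  threshold. Squaring, as decorrelation involves squared distances, replaces the rate \<sigma> by
  its square.\<close>

lemma coupling_geometric:
  assumes A: "\<exists>\<delta> > 0. \<exists>\<sigma>. 0 < \<sigma> \<and> \<sigma> < 1 \<and>
         (\<lambda>n. SUP \<xi>\<in>Xnbhd M eps Y \<tau> \<delta>. coupling_dist M E eps Y n \<xi>) \<in> O(\<lambda>n. \<sigma> ^ n)"
  obtains \<delta> K r where "\<delta> > 0" "K \<ge> 2" "0 < r" "r < 1"
    "\<And>n \<xi>. \<bar>xi0 M eps Y \<tau> - \<xi>\<bar> \<le> \<delta> \<Longrightarrow> (coupling_dist M E eps Y n \<xi>)\<^sup>2 \<le> K * r ^ n"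
proof -
  obtain \<delta> \<sigma> where \<delta>: "\<delta> > 0" and \<sigma>: "0 < \<sigma>" "\<sigma> < 1"
    and O: "(\<lambda>n. SUP \<xi>\<in>Xnbhd M eps Y \<tau> \<delta>. coupling_dist M E eps Y n \<xi>) \<in> O(\<lambda>n. \<sigma> ^ n)" using A by auto
  let ?s = "\<lambda>n. SUP \<xi>\<in>Xnbhd M eps Y \<tau> \<delta>. coupling_dist M E eps Y n \<xi>"
  obtain c where "eventually (\<lambda>n. norm (?s n) \<le> c * norm (\<sigma> ^ n)) sequentially" using O by (rule landau_o.bigE)
  then obtain N where N: "\<And>n. n \<ge> N \<Longrightarrow> ?s n \<le> c * \<sigma> ^ n"
    unfolding eventually_sequentially using \<sigma> by (force simp: abs_le_iff)
  \<comment> \<open>The three terms serve the requirement K >= 2, the range n >= N, and the range n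
    < N, where the distance is only known to be at most 1.\<close>
  define K where "K = max 2 (max (c\<^sup>2) (1 / (\<sigma>\<^sup>2) ^ N))"
  show thesis
  proof (rule that[of \<delta> K "\<sigma>\<^sup>2"])
    show "K \<ge> 2" by (simp add: K_def)
    show "0 < \<sigma>\<^sup>2" "\<sigma>\<^sup>2 < 1" using \<sigma> by (auto simp: abs_square_less_1)
    fix n \<xi> assume \<xi>: "\<bar>xi0 M eps Y \<tau> - \<xi>\<bar> \<le> \<delta>"
    let ?c = "coupling_dist M E eps Y n \<xi>"
    have c0: "?c \<ge> 0" by (simp add: coupling_dist_def)
    show "?c\<^sup>2 \<le> K * (\<sigma>\<^sup>2) ^ n"
    proof (cases "n \<ge> N")
      case True
      have "?c \<le> ?s n"
        using \<xi> by (intro cSUP_upper bdd_aboveI2[where M=1] coupling_dist_le_1) (auto simp: Xnbhd_def)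
      also have "\<dots> \<le> c * \<sigma> ^ n" by (rule N[OF True])
      finally have "?c\<^sup>2 \<le> (c * \<sigma> ^ n)\<^sup>2" using c0 by (intro power_mono)
      also have "\<dots> = c\<^sup>2 * (\<sigma>\<^sup>2) ^ n" by (simp add: power_mult_distrib power_mult[symmetric] mult.commute)
      also have "\<dots> \<le> K * (\<sigma>\<^sup>2) ^ n" by (intro mult_right_mono) (auto simp: K_def)
      finally show ?thesis .
    next
      case False
      have "?c\<^sup>2 \<le> 1" using power_mono[OF coupling_dist_le_1 c0, of 2] by simp
      also have "1 \<le> 1 / (\<sigma>\<^sup>2) ^ N * (\<sigma>\<^sup>2) ^ n"
      proof -
        have "(\<sigma>\<^sup>2) ^ N \<le> (\<sigma>\<^sup>2) ^ n" using False \<sigma> by (intro power_decreasing) (auto simp: power_le_one)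
        then show ?thesis using \<sigma> by (simp add: divide_simps)
      qed
      also have "\<dots> \<le> K * (\<sigma>\<^sup>2) ^ n" by (intro mult_right_mono) (auto simp: K_def)
      finally show ?thesis .
    qed
  qed (rule \<delta>)
qed

lemma stationary_gmcI:
  assumes "\<delta> > 0" "K \<ge> 2" "0 < r" "r < 1"
    and K: "\<And>n \<xi>. \<bar>\<xi>0 - \<xi>\<bar> \<le> \<delta> \<Longrightarrow> (coupling_dist M E eps Y n \<xi>)\<^sup>2 \<le> K * r ^ n"
  shows "stationary_gmc M X \<xi>0 \<delta> K r"
proof
  fix a b :: "(int \<Rightarrow> real) \<Rightarrow> complex" and s :: int and J :: "int set" and t \<xi> and c :: real
  assume a: "a \<in> borel_measurable path_space" "b \<in> borel_measurable path_space" "\<And>x. norm (a x) \<le> 1" "\<And>x. norm (b x) \<le> 1"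
    "\<And>x y. (\<And>t. t \<le> s \<Longrightarrow> x t = y t) \<Longrightarrow> a x = a y"
    and J: "finite J" and t: "\<And>i. i \<in> J \<Longrightarrow> t i > s \<and> \<bar>\<xi>0 - \<xi> i\<bar> \<le> \<delta>" and c: "0 \<le> c"
    and lip: "\<And>x y. norm (b x - b y) \<le> c * (\<Sum>i\<in>J. \<bar>of_bool (x (t i) < \<xi> i) - of_bool (y (t i) < \<xi> i)\<bar>)"
  have "norm ((\<integral>\<omega>. a (\<lambda>t. X t \<omega>) * b (\<lambda>t. X t \<omega>) \<partial>M) - (\<integral>\<omega>. a (\<lambda>t. X t \<omega>) \<partial>M) * (\<integral>\<omega>. b (\<lambda>t. X t \<omega>) \<partial>M))
     \<le> c * (\<Sum>i\<in>J. (coupling_dist M E eps Y (nat (t i - s)) (\<xi> i))\<^sup>2)"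
    by (rule decorrelation[OF a J _ lip]) (use t in auto)
  also have "\<dots> \<le> c * (\<Sum>i\<in>J. K * r ^ nat (t i - s))"
    using t by (intro mult_left_mono sum_mono K c) auto
  finally show "norm ((\<integral>\<omega>. a (\<lambda>t. X t \<omega>) * b (\<lambda>t. X t \<omega>) \<partial>M) - (\<integral>\<omega>. a (\<lambda>t. X t \<omega>) \<partial>M) * (\<integral>\<omega>. b (\<lambda>t. X t \<omega>) \<partial>M))
     \<le> c * (\<Sum>i\<in>J. K * r ^ nat (t i - s))" .
qed (use assms X_shift in auto)

end

section \<open>Identification of the statistic and conclusion\<close>

lemma CM_eq:
  "CM eps Y \<tau> xh n \<omega> = (\<Sum>j<n - 1. wt j *
    ((\<Sum>t\<in>{int (Suc j) + 1..int n}. Vfun \<tau> (xh n \<omega>) (Xproc eps Y t \<omega>) * Vfun \<tau> (xh n \<omega>) (Xproc eps Y (t - int (Suc j)) \<omega>)) / sqrt (real n))\<^sup>2)"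
proof -
  define r where "r j = (\<Sum>t\<in>{int j + 1..int n}. Vfun \<tau> (xh n \<omega>) (Xproc eps Y t \<omega>) * Vfun \<tau> (xh n \<omega>) (Xproc eps Y (t - int j) \<omega>))" for j
  have "rhat eps Y \<tau> (xh n \<omega>) n j \<omega> = r j / real n" for j
    unfolding rhat_def r_def
    by (simp, rule disjI2, rule sum.reindex_bij_witness[of _ nat int]) auto
  then have "CM eps Y \<tau> xh n \<omega> = (\<Sum>j = 1..n - 1. real n / (2 * pi) * (r j / real n / real j)\<^sup>2)"
    by (simp add: CM_def sum_distrib_left)
  also have "\<dots> = (\<Sum>j<n - 1. real n / (2 * pi) * (r (Suc j) / real n / real (Suc j))\<^sup>2)"
    by (rule sum.reindex_bij_witness[of _ Suc "\<lambda>j. j - 1"]) auto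
  also have "\<dots> = (\<Sum>j<n - 1. wt j * (r (Suc j) / sqrt (real n))\<^sup>2)"
    \<comment> \<open>The prefactor n and the squared average 1 / n^2 leave 1 / n, which enters the
      square as 1 / sqrt n.\<close>
    by (rule sum.cong) (auto simp: wt_def power_divide power2_eq_square simp del: of_nat_Suc)
  finally show ?thesis by (simp add: r_def)
qed

theorem theorem4p1:
  fixes M :: "'a measure" and E :: "'e measure"
    and eps :: "int \<Rightarrow> 'a \<Rightarrow> 'e" and Y :: "(nat \<Rightarrow> 'e) \<Rightarrow> real"
    and \<tau> :: real and xih :: "nat \<Rightarrow> 'a \<Rightarrow> real"
  assumes M: "prob_space M"
    and eps_meas: "\<And>t. eps t \<in> measurable M E"
    and eps_indep: "prob_space.indep_vars M (\<lambda>_. E) eps UNIV"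
    and eps_ident: "\<And>t. distr M E (eps t) = distr M E (eps 0)"
    and Y_meas: "Y \<in> borel_measurable (PiM UNIV (\<lambda>_::nat. E))"
    and tau: "0 < \<tau>" "\<tau> < 1"
    and condA: "\<exists>\<delta> > 0. \<exists>\<sigma>. 0 < \<sigma> \<and> \<sigma> < 1 \<and>
         (\<lambda>n. SUP \<xi>\<in>Xnbhd M eps Y \<tau> \<delta>. coupling_dist M E eps Y n \<xi>) \<in> O(\<lambda>n. \<sigma> ^ n)"
    and condB_lip: "\<exists>\<eta> > 0. \<exists>L. L-lipschitz_on {xi0 M eps Y \<tau> - \<eta> .. xi0 M eps Y \<tau> + \<eta>} (FX M eps Y)"
    and condB_dens: "\<exists>f \<eta>. \<eta> > 0 \<and>
         (\<forall>x \<in> {xi0 M eps Y \<tau> - \<eta> .. xi0 M eps Y \<tau> + \<eta>}. \<forall>y \<in> {xi0 M eps Y \<tau> - \<eta> .. xi0 M eps Y \<tau> + \<eta>}.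
             y \<le> x \<longrightarrow> (f has_integral (FX M eps Y x - FX M eps Y y)) {y..x})
         \<and> isCont f (xi0 M eps Y \<tau>) \<and> f (xi0 M eps Y \<tau>) > 0"
    and xih_meas: "\<And>n. xih n \<in> borel_measurable M"
    and xih_min: "\<And>n \<omega> x. \<omega> \<in> space M \<Longrightarrow>
         (\<Sum>t = 1..n. rho \<tau> (Xproc eps Y (int t) \<omega> - xih n \<omega>)) \<le> (\<Sum>t = 1..n. rho \<tau> (Xproc eps Y (int t) \<omega> - x))"
  shows
    "((\<exists>\<delta> > 0. \<forall>j::int > 0. \<forall>\<xi> \<in> Xnbhd M eps Y \<tau> \<delta>. \<forall>\<xi>' \<in> Xnbhd M eps Y \<tau> \<delta>.
          measure M {\<omega> \<in> space M. Xproc eps Y 0 \<omega> < \<xi> \<and> Xproc eps Y j \<omega> < \<xi>'}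
          = measure M {\<omega> \<in> space M. Xproc eps Y 0 \<omega> < \<xi>} * measure M {\<omega> \<in> space M. Xproc eps Y 0 \<omega> < \<xi>'})
      \<longrightarrow> (\<exists>(N :: (nat \<Rightarrow> real) measure) S. gaussian_L2Pi N S (Kcov M eps Y \<tau>) \<and>
            weak_conv_m (\<lambda>n. distr M borel (CM eps Y \<tau> xih n)) (distr N borel (\<lambda>\<omega>. normPi2 (S \<omega>)))))
     \<and> ((\<exists>j::int > 0. rtau M eps Y \<tau> j \<noteq> 0) \<longrightarrow>
         (\<forall>B. (\<lambda>n. measure M {\<omega> \<in> space M. CM eps Y \<tau> xih n \<omega> > B}) \<longlonglongrightarrow> 1))"
proof -
  interpret bernoulli_shift M E eps Y
    using M eps_meas eps_indep eps_ident Y_meas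
    unfolding bernoulli_shift_def bernoulli_shift_axioms_def by blast
  let ?\<xi> = "xi0 M eps Y \<tau>"
  obtain \<delta>1 K r where \<delta>1: "\<delta>1 > 0" and Kr: "K \<ge> 2" "0 < r" "r < 1"
    and cd: "\<And>n \<xi>. \<bar>?\<xi> - \<xi>\<bar> \<le> \<delta>1 \<Longrightarrow> (coupling_dist M E eps Y n \<xi>)\<^sup>2 \<le> K * r ^ n"
    by (rule coupling_geometric[OF condA]) (rule that; blast)
  obtain \<delta>2 \<kappa> L where \<delta>2: "\<delta>2 > 0" and \<kappa>: "\<kappa> > 0" and p\<xi>: "measure M {\<omega> \<in> space M. X 0 \<omega> < ?\<xi>} = \<tau>"
    and incr: "\<And>u v. \<bar>?\<xi> - u\<bar> \<le> \<delta>2 \<Longrightarrow> \<bar>?\<xi> - v\<bar> \<le> \<delta>2 \<Longrightarrow> u \<le> v \<Longrightarrow>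
      \<kappa> * (v - u) \<le> measure M {\<omega> \<in> space M. X 0 \<omega> < v} - measure M {\<omega> \<in> space M. X 0 \<omega> < u} \<and>
      measure M {\<omega> \<in> space M. X 0 \<omega> < v} - measure M {\<omega> \<in> space M. X 0 \<omega> < u} \<le> L * (v - u)"
    by (rule quantile_regularity[OF tau condB_lip condB_dens]) (rule that; blast)
  \<comment> \<open>Proved for every sufficiently small radius, because part (i) must also shrink it
    to the radius of pairwise independence.\<close>
  have gq: "gmc_quantile M X ?\<xi> \<delta> K r \<tau> \<kappa> L xih" if \<delta>: "\<delta> > 0" "\<delta> \<le> \<delta>1" "\<delta> \<le> \<delta>2" for \<delta>
  proof -
    interpret g: stationary_gmc M X ?\<xi> \<delta> K r
      by (rule stationary_gmcI[OF \<delta>(1) Kr]) (rule cd, use \<delta> in simp)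
    show ?thesis
    proof
      show "0 < \<tau>" "\<tau> < 1" "\<kappa> > 0" by (fact tau \<kappa>)+
      show "g.p ?\<xi> = \<tau>" unfolding g.p_def by (rule p\<xi>)
      show "\<kappa> * (v - u) \<le> g.p v - g.p u \<and> g.p v - g.p u \<le> L * (v - u)" if "g.near u" "g.near v" "u \<le> v" for u v
        unfolding g.p_def using that \<delta> by (intro incr) (auto simp: g.near_def)
      show "xih n \<in> borel_measurable M" for n by (rule xih_meas)
      fix n \<omega> x assume \<omega>: "\<omega> \<in> space M"
      have re: "(\<Sum>t\<in>{1..int n}. f t) = (\<Sum>t = 1..n. f (int t))" for f :: "int \<Rightarrow> real"
        by (rule sum.reindex_bij_witness[of _ int nat]) auto
      show "(\<Sum>t\<in>{1..int n}. rho \<tau> (X t \<omega> - xih n \<omega>)) \<le> (\<Sum>t\<in>{1..int n}. rho \<tau> (X t \<omega> - x))"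
        unfolding re by (rule xih_min[OF \<omega>])
    qed
  qed
  show ?thesis
  proof (intro conjI impI allI)
    assume "\<exists>\<delta> > 0. \<forall>j::int > 0. \<forall>\<xi> \<in> Xnbhd M eps Y \<tau> \<delta>. \<forall>\<xi>' \<in> Xnbhd M eps Y \<tau> \<delta>.
          measure M {\<omega> \<in> space M. Xproc eps Y 0 \<omega> < \<xi> \<and> Xproc eps Y j \<omega> < \<xi>'}
          = measure M {\<omega> \<in> space M. Xproc eps Y 0 \<omega> < \<xi>} * measure M {\<omega> \<in> space M. Xproc eps Y 0 \<omega> < \<xi>'}"
    then obtain \<delta>3 where \<delta>3: "\<delta>3 > 0" and pair: "\<And>j \<xi> \<xi>'. j > 0 \<Longrightarrow> \<bar>?\<xi> - \<xi>\<bar> \<le> \<delta>3 \<Longrightarrow> \<bar>?\<xi> - \<xi>'\<bar> \<le> \<delta>3 \<Longrightarrow>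
        measure M {\<omega> \<in> space M. X 0 \<omega> < \<xi> \<and> X j \<omega> < \<xi>'} = measure M {\<omega> \<in> space M. X 0 \<omega> < \<xi>} * measure M {\<omega> \<in> space M. X 0 \<omega> < \<xi>'}"
      unfolding Xnbhd_def by blast
    define \<delta> where "\<delta> = min \<delta>1 (min \<delta>2 \<delta>3)"
    have \<delta>: "\<delta> > 0" "\<delta> \<le> \<delta>1" "\<delta> \<le> \<delta>2" "\<delta> \<le> \<delta>3" using \<delta>1 \<delta>2 \<delta>3 by (auto simp: \<delta>_def)
    interpret q: gmc_quantile M X ?\<xi> \<delta> K r \<tau> \<kappa> L xih by (rule gq[OF \<delta>(1-3)])
    interpret q: gmc_quantile_indep M X ?\<xi> \<delta> K r \<tau> \<kappa> L xih
    proof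
      show "measure M {\<omega> \<in> space M. X 0 \<omega> < \<xi> \<and> X j \<omega> < \<xi>'} = q.p \<xi> * q.p \<xi>'" if "j > 0" "q.near \<xi>" "q.near \<xi>'" for j \<xi> \<xi>'
        unfolding q.p_def using that \<delta> by (intro pair) (auto simp: q.near_def)
    qed
    have CM: "CM eps Y \<tau> xih = q.stat"
      by (intro ext) (simp only: CM_eq q.stat_def q.R_def)
    have cov: "covV M eps Y \<tau> (int (Suc j)) (int (Suc k)) l = q.cv (int (Suc j)) (int (Suc k)) l" for j k l
    proof -
      let ?V = "\<lambda>t \<omega>. Vfun \<tau> ?\<xi> (X t \<omega>)"
      have "(\<integral>\<omega>. ?V s \<omega> * ?V t \<omega> \<partial>M) = 0" if "s \<noteq> t" for s t
        using q.E2_w[OF q.near_\<xi>0 q.near_\<xi>0 that] unfolding q.E2_def q.w_def q.p_\<xi>0 by simp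
      from this[of 0 "int (Suc j)"] show ?thesis
        unfolding covV_def Let_def q.cv_def q.E4_def q.w_def q.p_\<xi>0 Vproc_def by simp
    qed
    have ker: "Kcov M eps Y \<tau> = gauss_series.kernel q.cc"
      by (intro ext) (simp only: Kcov_def gauss_series.kernel_def[OF q.gauss_series_cc] q.cc_def cov)
    obtain S where "gaussian_L2Pi gauss_seq S (gauss_series.kernel q.cc)"
      "weak_conv_m (\<lambda>n. distr M borel (q.stat n)) (distr gauss_seq borel (\<lambda>z. normPi2 (S z)))"
      by (rule q.stat_limit)
    then show "\<exists>(N :: (nat \<Rightarrow> real) measure) S. gaussian_L2Pi N S (Kcov M eps Y \<tau>) \<and>
            weak_conv_m (\<lambda>n. distr M borel (CM eps Y \<tau> xih n)) (distr N borel (\<lambda>\<omega>. normPi2 (S \<omega>)))"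
      unfolding CM ker by blast
  next
    fix B :: real
    assume "\<exists>j::int > 0. rtau M eps Y \<tau> j \<noteq> 0"
    then obtain j :: int where j: "j > 0" "rtau M eps Y \<tau> j \<noteq> 0" by blast
    define \<delta> where "\<delta> = min \<delta>1 \<delta>2"
    have \<delta>: "\<delta> > 0" "\<delta> \<le> \<delta>1" "\<delta> \<le> \<delta>2" using \<delta>1 \<delta>2 by (auto simp: \<delta>_def)
    interpret q: gmc_quantile M X ?\<xi> \<delta> K r \<tau> \<kappa> L xih by (rule gq[OF \<delta>])
    have CM: "CM eps Y \<tau> xih = q.stat"
      by (intro ext) (simp only: CM_eq q.stat_def q.R_def)
    \<comment> \<open>The positive integer lag j sits at the shifted natural index j - 1.\<close>
    have "int (Suc (nat j - 1)) = j" using j by simp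
    then have "q.lagcov (Suc (nat j - 1)) = rtau M eps Y \<tau> j"
      unfolding q.lagcov_def q.E2_def rtau_def Vproc_def by simp
    then show "(\<lambda>n. measure M {\<omega> \<in> space M. CM eps Y \<tau> xih n \<omega> > B}) \<longlonglongrightarrow> 1"
      unfolding CM using j by (intro q.stat_diverges[of "nat j - 1"]) simp
  qed
qed

end
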